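(* Let $m$ be a natural number and let $\mu_0,\dots,\mu_m\in\Lambda+\sharp$ be different points. There exists a family of linear functionals $\gamma_m^{\lambda}$, $\lambda\in\Lambda$, continuous on $H^m=\bigcup_{\delta>1}H^{\delta,m}$, such that for an arbitrary $f\in H^m$ the equation $$f=\sum_{j=0}^{m}\gamma^{\sharp}(\mathbf{a}^jf)\,\mathbf{d}_{m,j}+\sum_{\lambda\in\Lambda}\gamma_m^{\lambda}(f)\,\mathbf{e}_\lambda$$ holds in the Sobolev space $W_2^m(\mathbb{R})$, and for any $\delta>1$ there exists a constant $C_\delta$ such that for all $f\in H^{\delta,m}$ $$\sum_{\lambda\in\Lambda}(|\lambda|^2+1)^m|\gamma_m^{\lambda}(f)|^2\le C_\delta\|f\|_{\delta,m}^2 .$$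
   Context: The phase plane is $\Phi=\mathbb{R}\times\mathbb{R}$ with points $\lambda=(p,\theta)$, Euclidean norm $|\lambda|^2=p^2+\theta^2$ and Lebesgue measure $d\lambda=dp\,d\theta$. For $\lambda=(p,\theta)\in\Phi$ the Gabor function is $\mathbf{e}_\lambda(x)=2^{1/4}\exp(-\pi(x-p)^2+2\pi i\theta x)$, $x\in\mathbb{R}$. $\langle f|g\rangle=\int f\bar g\,dx$ is the scalar product of $L_2=L_2(\mathbb{R})$. $\Lambda=\mathbb{Z}\times\mathbb{Z}$, $\sharp=(1/2,1/2)$. The annihilation operator is $\mathbf{a}=\frac{1}{2\pi}\frac{d}{dx}+x$. For $\delta>0$, $H^\delta$ is the space of $f\in L_2$ with $\|f\|_\delta:=\left(\int_\Phi(|\lambda|^{\delta}+1)|\langle f|\mathbf{e}_\lambda\rangle|^2d\lambda\right)^{1/2}<\infty$. $H^{\delta,m}$ is the space of functions $f$ with $\mathbf{a}^jf\in H^\delta$ for $j=0,\dots,m$, with norm $\|f\|_{\delta,m}=\left(\sum_{j=0}^m\|\mathbf{a}^jf\|_\delta^2\right)^{1/2}$. A linear functional on $H^m$ is called continuous if its restriction to each $H^{\delta,m}$, $\delta>1$, is continuous. With $\Theta(z)=2^{1/4}\sum_{q\in\mathbb{Z}}\exp(2\pi iqz-\pi q^2)$ and the Zak transform $Zf(y,\xi)=\sum_{q\in\mathbb{Z}}\exp(2\pi iq\xi)f(y+q)$, the sharp Poisson functional is $\gamma^\sharp(f)=\frac{1}{i\Theta(0)}\sum_{q\in\mathbb{Z}}(-1)^qf(q+1/2)=\frac{Zf(1/2,1/2)}{i\Theta(0)}$,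 taken as a well-defined continuous functional on $H=\bigcup_{\delta>1}H^\delta$. The functions $\mathbf{d}_{m,j}$, $j=0,\dots,m$, are the linear combinations $\mathbf{d}_{m,j}=\sum_{s=0}^mh_j^s\mathbf{e}_{\mu_s}$ whose coefficients $h_j^s\in\mathbb{C}$ are determined by $\gamma^\sharp(\mathbf{a}^k\mathbf{d}_{m,j})=\delta_j^k$ (Kronecker delta) for $k,j=0,\dots,m$.
   Formalization: With the stated norm the sharp Poisson functional is not continuous on H^δ for 1<δ≤2 and the claim fails there; the bound δ>1 is replaced by δ>δ_0 for any δ_0≥1 such that this functional is well defined and continuous on all H^δ, δ>δ_0, which effectively means δ>2. *)

theory Defs
  imports "HOL-Analysis.Analysis"
begin

(* Elements of L_2(R) are represented by functions, two functions being identified when they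
   agree almost everywhere.  All notions below respect this identification. *)

definition L2 :: "(real \<Rightarrow> complex) set" where
  "L2 = {f. f \<in> borel_measurable lborel \<and> integrable lborel (\<lambda>x. (cmod (f x))\<^sup>2)}"

definition L2_norm :: "(real \<Rightarrow> complex) \<Rightarrow> real" where
  "L2_norm f = sqrt (LINT x|lborel. (cmod (f x))\<^sup>2)"

definition L2_inner :: "(real \<Rightarrow> complex) \<Rightarrow> (real \<Rightarrow> complex) \<Rightarrow> complex" where
  "L2_inner f g = (LINT x|lborel. f x * cnj (g x))"

definition gabor :: "real \<times> real \<Rightarrow> real \<Rightarrow> complex" where
  "gabor = (\<lambda>(p, \<theta>) x. of_real (2 powr (1/4)) *
      exp (of_real (- pi * (x - p)\<^sup>2) + 2 * of_real pi * \<i> * of_real \<theta> * of_real x))"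

definition Lambda :: "(real \<times> real) set" where
  "Lambda = \<int> \<times> \<int>"

definition sharp_pt :: "real \<times> real" where
  "sharp_pt = (1/2, 1/2)"

definition test_function :: "(real \<Rightarrow> complex) \<Rightarrow> bool" where
  "test_function \<phi> \<longleftrightarrow>
     (\<exists>D :: nat \<Rightarrow> real \<Rightarrow> complex. D 0 = \<phi> \<and>
        (\<forall>k x. (D k has_vector_derivative D (Suc k) x) (at x))) \<and>
     (\<exists>R. \<forall>x. \<bar>x\<bar> > R \<longrightarrow> \<phi> x = 0)"

definition locally_integrable :: "(real \<Rightarrow> complex) \<Rightarrow> bool" where
  "locally_integrable f \<longleftrightarrow> (\<forall>K. compact K \<longrightarrow> set_integrable lborel K f)"

definition is_weak_deriv :: "(real \<Rightarrow> complex) \<Rightarrow> (real \<Rightarrow> complex) \<Rightarrow> bool" where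
  "is_weak_deriv f g \<longleftrightarrow> locally_integrable f \<and> locally_integrable g \<and>
     (\<forall>\<phi>. test_function \<phi> \<longrightarrow>
        (LINT x|lborel. f x * vector_derivative \<phi> (at x)) = - (LINT x|lborel. g x * \<phi> x))"

definition weakly_differentiable :: "(real \<Rightarrow> complex) \<Rightarrow> bool" where
  "weakly_differentiable f \<longleftrightarrow> (\<exists>g. is_weak_deriv f g)"

(* Unique up to a null set when it exists. *)
definition weak_deriv :: "(real \<Rightarrow> complex) \<Rightarrow> real \<Rightarrow> complex" where
  "weak_deriv f = (SOME g. is_weak_deriv f g)"

definition annih :: "(real \<Rightarrow> complex) \<Rightarrow> real \<Rightarrow> complex" where
  "annih f = (\<lambda>x. weak_deriv f x / of_real (2 * pi) + of_real x * f x)"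

(* The norm on real * real is the Euclidean one, and lborel on it is planar Lebesgue measure. *)
definition H_space :: "real \<Rightarrow> (real \<Rightarrow> complex) set" where
  "H_space \<delta> = {f \<in> L2. integrable lborel
      (\<lambda>l :: real \<times> real. (norm l powr \<delta> + 1) * (cmod (L2_inner f (gabor l)))\<^sup>2)}"

definition H_norm :: "real \<Rightarrow> (real \<Rightarrow> complex) \<Rightarrow> real" where
  "H_norm \<delta> f = sqrt (LINT l :: real \<times> real|lborel.
      (norm l powr \<delta> + 1) * (cmod (L2_inner f (gabor l)))\<^sup>2)"

(* weak_deriv is a choice operator, so that the derivatives entering a^j f exist has to be
   required explicitly. *)
definition Hm_space :: "real \<Rightarrow> nat \<Rightarrow> (real \<Rightarrow> complex) set" where
  "Hm_space \<delta> m = {f. (\<forall>j<m. weakly_differentiable ((annih ^^ j) f)) \<and>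
                       (\<forall>j\<le>m. (annih ^^ j) f \<in> H_space \<delta>)}"

definition Hm_norm :: "real \<Rightarrow> nat \<Rightarrow> (real \<Rightarrow> complex) \<Rightarrow> real" where
  "Hm_norm \<delta> m f = sqrt (\<Sum>j\<le>m. (H_norm \<delta> ((annih ^^ j) f))\<^sup>2)"

(* The spaces decrease as \<delta> grows.  H^m is the case \<delta>0 = 1, and H the case \<delta>0 = 1, m = 0. *)
definition Hm_union :: "real \<Rightarrow> nat \<Rightarrow> (real \<Rightarrow> complex) set" where
  "Hm_union \<delta>0 m = (\<Union>\<delta>\<in>{\<delta>0<..}. Hm_space \<delta> m)"

definition linear_functional_on ::
  "(real \<Rightarrow> complex) set \<Rightarrow> ((real \<Rightarrow> complex) \<Rightarrow> complex) \<Rightarrow> bool" where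
  "linear_functional_on V \<gamma> \<longleftrightarrow>
     (\<forall>f\<in>V. \<forall>g\<in>V. \<gamma> (\<lambda>x. f x + g x) = \<gamma> f + \<gamma> g) \<and>
     (\<forall>c. \<forall>f\<in>V. \<gamma> (\<lambda>x. c * f x) = c * \<gamma> f)"

definition continuous_functional_on ::
  "((real \<Rightarrow> complex) \<Rightarrow> real) \<Rightarrow> (real \<Rightarrow> complex) set \<Rightarrow>
     ((real \<Rightarrow> complex) \<Rightarrow> complex) \<Rightarrow> bool" where
  "continuous_functional_on N V \<gamma> \<longleftrightarrow>
     (\<forall>f\<in>V. \<forall>\<epsilon>>0. \<exists>\<eta>>0. \<forall>g\<in>V. N (\<lambda>x. g x - f x) < \<eta> \<longrightarrow> cmod (\<gamma> g - \<gamma> f) < \<epsilon>)"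

definition continuous_linear_functional ::
  "real \<Rightarrow> nat \<Rightarrow> ((real \<Rightarrow> complex) \<Rightarrow> complex) \<Rightarrow> bool" where
  "continuous_linear_functional \<delta>0 m \<gamma> \<longleftrightarrow>
     linear_functional_on (Hm_union \<delta>0 m) \<gamma> \<and>
     (\<forall>\<delta>>\<delta>0. continuous_functional_on (Hm_norm \<delta> m) (Hm_space \<delta> m) \<gamma>)"

definition has_cont_rep :: "(real \<Rightarrow> complex) \<Rightarrow> bool" where
  "has_cont_rep f \<longleftrightarrow> (\<exists>g. continuous_on UNIV g \<and> (AE x in lborel. f x = g x))"

(* Two continuous functions that agree almost everywhere are equal, so the representative
   is unique. *)
definition cont_rep :: "(real \<Rightarrow> complex) \<Rightarrow> real \<Rightarrow> complex" where
  "cont_rep f = (THE g. continuous_on UNIV g \<and> (AE x in lborel. f x = g x))"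

definition Theta :: "complex \<Rightarrow> complex" where
  "Theta z = of_real (2 powr (1/4)) *
     (\<Sum>\<^sub>\<infinity>q\<in>(UNIV :: int set). exp (2 * of_real pi * \<i> * of_int q * z - of_real pi * (of_int q)\<^sup>2))"

(* Point values of an element of L_2 are those of its continuous representative. *)
definition gamma_sharp :: "(real \<Rightarrow> complex) \<Rightarrow> complex" where
  "gamma_sharp f = 1 / (\<i> * Theta 0) *
     (\<Sum>\<^sub>\<infinity>q\<in>(UNIV :: int set). (-1) powi q * cont_rep f (of_int q + 1/2))"

(* The functional gamma_sharp is well defined and continuous on the union of the spaces
   H^\<delta>, \<delta> > \<delta>0.  The exponent is a parameter because, with the weight |l|^\<delta> of H_norm, this
   holds if \<delta>0 >= 2 but not for 1 <= \<delta>0 < 2: one has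
   |gamma_sharp f| <= const * (LINT l. (norm l powr \<delta> + 1) powr (-1))^(1/2) * H_norm \<delta> f,
   and finite sums of Gabor functions at half-integer points show that \<delta> > 2 is also necessary. *)
definition gamma_sharp_well_defined :: "real \<Rightarrow> bool" where
  "gamma_sharp_well_defined \<delta>0 \<longleftrightarrow>
     (\<forall>f\<in>Hm_union \<delta>0 0. has_cont_rep f \<and>
        (\<lambda>q :: int. (-1) powi q * cont_rep f (of_int q + 1/2)) summable_on UNIV) \<and>
     continuous_linear_functional \<delta>0 0 gamma_sharp"

definition gabor_comb ::
  "nat \<Rightarrow> (nat \<Rightarrow> real \<times> real) \<Rightarrow> (nat \<Rightarrow> complex) \<Rightarrow> real \<Rightarrow> complex" where
  "gabor_comb m \<mu> c = (\<lambda>x. \<Sum>s\<le>m. c s * gabor (\<mu> s) x)"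

(* h j s is the coefficient of the Gabor function at \<mu> s in d_{m,j}.  The equations determine
   h j s for all j, s \<le> m, because annih multiplies gabor (p, \<theta>) by p + \<i>\<theta>: the matrix of the
   linear system is a Vandermonde matrix with columns scaled by nonzero factors. *)
definition d_coeff :: "nat \<Rightarrow> (nat \<Rightarrow> real \<times> real) \<Rightarrow> nat \<Rightarrow> nat \<Rightarrow> complex" where
  "d_coeff m \<mu> = (SOME h. \<forall>j\<le>m. \<forall>k\<le>m.
      gamma_sharp ((annih ^^ k) (gabor_comb m \<mu> (h j))) = (if k = j then 1 else 0))"

definition d_fun :: "nat \<Rightarrow> (nat \<Rightarrow> real \<times> real) \<Rightarrow> nat \<Rightarrow> real \<Rightarrow> complex" where
  "d_fun m \<mu> j = gabor_comb m \<mu> (d_coeff m \<mu> j)"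

definition sobolev :: "nat \<Rightarrow> (real \<Rightarrow> complex) set" where
  "sobolev m = {f. (\<forall>j<m. weakly_differentiable ((weak_deriv ^^ j) f)) \<and>
                   (\<forall>j\<le>m. (weak_deriv ^^ j) f \<in> L2)}"

definition sobolev_norm :: "nat \<Rightarrow> (real \<Rightarrow> complex) \<Rightarrow> real" where
  "sobolev_norm m f = sqrt (\<Sum>j\<le>m. (L2_norm ((weak_deriv ^^ j) f))\<^sup>2)"

(* f is the unconditional sum of the family u over A, in the Sobolev norm. *)
definition has_sobolev_sum ::
  "nat \<Rightarrow> ('i \<Rightarrow> real \<Rightarrow> complex) \<Rightarrow> (real \<Rightarrow> complex) \<Rightarrow> 'i set \<Rightarrow> bool" where
  "has_sobolev_sum m u f A \<longleftrightarrow> f \<in> sobolev m \<and> (\<forall>i\<in>A. u i \<in> sobolev m) \<and>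
     ((\<lambda>F. sobolev_norm m (\<lambda>x. f x - (\<Sum>i\<in>F. u i x))) \<longlongrightarrow> 0) (finite_subsets_at_top A)"

end

theory Submission
  imports Defs "HOL-Probability.Probability"
begin

text \<open>Pair \<open>f\<close> with the time-frequency shifts, over the lattice, of Bastiaans' dual window of the Gaussian; this gives the coefficient
\<open>beta l f\<close>. The window is bounded but does not decay, and it jumps exactly at the half-integers. Integration by parts therefore gives,
for \<open>l = (p, q)\<close>,
\<open>beta l (annih f) = (p + i q) * beta l f + kappa * (-1)^(p+q) * half_int_sum f\<close>,
where \<open>half_int_sum f\<close> is the alternating sum of the values of \<open>f\<close> at the half-integers, a nonzero multiple of \<open>gamma_sharp f\<close>.
If \<open>half_int_sum f = 0\<close>, this identity for Gabor functions shows that \<open>f\<close> is mapped to its coefficients by a kernel that is Hilbert-Schmidt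
with respect to the weight of \<open>H_space \<delta>\<close>, \<open>\<delta> > 2\<close>; so they are square summable, and by the Poisson summation formula
they expand \<open>f\<close>. In general put \<open>g = f - (\<Sum>j\<le>m. gamma_sharp (annih^j f) * d_fun m \<mu> j)\<close>. Then \<open>half_int_sum\<close> vanishes at
\<open>g, annih g, ..., annih^m g\<close>, hence \<open>beta l (annih^j g) = (p + i q)^j * beta l g\<close>, and the square summability for the iterates is the
weighted summability for \<open>g\<close>. A Bessel inequality for lattice sums upgrades the convergence to the Sobolev norm.
Testing on finite sums of Gabor functions at half-integer points shows that the continuity of \<open>gamma_sharp\<close> forces \<open>\<delta>0 \<ge> 2\<close>.\<close>

text \<open>The lattice has critical density, and the Zak transform of the Gaussian vanishes at
  (1/2, 1/2), which is the identity \<open>theta_term_sum_zero\<close>. This zero is the reason why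
  the dual window does not decay and why \<open>gamma_sharp\<close> appears as an obstruction. In l
  the coefficient of a Gabor function centred at \<eta> falls off only like 1 / norm (\<eta> - l),
  whose squares just fail to be summable over a planar lattice; one further power of norm l is
  enough. The number 2 enters through the integrability of (1 + norm \<eta>) powr (- \<delta>) over
  the plane: for \<delta> > 2 every element of \<open>H_space \<delta>\<close> has an integrable
  Gabor transform, so that statements about it are superpositions of statements about single Gabor
  functions, with bounds uniform in their centres. Since \<open>weak_deriv\<close> is a choice
  operator, identities between iterates of \<open>annih\<close> hold almost everywhere only;
  functionals are therefore handled through the transform \<open>trf\<close>, which ignores null
  sets, and point values through its synthesis \<open>synth\<close>.\<close>

section \<open>Gaussian integrals and the Gabor transform\<close>

text \<open>Absolute integrability of the double integral follows because the kernels K(., y) have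
  uniformly bounded L1 norms while A supplies the integrability in y. Identities known for single
  Gabor functions are extended in this way to integrable superpositions of them.\<close>

lemma superpose:
  fixes A :: "'b \<Rightarrow> complex" and K :: "'a \<Rightarrow> 'b \<Rightarrow> complex"
  assumes "sigma_finite_measure M" "sigma_finite_measure N"
    and A: "integrable N A"
    and K: "(\<lambda>(x,y). K x y) \<in> borel_measurable (M \<Otimes>\<^sub>M N)"
    and int: "\<And>y. y \<in> space N \<Longrightarrow> integrable M (\<lambda>x. K x y)"
    and bd: "\<And>y. y \<in> space N \<Longrightarrow> (LINT x|M. norm (K x y)) \<le> C"
  shows "integrable M (\<lambda>x. LINT y|N. A y * K x y)"
    and "(LINT x|M. LINT y|N. A y * K x y) = (LINT y|N. A y * (LINT x|M. K x y))"
    and "integrable (N \<Otimes>\<^sub>M M) (\<lambda>(y,x). A y * K x y)"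
proof -
  interpret P: pair_sigma_finite N M
    using assms by (simp add: pair_sigma_finite_def)
  have [measurable]: "A \<in> borel_measurable N" using A by auto
  have Km: "(\<lambda>(y,x). K x y) \<in> borel_measurable (N \<Otimes>\<^sub>M M)"
    using measurable_compose[OF measurable_pair_swap' K] by (simp add: case_prod_unfold)
  have meas: "(\<lambda>(y,x). A y * K x y) \<in> borel_measurable (N \<Otimes>\<^sub>M M)"
    using Km by (simp add: case_prod_unfold)
  have Kn: "(\<lambda>(y,x). norm (K x y)) \<in> borel_measurable (N \<Otimes>\<^sub>M M)"
    using Km by (simp add: case_prod_unfold)
  have "(\<lambda>y. LINT x|M. norm (K x y)) \<in> borel_measurable N"
    using P.M2.borel_measurable_lebesgue_integral[OF Kn] by simp
  then have "integrable N (\<lambda>y. LINT x|M. norm (A y * K x y))"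
    unfolding norm_mult
    by (intro Bochner_Integration.integrable_bound[OF integrable_norm[OF integrable_mult_right[OF A, of C]]])
      (auto simp: norm_mult mult.commute[of "\<bar>C\<bar>"] intro!: AE_I2 mult_left_mono
        order_trans[OF bd abs_ge_self])
  then show *: "integrable (N \<Otimes>\<^sub>M M) (\<lambda>(y,x). A y * K x y)"
    using int by (intro P.Fubini_integrable meas) (auto intro!: AE_I2)
  show "integrable M (\<lambda>x. LINT y|N. A y * K x y)"
    using P.integrable_snd[OF *] by simp
  show "(LINT x|M. LINT y|N. A y * K x y) = (LINT y|N. A y * (LINT x|M. K x y))"
    using P.Fubini_integral[OF *] by (simp cong: Bochner_Integration.integral_cong)
qed

text \<open>Up to the factor sqrt s this is the normal density with mean c and variance 1 / (2 pi
  s).\<close>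

lemma gaussian_integral:
  fixes s c :: real
  assumes "s > 0"
  shows "integrable lborel (\<lambda>x. exp (- (pi * s) * (x - c)\<^sup>2))"
    and "(LINT x|lborel. exp (- (pi * s) * (x - c)\<^sup>2)) = 1 / sqrt s"
proof -
  define \<sigma> where "\<sigma> = 1 / sqrt (2 * pi * s)"
  have \<sigma>: "\<sigma> > 0" "\<sigma>\<^sup>2 = 1 / (2 * pi * s)"
    using assms by (auto simp: \<sigma>_def power_divide)
  have "2 * pi * \<sigma>\<^sup>2 = 1 / s" using assms \<sigma> by (simp add: field_simps)
  moreover have "(x - c)\<^sup>2 / (2 * \<sigma>\<^sup>2) = (pi * s) * (x - c)\<^sup>2" for x
    using assms \<sigma> by (simp add: field_simps)
  ultimately have *: "normal_density c \<sigma> x = sqrt s * exp (- (pi * s) * (x - c)\<^sup>2)" for x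
    unfolding normal_density_def by (simp add: real_sqrt_divide)
  have i: "integrable lborel (\<lambda>x. (1 / sqrt s) * normal_density c \<sigma> x)"
    using \<sigma> by (intro integrable_mult_right integrable_normal_density)
  have eq: "(\<lambda>x. (1 / sqrt s) * normal_density c \<sigma> x) = (\<lambda>x. exp (- (pi * s) * (x - c)\<^sup>2))"
    unfolding * using assms by auto
  show "integrable lborel (\<lambda>x. exp (- (pi * s) * (x - c)\<^sup>2))"
    using i unfolding eq .
  have "(LINT x|lborel. (1 / sqrt s) * normal_density c \<sigma> x) = 1 / sqrt s"
    using \<sigma> by simp
  then show "(LINT x|lborel. exp (- (pi * s) * (x - c)\<^sup>2)) = 1 / sqrt s"
    unfolding eq .
qed

lemma borel_measurable_cis[measurable (raw)]:
  "f \<in> borel_measurable M \<Longrightarrow> (\<lambda>x. cis (f x)) \<in> borel_measurable M"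
  unfolding cis_conv_exp by measurable

text \<open>The substitution x = c + y / r with r = sqrt (2 pi s) turns the integral into the
  characteristic function of the standard normal distribution at t = 2 pi \<tau> / r.\<close>

lemma gaussian_fourier:
  fixes s c \<tau> :: real
  assumes "s > 0"
  shows "integrable lborel (\<lambda>x. of_real (exp (- (pi * s) * (x - c)\<^sup>2)) * cis (2 * pi * \<tau> * x))"
    and "(LINT x|lborel. of_real (exp (- (pi * s) * (x - c)\<^sup>2)) * cis (2 * pi * \<tau> * x)) =
      of_real (exp (- pi * \<tau>\<^sup>2 / s) / sqrt s) * cis (2 * pi * \<tau> * c)"
proof -
  show "integrable lborel (\<lambda>x. of_real (exp (- (pi * s) * (x - c)\<^sup>2)) * cis (2 * pi * \<tau> * x))"
    by (rule Bochner_Integration.integrable_bound[OF gaussian_integral(1)[OF assms, of c]])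
      (auto simp: norm_mult)
  define r where "r = sqrt (2 * pi * s)"
  have r: "r > 0" "r\<^sup>2 = 2 * pi * s" using assms by (auto simp: r_def)
  define t where "t = 2 * pi * \<tau> / r"
  have t2: "t\<^sup>2 / 2 = pi * \<tau>\<^sup>2 / s"
    unfolding t_def power_divide r(2) using assms by (simp add: power2_eq_square field_simps)
  have "(LINT x|lborel. of_real (exp (- (pi * s) * (x - c)\<^sup>2)) * cis (2 * pi * \<tau> * x)) =
    (1/r) *\<^sub>R (LINT y|lborel. of_real (exp (- (pi * s) * (c + (1/r) * y - c)\<^sup>2)) * cis (2 * pi * \<tau> * (c + (1/r) * y)))"
    using r by (subst lborel_integral_real_affine[of "1/r" _ c]) auto
  also have "(\<lambda>y. of_real (exp (- (pi * s) * (c + (1/r) * y - c)\<^sup>2)) * cis (2 * pi * \<tau> * (c + (1/r) * y))) =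
     (\<lambda>y. (of_real (sqrt (2 * pi)) * cis (2 * pi * \<tau> * c)) * (std_normal_density y *\<^sub>R iexp (t * y)))"
  proof
    fix y
    have "(pi * s) * (c + (1/r) * y - c)\<^sup>2 = y\<^sup>2 / 2"
      using assms r by (simp add: power_divide)
    then have "exp (- (pi * s) * (c + (1/r) * y - c)\<^sup>2) = sqrt (2 * pi) * std_normal_density y"
      by (simp add: normal_density_def)
    moreover have "cis (2 * pi * \<tau> * (c + (1/r) * y)) = cis (2 * pi * \<tau> * c) * iexp (t * y)"
    proof -
      have "2 * pi * \<tau> * (c + (1/r) * y) = 2 * pi * \<tau> * c + t * y"
        using r by (simp add: t_def field_simps)
      then have "cis (2 * pi * \<tau> * (c + (1/r) * y)) = cis (2 * pi * \<tau> * c) * cis (t * y)"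
        by (simp only: cis_mult)
      then show ?thesis by (simp only: cis_conv_exp of_real_mult)
    qed
    ultimately show "of_real (exp (- (pi * s) * (c + (1/r) * y - c)\<^sup>2)) * cis (2 * pi * \<tau> * (c + (1/r) * y)) =
      (of_real (sqrt (2 * pi)) * cis (2 * pi * \<tau> * c)) * (std_normal_density y *\<^sub>R iexp (t * y))"
      by (simp add: scaleR_conv_of_real)
  qed
  also have "(LINT y|lborel. (of_real (sqrt (2 * pi)) * cis (2 * pi * \<tau> * c)) * (std_normal_density y *\<^sub>R iexp (t * y)))
    = (of_real (sqrt (2 * pi)) * cis (2 * pi * \<tau> * c)) * char std_normal_distribution t"
    by (subst integral_mult_right_zero) (simp add: char_def integral_density normal_density_nonneg)
  also have "char std_normal_distribution t = of_real (exp (- pi * \<tau>\<^sup>2 / s))"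
    unfolding char_std_normal_distribution using t2 by simp
  also have "(1/r) *\<^sub>R (of_real (sqrt (2 * pi)) * cis (2 * pi * \<tau> * c) * complex_of_real (exp (- pi * \<tau>\<^sup>2 / s)))
     = of_real (exp (- pi * \<tau>\<^sup>2 / s) / sqrt s) * cis (2 * pi * \<tau> * c)"
    using assms by (simp add: r_def real_sqrt_mult scaleR_conv_of_real field_simps)
  finally show "(LINT x|lborel. of_real (exp (- (pi * s) * (x - c)\<^sup>2)) * cis (2 * pi * \<tau> * x)) =
      of_real (exp (- pi * \<tau>\<^sup>2 / s) / sqrt s) * cis (2 * pi * \<tau> * c)" .
qed

lemma gabor_eq: "gabor l x = of_real (2 powr (1/4) * exp (- pi * (x - fst l)\<^sup>2)) * cis (2 * pi * snd l * x)"
proof -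
  have "cis (2 * pi * snd l * x) = exp (2 * of_real pi * \<i> * of_real (snd l) * of_real x)"
    unfolding cis_conv_exp by (rule arg_cong[where f=exp]) simp
  then show ?thesis
    unfolding gabor_def case_prod_unfold of_real_mult exp_of_real[symmetric] exp_add by simp
qed

lemma norm_gabor: "norm (gabor l x) = 2 powr (1/4) * exp (- pi * (x - fst l)\<^sup>2)"
  unfolding gabor_eq by (simp add: norm_mult)

lemma gabor_measurable[measurable (raw)]:
  assumes "f \<in> borel_measurable M" "g \<in> borel_measurable M"
  shows "(\<lambda>x. gabor (f x) (g x)) \<in> borel_measurable M"
proof -
  have [measurable]: "(\<lambda>x. fst (f x)) \<in> borel_measurable M" "(\<lambda>x. snd (f x)) \<in> borel_measurable M"
    by (rule borel_measurable_continuous_on[OF _ assms(1)]; intro continuous_intros)+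
  note assms(2)[measurable]
  show ?thesis unfolding gabor_eq by measurable
qed

section \<open>Cauchy-Schwarz and integrable weights on the phase plane\<close>

lemma integral_Cauchy_Schwarz:
  fixes f g :: "'a \<Rightarrow> real"
  assumes [measurable]: "f \<in> borel_measurable M" "g \<in> borel_measurable M"
    and f: "integrable M (\<lambda>x. (f x)\<^sup>2)" and g: "integrable M (\<lambda>x. (g x)\<^sup>2)"
  shows "integrable M (\<lambda>x. f x * g x)"
    and "(LINT x|M. \<bar>f x * g x\<bar>)\<^sup>2 \<le> (LINT x|M. (f x)\<^sup>2) * (LINT x|M. (g x)\<^sup>2)"
proof -
  have am: "2 * \<bar>a * b\<bar> \<le> a\<^sup>2 + b\<^sup>2" for a b :: real
    using sum_squares_bound[of "\<bar>a\<bar>" "\<bar>b\<bar>"] by (simp add: abs_mult)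
  show i: "integrable M (\<lambda>x. f x * g x)"
    by (rule Bochner_Integration.integrable_bound[OF Bochner_Integration.integrable_add[OF f g]])
      (auto intro!: AE_I2 order_trans[OF _ am])
  define A B I where "A = (LINT x|M. (f x)\<^sup>2)" "B = (LINT x|M. (g x)\<^sup>2)" "I = (LINT x|M. \<bar>f x * g x\<bar>)"
  have nn: "A \<ge> 0" "B \<ge> 0" "I \<ge> 0" by (auto simp: A_B_I_def)
  \<comment> \<open>The arithmetic-geometric inequality with a free scale t. The choice t = I / B is
    optimal; if B = 0, a large t forces I = 0.\<close>
  have key: "2 * t * I \<le> A + t\<^sup>2 * B" if "t > 0" for t
  proof -
    have "2 * t * I = (LINT x|M. 2 * \<bar>f x * (t * g x)\<bar>)"
      unfolding A_B_I_def using that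
      by (subst integral_mult_right_zero[symmetric]) (simp add: abs_mult mult_ac)
    also have "\<dots> \<le> (LINT x|M. (f x)\<^sup>2 + (t * g x)\<^sup>2)"
      using i f g by (intro integral_mono am)
        (auto simp: power_mult_distrib mult.left_commute[of _ t])
    also have "\<dots> = A + t\<^sup>2 * B"
      using f g by (simp add: A_B_I_def power_mult_distrib)
    finally show ?thesis .
  qed
  have "I\<^sup>2 \<le> A * B"
  proof (cases "B = 0")
    case True
    have "I \<le> 0"
    proof (rule ccontr)
      assume "\<not> I \<le> 0"
      then have "I > 0" by simp
      with key[of "(A + 1) / I"] nn True have "2 * (A + 1) \<le> A" by simp
      with nn show False by simp
    qed
    then show ?thesis using nn True by simp
  next
    case False
    show ?thesis
    proof (cases "I = 0")
      case True then show ?thesis using nn by simp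
    next
      case I0: False
      have "2 * (I / B) * I \<le> A + (I / B)\<^sup>2 * B" using False I0 nn by (intro key) auto
      then show ?thesis using False nn by (simp add: field_simps power2_eq_square)
    qed
  qed
  then show "(LINT x|M. \<bar>f x * g x\<bar>)\<^sup>2 \<le> (LINT x|M. (f x)\<^sup>2) * (LINT x|M. (g x)\<^sup>2)"
    by (simp add: A_B_I_def)
qed

lemma integrable_product:
  fixes f g :: "real \<Rightarrow> real"
  assumes f: "integrable lborel f" and g: "integrable lborel g"
  shows "integrable lborel (\<lambda>l :: real \<times> real. f (fst l) * g (snd l))"
proof -
  have [measurable]: "f \<in> borel_measurable lborel" "g \<in> borel_measurable lborel" using f g by auto
  have "integrable (lborel \<Otimes>\<^sub>M lborel) (\<lambda>l :: real \<times> real. f (fst l) * g (snd l))"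
    using f g by (intro lborel_pair.Fubini_integrable) (auto simp: abs_mult)
  then show ?thesis unfolding lborel_prod .
qed

lemma integral_iterated:
  fixes f :: "real \<times> real \<Rightarrow> complex"
  assumes "integrable lborel f"
  shows "integral\<^sup>L lborel f = (LINT p|lborel. LINT q|lborel. f (p, q))"
  using lborel_pair.integral_fst[of "\<lambda>p q. f (p, q)"] assms unfolding lborel_prod by simp

lemma integrable_even_real:
  fixes f :: "real \<Rightarrow> real"
  assumes [measurable]: "f \<in> borel_measurable borel"
    and "set_integrable lborel {0..} f" "\<And>x. f (- x) = f x"
  shows "integrable lborel f"
proof -
  have 1: "integrable lborel (\<lambda>x. indicator {0..} x * f x)"
    using assms(2) by (simp add: set_integrable_def)
  have "integrable lborel (\<lambda>x. indicator {0..} (0 + (-1) * x) * f (0 + (-1) * x))"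
    by (rule lborel_integrable_real_affine[OF 1]) simp
  then have 2: "integrable lborel (\<lambda>x. indicator {..0} x * f x)"
    by (rule back_subst[where P = "integrable lborel"]) (auto simp: assms(3) indicator_def fun_eq_iff)
  show ?thesis
    by (rule Bochner_Integration.integrable_bound[OF Bochner_Integration.integrable_add[OF integrable_norm[OF 1] integrable_norm[OF 2]]])
      (auto intro!: AE_I2 simp: indicator_def)
qed

lemma integrable_one_plus_abs_powr:
  assumes "a > 1"
  shows "integrable lborel (\<lambda>x::real. (1 + \<bar>x\<bar>) powr (- a))"
proof (rule integrable_even_real)
  define F where "F x = - ((1 + x) powr (1 - a)) / (a - 1)" for x :: real
  have lim: "(F \<longlongrightarrow> 0) at_top"
  proof -
    have "((\<lambda>x. (1 + x) powr (1 - a)) \<longlongrightarrow> 0) at_top"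
      using assms by (intro tendsto_neg_powr filterlim_tendsto_add_at_top[OF tendsto_const] filterlim_ident) auto
    then show ?thesis
      unfolding F_def using tendsto_divide[OF tendsto_minus tendsto_const, of "\<lambda>x. (1 + x) powr (1 - a)" 0 at_top "a - 1"] assms
      by simp
  qed
  have "(\<integral>\<^sup>+x. ennreal ((1 + \<bar>x\<bar>) powr (- a)) * indicator {0..} x \<partial>lborel) = 0 - F 0"
  proof (rule nn_integral_FTC_atLeast[OF _ _ _ lim])
    fix x :: real assume "0 \<le> x"
    then have "(F has_real_derivative - ((1 - a) * (1 + x) powr (1 - a - 1)) / (a - 1)) (at x)"
      unfolding F_def using assms by (auto intro!: derivative_eq_intros)
    moreover have "- ((1 - a) * (1 + x) powr (1 - a - 1)) / (a - 1) = (1 + \<bar>x\<bar>) powr (- a)"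
      using assms \<open>0 \<le> x\<close> by (simp add: field_simps)
    ultimately show "(F has_real_derivative (1 + \<bar>x\<bar>) powr (- a)) (at x)" by simp
  qed auto
  also have "\<dots> < \<infinity>" by simp
  finally have "integrable lborel (\<lambda>x. (1 + \<bar>x\<bar>) powr (- a) * indicator {0..} x)"
    by (subst integrable_iff_bounded) (auto simp: ennreal_mult' ennreal_indicator abs_mult)
  then show "set_integrable lborel {0..} (\<lambda>x. (1 + \<bar>x\<bar>) powr (- a))"
    by (simp add: set_integrable_def mult.commute)
qed auto

text \<open>The exponent is split evenly between the two coordinates, so that a > 2 becomes two
  one-dimensional exponents a / 2 > 1. The positive results below owe their condition \<delta> > 2
  to this.\<close>

lemma integrable_phase_plane_decay:
  assumes "a > 2"
  shows "integrable lborel (\<lambda>l :: real \<times> real. (1 + norm l) powr (- a))"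
proof -
  have "integrable lborel (\<lambda>l :: real \<times> real. (1 + \<bar>fst l\<bar>) powr (- (a/2)) * (1 + \<bar>snd l\<bar>) powr (- (a/2)))"
    using assms by (intro integrable_product integrable_one_plus_abs_powr) auto
  then show ?thesis
  proof (rule Bochner_Integration.integrable_bound)
    show "AE l in lborel. norm ((1 + norm l) powr (- a)) \<le> norm ((1 + \<bar>fst l\<bar>) powr (- (a/2)) * (1 + \<bar>snd l\<bar>) powr (- (a/2)))"
    proof (intro AE_I2)
      fix l :: "real \<times> real"
      have n: "\<bar>fst l\<bar> \<le> norm l" "\<bar>snd l\<bar> \<le> norm l"
        using norm_fst_le[of "fst l" "snd l"] norm_snd_le[of "snd l" "fst l"] by auto
      have "(1 + norm l) powr (- a) = (1 + norm l) powr (- (a/2)) * (1 + norm l) powr (- (a/2))"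
        by (simp flip: powr_add)
      also have "\<dots> \<le> (1 + \<bar>fst l\<bar>) powr (- (a/2)) * (1 + \<bar>snd l\<bar>) powr (- (a/2))"
        using n assms by (intro mult_mono powr_mono2') auto
      finally show "norm ((1 + norm l) powr (- a)) \<le> norm ((1 + \<bar>fst l\<bar>) powr (- (a/2)) * (1 + \<bar>snd l\<bar>) powr (- (a/2)))"
        by simp
    qed
  qed auto
qed

lemma weight_lower_bound:
  fixes l :: "real \<times> real"
  assumes "\<delta> > 0"
  shows "(1 + norm l) powr \<delta> \<le> 2 powr \<delta> * (norm l powr \<delta> + 1)"
proof (cases "norm l \<le> 1")
  case True
  then have "(1 + norm l) powr \<delta> \<le> 2 powr \<delta> * 1"
    using assms by (auto intro!: powr_mono2)
  also have "\<dots> \<le> 2 powr \<delta> * (norm l powr \<delta> + 1)" by (intro mult_left_mono) auto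
  finally show ?thesis .
next
  case False
  then have "(1 + norm l) powr \<delta> \<le> (2 * norm l) powr \<delta>"
    using assms by (auto intro!: powr_mono2)
  also have "\<dots> \<le> 2 powr \<delta> * (norm l powr \<delta> + 1)"
    by (simp add: powr_mult)
  finally show ?thesis .
qed


section \<open>Inner products of Gabor functions and the reproducing formula\<close>

lemma gabor_in_L2: "gabor l \<in> L2"
  and gabor_integrable: "integrable lborel (gabor l)"
  and integral_norm_gabor: "(LINT x|lborel. norm (gabor l x)) = 2 powr (1/4)"
  and integral_norm_gabor_sq: "(LINT x|lborel. (norm (gabor l x))\<^sup>2) = 1"
proof -
  have sq: "(norm (gabor l x))\<^sup>2 = sqrt 2 * exp (- (pi * 2) * (x - fst l)\<^sup>2)" for x
    unfolding norm_gabor power_mult_distrib by (simp add: powr_half_sqrt[symmetric] powr_power flip: exp_double)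
  show "gabor l \<in> L2"
    unfolding L2_def mem_Collect_eq sq using gaussian_integral(1)[of 2 "fst l"] by (auto intro!: integrable_mult_right)
  have "integrable lborel (\<lambda>x. norm (gabor l x))"
    unfolding norm_gabor using gaussian_integral(1)[of 1 "fst l"] by (auto intro!: integrable_mult_right)
  then show "integrable lborel (gabor l)"
    by (subst (asm) integrable_norm_iff) auto
  show "(LINT x|lborel. norm (gabor l x)) = 2 powr (1/4)"
    unfolding norm_gabor using gaussian_integral(2)[of 1 "fst l"] by simp
  show "(LINT x|lborel. (norm (gabor l x))\<^sup>2) = 1"
    unfolding sq using gaussian_integral(2)[of 2 "fst l"] by simp
qed

text \<open>Completing the square: the product of the two Gaussians is a Gaussian of doubled rate
  about the midpoint c, and the integral is its Fourier transform at the frequency difference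
  \<tau>. The modulus depends on the distance of the two points only, so this reproducing kernel
  decays like a Gaussian.\<close>

lemma L2_inner_gabor_gabor:
  "L2_inner (gabor a) (gabor b) =
    of_real (exp (- (pi / 2) * (norm (a - b))\<^sup>2)) * cis (pi * (snd a - snd b) * (fst a + fst b))"
proof -
  define c \<tau> where "c = (fst a + fst b) / 2" and "\<tau> = snd a - snd b"
  have "gabor a x * cnj (gabor b x) =
    of_real (sqrt 2 * exp (- (pi / 2) * (fst a - fst b)\<^sup>2)) * (of_real (exp (- (pi * 2) * (x - c)\<^sup>2)) * cis (2 * pi * \<tau> * x))" for x
  proof -
    have 1: "2 powr (1/4) * 2 powr (1/4) = sqrt (2::real)"
      by (simp add: powr_half_sqrt flip: powr_add)
    have 2: "- pi * (x - fst a)\<^sup>2 + - pi * (x - fst b)\<^sup>2 = - (pi / 2) * (fst a - fst b)\<^sup>2 + - (pi * 2) * (x - c)\<^sup>2"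
      by (simp add: c_def power2_eq_square field_simps)
    have "gabor a x * cnj (gabor b x) = of_real ((2 powr (1/4) * 2 powr (1/4)) * (exp (- pi * (x - fst a)\<^sup>2) * exp (- pi * (x - fst b)\<^sup>2)))
      * (cis (2 * pi * snd a * x) * cis (- (2 * pi * snd b * x)))"
      unfolding gabor_eq by (simp add: cis_cnj)
    also have "cis (2 * pi * snd a * x) * cis (- (2 * pi * snd b * x)) = cis (2 * pi * \<tau> * x)"
      unfolding cis_mult \<tau>_def by (simp add: algebra_simps)
    finally show ?thesis unfolding 1 exp_add[symmetric] 2 unfolding exp_add by simp
  qed
  then have "L2_inner (gabor a) (gabor b) = of_real (sqrt 2 * exp (- (pi / 2) * (fst a - fst b)\<^sup>2)) *
     (of_real (exp (- pi * \<tau>\<^sup>2 / 2) / sqrt 2) * cis (2 * pi * \<tau> * c))"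
    unfolding L2_inner_def using gaussian_fourier(2)[of 2 c \<tau>] by simp
  also have "\<dots> = of_real (exp (- (pi / 2) * (fst a - fst b)\<^sup>2) * exp (- pi * \<tau>\<^sup>2 / 2)) * cis (2 * pi * \<tau> * c)"
    by simp
  also have "exp (- (pi / 2) * (fst a - fst b)\<^sup>2) * exp (- pi * \<tau>\<^sup>2 / 2) = exp (- (pi / 2) * (norm (a - b))\<^sup>2)"
    by (simp add: \<tau>_def norm_prod_def field_simps flip: exp_add)
  also have "2 * pi * \<tau> * c = pi * (snd a - snd b) * (fst a + fst b)"
    by (simp add: c_def \<tau>_def)
  finally show ?thesis .
qed

lemma norm_L2_inner_gabor_gabor:
  "norm (L2_inner (gabor a) (gabor b)) = exp (- (pi / 2) * (fst a - fst b)\<^sup>2) * exp (- (pi / 2) * (snd a - snd b)\<^sup>2)"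
  unfolding L2_inner_gabor_gabor by (simp add: norm_mult norm_prod_def field_simps flip: exp_add)

lemma L2_inner_cnj: "L2_inner g f = cnj (L2_inner f g)"
proof -
  have "(\<lambda>x. g x * cnj (f x)) = (\<lambda>x. cnj (f x * cnj (g x)))"
    by (simp add: mult.commute)
  then show ?thesis unfolding L2_inner_def by (simp only: Bochner_Integration.integral_cnj)
qed

lemma borel_measurable_cnj[measurable (raw)]:
  "f \<in> borel_measurable M \<Longrightarrow> (\<lambda>x. cnj (f x)) \<in> borel_measurable M"
  by (rule borel_measurable_continuous_on[of cnj]) (intro continuous_intros)

lemma integrable_L2_inner_gabor_gabor: "integrable lborel (\<lambda>\<eta>. L2_inner (gabor \<mu>) (gabor \<eta>))"
proof -
  have "integrable lborel (\<lambda>\<eta> :: real \<times> real. exp (- (pi * (1/2)) * (fst \<eta> - fst \<mu>)\<^sup>2) * exp (- (pi * (1/2)) * (snd \<eta> - snd \<mu>)\<^sup>2))"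
    by (intro integrable_product gaussian_integral) auto
  then show ?thesis
  proof (rule Bochner_Integration.integrable_bound)
    show "(\<lambda>\<eta>. L2_inner (gabor \<mu>) (gabor \<eta>)) \<in> borel_measurable lborel"
      unfolding L2_inner_def by measurable
  qed (auto simp: norm_L2_inner_gabor_gabor power2_commute)
qed

text \<open>Two Gaussian integrals in succession: after the integration over the frequency q the
  exponents in p recombine to a Gaussian about x, whose integral has mass 1. The inversion of the
  Gabor transform for general functions is deduced from this case.\<close>

lemma gabor_reproducing:
  "gabor \<mu> x = (LINT \<eta>|lborel. L2_inner (gabor \<mu>) (gabor \<eta>) * gabor \<eta> x)"
proof -
  define G where "G p = 2 powr (1/4) * exp (- (pi / 2) * (fst \<mu> - p)\<^sup>2) * exp (- pi * (x - p)\<^sup>2)" for p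
  define t where "t p = x - (fst \<mu> + p) / 2" for p
  have split: "L2_inner (gabor \<mu>) (gabor (p, q)) * gabor (p, q) x =
     (of_real (G p) * cis (pi * snd \<mu> * (fst \<mu> + p))) *
     (of_real (exp (- (pi * (1/2)) * (q - snd \<mu>)\<^sup>2)) * cis (2 * pi * t p * q))" for p q
  proof -
    have c: "cis (pi * (snd \<mu> - q) * (fst \<mu> + p)) * cis (2 * pi * q * x) = cis (pi * snd \<mu> * (fst \<mu> + p)) * cis (2 * pi * t p * q)"
      unfolding cis_mult by (rule arg_cong[where f = cis]) (simp add: t_def field_simps)
    have e: "exp (- (pi / 2) * (norm (\<mu> - (p, q)))\<^sup>2) = exp (- (pi / 2) * (fst \<mu> - p)\<^sup>2) * exp (- (pi * (1/2)) * (q - snd \<mu>)\<^sup>2)"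
      by (cases \<mu>) (simp add: norm_prod_def field_simps power2_commute flip: exp_add)
    show ?thesis
      unfolding L2_inner_gabor_gabor gabor_eq e G_def using arg_cong[OF c, of "\<lambda>z. of_real (exp (- (pi / 2) * (fst \<mu> - p)\<^sup>2) * exp (- (pi * (1/2)) * (q - snd \<mu>)\<^sup>2) * (2 powr (1/4) * exp (- pi * (x - p)\<^sup>2))) * z"]
      by (simp add: mult_ac)
  qed
  have int: "integrable lborel (\<lambda>\<eta>. L2_inner (gabor \<mu>) (gabor \<eta>) * gabor \<eta> x)"
  proof (rule Bochner_Integration.integrable_bound[OF integrable_mult_right[OF integrable_L2_inner_gabor_gabor[of \<mu>], of "of_real (2 powr (1/4))"]])
    show "(\<lambda>\<eta>. L2_inner (gabor \<mu>) (gabor \<eta>) * gabor \<eta> x) \<in> borel_measurable lborel"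
      unfolding L2_inner_def by measurable
    show "AE \<eta> in lborel. norm (L2_inner (gabor \<mu>) (gabor \<eta>) * gabor \<eta> x) \<le> norm (complex_of_real (2 powr (1/4)) * L2_inner (gabor \<mu>) (gabor \<eta>))"
      by (intro AE_I2) (auto simp: norm_mult norm_gabor mult.commute[of "2 powr _"] intro!: mult_left_mono)
  qed
  have "(LINT \<eta>|lborel. L2_inner (gabor \<mu>) (gabor \<eta>) * gabor \<eta> x) =
      (LINT p|lborel. (of_real (G p) * cis (pi * snd \<mu> * (fst \<mu> + p))) *
        (of_real (exp (- pi * (t p)\<^sup>2 / (1/2)) / sqrt (1/2)) * cis (2 * pi * t p * snd \<mu>)))"
    unfolding integral_iterated[OF int] split
  proof (intro Bochner_Integration.integral_cong refl)
    fix p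
    show "(LINT q|lborel. (of_real (G p) * cis (pi * snd \<mu> * (fst \<mu> + p))) *
        (of_real (exp (- (pi * (1/2)) * (q - snd \<mu>)\<^sup>2)) * cis (2 * pi * t p * q))) =
      (of_real (G p) * cis (pi * snd \<mu> * (fst \<mu> + p))) *
        (of_real (exp (- pi * (t p)\<^sup>2 / (1/2)) / sqrt (1/2)) * cis (2 * pi * t p * snd \<mu>))"
      using gaussian_fourier(2)[of "1/2" "snd \<mu>" "t p"] by (simp only: integral_mult_right_zero)
  qed
  also have "\<dots> = (LINT p|lborel. gabor \<mu> x * (of_real (sqrt 2) * of_real (exp (- (pi * 2) * (p - x)\<^sup>2))))"
  proof (intro Bochner_Integration.integral_cong refl)
    fix p
    have c: "cis (pi * snd \<mu> * (fst \<mu> + p)) * cis (2 * pi * t p * snd \<mu>) = cis (2 * pi * snd \<mu> * x)"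
      unfolding cis_mult by (rule arg_cong[where f = cis]) (simp add: t_def field_simps)
    have "- (pi / 2) * (fst \<mu> - p)\<^sup>2 + - pi * (x - p)\<^sup>2 + - pi * (t p)\<^sup>2 / (1/2) = - pi * (x - fst \<mu>)\<^sup>2 + - (pi * 2) * (p - x)\<^sup>2"
      by (simp add: t_def power2_eq_square field_simps)
    then have e: "exp (- (pi / 2) * (fst \<mu> - p)\<^sup>2) * exp (- pi * (x - p)\<^sup>2) * exp (- pi * (t p)\<^sup>2 / (1/2)) = exp (- pi * (x - fst \<mu>)\<^sup>2) * exp (- (pi * 2) * (p - x)\<^sup>2)"
      by (simp only: exp_add[symmetric])
    have "(of_real (G p) * cis (pi * snd \<mu> * (fst \<mu> + p))) *
        (of_real (exp (- pi * (t p)\<^sup>2 / (1/2)) / sqrt (1/2)) * cis (2 * pi * t p * snd \<mu>)) =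
       of_real (2 powr (1/4) * sqrt 2 * (exp (- (pi / 2) * (fst \<mu> - p)\<^sup>2) * exp (- pi * (x - p)\<^sup>2) * exp (- pi * (t p)\<^sup>2 / (1/2)))) *
       (cis (pi * snd \<mu> * (fst \<mu> + p)) * cis (2 * pi * t p * snd \<mu>))"
      unfolding G_def by (simp add: real_sqrt_divide)
    also have "\<dots> = gabor \<mu> x * (of_real (sqrt 2) * of_real (exp (- (pi * 2) * (p - x)\<^sup>2)))"
      unfolding c e gabor_eq by simp
    finally show "(of_real (G p) * cis (pi * snd \<mu> * (fst \<mu> + p))) *
        (of_real (exp (- pi * (t p)\<^sup>2 / (1/2)) / sqrt (1/2)) * cis (2 * pi * t p * snd \<mu>)) =
       gabor \<mu> x * (of_real (sqrt 2) * of_real (exp (- (pi * 2) * (p - x)\<^sup>2)))" .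
  qed
  also have "\<dots> = gabor \<mu> x * (of_real (sqrt 2) * of_real (LINT p|lborel. exp (- (pi * 2) * (p - x)\<^sup>2)))"
    by simp
  also have "\<dots> = gabor \<mu> x"
    by (subst gaussian_integral(2)) auto
  finally show ?thesis by simp
qed


text \<open>The positive and negative parts of u have the same total mass c and the same Fourier
  transform. If c > 0, division by c turns them into probability densities, which the uniqueness
  theorem of Levy identifies.\<close>

lemma fourier_uniqueness_real:
  fixes u :: "real \<Rightarrow> real"
  assumes u: "integrable lborel u"
    and z: "\<And>t. (LINT x|lborel. of_real (u x) * cis (t * x)) = 0"
  shows "AE x in lborel. u x = 0"
proof -
  have [measurable]: "u \<in> borel_measurable borel" using u by auto
  define up un where "up x = max (u x) 0" and "un x = max (- u x) 0" for x
  have u_eq: "u x = up x - un x" and nn: "up x \<ge> 0" "un x \<ge> 0" for x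
    by (auto simp: up_def un_def)
  have i: "integrable lborel up" "integrable lborel un"
    unfolding up_def un_def using u by auto
  have [measurable]: "up \<in> borel_measurable borel" "un \<in> borel_measurable borel" using i by auto
  have eq: "(LINT x|lborel. of_real (up x) * cis (t * x)) = (LINT x|lborel. of_real (un x) * cis (t * x))" for t
  proof -
    have j: "integrable lborel (\<lambda>x. of_real (up x) * cis (t * x))" "integrable lborel (\<lambda>x. of_real (un x) * cis (t * x))"
      using i by (auto intro: Bochner_Integration.integrable_bound simp: norm_mult)
    show ?thesis
      using z[of t] unfolding u_eq of_real_diff left_diff_distrib by (simp add: j)
  qed
  define c where "c = (LINT x|lborel. up x)"
  have c': "c = (LINT x|lborel. un x)"
  proof -
    have "complex_of_real (LINT x|lborel. up x) = complex_of_real (LINT x|lborel. un x)"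
      using eq[of 0] by simp
    then show ?thesis unfolding c_def of_real_eq_iff .
  qed
  have "AE x in lborel. up x = un x"
  proof (cases "c = 0")
    case True
    then have "AE x in lborel. up x = 0" "AE x in lborel. un x = 0"
      using integral_nonneg_eq_0_iff_AE[OF i(1)] integral_nonneg_eq_0_iff_AE[OF i(2)] nn c_def c' by auto
    then show ?thesis by eventually_elim simp
  next
    case False
    then have c: "c > 0" using Bochner_Integration.integral_nonneg[of lborel up, OF nn(1)] c_def by linarith
    define M N where "M = density lborel (\<lambda>x. ennreal (up x / c))" and "N = density lborel (\<lambda>x. ennreal (un x / c))"
    have "real_distribution M" unfolding M_def
    proof (intro real_distribution.intro real_distribution_axioms.intro prob_spaceI)
      have "(\<integral>\<^sup>+x. ennreal (up x / c) \<partial>lborel) = ennreal (LINT x|lborel. up x / c)"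
        using i c nn by (intro nn_integral_eq_integral) auto
      then show "emeasure (density lborel (\<lambda>x. ennreal (up x / c))) (space (density lborel (\<lambda>x. ennreal (up x / c)))) = 1"
        using c by (simp add: emeasure_density c_def[symmetric])
    qed auto
    moreover have "real_distribution N" unfolding N_def
    proof (intro real_distribution.intro real_distribution_axioms.intro prob_spaceI)
      have "(\<integral>\<^sup>+x. ennreal (un x / c) \<partial>lborel) = ennreal (LINT x|lborel. un x / c)"
        using i c nn by (intro nn_integral_eq_integral) auto
      then show "emeasure (density lborel (\<lambda>x. ennreal (un x / c))) (space (density lborel (\<lambda>x. ennreal (un x / c)))) = 1"
        using c by (simp add: emeasure_density c'[symmetric])
    qed auto
    moreover have "char M = char N"
    proof
      fix t
      have "char M t = (LINT x|lborel. of_real (up x) * cis (t * x)) / c"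
        unfolding char_def M_def using c nn
        by (subst integral_density) (auto simp: scaleR_conv_of_real cis_conv_exp simp flip: integral_divide_zero)
      moreover have "char N t = (LINT x|lborel. of_real (un x) * cis (t * x)) / c"
        unfolding char_def N_def using c nn
        by (subst integral_density) (auto simp: scaleR_conv_of_real cis_conv_exp simp flip: integral_divide_zero)
      ultimately show "char M t = char N t" using eq by simp
    qed
    ultimately have "M = N" by (rule Levy_uniqueness)
    then have "AE x in lborel. ennreal (up x / c) = ennreal (un x / c)"
      unfolding M_def N_def by (subst (asm) sigma_finite_measure.density_unique_iff[OF lborel.sigma_finite_measure_axioms]) auto
    then show ?thesis
    proof eventually_elim
      case (elim x)
      then show ?case using c nn[of x] by (simp add: ennreal_inj)
    qed
  qed
  then show ?thesis by eventually_elim (simp add: u_eq)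
qed

lemma fourier_uniqueness:
  fixes u :: "real \<Rightarrow> complex"
  assumes u: "integrable lborel u"
    and z: "\<And>t. (LINT x|lborel. u x * cis (t * x)) = 0"
  shows "AE x in lborel. u x = 0"
proof -
  have j: "integrable lborel (\<lambda>x. u x * cis (t * x))" "integrable lborel (\<lambda>x. cnj (u x) * cis (t * x))" for t
    using u by (auto intro: Bochner_Integration.integrable_bound[OF u] simp: norm_mult)
  have zc: "(LINT x|lborel. cnj (u x) * cis (t * x)) = 0" for t
  proof -
    have "(LINT x|lborel. cnj (u x) * cis (t * x)) = (LINT x|lborel. cnj (u x * cis ((- t) * x)))"
      by (simp add: cis_cnj)
    also have "\<dots> = 0" unfolding Bochner_Integration.integral_cnj z by simp
    finally show ?thesis .
  qed
  have "AE x in lborel. Re (u x) = 0"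
  proof (rule fourier_uniqueness_real)
    fix t
    have "complex_of_real (Re (u x)) * cis (t * x) = (u x * cis (t * x) + cnj (u x) * cis (t * x)) / 2" for x
      by (simp add: complex_eq_iff)
    note * = this
    show "(LINT x|lborel. of_real (Re (u x)) * cis (t * x)) = 0"
      unfolding * by (simp add: j z zc)
  qed (use u in auto)
  moreover have "AE x in lborel. Im (u x) = 0"
  proof (rule fourier_uniqueness_real)
    fix t
    have "complex_of_real (Im (u x)) * cis (t * x) = (u x * cis (t * x) - cnj (u x) * cis (t * x)) / (2 * \<i>)" for x
      by (simp add: complex_eq_iff)
    note * = this
    show "(LINT x|lborel. of_real (Im (u x)) * cis (t * x)) = 0"
      unfolding * by (simp add: j z zc)
  qed (use u in auto)
  ultimately show ?thesis by eventually_elim (simp add: complex_eq_iff)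
qed

lemma L2_times_gabor_integrable:
  assumes "f \<in> L2"
  shows "integrable lborel (\<lambda>x. f x * cnj (gabor l x))"
    and "(LINT x|lborel. norm (f x * cnj (gabor l x))) \<le> L2_norm f"
    and "norm (L2_inner f (gabor l)) \<le> L2_norm f"
proof -
  have [measurable]: "f \<in> borel_measurable borel" and f: "integrable lborel (\<lambda>x. (norm (f x))\<^sup>2)"
    using assms by (auto simp: L2_def)
  have g: "integrable lborel (\<lambda>x. (norm (gabor l x))\<^sup>2)" using gabor_in_L2[of l] by (auto simp: L2_def)
  note cs = integral_Cauchy_Schwarz[OF _ _ f g]
  have "integrable lborel (\<lambda>x. norm (f x) * norm (gabor l x))" by (rule cs) auto
  then show i: "integrable lborel (\<lambda>x. f x * cnj (gabor l x))"
    by (rule Bochner_Integration.integrable_bound) (auto simp: norm_mult)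
  have "(LINT x|lborel. norm (f x * cnj (gabor l x)))\<^sup>2 \<le> (L2_norm f)\<^sup>2"
    using cs(2) unfolding integral_norm_gabor_sq by (simp add: norm_mult abs_mult L2_norm_def)
  then show *: "(LINT x|lborel. norm (f x * cnj (gabor l x))) \<le> L2_norm f"
    by (rule power2_le_imp_le) (simp add: L2_norm_def)
  show "norm (L2_inner f (gabor l)) \<le> L2_norm f"
    unfolding L2_inner_def by (rule order_trans[OF integral_norm_bound *])
qed

lemma L2_inner_gabor_measurable[measurable]:
  assumes "f \<in> L2"
  shows "(\<lambda>l. L2_inner f (gabor l)) \<in> borel_measurable borel"
proof -
  have [measurable]: "f \<in> borel_measurable borel" using assms by (auto simp: L2_def)
  have "(\<lambda>l. LINT x|lborel. f x * cnj (gabor l x)) \<in> borel_measurable lborel"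
    by measurable
  then show ?thesis by (simp add: L2_inner_def)
qed

text \<open>The adjoint of the Gabor transform. Applied to an integrable transform it recovers the
  function, and being defined pointwise it singles out the continuous representative.\<close>

definition synth :: "(real \<times> real \<Rightarrow> complex) \<Rightarrow> real \<Rightarrow> complex" where
  "synth A x = (LINT l|lborel. A l * gabor l x)"

lemma synth_measurable[measurable]:
  assumes "integrable lborel A"
  shows "synth A \<in> borel_measurable borel"
proof -
  have [measurable]: "A \<in> borel_measurable borel" using assms by auto
  have "(\<lambda>x. LINT l|lborel. A l * gabor l x) \<in> borel_measurable lborel" by measurable
  then show ?thesis by (simp add: synth_def[abs_def])
qed

lemma gabor_continuous: "continuous_on UNIV (gabor l)"
  unfolding gabor_eq[abs_def] cis_conv_exp by (intro continuous_intros)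

lemma synth_continuous:
  assumes A: "integrable lborel A"
  shows "continuous_on UNIV (synth A)"
proof -
  have [measurable]: "A \<in> borel_measurable borel" using A by auto
  have "(\<lambda>n. synth A (X n)) \<longlonglongrightarrow> synth A x" if X: "X \<longlonglongrightarrow> x" for X x
    unfolding synth_def
  proof (rule integral_dominated_convergence)
    show "integrable lborel (\<lambda>l. norm (of_real (2 powr (1/4)) * A l))"
      using A by auto
    show "AE l in lborel. (\<lambda>n. A l * gabor l (X n)) \<longlonglongrightarrow> A l * gabor l x"
      using gabor_continuous continuous_on_tendsto_compose[OF gabor_continuous X] by (auto intro!: tendsto_intros)
    show "AE l in lborel. norm (A l * gabor l (X n)) \<le> norm (of_real (2 powr (1/4)) * A l)" for n
      by (auto simp: norm_mult norm_gabor mult.commute[of "2 powr _"] intro!: mult_left_mono)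
  qed auto
  then show ?thesis
    by (auto simp: continuous_on_sequentially o_def)
qed

text \<open>f and the synthesis S of its transform have the same Gabor transform. At the points (0,
  \<theta>) this says that f - S, multiplied by a strictly positive Gaussian, has vanishing Fourier
  transform.\<close>

lemma synth_eq_of_transform_integrable:
  assumes f: "f \<in> L2" and V: "integrable lborel (\<lambda>l. L2_inner f (gabor l))"
  shows "AE x in lborel. f x = synth (\<lambda>l. L2_inner f (gabor l)) x"
proof -
  define A where "A = (\<lambda>l. L2_inner f (gabor l))"
  have A: "integrable lborel A" using V by (simp add: A_def)
  have [measurable]: "f \<in> borel_measurable borel" "A \<in> borel_measurable borel"
    using f A by (auto simp: L2_def)
  have s: "sigma_finite_measure lborel" by (rule lborel.sigma_finite_measure_axioms)
  define S where "S = synth A"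
  have [measurable]: "S \<in> borel_measurable borel" unfolding S_def using synth_measurable[OF A] .
  have ig: "integrable lborel (\<lambda>x. gabor \<eta> x * cnj (gabor \<mu> x))" for \<eta> \<mu>
    by (rule L2_times_gabor_integrable[OF gabor_in_L2])
  have Sint: "integrable lborel (\<lambda>x. S x * cnj (gabor \<mu> x))"
    and Sval: "(LINT x|lborel. S x * cnj (gabor \<mu> x)) = (LINT \<eta>|lborel. A \<eta> * L2_inner (gabor \<eta>) (gabor \<mu>))" for \<mu>
  proof -
    have eq: "(\<lambda>x. LINT \<eta>|lborel. A \<eta> * (gabor \<eta> x * cnj (gabor \<mu> x))) = (\<lambda>x. S x * cnj (gabor \<mu> x))"
      by (simp add: S_def synth_def[abs_def] mult.assoc[symmetric])
    have b: "(LINT x|lborel. norm (gabor \<eta> x * cnj (gabor \<mu> x))) \<le> 1" for \<eta>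
      using L2_times_gabor_integrable(2)[OF gabor_in_L2[of \<eta>], of \<mu>] by (simp add: L2_norm_def integral_norm_gabor_sq)
    have m: "(\<lambda>(x, \<eta>). gabor \<eta> x * cnj (gabor \<mu> x)) \<in> borel_measurable (lborel \<Otimes>\<^sub>M lborel)"
      by measurable
    show "integrable lborel (\<lambda>x. S x * cnj (gabor \<mu> x))"
      using superpose(1)[OF s s A m ig b] unfolding eq by simp
    show "(LINT x|lborel. S x * cnj (gabor \<mu> x)) = (LINT \<eta>|lborel. A \<eta> * L2_inner (gabor \<eta>) (gabor \<mu>))"
      using superpose(2)[OF s s A m ig b] unfolding eq L2_inner_def by simp
  qed
  \<comment> \<open>In the inner product with f the function gabor \<mu> is replaced by its own
    synthesis and the integrals are exchanged. The result is the same integral that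
    \<open>Sval\<close> gives for S.\<close>
  have Aval: "A \<mu> = (LINT \<eta>|lborel. A \<eta> * L2_inner (gabor \<eta>) (gabor \<mu>))" for \<mu>
  proof -
    have B: "integrable lborel (\<lambda>\<eta>. cnj (L2_inner (gabor \<mu>) (gabor \<eta>)))"
      using integrable_L2_inner_gabor_gabor[of \<mu>] by simp
    have m: "(\<lambda>(x, \<eta>). f x * cnj (gabor \<eta> x)) \<in> borel_measurable (lborel \<Otimes>\<^sub>M lborel)"
      by measurable
    have "A \<mu> = (LINT x|lborel. f x * cnj (LINT \<eta>|lborel. L2_inner (gabor \<mu>) (gabor \<eta>) * gabor \<eta> x))"
      unfolding A_def L2_inner_def[of f] by (simp only: gabor_reproducing[symmetric])
    also have "\<dots> = (LINT x|lborel. LINT \<eta>|lborel. cnj (L2_inner (gabor \<mu>) (gabor \<eta>)) * (f x * cnj (gabor \<eta> x)))"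
    proof (intro Bochner_Integration.integral_cong refl)
      fix x
      have "(\<lambda>\<eta>. cnj (L2_inner (gabor \<mu>) (gabor \<eta>)) * (f x * cnj (gabor \<eta> x))) =
         (\<lambda>\<eta>. f x * cnj (L2_inner (gabor \<mu>) (gabor \<eta>) * gabor \<eta> x))" by (simp add: mult_ac)
      then show "f x * cnj (LINT \<eta>|lborel. L2_inner (gabor \<mu>) (gabor \<eta>) * gabor \<eta> x) =
         (LINT \<eta>|lborel. cnj (L2_inner (gabor \<mu>) (gabor \<eta>)) * (f x * cnj (gabor \<eta> x)))"
        by (simp only: Bochner_Integration.integral_cnj integral_mult_right_zero)
    qed
    also have "\<dots> = (LINT \<eta>|lborel. cnj (L2_inner (gabor \<mu>) (gabor \<eta>)) * A \<eta>)"
      using superpose(2)[OF s s B m] L2_times_gabor_integrable[OF f] unfolding A_def L2_inner_def[of f] by blast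
    also have "\<dots> = (LINT \<eta>|lborel. A \<eta> * L2_inner (gabor \<eta>) (gabor \<mu>))"
      by (simp add: L2_inner_cnj[of "gabor _" "gabor \<mu>"] mult.commute)
    finally show ?thesis .
  qed
  define g :: "real \<Rightarrow> complex" where "g x = of_real (2 powr (1/4) * exp (- pi * x\<^sup>2))" for x :: real
  have gg: "cnj (gabor (0, \<theta>) x) = g x * cis (- (2 * pi * \<theta>) * x)" for x \<theta>
    unfolding gabor_eq g_def by (simp add: cis_cnj)
  have "AE x in lborel. (f x - S x) * g x = 0"
  proof (rule fourier_uniqueness)
    have "integrable lborel (\<lambda>x. f x * cnj (gabor (0,0) x) - S x * cnj (gabor (0,0) x))"
      using L2_times_gabor_integrable[OF f] Sint by auto
    then show "integrable lborel (\<lambda>x. (f x - S x) * g x)"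
      unfolding gg by (simp add: left_diff_distrib)
    fix t
    have "(f x - S x) * g x * cis (t * x) = f x * cnj (gabor (0, - t / (2 * pi)) x) - S x * cnj (gabor (0, - t / (2 * pi)) x)" for x
      unfolding gg by (simp add: algebra_simps)
    then have "(LINT x|lborel. (f x - S x) * g x * cis (t * x)) = A (0, - t / (2 * pi)) - (LINT \<eta>|lborel. A \<eta> * L2_inner (gabor \<eta>) (gabor (0, - t / (2 * pi))))"
      using L2_times_gabor_integrable(1)[OF f] Sint Sval unfolding A_def L2_inner_def[of f] by simp
    then show "(LINT x|lborel. (f x - S x) * g x * cis (t * x)) = 0"
      by (simp flip: Aval)
  qed
  then show ?thesis
    unfolding S_def A_def by eventually_elim (auto simp: g_def)
qed

section \<open>Weak derivatives\<close>

text \<open>Differentiability to a finite order, in place of the infinite sequence of derivatives in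
  \<open>test_function\<close>: closure under sums, products, inverses and affine substitutions then
  follows by induction on the order.\<close>

primrec times_diff :: "nat \<Rightarrow> (real \<Rightarrow> complex) \<Rightarrow> bool" where
  "times_diff 0 f \<longleftrightarrow> True"
| "times_diff (Suc n) f \<longleftrightarrow> (\<exists>f'. (\<forall>x. (f has_vector_derivative f' x) (at x)) \<and> times_diff n f')"

lemma times_diff_SucI:
  "(\<And>x. (f has_vector_derivative f' x) (at x)) \<Longrightarrow> times_diff n f' \<Longrightarrow> times_diff (Suc n) f"
  by auto

lemma times_diff_Suc_D: "times_diff (Suc n) f \<Longrightarrow> times_diff n f"
  by (induction n arbitrary: f) auto

lemma times_diff_const: "times_diff n (\<lambda>x. c)"
  by (induction n arbitrary: c) (auto intro!: exI[of _ "\<lambda>x. 0"])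

lemma times_diff_ident: "times_diff n of_real"
proof (cases n)
  case (Suc k)
  have "\<forall>x. (complex_of_real has_vector_derivative 1) (at x)"
    by (auto intro!: derivative_eq_intros simp: has_vector_derivative_def scaleR_conv_of_real has_derivative_of_real[OF has_derivative_ident])
  then show ?thesis using times_diff_const[of k 1] Suc by (auto intro!: exI[of _ "\<lambda>x. 1"])
qed auto

lemma times_diff_add: "times_diff n f \<Longrightarrow> times_diff n g \<Longrightarrow> times_diff n (\<lambda>x. f x + g x)"
proof (induction n arbitrary: f g)
  case (Suc n)
  then obtain f' g' where "\<forall>x. (f has_vector_derivative f' x) (at x)" "times_diff n f'"
    "\<forall>x. (g has_vector_derivative g' x) (at x)" "times_diff n g'" by auto
  then show ?case
    using Suc.IH[of f' g'] by (auto intro!: exI[of _ "\<lambda>x. f' x + g' x"] derivative_intros)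
qed auto

lemma times_diff_mult: "times_diff n f \<Longrightarrow> times_diff n g \<Longrightarrow> times_diff n (\<lambda>x. f x * g x)"
proof (induction n arbitrary: f g)
  case (Suc n)
  then obtain f' g' where *: "\<forall>x. (f has_vector_derivative f' x) (at x)" "times_diff n f'"
    "\<forall>x. (g has_vector_derivative g' x) (at x)" "times_diff n g'" by auto
  have "times_diff n (\<lambda>x. f x * g' x + f' x * g x)"
    using * Suc by (intro times_diff_add Suc.IH) (auto dest: times_diff_Suc_D simp del: times_diff.simps)
  then show ?case
    using * by (auto intro!: exI[of _ "\<lambda>x. f x * g' x + f' x * g x"] has_vector_derivative_mult)
qed auto

lemma times_diff_inverse:
  "times_diff n f \<Longrightarrow> (\<And>x. f x \<noteq> 0) \<Longrightarrow> times_diff n (\<lambda>x. inverse (f x))"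
proof (induction n arbitrary: f)
  case (Suc n)
  then obtain f' where *: "\<forall>x. (f has_vector_derivative f' x) (at x)" "times_diff n f'" by auto
  have i: "times_diff n (\<lambda>x. inverse (f x))"
    using Suc by (intro Suc.IH) (auto dest: times_diff_Suc_D simp del: times_diff.simps)
  have "times_diff n (\<lambda>x. (-1) * (inverse (f x) * (f' x * inverse (f x))))"
    using * i by (intro times_diff_mult times_diff_const)
  moreover have "((\<lambda>x. inverse (f x)) has_vector_derivative (-1) * (inverse (f x) * (f' x * inverse (f x)))) (at x)" for x
  proof -
    have "(f has_derivative (\<lambda>h. h *\<^sub>R f' x)) (at x)"
      using * by (auto simp: has_vector_derivative_def)
    from Deriv.has_derivative_inverse[OF Suc.prems(2) this] show ?thesis
      by (auto simp: has_vector_derivative_def scaleR_conv_of_real mult_ac)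
  qed
  ultimately show ?case by (intro times_diff_SucI)
qed auto

lemma times_diff_affine:
  "times_diff n f \<Longrightarrow> times_diff n (\<lambda>x. f (c * x + d))"
proof (induction n arbitrary: f)
  case (Suc n)
  then obtain f' where *: "\<forall>x. (f has_vector_derivative f' x) (at x)" "times_diff n f'" by auto
  have "times_diff n (\<lambda>x. of_real c * f' (c * x + d))"
    by (intro times_diff_mult times_diff_const Suc.IH *)
  moreover have "((\<lambda>x. f (c * x + d)) has_vector_derivative of_real c * f' (c * x + d)) (at x)" for x
  proof -
    have 1: "((\<lambda>x. c * x + d) has_real_derivative c) (at x)" by (auto intro!: derivative_eq_intros)
    have "((\<lambda>x. c * x + d) has_vector_derivative c) (at x)"
      using 1 by (simp add: has_real_derivative_iff_has_vector_derivative)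
    then have "(f \<circ> (\<lambda>x. c * x + d) has_vector_derivative c *\<^sub>R f' (c * x + d)) (at x)"
      using * by (intro vector_diff_chain_at) auto
    then show ?thesis by (simp add: o_def scaleR_conv_of_real)
  qed
  ultimately show ?case by (intro times_diff_SucI)
qed auto

text \<open>Derivatives are unique, so the witnesses for different orders n agree, and iterating
  \<open>vector_derivative\<close> yields one sequence that serves for all n.\<close>

lemma times_diff_all_imp:
  assumes "\<And>n. times_diff n f"
  obtains D where "D 0 = f" "\<And>k x. (D k has_vector_derivative D (Suc k) x) (at x)"
proof -
  define d where "d g = (\<lambda>x. vector_derivative g (at x))" for g :: "real \<Rightarrow> complex"
  define D where "D k = (d ^^ k) f" for k
  have 1: "(g has_vector_derivative d g x) (at x)" "times_diff n (d g)" if "times_diff (Suc n) g" for n g x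
  proof -
    from that obtain g' where g': "\<forall>x. (g has_vector_derivative g' x) (at x)" "times_diff n g'" by auto
    then have "d g = g'" by (auto simp: d_def fun_eq_iff intro: vector_derivative_at)
    then show "(g has_vector_derivative d g x) (at x)" "times_diff n (d g)" using g' by auto
  qed
  have 2: "\<forall>n. times_diff n (D k)" for k
    by (induction k) (use assms 1 in \<open>auto simp: D_def simp del: times_diff.simps\<close>)
  show ?thesis
    by (rule that[of D]) (use 1(1)[of 0] 2[rule_format, of "Suc 0"] in \<open>auto simp: D_def simp del: times_diff.simps\<close>)
qed

text \<open>The standard flat function exp (-1/x), with a polynomial factor in 1/x so that the class
  is closed under differentiation: P is replaced by X^2 (P - P'). At 0 the difference quotient tends
  to 0 from the right because the exponential beats every polynomial.\<close>

lemma times_diff_exp_inverse_poly: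
  "times_diff n (\<lambda>x. if x > 0 then of_real (poly P (1 / x) * exp (- 1 / x)) else 0)"
proof (induction n arbitrary: P)
  case (Suc n)
  define E where "E P x = (if x > 0 then poly P (1 / x) * exp (- 1 / x) else 0)" for P and x :: real
  define Q where "Q = monom 1 2 * (P - pderiv P)"
  have lim0: "((\<lambda>y. poly R y * exp (- y)) \<longlongrightarrow> 0) at_top" for R :: "real poly"
  proof (induction R)
    case (pCons a R)
    have "((\<lambda>y. poly R y * exp (- y)) \<longlongrightarrow> 0) at_top" for R :: "real poly"
    proof -
      have "((\<lambda>y. \<Sum>i\<le>degree R. coeff R i * (y ^ i / exp y)) \<longlongrightarrow> (\<Sum>i\<le>degree R. coeff R i * 0)) at_top"
        by (intro tendsto_intros tendsto_power_div_exp_0)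
      then show ?thesis by (simp add: poly_altdef exp_minus sum_distrib_right divide_inverse mult.assoc)
    qed
    then show ?case .
  qed simp
  have "(E P has_real_derivative E Q x) (at x)" for x
  proof -
    consider "x > 0" | "x < 0" | "x = 0" by linarith
    then show ?thesis
    proof cases
      case 1
      have "((\<lambda>x. poly P (1 / x) * exp (- 1 / x)) has_real_derivative E Q x) (at x)"
        using 1 by (auto intro!: derivative_eq_intros simp: E_def Q_def poly_monom field_simps power2_eq_square)
      then show ?thesis
        by (rule has_field_derivative_transform_within_open[of _ _ _ "{0<..}"]) (use 1 in \<open>auto simp: E_def\<close>)
    next
      case 2
      have "((\<lambda>x. 0) has_real_derivative E Q x) (at x)"
        using 2 by (auto simp: E_def)
      then show ?thesis
        by (rule has_field_derivative_transform_within_open[of _ _ _ "{..<0}"]) (use 2 in \<open>auto simp: E_def\<close>)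
    next
      case 3
      have r: "((\<lambda>h. E P h / h) \<longlongrightarrow> 0) (at_right 0)"
      proof -
        have "((\<lambda>h. poly ([:0, 1:] * P) (inverse h) * exp (- inverse h)) \<longlongrightarrow> 0) (at_right (0::real))"
          by (rule filterlim_compose[OF lim0 filterlim_inverse_at_top_right])
        moreover have "\<forall>\<^sub>F h in at_right (0::real). poly ([:0, 1:] * P) (inverse h) * exp (- inverse h) = E P h / h"
          by (auto simp: eventually_at_filter E_def divide_inverse intro!: always_eventually)
        ultimately show ?thesis by (rule Lim_transform_eventually)
      qed
      have l: "((\<lambda>h. E P h / h) \<longlongrightarrow> 0) (at_left 0)"
        by (rule Lim_transform_eventually[OF tendsto_const]) (auto simp: eventually_at_filter E_def intro!: always_eventually)
      have "((\<lambda>h. E P h / h) \<longlongrightarrow> 0) (at 0)"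
        using filterlim_split_at[OF l r] .
      then show ?thesis using 3 by (simp add: DERIV_def E_def)
    qed
  qed
  then have "((\<lambda>x. complex_of_real (E P x)) has_vector_derivative of_real (E Q x)) (at x)" for x
    by (intro has_vector_derivative_of_real) (simp add: has_real_derivative_iff_has_vector_derivative)
  then show ?case
    using Suc[of Q] by (auto simp: E_def if_distrib[of complex_of_real] cong: if_cong intro!: exI[of _ "\<lambda>x. of_real (E Q x)"])
qed auto


text \<open>The quotient e(x + 1) / (e(x + 1) + e(1 - x)) for the flat function e; x + 1 and 1 - x
  are never both non-positive, so the denominator does not vanish. Differences of rescaled
  translates of this step serve as cutoffs and as smoothed indicators of intervals.\<close>

lemma step_function_exists:
  obtains R R' :: "real \<Rightarrow> complex"
  where "\<And>n. times_diff n R" "\<And>x. (R has_vector_derivative R' x) (at x)" "\<And>n. times_diff n R'"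
    "\<And>x. x \<le> -1 \<Longrightarrow> R x = 0" "\<And>x. x \<ge> 1 \<Longrightarrow> R x = 1" "\<And>x. norm (R x) \<le> 1"
proof -
  define e where "e = (\<lambda>x::real. if x > 0 then complex_of_real (poly [:1:] (1 / x) * exp (- 1 / x)) else 0)"
  have e: "times_diff n e" for n unfolding e_def by (rule times_diff_exp_inverse_poly)
  define er where "er x = (if x > 0 then exp (- 1 / x) else 0)" for x :: real
  have e_er: "e x = of_real (er x)" for x by (simp add: e_def er_def)
  have pos: "er (x + 1) + er (1 - x) > 0" "er x \<ge> 0" for x by (auto simp: er_def add_pos_nonneg add_nonneg_pos)
  define R where "R x = e (1 * x + 1) * inverse (e (1 * x + 1) + e ((-1) * x + 1))" for x
  have R: "times_diff n R" for n
    unfolding R_def[abs_def]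
  proof (intro times_diff_mult times_diff_inverse times_diff_add times_diff_affine e)
    fix x show "e (1 * x + 1) + e (- 1 * x + 1) \<noteq> 0"
      using pos(1)[of x] unfolding e_er by (simp flip: of_real_add)
  qed
  have R_er: "R x = of_real (er (x + 1) / (er (x + 1) + er (1 - x)))" for x
    unfolding R_def e_er by (simp add: divide_inverse)
  obtain D where D: "D 0 = R" "\<And>k x. (D k has_vector_derivative D (Suc k) x) (at x)"
    using times_diff_all_imp[OF R] by metis
  have "times_diff n (D k)" for n k
    by (induction n arbitrary: k) (use D(2) in auto)
  show ?thesis
  proof (rule that[of R "D 1"])
    show "(R has_vector_derivative D 1 x) (at x)" for x using D(2)[of 0] D(1) by simp
    show "R x = 0" if "x \<le> -1" for x using that by (simp add: R_er er_def)
    show "R x = 1" if "x \<ge> 1" for x using that pos(1)[of x] by (simp add: R_er er_def)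
    show "norm (R x) \<le> 1" for x
      unfolding R_er norm_of_real using pos(1)[of x] pos(2)[of "x+1"] pos(2)[of "1-x"] by (simp add: divide_le_eq)
  qed fact+
qed

lemma test_functionI:
  assumes "\<And>n. times_diff n \<phi>" "\<And>x. \<bar>x\<bar> > R \<Longrightarrow> \<phi> x = 0"
  shows "test_function \<phi>"
  using times_diff_all_imp[OF assms(1)] assms(2) unfolding test_function_def by metis

lemma test_functionE:
  assumes "test_function \<phi>"
  obtains \<phi>' R where "\<And>x. (\<phi> has_vector_derivative \<phi>' x) (at x)" "\<And>n. times_diff n \<phi>" "\<And>n. times_diff n \<phi>'"
    "\<And>x. \<bar>x\<bar> > R \<Longrightarrow> \<phi> x = 0" "\<And>x. \<bar>x\<bar> > R \<Longrightarrow> \<phi>' x = 0" "\<And>x. vector_derivative \<phi> (at x) = \<phi>' x"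
    "continuous_on UNIV \<phi>" "continuous_on UNIV \<phi>'"
proof -
  obtain D R where D: "D 0 = \<phi>" "\<And>k x. (D k has_vector_derivative D (Suc k) x) (at x)"
    and R: "\<And>x. \<bar>x\<bar> > R \<Longrightarrow> \<phi> x = 0"
    using assms unfolding test_function_def by metis
  have td: "times_diff n (D k)" for n k
    by (induction n arbitrary: k) (use D(2) in auto)
  have c: "continuous_on UNIV (D k)" for k
    using D(2)[of k] by (auto intro!: continuous_at_imp_continuous_on has_vector_derivative_continuous)
  have z: "D 1 x = 0" if "\<bar>x\<bar> > R" for x
  proof -
    have "open {x::real. \<bar>x\<bar> > R}" by (intro open_Collect_less continuous_intros)
    moreover have "((\<lambda>x. 0 :: complex) has_vector_derivative 0) (at x)" by simp
    ultimately have "(\<phi> has_vector_derivative 0) (at x)"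
      using R that by (elim has_vector_derivative_transform_within_open) auto
    with D(2)[of 0 x] D(1) show ?thesis by (auto dest: vector_derivative_unique_at)
  qed
  show ?thesis
    by (rule that[of "D 1" R])
      (use D(2)[of 0] D(1) R td[of _ 0] td[of _ 1] c[of 0] c[of 1] z in \<open>auto intro: vector_derivative_at\<close>)
qed

section \<open>Locally integrable functions\<close>

lemma locally_integrable_measurable:
  assumes "locally_integrable f"
  shows "f \<in> borel_measurable borel"
proof (rule borel_measurable_LIMSEQ_metric)
  fix n :: nat
  have "set_integrable lborel {- real n .. real n} f" using assms unfolding locally_integrable_def by auto
  then show "(\<lambda>x. indicator {- real n .. real n} x *\<^sub>R f x) \<in> borel_measurable borel"
    unfolding set_integrable_def by auto
next
  fix x
  have "\<forall>\<^sub>F n in sequentially. indicator {- real n .. real n} x *\<^sub>R f x = f x"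
  proof -
    obtain N where "\<bar>x\<bar> \<le> real N" using real_arch_simple by blast
    then show ?thesis by (intro eventually_sequentiallyI[of N]) (auto simp: indicator_def)
  qed
  then show "(\<lambda>n. indicator {- real n .. real n} x *\<^sub>R f x) \<longlonglongrightarrow> f x"
    by (rule tendsto_eventually)
qed

lemma locally_integrable_mult_continuous:
  assumes f: "locally_integrable f" and g: "continuous_on UNIV g"
  shows "locally_integrable (\<lambda>x. f x * g x)"
  unfolding locally_integrable_def
proof (intro allI impI)
  fix K :: "real set" assume K: "compact K"
  have [measurable]: "f \<in> borel_measurable borel" "g \<in> borel_measurable borel" "K \<in> sets borel"
    using locally_integrable_measurable[OF f] borel_measurable_continuous_onI[OF g] borel_compact[OF K] by auto
  have "bounded (g ` K)" using compact_continuous_image[OF continuous_on_subset[OF g] K] by (auto intro: compact_imp_bounded)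
  then obtain B where B: "\<And>x. x \<in> K \<Longrightarrow> norm (g x) \<le> B" unfolding bounded_iff by auto
  have i: "integrable lborel (\<lambda>x. B *\<^sub>R (indicator K x *\<^sub>R f x))"
    using f K unfolding locally_integrable_def set_integrable_def by (intro integrable_scaleR_right) auto
  show "set_integrable lborel K (\<lambda>x. f x * g x)"
    unfolding set_integrable_def
  proof (rule Bochner_Integration.integrable_bound[OF i])
    have "norm (f x * g x) \<le> \<bar>B\<bar> * norm (f x)" if "x \<in> K" for x
      using mult_left_mono[OF order_trans[OF B[OF that] abs_ge_self], of "norm (f x)"] by (simp add: norm_mult mult.commute)
    then show "AE x in lborel. norm (indicator K x *\<^sub>R (f x * g x)) \<le> norm (B *\<^sub>R (indicator K x *\<^sub>R f x))"
      by (auto simp: indicator_def norm_mult)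
  qed auto
qed

lemma integrable_mult_compact_support:
  fixes f g :: "real \<Rightarrow> complex"
  assumes f: "locally_integrable f" and g: "continuous_on UNIV g" and R: "\<And>x. \<bar>x\<bar> > R \<Longrightarrow> g x = 0"
  shows "integrable lborel (\<lambda>x. f x * g x)"
proof -
  have "set_integrable lborel {-R..R} (\<lambda>x. f x * g x)"
    using locally_integrable_mult_continuous[OF f g] unfolding locally_integrable_def by auto
  then show ?thesis
    unfolding set_integrable_def
    by (rule back_subst[where P = "integrable lborel"]) (auto simp: indicator_def fun_eq_iff intro!: R)
qed

lemma locally_integrable_add:
  "locally_integrable f \<Longrightarrow> locally_integrable g \<Longrightarrow> locally_integrable (\<lambda>x. f x + g x)"
  unfolding locally_integrable_def by (simp add: set_integral_add)

lemma locally_integrable_cong_AE: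
  assumes f: "locally_integrable f" and g: "g \<in> borel_measurable borel" and ae: "AE x in lborel. f x = g x"
  shows "locally_integrable g"
  unfolding locally_integrable_def
proof (intro allI impI)
  fix K :: "real set" assume K: "compact K"
  note [measurable] = g locally_integrable_measurable[OF f] borel_compact[OF K]
  have "set_integrable lborel K f" using f K unfolding locally_integrable_def by auto
  then show "set_integrable lborel K g"
    unfolding set_integrable_def
    by (rule iffD1[OF integrable_cong_AE, rotated -1]) (use ae in auto)
qed

lemma L2_locally_integrable:
  assumes "f \<in> L2"
  shows "locally_integrable f"
  unfolding locally_integrable_def
proof (intro allI impI)
  fix K :: "real set" assume K: "compact K"
  have f: "integrable lborel (\<lambda>x. (norm (f x))\<^sup>2)" and [measurable]: "f \<in> borel_measurable borel" "K \<in> sets borel"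
    using assms borel_compact[OF K] by (auto simp: L2_def)
  have "integrable lborel (\<lambda>x. indicator K x :: real)"
    using K emeasure_compact_finite[OF K] by (auto simp: integrable_indicator_iff)
  from Bochner_Integration.integrable_add[OF this f]
  show "set_integrable lborel K f" unfolding set_integrable_def
  proof (rule Bochner_Integration.integrable_bound)
    have "norm (f x) \<le> 1 + (norm (f x))\<^sup>2" for x
      using sum_squares_bound[of 1 "norm (f x)"] norm_ge_zero[of "f x"] unfolding one_power2 by linarith
    then show "AE x in lborel. norm (indicator K x *\<^sub>R f x) \<le> norm (indicator K x + (norm (f x))\<^sup>2)"
      by (auto simp: indicator_def intro!: order_trans[OF _ abs_ge_self])
  qed auto
qed

lemma locally_integrable_continuous:
  assumes "continuous_on UNIV f"
  shows "locally_integrable f"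
  unfolding locally_integrable_def
proof (intro allI impI)
  fix K :: "real set" assume "compact K"
  then show "set_integrable lborel K f"
    unfolding set_integrable_def using continuous_on_subset[OF assms, of K]
    by (intro borel_integrable_compact) auto
qed


lemma times_diff_cis: "times_diff n (\<lambda>x. cis (t * x))"
proof (induction n)
  case (Suc n)
  have "((\<lambda>x. cis (t * x)) has_vector_derivative (\<i> * of_real t) * cis (t * x)) (at x)" for x
  proof -
    have "((\<lambda>z. exp (\<i> * of_real t * z)) has_field_derivative \<i> * of_real t * exp (\<i> * of_real t * of_real x)) (at (of_real x))"
      by (auto intro!: derivative_eq_intros)
    from has_vector_derivative_real_field[OF this] show ?thesis
      unfolding cis_conv_exp by (simp add: mult.assoc)
  qed
  then show ?case using times_diff_mult[OF times_diff_const Suc] by (intro times_diff_SucI)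
qed auto

text \<open>A smooth cutoff makes u integrable, and the cutoff times cis (t x) is a test function
  for every t. The Fourier transform of the cut-off function therefore vanishes identically, and
  Fourier uniqueness applies.\<close>

lemma weak_zero_imp_AE_zero:
  assumes u: "locally_integrable u" and z: "\<And>\<phi>. test_function \<phi> \<Longrightarrow> (LINT x|lborel. u x * \<phi> x) = 0"
  shows "AE x in lborel. u x = 0"
proof -
  obtain R R' :: "real \<Rightarrow> complex" where R: "\<And>n. times_diff n R" "\<And>x. (R has_vector_derivative R' x) (at x)"
    "\<And>n. times_diff n R'" "\<And>x. x \<le> -1 \<Longrightarrow> R x = 0" "\<And>x. x \<ge> 1 \<Longrightarrow> R x = 1" "\<And>x. norm (R x) \<le> 1"
    using step_function_exists by metis
  have "AE x in lborel. \<bar>x\<bar> \<le> real N \<longrightarrow> u x = 0" for N :: nat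
  proof -
    define cut where "cut x = R (1 * x + (real N + 1)) + (-1) * R (1 * x + (- real N - 1))" for x
    have td: "times_diff n cut" for n unfolding cut_def[abs_def]
      by (intro times_diff_add times_diff_mult times_diff_const times_diff_affine R)
    have supp: "cut x = 0" if "\<bar>x\<bar> > real N + 2" for x
      using that R(4,5) by (cases "x > 0") (auto simp: cut_def)
    have one: "cut x = 1" if "\<bar>x\<bar> \<le> real N" for x
      using that R(4,5) by (auto simp: cut_def)
    have c: "continuous_on UNIV cut"
      using test_functionE[OF test_functionI[OF td supp]] by metis
    have i: "integrable lborel (\<lambda>x. u x * cut x)"
      by (rule integrable_mult_compact_support[OF u c supp])
    have "AE x in lborel. u x * cut x = 0"
    proof (rule fourier_uniqueness[OF i])
      fix t
      have "test_function (\<lambda>x. cut x * cis (t * x))"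
        by (rule test_functionI[of _ "real N + 2"]) (auto intro!: times_diff_mult td times_diff_cis simp: supp)
      from z[OF this] show "(LINT x|lborel. u x * cut x * cis (t * x)) = 0" by (simp add: mult.assoc)
    qed
    then show ?thesis by eventually_elim (auto simp: one)
  qed
  then have "AE x in lborel. \<forall>N. \<bar>x\<bar> \<le> real N \<longrightarrow> u x = 0"
    by (subst AE_all_countable) blast
  then show ?thesis
  proof eventually_elim
    case (elim x)
    then show ?case using real_arch_simple[of "\<bar>x\<bar>"] by auto
  qed
qed

section \<open>Calculus of weak derivatives\<close>

lemma is_weak_deriv_unique:
  assumes "is_weak_deriv f g" "is_weak_deriv f h"
  shows "AE x in lborel. g x = h x"
proof -
  have g: "locally_integrable g" and h: "locally_integrable h" using assms by (auto simp: is_weak_deriv_def)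
  have m: "locally_integrable (\<lambda>x. - 1 * h x)"
    using locally_integrable_mult_continuous[OF h continuous_on_const[of UNIV "-1"]] by simp
  have "AE x in lborel. g x + - 1 * h x = 0"
  proof (rule weak_zero_imp_AE_zero[OF locally_integrable_add[OF g m]])
    fix \<phi> :: "real \<Rightarrow> complex" assume \<phi>: "test_function \<phi>"
    then have i: "integrable lborel (\<lambda>x. g x * \<phi> x)" "integrable lborel (\<lambda>x. h x * \<phi> x)"
      using test_functionE[OF \<phi>] integrable_mult_compact_support[OF g] integrable_mult_compact_support[OF h] by metis+
    have "(LINT x|lborel. g x * \<phi> x) = (LINT x|lborel. h x * \<phi> x)"
      using assms \<phi> by (auto simp: is_weak_deriv_def)
    then show "(LINT x|lborel. (g x + - 1 * h x) * \<phi> x) = 0"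
      using i by (simp add: algebra_simps)
  qed
  then show ?thesis by eventually_elim simp
qed

lemma weakly_differentiableD: "weakly_differentiable f \<Longrightarrow> is_weak_deriv f (weak_deriv f)"
  unfolding weakly_differentiable_def weak_deriv_def by (rule someI_ex[where P = "is_weak_deriv f"])

lemma weak_deriv_AE_eq:
  assumes "is_weak_deriv f g"
  shows "weakly_differentiable f" "AE x in lborel. weak_deriv f x = g x"
proof -
  show w: "weakly_differentiable f" using assms unfolding weakly_differentiable_def by blast
  show "AE x in lborel. weak_deriv f x = g x"
    by (rule is_weak_deriv_unique[OF weakly_differentiableD[OF w] assms])
qed

lemma is_weak_deriv_cong_AE:
  assumes w: "is_weak_deriv f g" and m: "f' \<in> borel_measurable borel" "g' \<in> borel_measurable borel"
    and ae: "AE x in lborel. f x = f' x" "AE x in lborel. g x = g' x"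
  shows "is_weak_deriv f' g'"
  unfolding is_weak_deriv_def
proof (intro conjI allI impI)
  have fg: "locally_integrable f" "locally_integrable g" using w by (auto simp: is_weak_deriv_def)
  note [measurable] = m fg[THEN locally_integrable_measurable]
  show "locally_integrable f'" "locally_integrable g'"
    using fg m ae by (auto intro: locally_integrable_cong_AE)
  fix \<phi> assume \<phi>: "test_function \<phi>"
  obtain \<phi>' R where c: "\<And>x. vector_derivative \<phi> (at x) = \<phi>' x" "continuous_on UNIV \<phi>" "continuous_on UNIV \<phi>'"
    using test_functionE[OF \<phi>] by metis
  have [measurable]: "\<phi> \<in> borel_measurable borel" "\<phi>' \<in> borel_measurable borel"
    using c by (auto intro: borel_measurable_continuous_onI)
  have "(LINT x|lborel. f x * \<phi>' x) = (LINT x|lborel. f' x * \<phi>' x)"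
    by (rule integral_cong_AE) (use ae(1) in auto)
  moreover have "(LINT x|lborel. g x * \<phi> x) = (LINT x|lborel. g' x * \<phi> x)"
    by (rule integral_cong_AE) (use ae(2) in auto)
  ultimately show "(LINT x|lborel. f' x * vector_derivative \<phi> (at x)) = - (LINT x|lborel. g' x * \<phi> x)"
    using w[unfolded is_weak_deriv_def, THEN conjunct2, THEN conjunct2, rule_format, OF \<phi>] unfolding c by simp
qed

lemma is_weak_deriv_mult_smooth:
  assumes w: "is_weak_deriv f g" and psi: "\<And>n. times_diff n \<psi>" "\<And>x. (\<psi> has_vector_derivative \<psi>' x) (at x)"
    and psi': "continuous_on UNIV \<psi>'"
  shows "is_weak_deriv (\<lambda>x. f x * \<psi> x) (\<lambda>x. g x * \<psi> x + f x * \<psi>' x)"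
  unfolding is_weak_deriv_def
proof (intro conjI allI impI)
  have fg: "locally_integrable f" "locally_integrable g" using w by (auto simp: is_weak_deriv_def)
  have c: "continuous_on UNIV \<psi>"
    using psi(2) by (auto intro!: continuous_at_imp_continuous_on has_vector_derivative_continuous)
  show "locally_integrable (\<lambda>x. f x * \<psi> x)" "locally_integrable (\<lambda>x. g x * \<psi> x + f x * \<psi>' x)"
    using fg c psi' by (auto intro!: locally_integrable_add locally_integrable_mult_continuous)
  fix \<phi> assume \<phi>: "test_function \<phi>"
  from test_functionE[OF \<phi>] obtain \<phi>' R where p: "\<And>x. (\<phi> has_vector_derivative \<phi>' x) (at x)" "\<And>n. times_diff n \<phi>"
    "\<And>x. \<bar>x\<bar> > R \<Longrightarrow> \<phi> x = 0" "\<And>x. \<bar>x\<bar> > R \<Longrightarrow> \<phi>' x = 0" "\<And>x. vector_derivative \<phi> (at x) = \<phi>' x"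
    "continuous_on UNIV \<phi>" "continuous_on UNIV \<phi>'" by metis
  have t: "test_function (\<lambda>x. \<psi> x * \<phi> x)"
    by (rule test_functionI[of _ R]) (auto intro!: times_diff_mult p psi)
  have d: "vector_derivative (\<lambda>x. \<psi> x * \<phi> x) (at x) = \<psi> x * \<phi>' x + \<psi>' x * \<phi> x" for x
    using psi(2) p(1) by (intro vector_derivative_at has_vector_derivative_mult)
  have i: "integrable lborel (\<lambda>x. f x * (\<psi> x * \<phi>' x))" "integrable lborel (\<lambda>x. f x * (\<psi>' x * \<phi> x))" "integrable lborel (\<lambda>x. g x * (\<psi> x * \<phi> x))"
    using p c psi' fg by (auto intro!: integrable_mult_compact_support[where R = R] continuous_intros)
  have "(LINT x|lborel. f x * (\<psi> x * \<phi>' x + \<psi>' x * \<phi> x)) = - (LINT x|lborel. g x * (\<psi> x * \<phi> x))"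
    using w[unfolded is_weak_deriv_def, THEN conjunct2, THEN conjunct2, rule_format, OF t] unfolding d .
  then have "(LINT x|lborel. f x * (\<psi> x * \<phi>' x)) = - (LINT x|lborel. g x * (\<psi> x * \<phi> x)) - (LINT x|lborel. f x * (\<psi>' x * \<phi> x))"
    using i by (simp add: distrib_left algebra_simps)
  also have "\<dots> = - (LINT x|lborel. g x * (\<psi> x * \<phi> x) + f x * (\<psi>' x * \<phi> x))"
    using i by simp
  finally show "(LINT x|lborel. f x * \<psi> x * vector_derivative \<phi> (at x)) = - (LINT x|lborel. (g x * \<psi> x + f x * \<psi>' x) * \<phi> x)"
    unfolding p(5) by (simp add: algebra_simps)
qed

lemma is_weak_deriv_linear:
  assumes w: "is_weak_deriv f f'" "is_weak_deriv g g'"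
  shows "is_weak_deriv (\<lambda>x. a * f x + b * g x) (\<lambda>x. a * f' x + b * g' x)"
  unfolding is_weak_deriv_def
proof (intro conjI allI impI)
  have li: "locally_integrable f" "locally_integrable f'" "locally_integrable g" "locally_integrable g'"
    using w by (auto simp: is_weak_deriv_def)
  have m: "locally_integrable (\<lambda>x. c * h x)" if "locally_integrable h" for c h
    using locally_integrable_mult_continuous[OF that continuous_on_const[of UNIV c]] by (simp add: mult.commute)
  show "locally_integrable (\<lambda>x. a * f x + b * g x)" "locally_integrable (\<lambda>x. a * f' x + b * g' x)"
    using li by (auto intro!: locally_integrable_add m)
  fix \<phi> assume \<phi>: "test_function \<phi>"
  from test_functionE[OF \<phi>] obtain \<phi>' R where p:
    "\<And>x. \<bar>x\<bar> > R \<Longrightarrow> \<phi> x = 0" "\<And>x. \<bar>x\<bar> > R \<Longrightarrow> \<phi>' x = 0" "\<And>x. vector_derivative \<phi> (at x) = \<phi>' x"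
    "continuous_on UNIV \<phi>" "continuous_on UNIV \<phi>'" by metis
  have i: "integrable lborel (\<lambda>x. f x * \<phi>' x)" "integrable lborel (\<lambda>x. g x * \<phi>' x)"
      "integrable lborel (\<lambda>x. f' x * \<phi> x)" "integrable lborel (\<lambda>x. g' x * \<phi> x)"
    using p li by (auto intro!: integrable_mult_compact_support[where R = R])
  have e: "(LINT x|lborel. f x * \<phi>' x) = - (LINT x|lborel. f' x * \<phi> x)" "(LINT x|lborel. g x * \<phi>' x) = - (LINT x|lborel. g' x * \<phi> x)"
    using w(1)[unfolded is_weak_deriv_def, THEN conjunct2, THEN conjunct2, rule_format, OF \<phi>]
      w(2)[unfolded is_weak_deriv_def, THEN conjunct2, THEN conjunct2, rule_format, OF \<phi>] unfolding p(3) .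
  have "(LINT x|lborel. (a * f x + b * g x) * \<phi>' x) = a * (LINT x|lborel. f x * \<phi>' x) + b * (LINT x|lborel. g x * \<phi>' x)"
    using i by (simp add: distrib_right mult.assoc)
  also have "\<dots> = - (LINT x|lborel. (a * f' x + b * g' x) * \<phi> x)"
    unfolding e using i by (simp add: distrib_right mult.assoc)
  finally show "(LINT x|lborel. (a * f x + b * g x) * vector_derivative \<phi> (at x)) = - (LINT x|lborel. (a * f' x + b * g' x) * \<phi> x)"
    unfolding p(3) .
qed

lemma is_weak_deriv_classical:
  assumes f: "\<And>x. (f has_vector_derivative f' x) (at x)" and f': "continuous_on UNIV f'"
  shows "is_weak_deriv f f'"
  unfolding is_weak_deriv_def
proof (intro conjI allI impI)
  have fc: "continuous_on UNIV f"
    using f by (auto intro!: continuous_at_imp_continuous_on has_vector_derivative_continuous)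
  show li: "locally_integrable f" "locally_integrable f'"
    using fc f' by (auto intro: locally_integrable_continuous)
  fix \<phi> assume \<phi>: "test_function \<phi>"
  from test_functionE[OF \<phi>] obtain \<phi>' R where p: "\<And>x. (\<phi> has_vector_derivative \<phi>' x) (at x)"
    "\<And>x. \<bar>x\<bar> > R \<Longrightarrow> \<phi> x = 0" "\<And>x. \<bar>x\<bar> > R \<Longrightarrow> \<phi>' x = 0" "\<And>x. vector_derivative \<phi> (at x) = \<phi>' x"
    "continuous_on UNIV \<phi>" "continuous_on UNIV \<phi>'" by metis
  have i: "integrable lborel (\<lambda>x. f x * \<phi>' x)" "integrable lborel (\<lambda>x. f' x * \<phi> x)"
    using p li by (auto intro!: integrable_mult_compact_support[where R = R])
  define r where "r = \<bar>R\<bar> + 1"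
  have r: "- r \<le> r" "r > R" "r > 0" by (auto simp: r_def)
  have "(LINT x|lborel. indicator {-r..r} x *\<^sub>R (f x * \<phi>' x + f' x * \<phi> x)) = f r * \<phi> r - f (-r) * \<phi> (-r)"
  proof (rule integral_FTC_atLeastAtMost[OF r(1)])
    show "((\<lambda>x. f x * \<phi> x) has_vector_derivative f x * \<phi>' x + f' x * \<phi> x) (at x within {- r..r})" for x
      by (rule has_vector_derivative_at_within[OF has_vector_derivative_mult[OF f p(1)]])
    show "continuous_on {- r..r} (\<lambda>x. f x * \<phi>' x + f' x * \<phi> x)"
      using fc f' p by (intro continuous_intros) (auto intro: continuous_on_subset)
  qed
  also have "\<dots> = 0" using p(2)[of r] p(2)[of "-r"] r by auto
  also have "(\<lambda>x. indicator {-r..r} x *\<^sub>R (f x * \<phi>' x + f' x * \<phi> x)) = (\<lambda>x. f x * \<phi>' x + f' x * \<phi> x)"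
    using p(2,3) r by (auto simp: indicator_def fun_eq_iff)
  finally have "(LINT x|lborel. f x * \<phi>' x) + (LINT x|lborel. f' x * \<phi> x) = 0"
    using i by simp
  then show "(LINT x|lborel. f x * vector_derivative \<phi> (at x)) = - (LINT x|lborel. f' x * \<phi> x)"
    unfolding p(4) by (simp add: eq_neg_iff_add_eq_0)
qed

text \<open>The weak derivative is tested against smoothed indicators of {a..b}, whose steps at a
  and b take place in layers of width of order 1/n. On the side of f this yields weighted averages
  of F over the two layers, which tend to F a and F b by continuity; on the side of g dominated
  convergence applies.\<close>

lemma is_weak_deriv_FTC:
  assumes w: "is_weak_deriv f g" and F: "continuous_on UNIV F" "AE x in lborel. f x = F x" and ab: "a < b"
  shows "F b - F a = (LINT x|lborel. indicator {a..b} x *\<^sub>R g x)"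
proof -
  obtain R R' :: "real \<Rightarrow> complex" where R: "\<And>n. times_diff n R" "\<And>x. (R has_vector_derivative R' x) (at x)"
    "\<And>n. times_diff n R'" "\<And>x. x \<le> -1 \<Longrightarrow> R x = 0" "\<And>x. x \<ge> 1 \<Longrightarrow> R x = 1" "\<And>x. norm (R x) \<le> 1"
    using step_function_exists by metis
  have fg: "locally_integrable f" "locally_integrable g" using w by (auto simp: is_weak_deriv_def)
  have Rc: "continuous_on UNIV R" "continuous_on UNIV R'"
  proof -
    obtain R'' where "\<And>x. (R' has_vector_derivative R'' x) (at x)" using R(3)[of "Suc 0"] by auto
    then show "continuous_on UNIV R" "continuous_on UNIV R'"
      using R(2) by (meson continuous_at_imp_continuous_on has_vector_derivative_continuous)+
  qed
  note [measurable] = F(1)[THEN borel_measurable_continuous_onI] fg[THEN locally_integrable_measurable] Rc[THEN borel_measurable_continuous_onI]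
  have R'0: "R' x = 0" if "x \<notin> {-1..1}" for x
  proof -
    have "(R has_vector_derivative 0) (at x)"
    proof (cases "x < -1")
      case True
      have "((\<lambda>x. 0 :: complex) has_vector_derivative 0) (at x)" by simp
      then show ?thesis
        by (rule has_vector_derivative_transform_within_open[where S = "{..< -1}"]) (use R(4) True in auto)
    next
      case False
      then have "x > 1" using that by auto
      have "((\<lambda>x. 1 :: complex) has_vector_derivative 0) (at x)" by simp
      then show ?thesis
        by (rule has_vector_derivative_transform_within_open[where S = "{1<..}"]) (use R(5) \<open>x > 1\<close> in auto)
    qed
    then show ?thesis using R(2)[of x] by (auto dest: vector_derivative_unique_at)
  qed
  have R'int: "(LINT x|lborel. R' x) = 1"
  proof -
    have "(LINT x|lborel. indicator {-1..1} x *\<^sub>R R' x) = R 1 - R (-1)"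
      by (rule integral_FTC_atLeastAtMost[OF _ has_vector_derivative_at_within[OF R(2)] continuous_on_subset[OF Rc(2)]]) auto
    also have "(\<lambda>x. indicator {-1..1} x *\<^sub>R R' x) = R'" using R'0 by (auto simp: indicator_def fun_eq_iff)
    finally show ?thesis using R(4,5) by simp
  qed
  \<comment> \<open>F against a rescaled bump concentrated at c. Since R' has integral 1, these
    bumps form an approximate identity.\<close>
  define I where "I n c = (LINT x|lborel. F x * (of_real (real (Suc n)) * R' (real (Suc n) * x + - real (Suc n) * c)))" for n c
  have Ilim: "(\<lambda>n. I n c) \<longlonglongrightarrow> F c" for c
  proof -
    have "I n c = (LINT y|lborel. F (c + (1 / real (Suc n)) * y) * R' y)" for n
      unfolding I_def by (subst lborel_integral_real_affine[of "1 / real (Suc n)" _ c]) (auto simp: field_simps scaleR_conv_of_real simp del: of_nat_Suc simp flip: integral_mult_right_zero)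
    moreover have "(\<lambda>n. LINT y|lborel. F (c + (1 / real (Suc n)) * y) * R' y) \<longlonglongrightarrow> (LINT y|lborel. F c * R' y)"
    proof -
      have "bounded (F ` {c-1..c+1})"
        using compact_continuous_image[OF continuous_on_subset[OF F(1)], of "{c-1..c+1}"] by (auto intro: compact_imp_bounded)
      then obtain B where B: "\<And>x. x \<in> {c-1..c+1} \<Longrightarrow> norm (F x) \<le> B" unfolding bounded_iff by (metis imageI)
      show ?thesis
      proof (rule integral_dominated_convergence)
        have "integrable lborel (\<lambda>x. (\<lambda>x. 1) x * R' x)"
          using Rc by (intro integrable_mult_compact_support[where R = 1] locally_integrable_continuous) (auto intro!: R'0)
        then show "integrable lborel (\<lambda>y. B * norm (R' y))" by auto
        show "AE y in lborel. (\<lambda>n. F (c + 1 / real (Suc n) * y) * R' y) \<longlonglongrightarrow> F c * R' y"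
        proof (intro AE_I2 tendsto_intros)
          fix y
          have "(\<lambda>n. c + 1 / real (Suc n) * y) \<longlonglongrightarrow> c + 0 * y"
            by (intro tendsto_intros LIMSEQ_Suc[OF lim_1_over_n])
          then show "(\<lambda>n. F (c + 1 / real (Suc n) * y)) \<longlonglongrightarrow> F c"
            using continuous_on_tendsto_compose[OF F(1)] by auto
        qed
        show "AE y in lborel. norm (F (c + 1 / real (Suc n) * y) * R' y) \<le> B * norm (R' y)" for n
        proof (intro AE_I2)
          fix y
          show "norm (F (c + 1 / real (Suc n) * y) * R' y) \<le> B * norm (R' y)"
          proof (cases "y \<in> {-1..1}")
            case True
            then have "\<bar>1 / real (Suc n) * y\<bar> \<le> 1" by (auto simp: abs_mult field_simps)
            then have "c + 1 / real (Suc n) * y \<in> {c-1..c+1}" unfolding abs_le_iff by auto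
            then show ?thesis using B by (auto simp: norm_mult intro!: mult_right_mono)
          qed (simp add: R'0)
        qed
      qed auto
    qed
    ultimately show ?thesis using R'int by simp
  qed
  define \<phi> where "\<phi> n x = R (real (Suc n) * x + - real (Suc n) * a) + (-1) * R (real (Suc n) * x + - real (Suc n) * b)" for n x
  define \<phi>' where "\<phi>' n x = of_real (real (Suc n)) * R' (real (Suc n) * x + - real (Suc n) * a) - of_real (real (Suc n)) * R' (real (Suc n) * x + - real (Suc n) * b)" for n x
  have hi: "real (Suc n) * x + - real (Suc n) * c \<ge> 1" if "x \<ge> c + 1" for n x c
  proof -
    have "real (Suc n) * 1 \<le> real (Suc n) * (x - c)" using that by (intro mult_left_mono) auto
    then show ?thesis by (simp add: algebra_simps)
  qed
  have lo: "real (Suc n) * x + - real (Suc n) * c \<le> - 1" if "x \<le> c - 1" for n x c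
  proof -
    have "real (Suc n) * 1 \<le> real (Suc n) * (c - x)" using that by (intro mult_left_mono) auto
    then show ?thesis by (simp add: algebra_simps)
  qed
  have supp: "\<phi> n x = 0" if "x \<notin> {a-1..b+1}" for n x
    using that ab lo[of x a n] lo[of x b n] hi[of a x n] hi[of b x n] R(4,5) by (auto simp: \<phi>_def not_le)
  have bd: "norm (\<phi> n x) \<le> 2" for n x
    unfolding \<phi>_def using norm_triangle_ineq4[of "R (real (Suc n) * x + - real (Suc n) * a)" "R (real (Suc n) * x + - real (Suc n) * b)"] R(6)
    by (smt (verit) mult_minus1 add_uminus_conv_diff)
  have t: "test_function (\<phi> n)" for n
  proof (rule test_functionI[of _ "\<bar>a\<bar> + \<bar>b\<bar> + 1"])
    show "times_diff k (\<phi> n)" for k unfolding \<phi>_def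
      by (intro times_diff_add times_diff_mult times_diff_const times_diff_affine R)
  qed (auto intro!: supp)
  have Rd: "((\<lambda>x. R (s * x + d)) has_vector_derivative of_real s * R' (s * x + d)) (at x)" for s d x
  proof -
    have 1: "((\<lambda>x. s * x + d) has_real_derivative s) (at x)" by (auto intro!: derivative_eq_intros)
    have "((\<lambda>x. s * x + d) has_vector_derivative s) (at x)"
      using 1 by (simp add: has_real_derivative_iff_has_vector_derivative)
    then have "(R \<circ> (\<lambda>x. s * x + d) has_vector_derivative s *\<^sub>R R' (s * x + d)) (at x)"
      using R(2) by (intro vector_diff_chain_at) auto
    then show ?thesis by (simp add: o_def scaleR_conv_of_real)
  qed
  have d: "vector_derivative (\<phi> n) (at x) = \<phi>' n x" for n x
  proof (rule vector_derivative_at)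
    show "(\<phi> n has_vector_derivative \<phi>' n x) (at x)"
      unfolding \<phi>_def[abs_def] \<phi>'_def mult_minus1 add_uminus_conv_diff by (intro derivative_intros Rd)
  qed
  have i: "integrable lborel (\<lambda>x. F x * (of_real (real (Suc n)) * R' (real (Suc n) * x + - real (Suc n) * c)))" for n c
  proof (rule integrable_mult_compact_support[where R = "\<bar>c\<bar> + 1"])
    show "continuous_on UNIV (\<lambda>x. of_real (real (Suc n)) * R' (real (Suc n) * x + - real (Suc n) * c))"
      by (intro continuous_intros continuous_on_compose2[OF Rc(2)]) auto
    fix x assume "\<bar>c\<bar> + 1 < \<bar>x\<bar>"
    then have "\<bar>x - c\<bar> > 1" by arith
    then have "1 * 1 < real (Suc n) * \<bar>x - c\<bar>" by (intro mult_le_less_imp_less) auto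
    moreover have "real (Suc n) * x + - real (Suc n) * c = real (Suc n) * (x - c)"
      by (simp only: right_diff_distrib mult_minus_left add_uminus_conv_diff)
    ultimately have "\<bar>real (Suc n) * x + - real (Suc n) * c\<bar> > 1"
      by (simp only: abs_mult abs_of_nat mult_1_right)
    then show "of_real (real (Suc n)) * R' (real (Suc n) * x + - real (Suc n) * c) = 0"
      by (auto intro!: R'0)
  qed (use F in \<open>auto intro: locally_integrable_continuous\<close>)
  have "(LINT x|lborel. f x * \<phi>' n x) = I n a - I n b" for n
  proof -
    have "(LINT x|lborel. f x * \<phi>' n x) = (LINT x|lborel. F x * \<phi>' n x)"
    proof (rule integral_cong_AE)
      show "AE x in lborel. f x * \<phi>' n x = F x * \<phi>' n x"
        using F(2) by eventually_elim simp
    qed (auto simp: \<phi>'_def)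
    also have "\<dots> = I n a - I n b"
      unfolding \<phi>'_def I_def right_diff_distrib using i by (intro Bochner_Integration.integral_diff)
    finally show ?thesis .
  qed
  then have e: "I n a - I n b = - (LINT x|lborel. g x * \<phi> n x)" for n
    using w[unfolded is_weak_deriv_def, THEN conjunct2, THEN conjunct2, rule_format, OF t[of n]] unfolding d by simp
  have "(\<lambda>n. LINT x|lborel. g x * \<phi> n x) \<longlonglongrightarrow> (LINT x|lborel. indicator {a..b} x *\<^sub>R g x)"
  proof (rule integral_dominated_convergence)
    have "set_integrable lborel {a-1..b+1} g" using fg by (auto simp: locally_integrable_def)
    then show "integrable lborel (\<lambda>x. 2 * norm (indicator {a-1..b+1} x *\<^sub>R g x))"
      unfolding set_integrable_def by (intro integrable_mult_right integrable_norm)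
    show "AE x in lborel. (\<lambda>n. g x * \<phi> n x) \<longlonglongrightarrow> indicator {a..b} x *\<^sub>R g x"
    proof -
      have "AE x in lborel. x \<noteq> a" "AE x in lborel. x \<noteq> b" by (rule AE_lborel_singleton)+
      then show ?thesis
      proof eventually_elim
        case (elim x)
        have ev: "\<forall>\<^sub>F n in sequentially. R (real (Suc n) * x + - real (Suc n) * c) = (if x > c then 1 else 0)" if xc: "x \<noteq> c" for c
        proof -
          obtain N where N: "1 / \<bar>x - c\<bar> < real N" using reals_Archimedean2 by blast
          show ?thesis
          proof (rule eventually_sequentiallyI[of N])
            fix n assume "N \<le> n"
            then have "1 / \<bar>x - c\<bar> < real (Suc n)" using N by simp
            then have "1 < real (Suc n) * \<bar>x - c\<bar>" using xc by (simp add: divide_less_eq)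
            then show "R (real (Suc n) * x + - real (Suc n) * c) = (if x > c then 1 else 0)"
              using xc by (auto intro!: R(4,5) simp: abs_if algebra_simps split: if_splits)
          qed
        qed
        have "\<forall>\<^sub>F n in sequentially. g x * \<phi> n x = indicator {a..b} x *\<^sub>R g x"
          using ev[OF elim(1)] ev[OF elim(2)]
          by eventually_elim (use ab elim in \<open>auto simp: \<phi>_def indicator_def\<close>)
        then show ?case by (rule tendsto_eventually)
      qed
    qed
    show "AE x in lborel. norm (g x * \<phi> n x) \<le> 2 * norm (indicator {a-1..b+1} x *\<^sub>R g x)" for n
      using supp[of _ n] bd[of n] by (auto simp: indicator_def norm_mult mult.commute[of 2] intro!: AE_I2 mult_left_mono)
  qed (auto simp: \<phi>_def)
  then have "(\<lambda>n. I n a - I n b) \<longlonglongrightarrow> - (LINT x|lborel. indicator {a..b} x *\<^sub>R g x)"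
    unfolding e by (rule tendsto_minus)
  moreover have "(\<lambda>n. I n a - I n b) \<longlonglongrightarrow> F a - F b" by (intro tendsto_intros Ilim)
  ultimately have "F a - F b = - (LINT x|lborel. indicator {a..b} x *\<^sub>R g x)" using LIMSEQ_unique by blast
  then show ?thesis by (metis minus_diff_eq minus_minus)
qed

section \<open>Iterates of the annihilation operator\<close>

abbreviation cpoint :: "real \<times> real \<Rightarrow> complex" where
  "cpoint l \<equiv> Complex (fst l) (snd l)"

lemma norm_cpoint: "norm (cpoint l) = norm l"
  by (cases l) (simp add: norm_prod_def cmod_def)

lemma annih_locally_integrable:
  assumes "weakly_differentiable f"
  shows "locally_integrable (annih f)"
proof -
  have w: "locally_integrable f" "locally_integrable (weak_deriv f)"
    using weakly_differentiableD[OF assms] by (auto simp: is_weak_deriv_def)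
  have "locally_integrable (\<lambda>x. weak_deriv f x * (1 / of_real (2 * pi)) + f x * of_real x)"
    by (intro locally_integrable_add locally_integrable_mult_continuous w continuous_intros)
  then show ?thesis by (simp add: annih_def mult.commute)
qed

lemma annih_AE_eq:
  assumes "is_weak_deriv f g"
  shows "AE x in lborel. annih f x = g x / of_real (2 * pi) + of_real x * f x"
  using weak_deriv_AE_eq(2)[OF assms] by eventually_elim (simp add: annih_def)

text \<open>The part of membership in \<open>Hm_space\<close> that makes the iterates meaningful,
  separated from integrability at infinity. For m = 0 the content is the local integrability of f,
  which provides measurability.\<close>

definition annih_regular :: "nat \<Rightarrow> (real \<Rightarrow> complex) \<Rightarrow> bool" where
  "annih_regular m f \<longleftrightarrow> locally_integrable f \<and> (\<forall>j<m. weakly_differentiable ((annih ^^ j) f))"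

lemma annih_regular_locally_integrable:
  assumes "annih_regular m f" "j \<le> m"
  shows "locally_integrable ((annih ^^ j) f)"
  using assms by (cases j) (auto simp: annih_regular_def intro!: annih_locally_integrable)

lemma annih_regular_mono: "annih_regular m f \<Longrightarrow> k \<le> m \<Longrightarrow> annih_regular k f"
  by (auto simp: annih_regular_def)

text \<open>The equality is one almost everywhere, since \<open>weak_deriv\<close> selects its
  values for f, g and the combination independently. At each step the combination of the selected
  derivatives is shown to be a weak derivative of the iterate, which changes of representative do
  not affect.\<close>

lemma annih_iterate_linear:
  assumes "annih_regular m f" "annih_regular m g"
  shows "annih_regular m (\<lambda>x. a * f x + b * g x)"
    and "j \<le> m \<Longrightarrow> AE x in lborel. (annih ^^ j) (\<lambda>x. a * f x + b * g x) x = a * (annih ^^ j) f x + b * (annih ^^ j) g x"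
proof -
  define h where "h = (\<lambda>x. a * f x + b * g x)"
  have "annih_regular m h \<and> (\<forall>j\<le>m. AE x in lborel. (annih ^^ j) h x = a * (annih ^^ j) f x + b * (annih ^^ j) g x)"
    using assms
  proof (induction m)
    case 0
    have m: "locally_integrable (\<lambda>x. c * h x)" if "locally_integrable h" for c h
      using locally_integrable_mult_continuous[OF that continuous_on_const[of UNIV c]] by (simp add: mult.commute)
    show ?case using 0 by (auto simp: annih_regular_def h_def intro!: locally_integrable_add m)
  next
    case (Suc m)
    then have IH: "annih_regular m h" "\<And>j. j \<le> m \<Longrightarrow> AE x in lborel. (annih ^^ j) h x = a * (annih ^^ j) f x + b * (annih ^^ j) g x"
      using annih_regular_mono[of "Suc m" _ m] by auto
    define u v w where "u = (annih ^^ m) f" and "v = (annih ^^ m) g" and "w = (annih ^^ m) h"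
    have wd: "is_weak_deriv u (weak_deriv u)" "is_weak_deriv v (weak_deriv v)"
      using Suc.prems by (auto simp: annih_regular_def u_def v_def intro!: weakly_differentiableD)
    define d where "d = (\<lambda>x. a * weak_deriv u x + b * weak_deriv v x)"
    have wl: "is_weak_deriv (\<lambda>x. a * u x + b * v x) d"
      unfolding d_def by (rule is_weak_deriv_linear[OF wd])
    have w: "is_weak_deriv w d"
    proof (rule is_weak_deriv_cong_AE[OF wl])
      show "w \<in> borel_measurable borel" unfolding w_def
        using annih_regular_locally_integrable[OF IH(1)] locally_integrable_measurable by auto
      show "d \<in> borel_measurable borel" using wl locally_integrable_measurable by (auto simp: is_weak_deriv_def)
      show "AE x in lborel. a * u x + b * v x = w x"
        using IH(2)[OF order_refl] by eventually_elim (simp add: u_def v_def w_def)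
    qed auto
    have "AE x in lborel. annih w x = a * annih u x + b * annih v x"
      using annih_AE_eq[OF w] IH(2)[OF order_refl]
      by eventually_elim (simp add: annih_def d_def u_def v_def w_def field_simps)
    moreover have "weakly_differentiable w" using weak_deriv_AE_eq(1)[OF w] .
    ultimately show ?case
      using IH by (auto simp: annih_regular_def less_Suc_eq le_Suc_eq u_def v_def w_def)
  qed
  then show "annih_regular m (\<lambda>x. a * f x + b * g x)"
    and "j \<le> m \<Longrightarrow> AE x in lborel. (annih ^^ j) (\<lambda>x. a * f x + b * g x) x = a * (annih ^^ j) f x + b * (annih ^^ j) g x"
    by (auto simp: h_def)
qed

lemma gabor_has_vector_derivative:
  "(gabor l has_vector_derivative 2 * of_real pi * (cpoint l - of_real x) * gabor l x) (at x)"
proof -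
  define p q where "p = fst l" and "q = snd l"
  define E where "E z = of_real (2 powr (1/4)) * exp (- of_real pi * (z - of_real p)\<^sup>2 + 2 * of_real pi * \<i> * of_real q * z)" for z :: complex
  have g: "gabor l = (\<lambda>x. E (of_real x))"
    by (auto simp: gabor_def E_def case_prod_unfold p_def q_def)
  have "(E has_field_derivative (2 * of_real pi * (Complex p q - of_real x) * E (of_real x))) (at (of_real x))"
    unfolding E_def by (auto intro!: derivative_eq_intros simp: Complex_eq algebra_simps)
  from has_vector_derivative_real_field[OF this] show ?thesis
    unfolding g by (simp add: p_def q_def)
qed

lemma gabor_is_weak_deriv: "is_weak_deriv (gabor l) (\<lambda>x. 2 * of_real pi * (cpoint l - of_real x) * gabor l x)"
  by (rule is_weak_deriv_classical[OF gabor_has_vector_derivative])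
    (intro continuous_intros gabor_continuous)

text \<open>The coherent state property: differentiating the Gaussian produces -x, which the
  multiplication by x in \<open>annih\<close> cancels.\<close>

lemma annih_gabor: "AE x in lborel. annih (gabor l) x = cpoint l * gabor l x"
  using annih_AE_eq[OF gabor_is_weak_deriv[of l]]
  by eventually_elim (simp add: field_simps)

lemma annih_iterate_gabor:
  "annih_regular m (gabor l)" "AE x in lborel. (annih ^^ m) (gabor l) x = cpoint l ^ m * gabor l x"
proof -
  have "annih_regular m (gabor l) \<and> (AE x in lborel. (annih ^^ m) (gabor l) x = cpoint l ^ m * gabor l x)"
  proof (induction m)
    case 0
    then show ?case by (auto simp: annih_regular_def gabor_continuous locally_integrable_continuous)
  next
    case (Suc m)
    define u where "u = (annih ^^ m) (gabor l)"
    define d where "d x = cpoint l ^ m * (2 * of_real pi * (cpoint l - of_real x) * gabor l x)" for x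
    have wl: "is_weak_deriv (\<lambda>x. cpoint l ^ m * gabor l x) d"
      using is_weak_deriv_linear[OF gabor_is_weak_deriv[of l] gabor_is_weak_deriv[of l], of "cpoint l ^ m" 0] by (simp add: d_def[abs_def])
    have w: "is_weak_deriv u d"
    proof (rule is_weak_deriv_cong_AE[OF wl])
      show "u \<in> borel_measurable borel" unfolding u_def
        using annih_regular_locally_integrable Suc locally_integrable_measurable by blast
      show "d \<in> borel_measurable borel" using wl locally_integrable_measurable by (auto simp: is_weak_deriv_def)
      show "AE x in lborel. cpoint l ^ m * gabor l x = u x"
        using Suc by (auto simp: u_def)
    qed auto
    have "AE x in lborel. (annih ^^ m) (gabor l) x = cpoint l ^ m * gabor l x" using Suc by simp
    with annih_AE_eq[OF w] have "AE x in lborel. annih u x = cpoint l ^ Suc m * gabor l x"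
      by eventually_elim (simp add: d_def u_def field_simps)
    moreover have "weakly_differentiable u" using weak_deriv_AE_eq(1)[OF w] .
    ultimately show ?case using Suc by (auto simp: annih_regular_def less_Suc_eq u_def)
  qed
  then show "annih_regular m (gabor l)" "AE x in lborel. (annih ^^ m) (gabor l) x = cpoint l ^ m * gabor l x" by auto
qed

lemma annih_regular_zero: "annih_regular m (\<lambda>x. 0)" "AE x in lborel. (annih ^^ m) (\<lambda>x. 0) x = 0"
  using annih_iterate_linear(1)[of m "gabor undefined" "gabor undefined" 0 0, OF annih_iterate_gabor(1) annih_iterate_gabor(1)]
    annih_iterate_linear(2)[of m "gabor undefined" "gabor undefined" m 0 0, OF annih_iterate_gabor(1) annih_iterate_gabor(1) order_refl] by auto

lemma annih_iterate_gabor_sum: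
  assumes "finite F"
  shows "annih_regular m (\<lambda>x. \<Sum>i\<in>F. c i * gabor (\<mu> i) x)"
    "AE x in lborel. (annih ^^ m) (\<lambda>x. \<Sum>i\<in>F. c i * gabor (\<mu> i) x) x = (\<Sum>i\<in>F. c i * cpoint (\<mu> i) ^ m * gabor (\<mu> i) x)"
proof -
  have "annih_regular m (\<lambda>x. \<Sum>i\<in>F. c i * gabor (\<mu> i) x) \<and>
    (AE x in lborel. (annih ^^ m) (\<lambda>x. \<Sum>i\<in>F. c i * gabor (\<mu> i) x) x = (\<Sum>i\<in>F. c i * cpoint (\<mu> i) ^ m * gabor (\<mu> i) x))"
    using assms
  proof (induction F)
    case empty
    then show ?case using annih_regular_zero by simp
  next
    case (insert i F)
    let ?s = "\<lambda>x. \<Sum>i\<in>F. c i * gabor (\<mu> i) x"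
    have s: "annih_regular m ?s" "AE x in lborel. (annih ^^ m) ?s x = (\<Sum>i\<in>F. c i * cpoint (\<mu> i) ^ m * gabor (\<mu> i) x)"
      using insert by auto
    note lin = annih_iterate_linear[OF annih_iterate_gabor(1)[of m "\<mu> i"] s(1), where a = "c i" and b = 1]
    have eq: "(\<lambda>x. \<Sum>i\<in>insert i F. c i * gabor (\<mu> i) x) = (\<lambda>x. c i * gabor (\<mu> i) x + 1 * ?s x)"
      using insert by simp
    have "AE x in lborel. (annih ^^ m) (\<lambda>x. c i * gabor (\<mu> i) x + 1 * ?s x) x = (\<Sum>i\<in>insert i F. c i * cpoint (\<mu> i) ^ m * gabor (\<mu> i) x)"
      using lin(2)[OF order_refl] s(2) annih_iterate_gabor(2)[of m "\<mu> i"]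
      by eventually_elim (use insert in simp)
    then show ?case unfolding eq using lin(1) by simp
  qed
  then show "annih_regular m (\<lambda>x. \<Sum>i\<in>F. c i * gabor (\<mu> i) x)"
    "AE x in lborel. (annih ^^ m) (\<lambda>x. \<Sum>i\<in>F. c i * gabor (\<mu> i) x) x = (\<Sum>i\<in>F. c i * cpoint (\<mu> i) ^ m * gabor (\<mu> i) x)"
    by auto
qed

section \<open>Exchange of discrete sums and integrals\<close>

lemma integrable_count_space_iff_norm_summable:
  fixes f :: "'a \<Rightarrow> complex"
  shows "integrable (count_space UNIV) f \<longleftrightarrow> (\<lambda>x. norm (f x)) summable_on UNIV"
  using abs_summable_equivalent[of f UNIV] by (simp add: Infinite_Set_Sum.abs_summable_on_def)

lemma integral_count_space_eq_infsum:
  fixes f :: "'a \<Rightarrow> complex"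
  assumes "(\<lambda>x. norm (f x)) summable_on UNIV"
  shows "(LINT x|count_space UNIV. f x) = infsum f UNIV"
  using infsetsum_infsum[of f UNIV] assms abs_summable_equivalent[of f UNIV] by (simp add: infsetsum_def)

lemma integral_count_space_eq_infsum_real:
  fixes f :: "'a \<Rightarrow> real"
  assumes "f summable_on UNIV" "\<And>x. f x \<ge> 0"
  shows "(LINT x|count_space UNIV. f x) = infsum f UNIV"
proof -
  have "(\<lambda>x. norm (f x)) summable_on UNIV" using assms by simp
  then show ?thesis
    using infsetsum_infsum[of f UNIV] abs_summable_equivalent[of f UNIV] by (simp add: infsetsum_def)
qed

text \<open>This is \<open>superpose\<close> with counting measure in the role of M; absolutely
  convergent unordered sums are Bochner integrals over it.\<close>

lemma superpose_sum:
  fixes A :: "'b \<Rightarrow> complex" and K :: "'a :: countable \<Rightarrow> 'b \<Rightarrow> complex"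
  assumes N: "sigma_finite_measure N" and A: "integrable N A"
    and K: "\<And>i. K i \<in> borel_measurable N"
    and sm: "\<And>y. (\<lambda>i. norm (K i y)) summable_on UNIV"
    and bd: "\<And>y. (\<Sum>\<^sub>\<infinity>i. norm (K i y)) \<le> C"
  shows "(\<lambda>i. norm (LINT y|N. A y * K i y)) summable_on UNIV"
    and "(\<Sum>\<^sub>\<infinity>i. LINT y|N. A y * K i y) = (LINT y|N. A y * (\<Sum>\<^sub>\<infinity>i. K i y))"
    and "integrable N (\<lambda>y. A y * (\<Sum>\<^sub>\<infinity>i. K i y))"
proof -
  have m: "(\<lambda>(i, y). K i y) \<in> borel_measurable (count_space UNIV \<Otimes>\<^sub>M N)"
    by (rule measurable_pair_measure_countable1) (auto simp: K)
  have i: "integrable (count_space UNIV) (\<lambda>i. K i y)" for y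
    using sm by (simp add: integrable_count_space_iff_norm_summable)
  have b: "(LINT i|count_space UNIV. norm (K i y)) \<le> C" for y
    using bd[of y] integral_count_space_eq_infsum_real[OF sm[of y]] by simp
  have sc: "sigma_finite_measure (count_space (UNIV :: 'a set))"
    by (rule sigma_finite_measure_count_space)
  note sp = superpose[OF sc N A m i b]
  show 1: "(\<lambda>i. norm (LINT y|N. A y * K i y)) summable_on UNIV"
    using sp(1) by (simp add: integrable_count_space_iff_norm_summable)
  show "(\<Sum>\<^sub>\<infinity>i. LINT y|N. A y * K i y) = (LINT y|N. A y * (\<Sum>\<^sub>\<infinity>i. K i y))"
    using sp(2) unfolding integral_count_space_eq_infsum[OF 1] integral_count_space_eq_infsum[OF sm] .
  interpret Q: pair_sigma_finite N "count_space (UNIV :: 'a set)"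
    using N sc by (simp add: pair_sigma_finite_def)
  have "integrable N (\<lambda>y. LINT i|count_space UNIV. A y * K i y)"
    using Q.integrable_fst[OF sp(3)] .
  then show "integrable N (\<lambda>y. A y * (\<Sum>\<^sub>\<infinity>i. K i y))"
    using integral_count_space_eq_infsum[OF sm] by simp
qed

section \<open>Sums over integer translates\<close>

lemma summable_on_int_powr:
  assumes "a > 1"
  shows "(\<lambda>n :: int. (1 + \<bar>real_of_int n\<bar>) powr (- a)) summable_on UNIV"
proof -
  define g where "g n = (1 + \<bar>real_of_int n\<bar>) powr (- a)" for n :: int
  have "summable (\<lambda>n. real n powr (- a))" using assms by (simp add: summable_real_powr_iff)
  then have "summable (\<lambda>n. real (Suc n) powr (- a))" by (subst summable_Suc_iff)
  then have "(\<lambda>n. (1 + real n) powr (- a)) summable_on UNIV"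
    by (intro norm_summable_imp_summable_on) (auto simp: add.commute)
  then have s: "(\<lambda>n. (1 + real n) powr (- a)) summable_on UNIV" .
  have "(g \<circ> int) summable_on UNIV" using s by (simp add: g_def o_def)
  then have 1: "g summable_on range int" by (subst summable_on_reindex) auto
  have "(g \<circ> (\<lambda>n. - int n)) summable_on UNIV" using s by (simp add: g_def o_def)
  then have 2: "g summable_on range (\<lambda>n. - int n)" by (subst summable_on_reindex) (auto simp: inj_on_def)
  have "g summable_on (range int \<union> range (\<lambda>n. - int n))" using 1 2 by (rule summable_on_union)
  also have "range int \<union> range (\<lambda>n. - int n) = UNIV"
  proof (rule UNIV_eq_I[symmetric])
    fix x :: int
    show "x \<in> range int \<union> range (\<lambda>n. - int n)"
      by (cases x rule: int_cases2) auto
  qed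
  finally show ?thesis by (simp add: g_def[abs_def])
qed

lemma one_plus_abs_shift_bound:
  fixes t :: real and n :: int
  assumes "\<bar>t\<bar> \<le> 1" "a \<ge> 0"
  shows "(1 + \<bar>real_of_int n + t\<bar>) powr (- a) \<le> 2 powr a * (1 + \<bar>real_of_int n\<bar>) powr (- a)"
proof -
  have "1 + \<bar>real_of_int n\<bar> \<le> 2 * (1 + \<bar>real_of_int n + t\<bar>)"
  proof -
    have "\<bar>real_of_int n\<bar> \<le> \<bar>real_of_int n + t\<bar> + \<bar>t\<bar>"
      using abs_triangle_ineq4[of "real_of_int n + t" t] by simp
    moreover have "0 \<le> \<bar>real_of_int n + t\<bar>" by simp
    moreover have "1 + u \<le> 2 * (1 + X)" if "u \<le> X + T" "0 \<le> X" "T \<le> 1" for u X T :: real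
      using that by argo
    ultimately show ?thesis using assms(1) by blast
  qed
  then have "(2 * (1 + \<bar>real_of_int n + t\<bar>)) powr (- a) \<le> (1 + \<bar>real_of_int n\<bar>) powr (- a)"
    using assms by (intro powr_mono2') auto
  then have "2 powr a * (2 * (1 + \<bar>real_of_int n + t\<bar>)) powr (- a) \<le> 2 powr a * (1 + \<bar>real_of_int n\<bar>) powr (- a)"
    by (intro mult_left_mono) auto
  moreover have "2 powr a * (2 * (1 + \<bar>real_of_int n + t\<bar>)) powr (- a) = (1 + \<bar>real_of_int n + t\<bar>) powr (- a)"
    by (subst powr_mult) (auto simp flip: powr_add mult.assoc)
  ultimately show ?thesis by (simp only:)
qed

text \<open>Translation by the floor of t reduces to a shift of size at most 1, so the bound does
  not depend on t. The later exchanges of sums and integrals rest on this uniformity.\<close>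

lemma int_shift_sum:
  fixes t a :: real
  assumes "a > 1"
  shows "(\<lambda>n :: int. (1 + \<bar>real_of_int n + t\<bar>) powr (- a)) summable_on UNIV"
    and "(\<Sum>\<^sub>\<infinity>n :: int. (1 + \<bar>real_of_int n + t\<bar>) powr (- a)) \<le> 2 powr a * (\<Sum>\<^sub>\<infinity>n :: int. (1 + \<bar>real_of_int n\<bar>) powr (- a))"
proof -
  define k where "k = \<lfloor>t\<rfloor>"
  have t: "\<bar>t - real_of_int k\<bar> \<le> 1" unfolding k_def by linarith
  define g h where "g n = (1 + \<bar>real_of_int n + (t - real_of_int k)\<bar>) powr (- a)"
    and "h n = 2 powr a * (1 + \<bar>real_of_int n\<bar>) powr (- a)" for n :: int
  have le: "g n \<le> h n" for n unfolding g_def h_def using t assms by (intro one_plus_abs_shift_bound) auto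
  have h: "h summable_on UNIV" unfolding h_def by (intro summable_on_cmult_right summable_on_int_powr assms)
  have g: "g summable_on UNIV"
    using summable_on_comparison_test[OF h] le by (auto simp: g_def)
  have eq: "(\<lambda>n :: int. (1 + \<bar>real_of_int n + t\<bar>) powr (- a)) = g \<circ> (\<lambda>n. n + k)"
    by (auto simp: g_def fun_eq_iff)
  have b: "bij (\<lambda>n :: int. n + k)" by (rule bijI') (auto intro: exI[of _ "_ - k"])
  show "(\<lambda>n :: int. (1 + \<bar>real_of_int n + t\<bar>) powr (- a)) summable_on UNIV"
    unfolding eq using g summable_on_reindex_bij_betw[OF b, of g] by (simp add: o_def)
  have "(\<Sum>\<^sub>\<infinity>n. (g \<circ> (\<lambda>n. n + k)) n) = infsum g UNIV"
    using infsum_reindex_bij_betw[OF b, of g] by (simp add: o_def)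
  also have "\<dots> \<le> infsum h UNIV" by (intro infsum_mono g h le)
  also have "\<dots> = 2 powr a * (\<Sum>\<^sub>\<infinity>n :: int. (1 + \<bar>real_of_int n\<bar>) powr (- a))"
    unfolding h_def by (intro infsum_cmult_right) (use summable_on_int_powr[OF assms] in auto)
  finally show "(\<Sum>\<^sub>\<infinity>n :: int. (1 + \<bar>real_of_int n + t\<bar>) powr (- a)) \<le> 2 powr a * (\<Sum>\<^sub>\<infinity>n :: int. (1 + \<bar>real_of_int n\<bar>) powr (- a))"
    unfolding eq .
qed

text \<open>The bound on c admits all the rates that occur below, among them pi / 2, pi - 1, pi and
  2 pi, with one constant.\<close>

lemma exp_neg_sq_le_powr:
  fixes x c :: real
  assumes "c \<ge> 1/2"
  shows "exp (- c * x\<^sup>2) \<le> 4 * (1 + \<bar>x\<bar>) powr (- 2)"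
proof -
  have "(1 + \<bar>x\<bar>)\<^sup>2 \<le> 2 * (1 + x\<^sup>2)" using sum_squares_bound[of 1 "\<bar>x\<bar>"] by (simp add: power2_eq_square algebra_simps)
  also have "\<dots> \<le> 4 * (1 + c * x\<^sup>2)" using mult_right_mono[OF assms, of "x\<^sup>2"] by simp
  also have "\<dots> \<le> 4 * exp (c * x\<^sup>2)" by (intro mult_left_mono exp_ge_add_one_self) auto
  finally have "(1 + \<bar>x\<bar>)\<^sup>2 \<le> 4 * exp (c * x\<^sup>2)" .
  moreover have "(1 + \<bar>x\<bar>) powr (- 2) = 1 / (1 + \<bar>x\<bar>)\<^sup>2"
    by (simp add: powr_minus divide_inverse flip: powr_numeral)
  moreover have "exp (- c * x\<^sup>2) = 1 / exp (c * x\<^sup>2)" by (simp add: exp_minus divide_inverse)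
  moreover have "(1 + \<bar>x\<bar>)\<^sup>2 > 0" by (simp add: add_pos_nonneg)
  ultimately show ?thesis by (simp add: divide_le_eq le_divide_eq)
qed

section \<open>The dual window of the Gaussian\<close>

lemma infsum_diff:
  fixes f g :: "'a \<Rightarrow> 'b :: real_normed_vector"
  assumes "f summable_on A" "g summable_on A"
  shows "(\<Sum>\<^sub>\<infinity>x\<in>A. f x - g x) = infsum f A - infsum g A"
proof -
  have "(\<Sum>\<^sub>\<infinity>x\<in>A. f x + - g x) = infsum f A + (\<Sum>\<^sub>\<infinity>x\<in>A. - g x)"
    using assms by (intro infsum_add summable_on_uminus[THEN iffD2]) auto
  then show ?thesis by (simp add: infsum_uminus)
qed

text \<open>One bound for all integer-spaced Gaussian sums, uniform in the shift and in rates c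
  \<ge> 1/2: the factor 4 is that of \<open>exp_neg_sq_le_powr\<close>, and 2 powr 2 is the price of
  the shift in \<open>int_shift_sum\<close>.\<close>

definition gauss_sum_bound :: real where
  "gauss_sum_bound = 4 * (2 powr 2 * (\<Sum>\<^sub>\<infinity>n :: int. (1 + \<bar>real_of_int n\<bar>) powr (- 2)))"

lemma gauss_int_sum:
  fixes c t :: real
  assumes "c \<ge> 1/2"
  shows "(\<lambda>n :: int. exp (- c * (real_of_int n + t)\<^sup>2)) summable_on UNIV"
    and "(\<Sum>\<^sub>\<infinity>n :: int. exp (- c * (real_of_int n + t)\<^sup>2)) \<le> gauss_sum_bound"
proof -
  have s: "(\<lambda>n :: int. 4 * (1 + \<bar>real_of_int n + t\<bar>) powr (- 2)) summable_on UNIV"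
    by (intro summable_on_cmult_right int_shift_sum(1)) simp
  show 1: "(\<lambda>n :: int. exp (- c * (real_of_int n + t)\<^sup>2)) summable_on UNIV"
    by (rule summable_on_comparison_test[OF s]) (use exp_neg_sq_le_powr[OF assms] in auto)
  have "(\<Sum>\<^sub>\<infinity>n :: int. exp (- c * (real_of_int n + t)\<^sup>2)) \<le> (\<Sum>\<^sub>\<infinity>n :: int. 4 * (1 + \<bar>real_of_int n + t\<bar>) powr (- 2))"
    by (intro infsum_mono 1 s exp_neg_sq_le_powr assms)
  also have "\<dots> = 4 * (\<Sum>\<^sub>\<infinity>n :: int. (1 + \<bar>real_of_int n + t\<bar>) powr (- 2))"
    by (intro infsum_cmult_right) (use int_shift_sum(1)[of 2] in auto)
  also have "\<dots> \<le> gauss_sum_bound"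
    unfolding gauss_sum_bound_def by (intro mult_left_mono int_shift_sum(2)) auto
  finally show "(\<Sum>\<^sub>\<infinity>n :: int. exp (- c * (real_of_int n + t)\<^sup>2)) \<le> gauss_sum_bound" .
qed

lemma gauss_sum_bound_nonneg: "gauss_sum_bound \<ge> 0"
  unfolding gauss_sum_bound_def by (intro mult_nonneg_nonneg infsum_nonneg) auto

definition alt :: "int \<Rightarrow> real" where
  "alt n = (if even n then 1 else - 1)"

lemma alt_simps: "alt (n + 1) = - alt n" "alt (- n) = alt n" "alt (m + n) = alt m * alt n" "alt 0 = 1"
    "alt n * alt n = 1" "\<bar>alt n\<bar> = 1" "alt (m - n) = alt m * alt n"
  by (auto simp: alt_def)

lemma cis_pi_int: "cis (pi * real_of_int n) = of_real (alt n)"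
proof (cases "even n")
  case True
  then obtain k where "n = 2 * k" by blast
  then show ?thesis using cis_multiple_2pi[of "real_of_int k"] by (simp add: alt_def mult_ac)
next
  case False
  then obtain k where k: "n = 2 * k + 1" using oddE by blast
  have "cis (pi * real_of_int n) = cis (2 * pi * real_of_int k) * cis pi"
    unfolding cis_mult by (rule arg_cong[where f = cis]) (simp add: k algebra_simps)
  then show ?thesis using cis_multiple_2pi[of "real_of_int k"] False by (simp add: alt_def)
qed

text \<open>Bastiaans' dual window: on \<open>{n - 1/2 ..< n + 1/2}\<close> it is \<open>exp (pi * x\<^sup>2)\<close> times the tail of
  \<open>\<Sum>n. (-1)^n * exp (- pi * (n + 1/2)\<^sup>2)\<close> starting at \<open>n\<close>. The whole series vanishes by symmetry, which
  makes the tails even in \<open>n\<close> and the window bounded.\<close>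

definition theta_term :: "int \<Rightarrow> real" where
  "theta_term n = alt n * exp (- pi * (real_of_int n + 1/2)\<^sup>2)"

definition theta_tail :: "int \<Rightarrow> real" where
  "theta_tail N = (\<Sum>\<^sub>\<infinity>n\<in>{N..}. theta_term n)"

definition theta_tail_sum :: real where
  "theta_tail_sum = (\<Sum>\<^sub>\<infinity>N. theta_tail N)"

lemma pi_ge_half: "pi \<ge> 1/2" using pi_gt3 by simp

lemma theta_term_abs_summable: "(\<lambda>n. \<bar>theta_term n\<bar>) summable_on A"
proof -
  have "(\<lambda>n. \<bar>theta_term n\<bar>) summable_on UNIV"
    using gauss_int_sum(1)[OF pi_ge_half, of "1/2"] by (simp add: theta_term_def abs_mult alt_simps)
  then show ?thesis by (rule summable_on_subset_banach) auto
qed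

lemma theta_term_summable: "theta_term summable_on A"
  by (rule abs_summable_summable) (use theta_term_abs_summable in simp)

lemma theta_term_reflect: "theta_term (- 1 - n) = - theta_term n"
proof -
  have "(real_of_int (- 1 - n) + 1/2)\<^sup>2 = (real_of_int n + 1/2)\<^sup>2"
    by (simp add: power2_eq_square algebra_simps)
  moreover have "alt (- 1 - n) = - alt n" by (auto simp: alt_def)
  ultimately show ?thesis by (simp add: theta_term_def)
qed

lemma bij_reflect: "bij_betw (\<lambda>n :: int. c - n) UNIV UNIV"
  by (rule bij_betwI[where g = "\<lambda>n. c - n"]) auto

lemma bij_shift: "bij_betw (\<lambda>n :: int. n + c) UNIV UNIV"
  by (rule bij_betwI[where g = "\<lambda>n. n - c"]) auto

text \<open>The terms with indices n and -1 - n cancel. This is the zero of the Zak transform of the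
  Gaussian at (1/2, 1/2).\<close>

lemma theta_term_sum_zero: "infsum theta_term UNIV = 0"
proof -
  have "infsum theta_term UNIV = (\<Sum>\<^sub>\<infinity>n. theta_term (- 1 - n))"
    using infsum_reindex_bij_betw[OF bij_reflect[of "- 1"], of theta_term] by simp
  also have "\<dots> = - infsum theta_term UNIV" unfolding theta_term_reflect by (rule infsum_uminus)
  finally show ?thesis by simp
qed

lemma theta_tail_step: "theta_tail N - theta_tail (N + 1) = theta_term N"
proof -
  have "{N..} = insert N {N + 1..}" by auto
  then have "theta_tail N = theta_term N + theta_tail (N + 1)"
    unfolding theta_tail_def by (simp add: infsum_insert[OF theta_term_summable])
  then show ?thesis by simp
qed

text \<open>By reflection the tail from -N is minus the sum of the terms below N, and that sum is
  minus the tail from N because the whole series vanishes.\<close>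

lemma theta_tail_even: "theta_tail (- N) = theta_tail N"
proof -
  have 1: "infsum theta_term UNIV = infsum theta_term {..N - 1} + infsum theta_term {N..}"
    by (subst infsum_Un_disjoint[symmetric, OF theta_term_summable theta_term_summable]) (auto intro!: arg_cong[where f = "infsum theta_term"])
  have "theta_tail (- N) = infsum theta_term ((\<lambda>n. - 1 - n) ` {..N - 1})"
  proof -
    have "(\<lambda>n. - 1 - n) ` {..N - 1} = {- N..}"
      by (auto intro!: image_eqI[where x = "- 1 - _"])
    then show ?thesis by (simp add: theta_tail_def)
  qed
  also have "\<dots> = infsum (theta_term \<circ> (\<lambda>n. - 1 - n)) {..N - 1}"
    by (rule infsum_reindex) (auto simp: inj_on_def)
  also have "\<dots> = - infsum theta_term {..N - 1}"
    unfolding o_def theta_term_reflect by (rule infsum_uminus)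
  also have "\<dots> = theta_tail N" using 1 theta_term_sum_zero by (simp add: theta_tail_def)
  finally show ?thesis .
qed

lemma exp_minus_pi_le: "exp (- pi) \<le> 1/8"
proof -
  have "exp (1::real) \<ge> 2" using exp_ge_add_one_self[of 1] by simp
  then have "2 ^ 3 \<le> exp (1::real) ^ 3" by (intro power_mono) auto
  also have "exp (1::real) ^ 3 = exp 3" by (simp flip: exp_of_nat_mult)
  also have "\<dots> \<le> exp pi" using pi_gt3 by simp
  finally show ?thesis by (simp add: exp_minus field_simps)
qed

lemma exp_minus_pi_mult_le: "exp (- pi * real n) \<le> (1/8) ^ n"
proof -
  have "exp (- pi * real n) = exp (- pi) ^ n" by (simp add: mult.commute flip: exp_of_nat_mult)
  also have "\<dots> \<le> (1/8) ^ n" by (intro power_mono exp_minus_pi_le) auto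
  finally show ?thesis .
qed

text \<open>Comparison with a geometric series: (N + j + 1/2)^2 exceeds (N + 1/2)^2 by at least j,
  and exp (- pi) \<le> 1/8, whence the constant 1 / (1 - 1/8) = 8/7.\<close>

lemma theta_tail_bound_nonneg: "\<bar>theta_tail (int N)\<bar> \<le> 8/7 * exp (- pi * (real N + 1/2)\<^sup>2)"
proof -
  define E where "E = exp (- pi * (real N + 1/2)\<^sup>2)"
  have img: "{int N..} = (\<lambda>j :: nat. int N + int j) ` UNIV"
    by (auto intro!: image_eqI[where x = "nat (_ - int N)"])
  have "\<bar>theta_tail (int N)\<bar> \<le> (\<Sum>\<^sub>\<infinity>n\<in>{int N..}. \<bar>theta_term n\<bar>)"
    unfolding theta_tail_def using norm_infsum_bound[of theta_term "{int N..}"] theta_term_abs_summable by simp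
  also have "\<dots> = (\<Sum>\<^sub>\<infinity>j :: nat. \<bar>theta_term (int N + int j)\<bar>)"
    unfolding img by (subst infsum_reindex) (auto simp: o_def inj_on_def)
  also have "\<dots> \<le> (\<Sum>\<^sub>\<infinity>j :: nat. E * (1/8) ^ j)"
  proof (rule infsum_mono)
    show "(\<lambda>j :: nat. \<bar>theta_term (int N + int j)\<bar>) summable_on UNIV"
      using theta_term_abs_summable[of "{int N..}"] unfolding img by (subst (asm) summable_on_reindex) (auto simp: o_def inj_on_def)
    have "summable (\<lambda>j. E * (1/8) ^ j)" by (intro summable_mult summable_geometric) auto
    then show "(\<lambda>j. E * (1/8) ^ j) summable_on UNIV"
      by (intro norm_summable_imp_summable_on) (auto simp: E_def abs_mult)
    fix j :: nat
    have "0 \<le> real j * real j + 2 * (real j * real N)" by simp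
    then have "(real N + real j + 1/2)\<^sup>2 \<ge> (real N + 1/2)\<^sup>2 + real j"
      by (simp add: power2_eq_square algebra_simps)
    then have "pi * ((real N + 1/2)\<^sup>2 + real j) \<le> pi * (real N + real j + 1/2)\<^sup>2"
      by (intro mult_left_mono) auto
    then have "\<bar>theta_term (int N + int j)\<bar> \<le> exp (- pi * (real N + 1/2)\<^sup>2 + - pi * real j)"
      unfolding theta_term_def by (simp add: abs_mult alt_simps(6) distrib_left)
    also have "\<dots> \<le> E * (1/8) ^ j" unfolding exp_add E_def by (intro mult_left_mono exp_minus_pi_mult_le) auto
    finally show "\<bar>theta_term (int N + int j)\<bar> \<le> E * (1/8) ^ j" .
  qed
  also have "\<dots> = E * (8/7)"
  proof -
    have "(\<lambda>j. E * (1/8) ^ j) sums (E * (1 / (1 - 1/8)))" by (intro sums_mult geometric_sums) auto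
    then have "((\<lambda>j. E * (1/8) ^ j) has_sum (E * (8/7))) UNIV"
      by (intro norm_summable_imp_has_sum) (auto simp: E_def abs_mult intro!: summable_mult summable_geometric)
    then show ?thesis by (rule infsumI)
  qed
  finally show ?thesis by (simp add: E_def mult.commute)
qed

lemma theta_tail_bound: "\<bar>theta_tail N\<bar> \<le> 8/7 * exp (- pi * (\<bar>real_of_int N\<bar> + 1/2)\<^sup>2)"
proof (cases "N \<ge> 0")
  case True
  then show ?thesis using theta_tail_bound_nonneg[of "nat N"] by simp
next
  case False
  then show ?thesis using theta_tail_bound_nonneg[of "nat (- N)"] theta_tail_even[of N] by simp
qed

text \<open>Completing the square: the factor exp (2 pi k N) moves the centre of the Gaussian bound
  for the tails from 0 to k, at the price of exp (pi k^2) in the constant.\<close>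

lemma theta_tail_exp_summable: "(\<lambda>N. \<bar>theta_tail N * exp (2 * pi * real_of_int k * real_of_int N)\<bar>) summable_on UNIV"
proof -
  define c where "c = 8/7 * exp (pi * (real_of_int k)\<^sup>2)"
  have s: "(\<lambda>N :: int. c * exp (- pi * (real_of_int N + (- real_of_int k))\<^sup>2)) summable_on UNIV"
    by (intro summable_on_cmult_right gauss_int_sum pi_ge_half)
  show ?thesis
  proof (rule summable_on_comparison_test[OF s])
    fix N :: int
    have "(real_of_int N)\<^sup>2 \<le> (\<bar>real_of_int N\<bar> + 1/2)\<^sup>2" by (simp add: power2_eq_square algebra_simps)
    then have "pi * (real_of_int N)\<^sup>2 \<le> pi * (\<bar>real_of_int N\<bar> + 1/2)\<^sup>2" by (intro mult_left_mono) auto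
    then have "\<bar>theta_tail N\<bar> \<le> 8/7 * exp (- pi * (real_of_int N)\<^sup>2)"
      by (intro order_trans[OF theta_tail_bound[of N]] mult_left_mono) auto
    then have "\<bar>theta_tail N * exp (2 * pi * real_of_int k * real_of_int N)\<bar> \<le> 8/7 * exp (- pi * (real_of_int N)\<^sup>2) * exp (2 * pi * real_of_int k * real_of_int N)"
      unfolding abs_mult by (simp add: mult_right_mono)
    also have "\<dots> = c * exp (- pi * (real_of_int N + (- real_of_int k))\<^sup>2)"
      unfolding c_def mult.assoc exp_add[symmetric] by (simp add: power2_eq_square algebra_simps)
    finally show "\<bar>theta_tail N * exp (2 * pi * real_of_int k * real_of_int N)\<bar> \<le> c * exp (- pi * (real_of_int N + (- real_of_int k))\<^sup>2)" .
  qed auto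
qed

lemma theta_tail_abs_summable: "(\<lambda>N. \<bar>theta_tail N\<bar>) summable_on A"
  by (rule summable_on_subset_banach[of _ UNIV]) (use theta_tail_exp_summable[of 0] in auto)

lemma theta_tail_summable: "theta_tail summable_on A"
  by (rule abs_summable_summable) (use theta_tail_abs_summable in simp)

text \<open>The single term \<open>theta_term 0\<close> = exp (- pi / 4) dominates everything else.
  For n \<ge> 1 one has (n + 1/2)^2 \<ge> 1/4 + 2 n, so the tails fall at least like (1/8)^(2 n) =
  (1/64)^n relative to it. The sum is the normalising constant of the dual window.\<close>

lemma theta_tail_sum_nonzero: "theta_tail_sum \<noteq> 0"
proof -
  define E where "E = exp (- pi / 4)"
  have E: "E > 0" by (simp add: E_def)
  have b: "\<bar>theta_tail (int (Suc n))\<bar> \<le> 8/7 * E * (1/64) ^ Suc n" for n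
  proof -
    have "real (Suc n) * 1 \<le> real (Suc n) * real (Suc n)" by (intro mult_left_mono) auto
    then have "(real (Suc n) + 1/2)\<^sup>2 \<ge> 1/4 + real (2 * Suc n)"
      by (simp add: power2_eq_square algebra_simps)
    then have "pi * (1/4 + real (2 * Suc n)) \<le> pi * (real (Suc n) + 1/2)\<^sup>2" by (intro mult_left_mono) auto
    then have "exp (- pi * (real (Suc n) + 1/2)\<^sup>2) \<le> exp (- pi / 4 + - pi * real (2 * Suc n))"
      by (simp add: distrib_left)
    also have "\<dots> \<le> E * (1/8) ^ (2 * Suc n)"
      unfolding exp_add E_def by (intro mult_left_mono exp_minus_pi_mult_le) auto
    also have "(1/8 :: real) ^ (2 * Suc n) = (1/64) ^ Suc n" by (simp only: power_mult) (simp add: power2_eq_square)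
    finally have "exp (- pi * (real (Suc n) + 1/2)\<^sup>2) \<le> E * (1/64) ^ Suc n" .
    then show ?thesis using theta_tail_bound_nonneg[of "Suc n"] by linarith
  qed
  define S where "S = infsum theta_tail {1..}"
  have img: "{1 :: int..} = (\<lambda>j :: nat. int (Suc j)) ` UNIV"
    by (auto intro!: image_eqI[where x = "nat (_ - 1)"])
  have S: "\<bar>S\<bar> \<le> 8/7 * E * (1/63)"
  proof -
    have "\<bar>S\<bar> \<le> (\<Sum>\<^sub>\<infinity>n\<in>{1..}. \<bar>theta_tail n\<bar>)"
      unfolding S_def using norm_infsum_bound[of theta_tail "{1..}"] theta_tail_abs_summable by simp
    also have "\<dots> = (\<Sum>\<^sub>\<infinity>j :: nat. \<bar>theta_tail (int (Suc j))\<bar>)"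
      unfolding img by (subst infsum_reindex) (auto simp: o_def inj_on_def)
    also have "\<dots> \<le> (\<Sum>\<^sub>\<infinity>j :: nat. 8/7 * E * (1/64) ^ Suc j)"
    proof (rule infsum_mono[OF _ _ b])
      show "(\<lambda>j :: nat. \<bar>theta_tail (int (Suc j))\<bar>) summable_on UNIV"
        using theta_tail_abs_summable[of "{1..}"] unfolding img by (subst (asm) summable_on_reindex) (auto simp: o_def inj_on_def)
      have "summable (\<lambda>j. 8/7 * E * ((1/64) * (1/64) ^ j))" by (intro summable_mult summable_geometric) auto
      then show "(\<lambda>j. 8/7 * E * (1/64) ^ Suc j) summable_on UNIV"
        using E by (intro norm_summable_imp_summable_on) (auto simp: abs_mult)
    qed
    also have "\<dots> = 8/7 * E * (1/63)"
    proof -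
      have "(\<lambda>j. 8/7 * E * ((1/64) * (1/64) ^ j)) sums (8/7 * E * ((1/64) * (1 / (1 - 1/64))))" by (intro sums_mult geometric_sums) auto
      then have "((\<lambda>j. 8/7 * E * (1/64) ^ Suc j) has_sum (8/7 * E * (1/63))) UNIV"
        using E by (intro norm_summable_imp_has_sum) (auto simp: abs_mult intro!: summable_mult summable_geometric)
      then show ?thesis by (rule infsumI)
    qed
    finally show ?thesis .
  qed
  have neg: "infsum theta_tail {..-1} = S"
  proof -
    have "{..-1 :: int} = uminus ` {1..}" by (auto intro!: image_eqI[where x = "- _"])
    then have "infsum theta_tail {..-1} = infsum (theta_tail \<circ> uminus) {1..}"
      using infsum_reindex[of uminus "{1 :: int..}" theta_tail] by (simp add: inj_on_def)
    then show ?thesis by (simp add: S_def o_def theta_tail_even)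
  qed
  have "theta_tail_sum = infsum theta_tail ({..-1} \<union> ({0} \<union> {1..}))"
    unfolding theta_tail_sum_def by (rule arg_cong[where f = "infsum theta_tail"]) auto
  also have "\<dots> = S + (theta_tail 0 + S)"
    by (subst infsum_Un_disjoint[OF theta_tail_summable theta_tail_summable], force, subst infsum_Un_disjoint[OF theta_tail_summable theta_tail_summable])
      (auto simp: neg S_def)
  finally have theta_tail_sum: "theta_tail_sum = 2 * S + theta_tail 0" by simp
  have "theta_tail 0 = theta_term 0 + theta_tail 1" using theta_tail_step[of 0] by simp
  moreover have "theta_term 0 = E" by (simp add: theta_term_def alt_def E_def power2_eq_square)
  moreover have "\<bar>theta_tail 1\<bar> \<le> 8/7 * E * (1/64)" using b[of 0] by simp
  ultimately have "theta_tail_sum \<ge> E - 8/7 * E * (1/64) - 2 * (8/7 * E * (1/63))" using S theta_tail_sum by linarith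
  then show ?thesis using E by simp
qed

definition dual_window :: "real \<Rightarrow> real" where
  "dual_window x = exp (pi * x\<^sup>2) * theta_tail \<lfloor>x + 1/2\<rfloor> / (theta_tail_sum * 2 powr (1/4))"

definition dual_window_bound :: real where
  "dual_window_bound = 8/7 / \<bar>theta_tail_sum * 2 powr (1/4)\<bar>"

lemma dual_window_bound_nonneg: "dual_window_bound \<ge> 0" by (simp add: dual_window_bound_def)

lemma dual_window_measurable[measurable]: "dual_window \<in> borel_measurable borel"
  unfolding dual_window_def[abs_def] by measurable

text \<open>The two exponents cancel at the far end of the cell, where the absolute value is at most
  the absolute value of N plus 1/2, and only the constant of the tail estimate is left.\<close>

lemma exp_theta_tail_bound:
  assumes "\<bar>x\<bar> \<le> \<bar>real_of_int N\<bar> + 1/2"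
  shows "exp (pi * x\<^sup>2) * \<bar>theta_tail N\<bar> \<le> 8/7"
proof -
  have "x\<^sup>2 \<le> (\<bar>real_of_int N\<bar> + 1/2)\<^sup>2" using power_mono[OF assms, of 2] by simp
  then have "pi * x\<^sup>2 \<le> pi * (\<bar>real_of_int N\<bar> + 1/2)\<^sup>2" by (intro mult_left_mono) auto
  then have "exp (pi * x\<^sup>2) * \<bar>theta_tail N\<bar> \<le> exp (pi * (\<bar>real_of_int N\<bar> + 1/2)\<^sup>2) * (8/7 * exp (- pi * (\<bar>real_of_int N\<bar> + 1/2)\<^sup>2))"
    by (intro mult_mono theta_tail_bound) auto
  also have "\<dots> = 8/7" by (simp add: exp_minus)
  finally show ?thesis .
qed

lemma dual_window_le: "\<bar>dual_window x\<bar> \<le> dual_window_bound"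
proof -
  have "\<bar>x\<bar> \<le> \<bar>real_of_int \<lfloor>x + 1/2\<rfloor>\<bar> + 1/2"
    using of_int_floor_le[of "x + 1/2"] floor_correct[of "x + 1/2"] by linarith
  from exp_theta_tail_bound[OF this] show ?thesis
    unfolding dual_window_def dual_window_bound_def abs_divide by (intro divide_right_mono) (auto simp: abs_mult)
qed

text \<open>Multiplying the terms of the series by \<open>exp (- 2 * pi * k * n)\<close> merely shifts the centre of the Gaussian by the integer
  \<open>k\<close>, so that the twisted series vanishes as well; summation by parts passes to the tails.\<close>

lemma theta_tail_exp_sum_zero:
  assumes "k \<noteq> 0"
  shows "(\<Sum>\<^sub>\<infinity>N. theta_tail N * exp (- 2 * pi * real_of_int k * real_of_int N)) = 0"
proof -
  define z where "z N = exp (- 2 * pi * real_of_int k * real_of_int N)" for N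
  define T where "T = (\<Sum>\<^sub>\<infinity>N. theta_tail N * z N)"
  have zs: "z (N + 1) = exp (- 2 * pi * real_of_int k) * z N" for N
    by (simp add: z_def algebra_simps flip: exp_add)
  have s: "(\<lambda>N. theta_tail N * z N) summable_on UNIV"
    by (rule abs_summable_summable) (use theta_tail_exp_summable[of "- k"] in \<open>simp add: z_def\<close>)
  have s1: "(\<lambda>N. theta_tail (N + 1) * z (N + 1)) summable_on UNIV"
    using s summable_on_reindex_bij_betw[OF bij_shift[of 1], of "\<lambda>N. theta_tail N * z N"] by simp
  have T1: "T = (\<Sum>\<^sub>\<infinity>N. theta_tail (N + 1) * z (N + 1))"
    unfolding T_def using infsum_reindex_bij_betw[OF bij_shift[of 1], of "\<lambda>N. theta_tail N * z N"] by simp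
  \<comment> \<open>Summation by parts: the multiplier exp (2 pi k) undoes the factor that z
    acquires under the index shift, so that differences of tails, hence single terms, appear. Their
    sum vanishes, and the multiplier differs from 1 because k \<noteq> 0.\<close>
  have "T - exp (2 * pi * real_of_int k) * T = (\<Sum>\<^sub>\<infinity>N. theta_tail N * z N) - (\<Sum>\<^sub>\<infinity>N. exp (2 * pi * real_of_int k) * (theta_tail (N + 1) * z (N + 1)))"
    using s1 by (subst infsum_cmult_right) (auto simp: T_def T1[unfolded T_def])
  also have "\<dots> = (\<Sum>\<^sub>\<infinity>N. theta_tail N * z N - exp (2 * pi * real_of_int k) * (theta_tail (N + 1) * z (N + 1)))"
    by (intro infsum_diff[symmetric] s summable_on_cmult_right s1)
  also have "\<dots> = (\<Sum>\<^sub>\<infinity>N. exp (pi * ((real_of_int k)\<^sup>2 + real_of_int k)) * alt k * theta_term (N + k))"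
  proof (rule infsum_cong)
    fix N :: int
    have "theta_tail N * z N - exp (2 * pi * real_of_int k) * (theta_tail (N + 1) * z (N + 1)) = (theta_tail N - theta_tail (N + 1)) * z N"
      unfolding zs by (simp add: algebra_simps flip: exp_add)
    also have "\<dots> = alt N * (exp (- pi * (real_of_int N + 1/2)\<^sup>2) * z N)"
      unfolding theta_tail_step by (simp add: theta_term_def)
    also have "exp (- pi * (real_of_int N + 1/2)\<^sup>2) * z N = exp (pi * ((real_of_int k)\<^sup>2 + real_of_int k)) * exp (- pi * (real_of_int (N + k) + 1/2)\<^sup>2)"
      unfolding z_def exp_add[symmetric] by (simp add: power2_eq_square algebra_simps)
    also have "alt N * (exp (pi * ((real_of_int k)\<^sup>2 + real_of_int k)) * exp (- pi * (real_of_int (N + k) + 1/2)\<^sup>2)) =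
      exp (pi * ((real_of_int k)\<^sup>2 + real_of_int k)) * alt k * theta_term (N + k)"
      by (simp add: theta_term_def alt_def)
    finally show "theta_tail N * z N - exp (2 * pi * real_of_int k) * (theta_tail (N + 1) * z (N + 1)) =
      exp (pi * ((real_of_int k)\<^sup>2 + real_of_int k)) * alt k * theta_term (N + k)" .
  qed
  also have "\<dots> = exp (pi * ((real_of_int k)\<^sup>2 + real_of_int k)) * alt k * (\<Sum>\<^sub>\<infinity>N. theta_term (N + k))"
    using theta_term_summable summable_on_reindex_bij_betw[OF bij_shift[of k], of theta_term] by (intro infsum_cmult_right) auto
  also have "(\<Sum>\<^sub>\<infinity>N. theta_term (N + k)) = 0"
    using infsum_reindex_bij_betw[OF bij_shift[of k], of theta_term] theta_term_sum_zero by simp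
  finally have "T * (1 - exp (2 * pi * real_of_int k)) = 0" by (simp add: algebra_simps)
  then show ?thesis using assms by (simp add: T_def z_def)
qed

text \<open>In the product of the growing and the decaying exponential the squares of the cell index
  r cancel, and only exp (- 2 pi k r) still depends on r. For k \<noteq> 0 the sum is then the
  twisted tail series, which vanishes; for k = 0 it is the normalising constant.\<close>

lemma dual_window_biorthogonal:
  fixes x :: real and k :: int
  shows "(\<Sum>\<^sub>\<infinity>p :: int. dual_window (x - real_of_int p) * (2 powr (1/4) * exp (- pi * (x + real_of_int k - real_of_int p)\<^sup>2))) = (if k = 0 then 1 else 0)"
proof -
  \<comment> \<open>N is the nearest integer to x and d the offset in [-1/2, 1/2). The substitution
    p = N - r makes r the index of the cell in which the argument of the window lies.\<close>
  define N d where "N = \<lfloor>x + 1/2\<rfloor>" and "d = x - real_of_int N"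
  define c where "c = exp (- pi * (real_of_int k)\<^sup>2 - 2 * pi * real_of_int k * d) / theta_tail_sum"
  have fl: "\<lfloor>d + real_of_int r + 1/2\<rfloor> = r" for r
    unfolding d_def N_def by linarith
  have "(\<Sum>\<^sub>\<infinity>p :: int. dual_window (x - real_of_int p) * (2 powr (1/4) * exp (- pi * (x + real_of_int k - real_of_int p)\<^sup>2))) =
    (\<Sum>\<^sub>\<infinity>r. dual_window (x - real_of_int (N - r)) * (2 powr (1/4) * exp (- pi * (x + real_of_int k - real_of_int (N - r))\<^sup>2)))"
    using infsum_reindex_bij_betw[OF bij_reflect[of N], symmetric] .
  also have "\<dots> = (\<Sum>\<^sub>\<infinity>r. c * (theta_tail r * exp (- 2 * pi * real_of_int k * real_of_int r)))"
  proof (rule infsum_cong)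
    fix r :: int
    have x: "x - real_of_int (N - r) = d + real_of_int r" "x + real_of_int k - real_of_int (N - r) = d + real_of_int r + real_of_int k"
      by (simp_all add: d_def)
    have e: "exp (pi * (d + real_of_int r)\<^sup>2) * exp (- pi * (d + real_of_int r + real_of_int k)\<^sup>2) =
      exp (- pi * (real_of_int k)\<^sup>2 - 2 * pi * real_of_int k * d) * exp (- 2 * pi * real_of_int k * real_of_int r)"
      unfolding exp_add[symmetric] by (simp add: power2_eq_square algebra_simps)
    have "dual_window (d + real_of_int r) * (2 powr (1/4) * exp (- pi * (d + real_of_int r + real_of_int k)\<^sup>2)) =
       (exp (pi * (d + real_of_int r)\<^sup>2) * exp (- pi * (d + real_of_int r + real_of_int k)\<^sup>2)) * theta_tail r / theta_tail_sum"
      unfolding dual_window_def fl by simp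
    then show "dual_window (x - real_of_int (N - r)) * (2 powr (1/4) * exp (- pi * (x + real_of_int k - real_of_int (N - r))\<^sup>2)) =
      c * (theta_tail r * exp (- 2 * pi * real_of_int k * real_of_int r))"
      unfolding x e c_def by simp
  qed
  also have "\<dots> = c * (\<Sum>\<^sub>\<infinity>r. theta_tail r * exp (- 2 * pi * real_of_int k * real_of_int r))"
  proof (rule infsum_cmult_right)
    have "(\<lambda>r. theta_tail r * exp (- 2 * pi * real_of_int k * real_of_int r)) summable_on UNIV"
      by (rule abs_summable_summable) (use theta_tail_exp_summable[of "- k"] in simp)
    then show "c \<noteq> 0 \<Longrightarrow> (\<lambda>r. theta_tail r * exp (- 2 * pi * real_of_int k * real_of_int r)) summable_on UNIV" .
  qed
  also have "\<dots> = (if k = 0 then 1 else 0)"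
    using theta_tail_exp_sum_zero[of k] theta_tail_sum_nonzero by (auto simp: c_def theta_tail_sum_def)
  finally show ?thesis .
qed

section \<open>Lattice coefficients and half-integer sums\<close>

lemma has_sum_single:
  fixes f :: "'a \<Rightarrow> 'b :: real_normed_vector"
  assumes "\<And>x. x \<noteq> a \<Longrightarrow> f x = 0"
  shows "(f has_sum f a) UNIV"
proof -
  have "(f has_sum (\<Sum>x\<in>{a}. f x)) {a}" by (rule has_sum_finite) simp
  then have "(f has_sum f a) {a}" by simp
  then show ?thesis
    by (rule iffD1[OF has_sum_cong_neutral, rotated -1]) (auto simp: assms)
qed

text \<open>Countable additivity over unit cells. For an integer c the cell borders are the
  half-integers, where the dual window jumps.\<close>

lemma integral_unit_partition:
  fixes u :: "real \<Rightarrow> complex" and c :: real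
  assumes u: "integrable lborel u"
  defines "I \<equiv> \<lambda>N :: int. {c + real_of_int N - 1/2 ..< c + real_of_int N + 1/2}"
  shows "(\<lambda>N. norm (LINT x|lborel. u x * indicator (I N) x)) summable_on UNIV"
    and "(\<Sum>\<^sub>\<infinity>N. LINT x|lborel. u x * indicator (I N) x) = (LINT x|lborel. u x)"
proof -
  have mem: "x \<in> I N \<longleftrightarrow> N = \<lfloor>x - c + 1/2\<rfloor>" for x N
    unfolding I_def eq_commute[of N] floor_eq_iff by auto
  have sum1: "((\<lambda>N. indicator (I N) x :: real) has_sum 1) UNIV"
    "((\<lambda>N. indicator (I N) x :: complex) has_sum 1) UNIV" for x
    using has_sum_single[of "\<lfloor>x - c + 1/2\<rfloor>" "\<lambda>N. indicator (I N) x :: real"]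
      has_sum_single[of "\<lfloor>x - c + 1/2\<rfloor>" "\<lambda>N. indicator (I N) x :: complex"] by (auto simp: mem)
  have n: "(\<lambda>N. norm (indicator (I N) x :: complex)) = (\<lambda>N. indicator (I N) x :: real)" for x
    by (auto simp: indicator_def)
  have [measurable]: "I N \<in> sets borel" for N by (simp add: I_def)
  have "(\<lambda>N. norm (indicator (I N) x :: complex)) summable_on UNIV"
       "(\<Sum>\<^sub>\<infinity>N. norm (indicator (I N) x :: complex)) \<le> 1" for x
    unfolding n using sum1(1)[of x] infsumI[OF sum1(1)[of x]] by (auto simp: summable_on_def)
  show "(\<lambda>N. norm (LINT x|lborel. u x * indicator (I N) x)) summable_on UNIV"
    by (rule superpose_sum(1)[OF lborel.sigma_finite_measure_axioms u]) (use \<open>\<And>x. (\<lambda>N. norm (indicator (I N) x :: complex)) summable_on UNIV\<close> \<open>\<And>x. (\<Sum>\<^sub>\<infinity>N. norm (indicator (I N) x :: complex)) \<le> 1\<close> in auto)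
  have "(\<Sum>\<^sub>\<infinity>N. LINT x|lborel. u x * indicator (I N) x) = (LINT x|lborel. u x * (\<Sum>\<^sub>\<infinity>N. indicator (I N) x))"
    by (rule superpose_sum(2)[OF lborel.sigma_finite_measure_axioms u]) (use \<open>\<And>x. (\<lambda>N. norm (indicator (I N) x :: complex)) summable_on UNIV\<close> \<open>\<And>x. (\<Sum>\<^sub>\<infinity>N. norm (indicator (I N) x :: complex)) \<le> 1\<close> in auto)
  then show "(\<Sum>\<^sub>\<infinity>N. LINT x|lborel. u x * indicator (I N) x) = (LINT x|lborel. u x)"
    using infsumI[OF sum1(2)] by simp
qed

definition beta :: "real \<times> real \<Rightarrow> (real \<Rightarrow> complex) \<Rightarrow> complex" where
  "beta l f = (LINT x|lborel. f x * (of_real (dual_window (x - fst l)) * cis (- (2 * pi * snd l * x))))"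

text \<open>It depends on point values, and is therefore applied to continuous functions: Gabor
  functions and the representatives given by \<open>synth\<close>.\<close>

definition half_int_sum :: "(real \<Rightarrow> complex) \<Rightarrow> complex" where
  "half_int_sum F = (\<Sum>\<^sub>\<infinity>n :: int. of_real (alt n) * F (real_of_int n + 1/2))"

text \<open>The factor 1 / (2 pi) is that of the derivative in \<open>annih\<close>, the remaining
  one is the normalisation of \<open>dual_window\<close>.\<close>

definition kappa :: real where
  "kappa = 1 / (2 * pi * (theta_tail_sum * 2 powr (1/4)))"

lemma beta_kernel_integrable:
  assumes f: "integrable lborel f"
  shows "integrable lborel (\<lambda>x. f x * (of_real (dual_window (x - p)) * cis (t * x)))"
    and "(LINT x|lborel. norm (f x * (of_real (dual_window (x - p)) * cis (t * x)))) \<le> dual_window_bound * (LINT x|lborel. norm (f x))"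
proof -
  have [measurable]: "f \<in> borel_measurable borel" using f by auto
  have le: "norm (f x * (of_real (dual_window (x - p)) * cis (t * x))) \<le> dual_window_bound * norm (f x)" for x
    using mult_left_mono[OF dual_window_le[of "x - p"], of "norm (f x)"] by (simp add: norm_mult mult.commute)
  show i: "integrable lborel (\<lambda>x. f x * (of_real (dual_window (x - p)) * cis (t * x)))"
  proof (rule Bochner_Integration.integrable_bound)
    show "integrable lborel (\<lambda>x. dual_window_bound * norm (f x))" using f by auto
  qed (auto intro!: AE_I2 order_trans[OF le])
  have "(LINT x|lborel. norm (f x * (of_real (dual_window (x - p)) * cis (t * x)))) \<le> (LINT x|lborel. dual_window_bound * norm (f x))"
    by (rule integral_mono[OF integrable_norm[OF i] _ le]) (use f in auto)
  then show "(LINT x|lborel. norm (f x * (of_real (dual_window (x - p)) * cis (t * x)))) \<le> dual_window_bound * (LINT x|lborel. norm (f x))"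
    by simp
qed

lemma norm_beta_le:
  assumes f: "integrable lborel f"
  shows "norm (beta l f) \<le> dual_window_bound * (LINT x|lborel. norm (f x))"
  using order_trans[OF integral_norm_bound beta_kernel_integrable(2)[OF f, of "fst l" "- (2 * pi * snd l)"]] by (simp add: beta_def)

lemma beta_cong_AE:
  assumes "AE x in lborel. f x = g x" "f \<in> borel_measurable borel" "g \<in> borel_measurable borel"
  shows "beta l f = beta l g"
proof -
  note [measurable] = assms(2,3)
  show ?thesis unfolding beta_def
  proof (rule integral_cong_AE)
    show "AE x in lborel. f x * (of_real (dual_window (x - fst l)) * cis (- (2 * pi * snd l * x))) = g x * (of_real (dual_window (x - fst l)) * cis (- (2 * pi * snd l * x)))"
      using assms(1) by eventually_elim simp
  qed auto
qed

lemma beta_linear: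
  assumes "integrable lborel f" "integrable lborel g"
  shows "beta l (\<lambda>x. a * f x + b * g x) = a * beta l f + b * beta l g"
proof -
  let ?k = "\<lambda>x. of_real (dual_window (x - fst l)) * cis (- (2 * pi * snd l * x))"
  have i: "integrable lborel (\<lambda>x. f x * ?k x)" "integrable lborel (\<lambda>x. g x * ?k x)"
    using beta_kernel_integrable(1)[OF assms(1), of "fst l" "- (2 * pi * snd l)"]
      beta_kernel_integrable(1)[OF assms(2), of "fst l" "- (2 * pi * snd l)"] by auto
  have "(\<lambda>x. (a * f x + b * g x) * ?k x) = (\<lambda>x. a * (f x * ?k x) + b * (g x * ?k x))"
    by (auto simp: algebra_simps)
  then show ?thesis unfolding beta_def by (simp only:) (use i in simp)
qed

lemma infsum_by_parts_int:
  fixes G :: "int \<Rightarrow> complex" and s :: "int \<Rightarrow> real"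
  assumes "(\<lambda>N. norm (of_real (s N) * G N)) summable_on UNIV" "(\<lambda>N. norm (of_real (s N) * G (N - 1))) summable_on UNIV"
  shows "(\<Sum>\<^sub>\<infinity>N. of_real (s N) * (G N - G (N - 1))) = (\<Sum>\<^sub>\<infinity>N. of_real (s N - s (N + 1)) * G N)"
proof -
  have 1: "(\<lambda>N. of_real (s N) * G N) summable_on UNIV" "(\<lambda>N. of_real (s N) * G (N - 1)) summable_on UNIV"
    using assms by (auto intro: abs_summable_summable)
  have 2: "(\<lambda>N. of_real (s (N + 1)) * G N) summable_on UNIV"
    "(\<Sum>\<^sub>\<infinity>N. of_real (s (N + 1)) * G N) = (\<Sum>\<^sub>\<infinity>N. of_real (s N) * G (N - 1))"
    using 1(2) summable_on_reindex_bij_betw[OF bij_shift[of 1], of "\<lambda>N. of_real (s N) * G (N - 1)"]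
      infsum_reindex_bij_betw[OF bij_shift[of 1], of "\<lambda>N. of_real (s N) * G (N - 1)"] by auto
  show ?thesis
    unfolding right_diff_distrib of_real_diff left_diff_distrib
    using infsum_diff[OF 1] infsum_diff[OF 1(1) 2(1)] 2(2) by simp
qed

text \<open>Integration by parts over the cells between consecutive half-integers, where the window is smooth:
  the jumps at the half-integers have size proportional to \<open>(-1)^n * exp (- pi * (n + 1/2)\<^sup>2)\<close>, and the Gaussian
  is cancelled by the factor \<open>exp (pi * x\<^sup>2)\<close> of the window, leaving the alternating sum of the values of \<open>F\<close>.\<close>

lemma beta_annih:
  fixes p q :: int
  defines "l \<equiv> (real_of_int p, real_of_int q)"
  assumes w: "weakly_differentiable f" and F: "continuous_on UNIV F" "AE x in lborel. f x = F x"
    and f: "integrable lborel f" and af: "integrable lborel (annih f)"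
    and S: "(\<lambda>n :: int. norm (F (real_of_int n + 1/2))) summable_on UNIV"
  shows "beta l (annih f) = cpoint l * beta l f + of_real (kappa * alt (p + q)) * half_int_sum F"
proof -
  define c where "c = real_of_int p"
  \<comment> \<open>The smooth factor of the kernel of \<open>beta\<close>, which on each cell is a
    constant multiple of \<psi>. It is also an integrating factor: 2 pi times (annih f - cpoint l f)
    \<psi> is the weak derivative of f \<psi>.\<close>
  define \<psi> where "\<psi> x = of_real (exp (pi * (x - c)\<^sup>2)) * cis (- (2 * pi * real_of_int q * x))" for x
  define \<psi>' where "\<psi>' x = 2 * of_real pi * (of_real x - cpoint l) * \<psi> x" for x
  have \<psi>d: "(\<psi> has_vector_derivative \<psi>' x) (at x)" for x
  proof -
    define E where "E z = exp (of_real pi * (z - of_real c)\<^sup>2 - 2 * of_real pi * \<i> * of_real (real_of_int q) * z)" for z :: complex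
    have g: "\<psi> = (\<lambda>x. E (of_real x))"
    proof
      fix x
      have "cis (- (2 * pi * real_of_int q * x)) = exp (- (2 * of_real pi * \<i> * of_real (real_of_int q) * of_real x))"
        unfolding cis_conv_exp by (rule arg_cong[where f = exp]) simp
      then show "\<psi> x = E (of_real x)" unfolding \<psi>_def E_def exp_of_real[symmetric] by (simp add: exp_diff exp_minus divide_inverse)
    qed
    have "(E has_field_derivative (2 * of_real pi * (of_real x - Complex c (real_of_int q)) * E (of_real x))) (at (of_real x))"
      unfolding E_def by (auto intro!: derivative_eq_intros simp: Complex_eq algebra_simps)
    from has_vector_derivative_real_field[OF this] show ?thesis
      unfolding g \<psi>'_def by (simp add: l_def c_def)
  qed
  have \<psi>td: "times_diff n \<psi>" for n
  proof (induction n)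
    case (Suc n)
    have "times_diff n (\<lambda>x. (2 * of_real pi) * (of_real x + - cpoint l) * \<psi> x)"
      by (intro times_diff_mult times_diff_add times_diff_const times_diff_ident Suc)
    then have "times_diff n \<psi>'" by (simp add: \<psi>'_def[abs_def])
    with \<psi>d show ?case by (rule times_diff_SucI)
  qed auto
  have \<psi>c: "continuous_on UNIV \<psi>" "continuous_on UNIV \<psi>'"
  proof -
    show *: "continuous_on UNIV \<psi>" using \<psi>d by (meson continuous_at_imp_continuous_on has_vector_derivative_continuous)
    show "continuous_on UNIV \<psi>'" unfolding \<psi>'_def by (intro continuous_intros *)
  qed
  define g where "g = weak_deriv f"
  have fg: "is_weak_deriv f g" unfolding g_def by (rule weakly_differentiableD[OF w])
  have W: "is_weak_deriv (\<lambda>x. f x * \<psi> x) (\<lambda>x. g x * \<psi> x + f x * \<psi>' x)"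
    by (rule is_weak_deriv_mult_smooth[OF fg \<psi>td \<psi>d \<psi>c(2)])
  define v where "v x = annih f x - cpoint l * f x" for x
  have vint: "integrable lborel v" unfolding v_def using f af by auto
  have gv: "g x * \<psi> x + f x * \<psi>' x = 2 * of_real pi * (v x * \<psi> x)" for x
    unfolding v_def annih_def \<psi>'_def g_def by (simp add: field_simps)
  \<comment> \<open>Boundary values of f \<psi>, indexed by the right end of the cell N, so that the
    left end carries G (N - 1).\<close>
  define G where "G N = F (c + real_of_int N + 1/2) * \<psi> (c + real_of_int N + 1/2)" for N :: int
  have FTC: "G N - G (N - 1) = 2 * of_real pi * (LINT x|lborel. indicator {c + real_of_int N - 1/2 .. c + real_of_int N + 1/2} x *\<^sub>R (v x * \<psi> x))" for N
  proof -
    have c: "continuous_on UNIV (\<lambda>x. F x * \<psi> x)" by (intro continuous_intros F \<psi>c)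
    have ae: "AE x in lborel. f x * \<psi> x = F x * \<psi> x" using F(2) by eventually_elim simp
    have a: "c + real_of_int (N - 1) + 1/2 = c + real_of_int N - 1/2" by simp
    show ?thesis
      using is_weak_deriv_FTC[OF W c ae, of "c + real_of_int N - 1/2" "c + real_of_int N + 1/2"]
      unfolding G_def a gv by (simp flip: integral_mult_right_zero add: scaleR_conv_of_real mult_ac)
  qed
  define I where "I N = {c + real_of_int N - 1/2 ..< c + real_of_int N + 1/2}" for N :: int
  let ?k = "\<lambda>x. of_real (dual_window (x - fst l)) * cis (- (2 * pi * snd l * x))"
  define u where "u x = v x * ?k x" for x
  have uint: "integrable lborel u"
    using beta_kernel_integrable(1)[OF vint, of "fst l" "- (2 * pi * snd l)"] by (simp add: u_def[abs_def])
  have piece: "(LINT x|lborel. u x * indicator (I N) x) = of_real kappa * (of_real (theta_tail N) * (G N - G (N - 1)))" for N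
  proof -
    have [measurable]: "f \<in> borel_measurable borel" "annih f \<in> borel_measurable borel" "\<psi> \<in> borel_measurable borel"
      using f af borel_measurable_continuous_onI[OF \<psi>c(1)] by auto
    have "(LINT x|lborel. u x * indicator (I N) x) =
      (LINT x|lborel. of_real (theta_tail N / (theta_tail_sum * 2 powr (1/4))) * (indicator {c + real_of_int N - 1/2 .. c + real_of_int N + 1/2} x *\<^sub>R (v x * \<psi> x)))"
    proof (rule integral_cong_AE)
      have "AE x in lborel. x \<noteq> c + real_of_int N + 1/2" by (rule AE_lborel_singleton)
      then show "AE x in lborel. u x * indicator (I N) x = of_real (theta_tail N / (theta_tail_sum * 2 powr (1/4))) * (indicator {c + real_of_int N - 1/2 .. c + real_of_int N + 1/2} x *\<^sub>R (v x * \<psi> x))"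
      proof eventually_elim
        case (elim x)
        show ?case
        proof (cases "x \<in> I N")
          case True
          then have "\<lfloor>x - c + 1/2\<rfloor> = N" unfolding I_def by (intro floor_unique) auto
          then have "dual_window (x - c) = exp (pi * (x - c)\<^sup>2) * theta_tail N / (theta_tail_sum * 2 powr (1/4))" by (simp add: dual_window_def)
          then show ?thesis using True by (simp add: u_def l_def c_def[symmetric] \<psi>_def I_def)
        next
          case False
          then show ?thesis using elim by (auto simp: I_def)
        qed
      qed
    qed (auto simp: u_def v_def I_def)
    also have "\<dots> = of_real (theta_tail N / (theta_tail_sum * 2 powr (1/4))) * (LINT x|lborel. indicator {c + real_of_int N - 1/2 .. c + real_of_int N + 1/2} x *\<^sub>R (v x * \<psi> x))"
      by (rule integral_mult_right_zero)
    also have "\<dots> = of_real kappa * (of_real (theta_tail N) * (G N - G (N - 1)))"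
      unfolding FTC by (simp add: kappa_def)
    finally show ?thesis .
  qed
  have normG: "norm (G N) = norm (F (c + real_of_int N + 1/2)) * exp (pi * (real_of_int N + 1/2)\<^sup>2)" for N
    unfolding G_def \<psi>_def by (simp add: norm_mult)
  have FS: "(\<lambda>N :: int. norm (F (c + real_of_int N + 1/2))) summable_on UNIV"
    using S summable_on_reindex_bij_betw[OF bij_shift[of p], of "\<lambda>n. norm (F (real_of_int n + 1/2))"]
    by (simp add: c_def add_ac)
  have FS1: "(\<lambda>N :: int. norm (F (c + real_of_int (N - 1) + 1/2))) summable_on UNIV"
    using FS summable_on_reindex_bij_betw[OF bij_shift[of "- 1"], of "\<lambda>N. norm (F (c + real_of_int N + 1/2))"]
    by simp
  have s1: "(\<lambda>N. norm (of_real (theta_tail N) * G N)) summable_on UNIV"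
  proof (rule summable_on_comparison_test[OF summable_on_cmult_right[OF FS, of "8/7"]])
    fix N :: int
    have e: "exp (pi * (real_of_int N + 1/2)\<^sup>2) * \<bar>theta_tail N\<bar> \<le> 8/7" by (rule exp_theta_tail_bound) linarith
    then show "norm (of_real (theta_tail N) * G N) \<le> 8/7 * norm (F (c + real_of_int N + 1/2))"
      using mult_left_mono[OF e, of "norm (F (c + real_of_int N + 1/2))"]
      unfolding norm_mult normG norm_of_real by (simp only: mult_ac norm_ge_zero simp_thms if_True)
  qed auto
  have s2: "(\<lambda>N. norm (of_real (theta_tail N) * G (N - 1))) summable_on UNIV"
  proof (rule summable_on_comparison_test[OF summable_on_cmult_right[OF FS1, of "8/7"]])
    fix N :: int
    have e: "exp (pi * (real_of_int (N - 1) + 1/2)\<^sup>2) * \<bar>theta_tail N\<bar> \<le> 8/7" by (rule exp_theta_tail_bound) (use abs_triangle_ineq4[of "real_of_int N" "1/2"] in simp)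
    then show "norm (of_real (theta_tail N) * G (N - 1)) \<le> 8/7 * norm (F (c + real_of_int (N - 1) + 1/2))"
      using mult_left_mono[OF e, of "norm (F (c + real_of_int (N - 1) + 1/2))"]
      unfolding norm_mult normG norm_of_real by (simp only: mult_ac norm_ge_zero simp_thms if_True)
  qed auto
  \<comment> \<open>At the cell borders the phase is (-1)^q, because 2 q times a half-integer is
    congruent to q modulo 2. The difference of consecutive tails is a theta term, whose Gaussian
    cancels the modulus of \<psi>.\<close>
  have G_eq: "of_real (theta_tail N - theta_tail (N + 1)) * G N = of_real (alt q) * (of_real (alt N) * F (real_of_int (N + p) + 1/2))" for N
  proof -
    have c: "cis (- (2 * pi * real_of_int q * (c + real_of_int N + 1/2))) = of_real (alt q)"
    proof -
      have "cis (- (2 * pi * real_of_int q * (c + real_of_int N + 1/2))) = cis (pi * real_of_int (- (2 * q * (p + N) + q)))"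
        by (rule arg_cong[where f = cis]) (simp add: c_def algebra_simps)
      also have "\<dots> = of_real (alt q)" unfolding cis_pi_int by (simp add: alt_def)
      finally show ?thesis .
    qed
    have e: "exp (- pi * (real_of_int N + 1/2)\<^sup>2) * exp (pi * (real_of_int N + 1/2)\<^sup>2) = 1"
      by (simp add: exp_minus)
    have "of_real (theta_tail N - theta_tail (N + 1)) * G N = of_real (alt N * (exp (- pi * (real_of_int N + 1/2)\<^sup>2) * exp (pi * (real_of_int N + 1/2)\<^sup>2))) * F (c + real_of_int N + 1/2) * of_real (alt q)"
      unfolding G_def \<psi>_def c theta_tail_step theta_term_def by simp
    then show ?thesis unfolding e by (simp add: c_def add_ac)
  qed
  have "beta l v = (\<Sum>\<^sub>\<infinity>N. LINT x|lborel. u x * indicator (I N) x)"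
    unfolding I_def integral_unit_partition(2)[OF uint] unfolding beta_def u_def[abs_def] ..
  also have "\<dots> = of_real kappa * (\<Sum>\<^sub>\<infinity>N. of_real (theta_tail N) * (G N - G (N - 1)))"
    unfolding piece by (rule infsum_cmult_right')
  also have "\<dots> = of_real kappa * (\<Sum>\<^sub>\<infinity>N. of_real (alt q) * (of_real (alt N) * F (real_of_int (N + p) + 1/2)))"
    unfolding infsum_by_parts_int[OF s1 s2] G_eq ..
  also have "(\<lambda>N. of_real (alt q) * (of_real (alt N) * F (real_of_int (N + p) + 1/2))) =
      (\<lambda>N. of_real (alt (p + q)) * (of_real (alt (N + p)) * F (real_of_int (N + p) + 1/2)))"
    by (auto simp: alt_def)
  also have "(\<Sum>\<^sub>\<infinity>N. of_real (alt (p + q)) * (of_real (alt (N + p)) * F (real_of_int (N + p) + 1/2))) = of_real (alt (p + q)) * half_int_sum F"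
    unfolding half_int_sum_def using infsum_reindex_bij_betw[OF bij_shift[of p], of "\<lambda>n. of_real (alt n) * F (real_of_int n + 1/2)"]
    by (subst infsum_cmult_right') simp
  finally have "beta l v = of_real (kappa * alt (p + q)) * half_int_sum F" by simp
  moreover have "beta l v = beta l (annih f) - cpoint l * beta l f"
    using beta_linear[OF af f, of l 1 "- cpoint l"] by (simp add: v_def[abs_def])
  ultimately show ?thesis by (simp add: algebra_simps)
qed

section \<open>Half-integer sums and lattice coefficients of Gabor functions\<close>

lemma gabor_half_int_sum:
  "(\<lambda>n :: int. norm (gabor \<eta> (real_of_int n + t))) summable_on UNIV"
  "(\<Sum>\<^sub>\<infinity>n :: int. norm (gabor \<eta> (real_of_int n + t))) \<le> 2 powr (1/4) * gauss_sum_bound"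
proof -
  have eq: "norm (gabor \<eta> (real_of_int n + t)) = 2 powr (1/4) * exp (- pi * (real_of_int n + (t - fst \<eta>))\<^sup>2)" for n :: int
    unfolding norm_gabor by (simp add: add_diff_eq)
  show "(\<lambda>n :: int. norm (gabor \<eta> (real_of_int n + t))) summable_on UNIV"
    unfolding eq by (intro summable_on_cmult_right gauss_int_sum pi_ge_half)
  show "(\<Sum>\<^sub>\<infinity>n :: int. norm (gabor \<eta> (real_of_int n + t))) \<le> 2 powr (1/4) * gauss_sum_bound"
    unfolding eq infsum_cmult_right' by (intro mult_left_mono gauss_int_sum pi_ge_half) auto
qed

lemma half_int_sum_gabor_bound: "norm (half_int_sum (gabor \<eta>)) \<le> 2 powr (1/4) * gauss_sum_bound"
proof -
  have n: "norm (of_real (alt n) * gabor \<eta> (real_of_int n + 1/2)) = norm (gabor \<eta> (real_of_int n + 1/2))" for n :: int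
    by (simp add: norm_mult alt_simps)
  have "norm (half_int_sum (gabor \<eta>)) \<le> (\<Sum>\<^sub>\<infinity>n :: int. norm (of_real (alt n) * gabor \<eta> (real_of_int n + 1/2)))"
    unfolding half_int_sum_def by (rule norm_infsum_bound) (unfold n, rule gabor_half_int_sum)
  also have "\<dots> \<le> 2 powr (1/4) * gauss_sum_bound" unfolding n by (rule gabor_half_int_sum)
  finally show ?thesis .
qed

lemma gabor_regular: "weakly_differentiable (gabor l)" "annih (gabor l) \<in> borel_measurable borel"
  "integrable lborel (annih (gabor l))"
proof -
  show 1: "weakly_differentiable (gabor l)" using weak_deriv_AE_eq(1)[OF gabor_is_weak_deriv] .
  show 2: "annih (gabor l) \<in> borel_measurable borel"
    by (rule locally_integrable_measurable[OF annih_locally_integrable[OF 1]])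
  have "integrable lborel (\<lambda>x. cpoint l * gabor l x)" using gabor_integrable by auto
  then show "integrable lborel (annih (gabor l))"
    by (rule iffD1[OF integrable_cong_AE, rotated -1]) (use 2 annih_gabor[of l] in auto)
qed

text \<open>The functional applied to annih (gabor \<eta>) is computed twice, by
  \<open>beta_annih\<close> and by the eigenvalue equation. The second bound covers the
  neighbourhood of \<eta> = l, where the first identity cannot be divided.\<close>

lemma beta_gabor:
  fixes p q :: int
  defines "l \<equiv> (real_of_int p, real_of_int q)"
  shows "(cpoint \<eta> - cpoint l) * beta l (gabor \<eta>) = of_real (kappa * alt (p + q)) * half_int_sum (gabor \<eta>)"
    and "norm (beta l' (gabor \<eta>)) \<le> dual_window_bound * 2 powr (1/4)"
proof -
  have 1: "beta l (annih (gabor \<eta>)) = cpoint l * beta l (gabor \<eta>) + of_real (kappa * alt (p + q)) * half_int_sum (gabor \<eta>)"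
    unfolding l_def
    by (rule beta_annih[OF gabor_regular(1) gabor_continuous _ gabor_integrable gabor_regular(3) gabor_half_int_sum(1)]) simp
  have "beta l (annih (gabor \<eta>)) = beta l (\<lambda>x. cpoint \<eta> * gabor \<eta> x + 0 * gabor \<eta> x)"
    by (rule beta_cong_AE) (use annih_gabor gabor_regular(2) in auto)
  also have "\<dots> = cpoint \<eta> * beta l (gabor \<eta>)"
    by (subst beta_linear[OF gabor_integrable gabor_integrable]) simp
  finally show "(cpoint \<eta> - cpoint l) * beta l (gabor \<eta>) = of_real (kappa * alt (p + q)) * half_int_sum (gabor \<eta>)"
    using 1 by (simp add: algebra_simps)
  show "norm (beta l' (gabor \<eta>)) \<le> dual_window_bound * 2 powr (1/4)"
    using norm_beta_le[OF gabor_integrable, of l' \<eta>] by (simp add: integral_norm_gabor)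
qed

text \<open>The Feichtinger algebra, that is, the modulation space M^1. It contains
  \<open>H_space \<delta>\<close> for every \<delta> > 2, and integrability of the transform is the
  hypothesis under which superpositions of Gabor functions may be exchanged with sums and
  integrals.\<close>

definition feichtinger :: "(real \<Rightarrow> complex) set" where
  "feichtinger = {f \<in> L2. integrable lborel (\<lambda>l. L2_inner f (gabor l))}"

abbreviation trf :: "(real \<Rightarrow> complex) \<Rightarrow> real \<times> real \<Rightarrow> complex" where
  "trf f \<equiv> (\<lambda>l. L2_inner f (gabor l))"

lemma feichtinger_measurable: "f \<in> feichtinger \<Longrightarrow> f \<in> borel_measurable borel"
  by (auto simp: feichtinger_def L2_def)

lemma continuous_AE_eq_imp_eq:
  fixes g h :: "real \<Rightarrow> complex"
  assumes "continuous_on UNIV g" "continuous_on UNIV h" "AE x in lborel. g x = h x"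
  shows "g = h"
proof (rule ccontr)
  assume "g \<noteq> h"
  then obtain y where y: "g y \<noteq> h y" by auto
  have "open {x. g x \<noteq> h x}" using assms by (intro open_Collect_neq)
  then obtain e where e: "e > 0" "ball y e \<subseteq> {x. g x \<noteq> h x}" using y openE by blast
  have "AE x in lborel. x \<notin> {y - e <..< y + e}"
    using assms(3) by eventually_elim (use e(2) in \<open>auto simp: subset_eq dist_real_def\<close>)
  then have "{y - e <..< y + e} \<in> null_sets lborel" by (subst (asm) AE_iff_null_sets[symmetric]) auto
  then show False using e(1) by (simp add: null_sets_def)
qed

lemma feichtinger_synth:
  assumes f: "f \<in> feichtinger"
  shows "AE x in lborel. f x = synth (trf f) x" "continuous_on UNIV (synth (trf f))"
    "integrable lborel f" "has_cont_rep f" "cont_rep f = synth (trf f)"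
proof -
  have A: "integrable lborel (trf f)" and [measurable]: "f \<in> borel_measurable borel"
    using f by (auto simp: feichtinger_def L2_def)
  show 1: "AE x in lborel. f x = synth (trf f) x"
    using f by (intro synth_eq_of_transform_integrable) (auto simp: feichtinger_def)
  show 2: "continuous_on UNIV (synth (trf f))" by (rule synth_continuous[OF A])
  have m: "(\<lambda>(x, \<eta>). gabor \<eta> x) \<in> borel_measurable (lborel \<Otimes>\<^sub>M lborel)" by measurable
  have "integrable lborel (\<lambda>x. LINT \<eta>|lborel. trf f \<eta> * gabor \<eta> x)"
    by (rule superpose(1)[OF lborel.sigma_finite_measure_axioms lborel.sigma_finite_measure_axioms A m])
      (use gabor_integrable integral_norm_gabor in auto)
  then have i: "integrable lborel (synth (trf f))" by (simp add: synth_def[abs_def])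
  then show i': "integrable lborel f"
    by (rule iffD2[OF integrable_cong_AE, rotated -1]) (use 1 synth_measurable[OF A] in auto)
  show "has_cont_rep f" unfolding has_cont_rep_def using 1 2 by blast
  show "cont_rep f = synth (trf f)" unfolding cont_rep_def
  proof (rule the_equality)
    fix g assume g: "continuous_on UNIV g \<and> (AE x in lborel. f x = g x)"
    then have "AE x in lborel. g x = synth (trf f) x" using 1 by (auto elim: eventually_elim2)
    then show "g = synth (trf f)"
      using g 2 by (intro continuous_AE_eq_imp_eq) auto
  qed (use 1 2 in auto)
qed


text \<open>Gabor functions have absolute half-integer sums bounded uniformly in \<eta>, so the sum
  passes under the synthesis integral.\<close>

lemma feichtinger_half_int_sum:
  assumes f: "f \<in> feichtinger"
  shows "(\<lambda>n :: int. norm (synth (trf f) (real_of_int n + 1/2))) summable_on UNIV"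
    and "half_int_sum (synth (trf f)) = (LINT \<eta>|lborel. trf f \<eta> * half_int_sum (gabor \<eta>))"
    and "integrable lborel (\<lambda>\<eta>. trf f \<eta> * half_int_sum (gabor \<eta>))"
proof -
  have A: "integrable lborel (trf f)" using f by (auto simp: feichtinger_def)
  have n: "norm (of_real (alt n) * gabor \<eta> (real_of_int n + 1/2)) = norm (gabor \<eta> (real_of_int n + 1/2))" for n :: int and \<eta>
    by (simp add: norm_mult alt_simps)
  have m: "(\<lambda>\<eta>. of_real (alt n) * gabor \<eta> (real_of_int n + 1/2)) \<in> borel_measurable lborel" for n :: int
    by measurable
  note sp = superpose_sum[OF lborel.sigma_finite_measure_axioms A m, unfolded n, OF gabor_half_int_sum]
  have eq: "(LINT \<eta>|lborel. trf f \<eta> * (of_real (alt n) * gabor \<eta> (real_of_int n + 1/2))) = of_real (alt n) * synth (trf f) (real_of_int n + 1/2)" for n :: int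
  proof -
    have "(\<lambda>\<eta>. trf f \<eta> * (of_real (alt n) * gabor \<eta> (real_of_int n + 1/2))) = (\<lambda>\<eta>. of_real (alt n) * (trf f \<eta> * gabor \<eta> (real_of_int n + 1/2)))"
      by (simp add: mult_ac)
    then show ?thesis by (simp only: integral_mult_right_zero synth_def)
  qed
  show "(\<lambda>n :: int. norm (synth (trf f) (real_of_int n + 1/2))) summable_on UNIV"
    using sp(1) unfolding eq by (simp add: norm_mult alt_simps)
  show "half_int_sum (synth (trf f)) = (LINT \<eta>|lborel. trf f \<eta> * half_int_sum (gabor \<eta>))"
    using sp(2) unfolding eq by (simp add: half_int_sum_def)
  show "integrable lborel (\<lambda>\<eta>. trf f \<eta> * half_int_sum (gabor \<eta>))"
    using sp(3) by (simp add: half_int_sum_def)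
qed

lemma beta_gabor_measurable: "(\<lambda>\<eta>. beta l (gabor \<eta>)) \<in> borel_measurable borel"
proof -
  have "(\<lambda>\<eta>. LINT x|lborel. gabor \<eta> x * (of_real (dual_window (x - fst l)) * cis (- (2 * pi * snd l * x)))) \<in> borel_measurable lborel"
    by measurable
  then show ?thesis by (simp add: beta_def)
qed

lemma feichtinger_beta:
  assumes f: "f \<in> feichtinger"
  shows "beta l f = (LINT \<eta>|lborel. trf f \<eta> * beta l (gabor \<eta>))"
    and "integrable lborel (\<lambda>\<eta>. trf f \<eta> * beta l (gabor \<eta>))"
proof -
  have A: "integrable lborel (trf f)" using f by (auto simp: feichtinger_def)
  let ?k = "\<lambda>x. of_real (dual_window (x - fst l)) * cis (- (2 * pi * snd l * x))"
  have k: "integrable lborel (\<lambda>x. gabor \<eta> x * ?k x)" for \<eta>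
    using beta_kernel_integrable(1)[OF gabor_integrable, of \<eta> "fst l" "- (2 * pi * snd l)"] by simp
  have b: "(LINT x|lborel. norm (gabor \<eta> x * ?k x)) \<le> dual_window_bound * 2 powr (1/4)" for \<eta>
    using beta_kernel_integrable(2)[OF gabor_integrable, of \<eta> "fst l" "- (2 * pi * snd l)"] by (simp add: integral_norm_gabor)
  have m: "(\<lambda>(x, \<eta>). gabor \<eta> x * ?k x) \<in> borel_measurable (lborel \<Otimes>\<^sub>M lborel)"
    by measurable
  note sp = superpose(2)[OF lborel.sigma_finite_measure_axioms lborel.sigma_finite_measure_axioms A m k b]
  have eq: "(LINT \<eta>|lborel. trf f \<eta> * (gabor \<eta> x * ?k x)) = synth (trf f) x * ?k x" for x
  proof -
    have "(\<lambda>\<eta>. trf f \<eta> * (gabor \<eta> x * ?k x)) = (\<lambda>\<eta>. (trf f \<eta> * gabor \<eta> x) * ?k x)" by (simp only: mult.assoc)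
    then show ?thesis by (simp only: integral_mult_left_zero synth_def)
  qed
  have "beta l f = beta l (synth (trf f))"
    by (rule beta_cong_AE) (use feichtinger_synth(1)[OF f] feichtinger_measurable[OF f] synth_measurable[OF A] in auto)
  also have "\<dots> = (LINT \<eta>|lborel. trf f \<eta> * beta l (gabor \<eta>))"
    using sp unfolding eq unfolding beta_def .
  finally show "beta l f = (LINT \<eta>|lborel. trf f \<eta> * beta l (gabor \<eta>))" .
  show "integrable lborel (\<lambda>\<eta>. trf f \<eta> * beta l (gabor \<eta>))"
  proof (rule Bochner_Integration.integrable_bound[OF integrable_mult_right[OF A, of "of_real (dual_window_bound * 2 powr (1/4))"]])
    show "(\<lambda>\<eta>. trf f \<eta> * beta l (gabor \<eta>)) \<in> borel_measurable lborel"
      using beta_gabor_measurable[of l] A by (auto intro!: borel_measurable_times)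
    have "norm (trf f \<eta> * beta l (gabor \<eta>)) \<le> norm (of_real (dual_window_bound * 2 powr (1/4)) * trf f \<eta>)" for \<eta>
      using mult_left_mono[OF beta_gabor(2)[of l \<eta>], of "norm (trf f \<eta>)"] dual_window_bound_nonneg by (simp add: norm_mult mult_ac)
    then show "AE \<eta> in lborel. norm (trf f \<eta> * beta l (gabor \<eta>)) \<le> norm (of_real (dual_window_bound * 2 powr (1/4)) * trf f \<eta>)" by simp
  qed
qed

lemma alt_powi: "(- 1 :: complex) powi n = of_real (alt n)"
proof (cases "even n")
  case True
  then obtain k where "n = 2 * k" by blast
  then show ?thesis by (simp add: alt_def power_int_mult)
next
  case False
  then obtain k where "n = 2 * k + 1" using oddE by blast
  then show ?thesis by (simp add: alt_def power_int_add power_int_mult)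
qed

lemma gamma_sharp_eq:
  assumes "f \<in> feichtinger"
  shows "gamma_sharp f = 1 / (\<i> * Theta 0) * half_int_sum (synth (trf f))"
  unfolding gamma_sharp_def feichtinger_synth(5)[OF assms] half_int_sum_def alt_powi ..

lemma Theta_0_nonzero: "Theta 0 \<noteq> 0"
proof -
  define e where "e q = exp (- pi * (real_of_int q)\<^sup>2)" for q :: int
  have e: "exp (2 * of_real pi * \<i> * of_int q * 0 - of_real pi * (of_int q)\<^sup>2) = complex_of_real (e q)" for q :: int
    by (simp add: e_def exp_of_real[symmetric])
  have s: "e summable_on UNIV" using gauss_int_sum(1)[OF pi_ge_half, of 0] by (simp add: e_def[abs_def])
  have "infsum e {0} \<le> infsum e UNIV"
    by (rule infsum_mono_neutral) (use s in \<open>auto simp: e_def\<close>)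
  then have "infsum e UNIV > 0" by (simp add: e_def)
  moreover have "Theta 0 = of_real (2 powr (1/4) * infsum e UNIV)"
    unfolding Theta_def e using infsumI[OF has_sum_of_real_iff[THEN iffD2, OF has_sum_infsum[OF s]]] by simp
  ultimately show ?thesis by simp
qed

lemma feichtinger_linear:
  assumes "f \<in> feichtinger" "g \<in> feichtinger"
  shows "(\<lambda>x. a * f x + b * g x) \<in> feichtinger"
    and "trf (\<lambda>x. a * f x + b * g x) = (\<lambda>l. a * trf f l + b * trf g l)"
proof -
  have L: "f \<in> L2" "g \<in> L2" and V: "integrable lborel (trf f)" "integrable lborel (trf g)"
    using assms by (auto simp: feichtinger_def)
  show eq: "trf (\<lambda>x. a * f x + b * g x) = (\<lambda>l. a * trf f l + b * trf g l)"
  proof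
    fix l
    have "(\<lambda>x. (a * f x + b * g x) * cnj (gabor l x)) = (\<lambda>x. a * (f x * cnj (gabor l x)) + b * (g x * cnj (gabor l x)))"
      by (auto simp: algebra_simps)
    then show "trf (\<lambda>x. a * f x + b * g x) l = a * trf f l + b * trf g l"
      unfolding L2_inner_def by (simp only:) (use L2_times_gabor_integrable(1) L in simp)
  qed
  have [measurable]: "f \<in> borel_measurable borel" "g \<in> borel_measurable borel"
    and i: "integrable lborel (\<lambda>x. (norm (f x))\<^sup>2)" "integrable lborel (\<lambda>x. (norm (g x))\<^sup>2)"
    using L by (auto simp: L2_def)
  have le: "(norm (a * f x + b * g x))\<^sup>2 \<le> 2 * (norm a)\<^sup>2 * (norm (f x))\<^sup>2 + 2 * (norm b)\<^sup>2 * (norm (g x))\<^sup>2" for x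
  proof -
    have "(norm (a * f x + b * g x))\<^sup>2 \<le> (norm a * norm (f x) + norm b * norm (g x))\<^sup>2"
      by (intro power_mono order_trans[OF norm_triangle_ineq]) (auto simp: norm_mult)
    also have "\<dots> \<le> 2 * (norm a * norm (f x))\<^sup>2 + 2 * (norm b * norm (g x))\<^sup>2"
      using sum_squares_bound[of "norm a * norm (f x)" "norm b * norm (g x)"] by (simp add: power2_sum)
    finally show ?thesis by (simp add: power_mult_distrib)
  qed
  have "integrable lborel (\<lambda>x. 2 * (norm a)\<^sup>2 * (norm (f x))\<^sup>2 + 2 * (norm b)\<^sup>2 * (norm (g x))\<^sup>2)"
    using i by (intro Bochner_Integration.integrable_add integrable_mult_right)
  then have "integrable lborel (\<lambda>x. (norm (a * f x + b * g x))\<^sup>2)"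
    by (rule Bochner_Integration.integrable_bound) (use le in \<open>auto intro!: AE_I2 order_trans[OF _ abs_ge_self]\<close>)
  then show "(\<lambda>x. a * f x + b * g x) \<in> feichtinger"
    using V unfolding feichtinger_def mem_Collect_eq eq by (auto simp: L2_def)
qed

lemma trf_cong_AE:
  assumes "AE x in lborel. f x = g x" "f \<in> borel_measurable borel" "g \<in> borel_measurable borel"
  shows "trf f = trf g"
proof
  fix l
  note [measurable] = assms(2,3)
  show "trf f l = trf g l" unfolding L2_inner_def
  proof (rule integral_cong_AE)
    show "AE x in lborel. f x * cnj (gabor l x) = g x * cnj (gabor l x)"
      using assms(1) by eventually_elim simp
  qed auto
qed

lemma L2_cong_AE:
  assumes "f \<in> L2" "AE x in lborel. f x = g x" "g \<in> borel_measurable borel"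
  shows "g \<in> L2" "L2_norm g = L2_norm f"
proof -
  have [measurable]: "f \<in> borel_measurable borel" "g \<in> borel_measurable borel" using assms by (auto simp: L2_def)
  have ae: "AE x in lborel. (norm (f x))\<^sup>2 = (norm (g x))\<^sup>2" using assms(2) by eventually_elim simp
  show "g \<in> L2"
    using assms iffD1[OF integrable_cong_AE[OF _ _ ae]] by (auto simp: L2_def)
  show "L2_norm g = L2_norm f" unfolding L2_norm_def
    by (rule arg_cong[where f = sqrt], rule integral_cong_AE) (use ae in auto)
qed

lemma gabor_feichtinger: "gabor l \<in> feichtinger"
  by (simp add: feichtinger_def gabor_in_L2 integrable_L2_inner_gabor_gabor)

section \<open>Square summability of the lattice coefficients\<close>

lemma summable_on_product:
  fixes f g :: "'a \<Rightarrow> real"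
  assumes "f summable_on UNIV" "g summable_on UNIV" "\<And>x. f x \<ge> 0" "\<And>x. g x \<ge> 0"
  shows "(\<lambda>l. f (fst l) * g (snd l)) summable_on UNIV"
    and "(\<Sum>\<^sub>\<infinity>l. f (fst l) * g (snd l)) = infsum f UNIV * infsum g UNIV"
proof -
  have 1: "((\<lambda>y. f (fst (x, y)) * g (snd (x, y))) has_sum (f x * infsum g UNIV)) UNIV" for x
    using has_sum_cmult_right[OF has_sum_infsum[OF assms(2)], of "f x"] by simp
  have 2: "((\<lambda>x. f x * infsum g UNIV) has_sum (infsum f UNIV * infsum g UNIV)) UNIV"
    using has_sum_cmult_left[OF has_sum_infsum[OF assms(1)]] .
  have s: "(\<lambda>l. f (fst l) * g (snd l)) summable_on (Sigma UNIV (\<lambda>_. UNIV))"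
    by (rule summable_on_SigmaI[OF 1]) (use 2 assms in \<open>auto simp: summable_on_def\<close>)
  then show "(\<lambda>l. f (fst l) * g (snd l)) summable_on UNIV" by simp
  show "(\<Sum>\<^sub>\<infinity>l. f (fst l) * g (snd l)) = infsum f UNIV * infsum g UNIV"
    using infsumI[OF has_sum_SigmaI[OF 1 2 s]] by simp
qed

text \<open>Indexing the lattice by a countable type lets lattice sums run over the whole type, the
  form required by \<open>superpose_sum\<close>.\<close>

definition lat :: "int \<times> int \<Rightarrow> real \<times> real" where
  "lat z = (real_of_int (fst z), real_of_int (snd z))"

lemma inj_lat: "inj lat"
  by (auto simp: inj_on_def lat_def prod_eq_iff)

lemma Lambda_eq: "Lambda = range lat"
  unfolding Lambda_def lat_def by (auto simp: image_iff elim!: Ints_cases)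

lemma H_norm_sq: "(H_norm \<delta> f)\<^sup>2 = (LINT l|lborel. (norm l powr \<delta> + 1) * (cmod (L2_inner f (gabor l)))\<^sup>2)"
  unfolding H_norm_def by (intro real_sqrt_pow2 Bochner_Integration.integral_nonneg) auto

lemma H_norm_nonneg: "H_norm \<delta> f \<ge> 0"
  unfolding H_norm_def by (auto intro!: Bochner_Integration.integral_nonneg)

text \<open>Cauchy-Schwarz with the weight (1 + norm \<eta>) powr \<delta> divided between the two
  factors. The constant 2 powr \<delta> comes from comparing this weight with norm \<eta> powr
  \<delta> + 1.\<close>

lemma H_space_pairing:
  assumes f: "f \<in> H_space \<delta>" and d: "\<delta> > 0" and k[measurable]: "k \<in> borel_measurable borel"
    and ki: "integrable lborel (\<lambda>\<eta>. (norm (k \<eta>))\<^sup>2 * (1 + norm \<eta>) powr (- \<delta>))"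
  shows "integrable lborel (\<lambda>\<eta>. trf f \<eta> * k \<eta>)"
    and "(norm (LINT \<eta>|lborel. trf f \<eta> * k \<eta>))\<^sup>2 \<le>
      (LINT \<eta>|lborel. (norm (k \<eta>))\<^sup>2 * (1 + norm \<eta>) powr (- \<delta>)) * (2 powr \<delta> * (H_norm \<delta> f)\<^sup>2)"
proof -
  have L2: "f \<in> L2" and w: "integrable lborel (\<lambda>l. (norm l powr \<delta> + 1) * (cmod (trf f l))\<^sup>2)"
    using f by (auto simp: H_space_def)
  have [measurable]: "trf f \<in> borel_measurable borel" by (rule L2_inner_gabor_measurable[OF L2])
  define u v where "u \<eta> = norm (trf f \<eta>) * (1 + norm \<eta>) powr (\<delta>/2)" and "v \<eta> = norm (k \<eta>) * (1 + norm \<eta>) powr (- (\<delta>/2))" for \<eta>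
  have [measurable]: "u \<in> borel_measurable borel" "v \<in> borel_measurable borel"
    unfolding u_def v_def by measurable
  have pw: "((1 + norm \<eta>) powr (a/2))\<^sup>2 = (1 + norm \<eta>) powr a" for a and \<eta> :: "real \<times> real"
    by (simp add: power2_eq_square flip: powr_add)
  have u2: "(u \<eta>)\<^sup>2 \<le> 2 powr \<delta> * ((norm \<eta> powr \<delta> + 1) * (cmod (trf f \<eta>))\<^sup>2)" for \<eta>
    using mult_left_mono[OF weight_lower_bound[OF d, of \<eta>], of "(cmod (trf f \<eta>))\<^sup>2"]
    unfolding u_def power_mult_distrib pw by (simp add: mult_ac)
  have v2: "(v \<eta>)\<^sup>2 = (norm (k \<eta>))\<^sup>2 * (1 + norm \<eta>) powr (- \<delta>)" for \<eta>
    unfolding v_def power_mult_distrib using pw[of \<eta> "- \<delta>"] by simp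
  have ui: "integrable lborel (\<lambda>\<eta>. (u \<eta>)\<^sup>2)"
    by (rule Bochner_Integration.integrable_bound[OF integrable_mult_right[OF w, of "2 powr \<delta>"]])
      (use u2 in \<open>auto intro!: AE_I2 order_trans[OF _ abs_ge_self]\<close>)
  have vi: "integrable lborel (\<lambda>\<eta>. (v \<eta>)\<^sup>2)" using ki by (simp add: v2)
  have uv: "u \<eta> * v \<eta> = norm (trf f \<eta> * k \<eta>)" for \<eta>
  proof -
    have "(1 + norm \<eta>) powr (\<delta>/2) * (1 + norm \<eta>) powr (- (\<delta>/2)) = 1"
    proof -
      have "1 + norm \<eta> \<noteq> 0" using norm_ge_zero[of \<eta>] by linarith
      then show ?thesis by (simp flip: powr_add)
    qed
    then have "norm (trf f \<eta>) * norm (k \<eta>) * ((1 + norm \<eta>) powr (\<delta>/2) * (1 + norm \<eta>) powr (- (\<delta>/2))) = norm (trf f \<eta> * k \<eta>)"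
      by (simp add: norm_mult)
    then show ?thesis unfolding u_def v_def by (simp only: mult_ac)
  qed
  note cs = integral_Cauchy_Schwarz[OF _ _ ui vi, unfolded uv]
  have "integrable lborel (\<lambda>\<eta>. norm (trf f \<eta> * k \<eta>))" by (rule cs(1)) auto
  then show i: "integrable lborel (\<lambda>\<eta>. trf f \<eta> * k \<eta>)"
    by (subst (asm) integrable_norm_iff) auto
  have "(norm (LINT \<eta>|lborel. trf f \<eta> * k \<eta>))\<^sup>2 \<le> (LINT \<eta>|lborel. \<bar>norm (trf f \<eta> * k \<eta>)\<bar>)\<^sup>2"
    by (intro power_mono) (auto intro: order_trans[OF integral_norm_bound])
  also have "\<dots> \<le> (LINT \<eta>|lborel. (u \<eta>)\<^sup>2) * (LINT \<eta>|lborel. (v \<eta>)\<^sup>2)" by (rule cs(2)) auto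
  also have "\<dots> \<le> (2 powr \<delta> * (H_norm \<delta> f)\<^sup>2) * (LINT \<eta>|lborel. (v \<eta>)\<^sup>2)"
  proof (rule mult_right_mono)
    have "(LINT \<eta>|lborel. (u \<eta>)\<^sup>2) \<le> (LINT \<eta>|lborel. 2 powr \<delta> * ((norm \<eta> powr \<delta> + 1) * (cmod (trf f \<eta>))\<^sup>2))"
      by (rule integral_mono[OF ui _ u2]) (use w in auto)
    then show "(LINT \<eta>|lborel. (u \<eta>)\<^sup>2) \<le> 2 powr \<delta> * (H_norm \<delta> f)\<^sup>2" by (simp add: H_norm_sq)
  qed auto
  finally show "(norm (LINT \<eta>|lborel. trf f \<eta> * k \<eta>))\<^sup>2 \<le>
      (LINT \<eta>|lborel. (norm (k \<eta>))\<^sup>2 * (1 + norm \<eta>) powr (- \<delta>)) * (2 powr \<delta> * (H_norm \<delta> f)\<^sup>2)"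
    by (simp add: v2 mult.commute)
qed

text \<open>The pairing with the constant kernel 1, whose weighted norm is finite because \<delta> >
  2.\<close>

lemma H_space_feichtinger:
  assumes "f \<in> H_space \<delta>" "\<delta> > 2"
  shows "f \<in> feichtinger"
  using H_space_pairing(1)[OF assms(1), of "\<lambda>_. 1"] assms integrable_phase_plane_decay[of \<delta>]
  by (auto simp: feichtinger_def H_space_def)

lemma trf_gabor_nonzero: "trf (gabor a) b \<noteq> 0"
  using norm_L2_inner_gabor_gabor[of a b] by auto

text \<open>The product with the transform of one fixed Gabor function is integrable, hence
  measurable, and that transform has no zeros, so it can be divided out.\<close>

lemma half_int_sum_gabor_measurable: "(\<lambda>\<eta>. half_int_sum (gabor \<eta>)) \<in> borel_measurable borel"
proof -
  let ?A = "trf (gabor 0)"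
  have [measurable]: "(\<lambda>\<eta>. ?A \<eta> * half_int_sum (gabor \<eta>)) \<in> borel_measurable borel" "?A \<in> borel_measurable borel"
    using feichtinger_half_int_sum(3)[OF gabor_feichtinger[of 0]] integrable_L2_inner_gabor_gabor[of 0] by auto
  have "(\<lambda>\<eta>. half_int_sum (gabor \<eta>)) = (\<lambda>\<eta>. ?A \<eta> * half_int_sum (gabor \<eta>) / ?A \<eta>)"
    using trf_gabor_nonzero by auto
  also have "\<dots> \<in> borel_measurable borel" by measurable
  finally show ?thesis .
qed

lemma half_int_sum_H_bound:
  assumes "\<delta> > 2"
  shows "\<exists>C\<ge>0. \<forall>f\<in>H_space \<delta>. (norm (half_int_sum (synth (trf f))))\<^sup>2 \<le> C * (H_norm \<delta> f)\<^sup>2"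
proof -
  define G where "G = 2 powr (1/4) * gauss_sum_bound"
  let ?k = "\<lambda>\<eta>. half_int_sum (gabor \<eta>)"
  have le: "(norm (?k \<eta>))\<^sup>2 * (1 + norm \<eta>) powr (- \<delta>) \<le> G\<^sup>2 * (1 + norm \<eta>) powr (- \<delta>)" for \<eta>
    by (intro mult_right_mono power_mono) (auto simp: G_def half_int_sum_gabor_bound)
  have i: "integrable lborel (\<lambda>\<eta>. (norm (?k \<eta>))\<^sup>2 * (1 + norm \<eta>) powr (- \<delta>))"
    by (rule Bochner_Integration.integrable_bound[OF integrable_mult_right[OF integrable_phase_plane_decay[OF assms], of "G\<^sup>2"]])
      (use le half_int_sum_gabor_measurable in \<open>auto intro!: AE_I2 order_trans[OF le abs_ge_self]\<close>)
  define C where "C = (LINT \<eta>|lborel. (norm (?k \<eta>))\<^sup>2 * (1 + norm \<eta>) powr (- \<delta>)) * 2 powr \<delta>"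
  show ?thesis
  proof (intro exI[of _ C] conjI ballI)
    show "C \<ge> 0" unfolding C_def by (auto intro!: mult_nonneg_nonneg Bochner_Integration.integral_nonneg)
    fix f assume f: "f \<in> H_space \<delta>"
    show "(norm (half_int_sum (synth (trf f))))\<^sup>2 \<le> C * (H_norm \<delta> f)\<^sup>2"
      unfolding feichtinger_half_int_sum(2)[OF H_space_feichtinger[OF f assms]] C_def
      using H_space_pairing(2)[OF f _ half_int_sum_gabor_measurable i] assms by (simp add: mult.assoc)
  qed
qed

text \<open>By \<open>beta_gabor\<close> the coefficient is \<open>kappa * alt (p + q) * half_int_sum (gabor \<eta>) / (\<eta> - l)\<close>. Subtracting its value with \<open>\<eta> - l\<close> replaced
  by \<open>sharp_pt - l\<close>, which is harmless when the half-integer sum of the function vanishes, gains a factor of order \<open>1 / l\<close>.\<close>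

lemma beta_gabor_difference_bound:
  fixes z :: "int \<times> int"
  defines "b \<equiv> of_real (kappa * alt (fst z + snd z)) / (cpoint sharp_pt - cpoint (lat z))"
  shows "norm (beta (lat z) (gabor \<eta>) - b * half_int_sum (gabor \<eta>)) \<le>
    (4 * (dual_window_bound * 2 powr (1/4)) + 10 * (\<bar>kappa\<bar> * (2 powr (1/4) * gauss_sum_bound))) *
      ((1 + norm \<eta>) / ((1 + norm (lat z)) * (1 + norm (lat z - \<eta>))))"
proof -
  define l \<mu> B K where "l = lat z" and "\<mu> = sharp_pt" and "B = dual_window_bound * 2 powr (1/4)" and "K = \<bar>kappa\<bar> * (2 powr (1/4) * gauss_sum_bound)"
  have BK: "B \<ge> 0" "K \<ge> 0" using dual_window_bound_nonneg gauss_sum_bound_nonneg by (auto simp: B_def K_def)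
  define X where "X = of_real (kappa * alt (fst z + snd z)) * half_int_sum (gabor \<eta>)"
  have X: "norm X \<le> K"
    unfolding X_def K_def norm_mult norm_of_real abs_mult alt_simps(6) using mult_left_mono[OF half_int_sum_gabor_bound, of "\<bar>kappa\<bar>"] by simp
  have nd: "norm (cpoint u - cpoint v) = norm (u - v)" for u v :: "real \<times> real"
    using norm_cpoint[of "u - v"] by (simp add: minus_complex.code)
  have half: "1/2 \<le> norm (\<mu> - l)"
  proof -
    have "\<bar>1/2 - real_of_int (fst z)\<bar> \<ge> 1/2"
    proof (cases "fst z \<ge> 1")
      case True
      then have "real_of_int (fst z) \<ge> 1" by simp
      then show ?thesis by simp
    next
      case False
      then have "real_of_int (fst z) \<le> 0" by simp
      then show ?thesis by simp
    qed
    also have "\<dots> \<le> norm (\<mu> - l)"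
      using norm_fst_le[of "fst (\<mu> - l)" "snd (\<mu> - l)"] by (simp add: \<mu>_def sharp_pt_def l_def lat_def)
    finally show ?thesis .
  qed
  have n\<mu>: "norm \<mu> \<le> 1"
    by (simp add: \<mu>_def sharp_pt_def norm_prod_def power2_eq_square)
  \<comment> \<open>With norm \<mu> \<le> 1 and norm (\<mu> - l) \<ge> 1/2 the left side is at most
    2 + norm (\<mu> - l), and 2 \<le> 4 norm (\<mu> - l).\<close>
  have far: "1 + norm l \<le> 5 * norm (\<mu> - l)"
  proof -
    have "norm l \<le> norm (\<mu> - l) + norm \<mu>" using norm_triangle_ineq4[of \<mu> "\<mu> - l"] by simp
    then show ?thesis using n\<mu> half by argo
  qed
  have bG: "b * half_int_sum (gabor \<eta>) = X / (cpoint \<mu> - cpoint l)" by (simp add: b_def X_def \<mu>_def l_def)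
  have rel: "(cpoint \<eta> - cpoint l) * beta l (gabor \<eta>) = X"
    using beta_gabor(1)[of \<eta> "fst z" "snd z"] by (simp add: X_def l_def lat_def)
  define R where "R = (1 + norm \<eta>) / ((1 + norm l) * (1 + norm (l - \<eta>)))"
  have R: "R \<ge> 0" unfolding R_def by (intro divide_nonneg_nonneg mult_nonneg_nonneg add_nonneg_nonneg) auto
  have p: "1 + norm l > 0" "1 + norm (l - \<eta>) > 0" by (auto intro: add_pos_nonneg)
  \<comment> \<open>For norm (l - \<eta>) \<ge> 1 the relation \<open>rel\<close> is divided by
    \<eta> - l, and the factors 2 and 5 are lost in adjusting the denominators. For smaller
    distances the two terms are bounded separately, which suffices because R \<ge> 1/4
    there.\<close>
  have "norm (beta l (gabor \<eta>) - b * half_int_sum (gabor \<eta>)) \<le> (4 * B + 10 * K) * R"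
  proof (cases "norm (l - \<eta>) \<ge> 1")
    case True
    then have ne: "cpoint \<eta> - cpoint l \<noteq> 0" "cpoint \<mu> - cpoint l \<noteq> 0"
      using nd[of \<eta> l] nd[of \<mu> l] half by (auto simp: norm_minus_commute)
    have be: "beta l (gabor \<eta>) = X / (cpoint \<eta> - cpoint l)" using rel ne by (simp add: field_simps)
    have "beta l (gabor \<eta>) - b * half_int_sum (gabor \<eta>) = X * (cpoint \<mu> - cpoint \<eta>) / ((cpoint \<eta> - cpoint l) * (cpoint \<mu> - cpoint l))"
    proof -
      have "X / a - X / b = X * (b - a) / (a * b)" if "a \<noteq> 0" "b \<noteq> 0" for a b :: complex
        using that by (simp add: field_simps)
      from this[OF ne] show ?thesis unfolding be bG by simp
    qed
    then have "norm (beta l (gabor \<eta>) - b * half_int_sum (gabor \<eta>)) = norm X * norm (\<mu> - \<eta>) / (norm (\<eta> - l) * norm (\<mu> - l))"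
      by (simp add: norm_mult norm_divide nd)
    also have "\<dots> \<le> K * (1 + norm \<eta>) / (((1 + norm (l - \<eta>)) / 2) * ((1 + norm l) / 5))"
    proof (intro frac_le mult_mono X)
      show "norm (\<mu> - \<eta>) \<le> 1 + norm \<eta>" using norm_triangle_ineq4[of \<mu> \<eta>] n\<mu> by linarith
      show "(1 + norm (l - \<eta>)) / 2 \<le> norm (\<eta> - l)" using True by (simp add: norm_minus_commute)
      show "(1 + norm l) / 5 \<le> norm (\<mu> - l)" using far by simp
    qed (use BK p in auto)
    also have "\<dots> = 10 * K * R" by (simp add: R_def mult_ac)
    also have "\<dots> \<le> (4 * B + 10 * K) * R" using BK R by (intro mult_right_mono) auto
    finally show ?thesis .
  next
    case False
    have "norm (beta l (gabor \<eta>) - b * half_int_sum (gabor \<eta>)) \<le> B + K / (1/2)"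
    proof (rule order_trans[OF norm_triangle_ineq4 add_mono])
      show "norm (beta l (gabor \<eta>)) \<le> B" unfolding B_def by (rule beta_gabor(2))
      show "norm (b * half_int_sum (gabor \<eta>)) \<le> K / (1/2)"
        unfolding bG norm_divide nd using half by (intro frac_le X BK) auto
    qed
    also have "\<dots> \<le> (4 * B + 8 * K) * (1/4)" by simp
    also have "\<dots> \<le> (4 * B + 8 * K) * R"
    proof (rule mult_left_mono)
      have "norm l \<le> norm (l - \<eta>) + norm \<eta>" using norm_triangle_sub[of l \<eta>] by (simp add: add.commute)
      then have "1 + norm l \<le> 2 * (1 + norm \<eta>)" using False norm_ge_zero[of \<eta>] by argo
      then have "(1 + norm l) * (1 + norm (l - \<eta>)) \<le> (2 * (1 + norm \<eta>)) * 2"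
        using False p by (intro mult_mono) auto
      then show "1/4 \<le> R" unfolding R_def using p by (simp add: le_divide_eq)
    qed (use BK in auto)
    also have "\<dots> \<le> (4 * B + 10 * K) * R" using BK R by (intro mult_right_mono) auto
    finally show ?thesis .
  qed
  then show ?thesis by (simp add: l_def B_def K_def R_def)
qed

text \<open>The larger of x and y is replaced by the smaller one, which can only increase a negative
  power.\<close>

lemma powr_mult_le_sum:
  fixes x y s t :: real
  assumes "x > 0" "y > 0" "s \<ge> 0" "t \<ge> 0"
  shows "x powr (- s) * y powr (- t) \<le> x powr (- (s + t)) + y powr (- (s + t))"
proof (cases "x \<le> y")
  case True
  then have "x powr (- s) * y powr (- t) \<le> x powr (- s) * x powr (- t)"
    using assms by (intro mult_left_mono powr_mono2') auto
  also have "\<dots> = x powr (- (s + t))" by (simp flip: powr_add)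
  finally show ?thesis by (simp add: add_increasing2)
next
  case False
  then have "x powr (- s) * y powr (- t) \<le> y powr (- s) * y powr (- t)"
    using assms by (intro mult_right_mono powr_mono2') auto
  also have "\<dots> = y powr (- (s + t))" by (simp flip: powr_add)
  finally show ?thesis by (simp add: add_increasing)
qed

lemma integral_shifted_decay:
  fixes l :: "real \<times> real"
  assumes "a > 2"
  shows "integrable lborel (\<lambda>\<eta> :: real \<times> real. (1 + norm (l - \<eta>)) powr (- a))"
    and "(LINT \<eta>|lborel. (1 + norm (l - \<eta>)) powr (- a)) = (LINT \<eta> :: real \<times> real|lborel. (1 + norm \<eta>) powr (- a))"
proof -
  define g where "g \<eta> = (1 + norm \<eta>) powr (- a)" for \<eta> :: "real \<times> real"
  have [measurable]: "g \<in> borel_measurable borel" unfolding g_def by measurable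
  have d: "distr lborel borel (\<lambda>\<eta>. (- l) + \<eta>) = lborel" for l :: "real \<times> real" by (rule lborel_distr_plus)
  have eq: "(1 + norm (l - \<eta>)) powr (- a) = g ((- l) + \<eta>)" for \<eta>
    by (simp add: g_def norm_minus_commute[of l])
  have "integrable (distr lborel borel (\<lambda>\<eta>. (- l) + \<eta>)) g"
    unfolding d unfolding g_def by (rule integrable_phase_plane_decay[OF assms])
  then show "integrable lborel (\<lambda>\<eta> :: real \<times> real. (1 + norm (l - \<eta>)) powr (- a))"
    unfolding eq by (subst (asm) integrable_distr_eq) auto
  have "(LINT \<eta>|lborel. g ((- l) + \<eta>)) = integral\<^sup>L (distr lborel borel (\<lambda>\<eta>. (- l) + \<eta>)) g"
    by (rule integral_distr[symmetric]) auto
  then show "(LINT \<eta>|lborel. (1 + norm (l - \<eta>)) powr (- a)) = (LINT \<eta> :: real \<times> real|lborel. (1 + norm \<eta>) powr (- a))"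
    unfolding eq d by (simp only: g_def[abs_def])
qed

text \<open>The rows have to decay in l slightly faster than the power -2, the borderline of
  summability over a planar lattice. The additional decay is bought with the surplus \<delta> - 2
  through the submultiplicativity 1 + norm l \<le> (1 + norm \<eta>) (1 + norm (l -
  \<eta>)).\<close>

lemma kernel_row_bound:
  assumes "\<delta> > 2"
  obtains e J where "e > 0" "J \<ge> 0"
    "\<And>l :: real \<times> real. integrable lborel (\<lambda>\<eta>. ((1 + norm \<eta>) / ((1 + norm l) * (1 + norm (l - \<eta>))))\<^sup>2 * (1 + norm \<eta>) powr (- \<delta>))"
    "\<And>l :: real \<times> real. (LINT \<eta>|lborel. ((1 + norm \<eta>) / ((1 + norm l) * (1 + norm (l - \<eta>))))\<^sup>2 * (1 + norm \<eta>) powr (- \<delta>)) \<le> J * (1 + norm l) powr (- (2 + e))"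
proof -
  \<comment> \<open>The surplus is used in three equal shares. One is exchanged for decay in l,
    which lowers the exponent of 1 + norm (l - \<eta>) to 2 - e; the other two remain on 1 + norm
    \<eta>, so that the two exponents add up to 2 + e > 2.\<close>
  define e where "e = min 1 ((\<delta> - 2) / 3)"
  have e: "e > 0" "e \<le> 1" "3 * e \<le> \<delta> - 2"
    using assms min.cobounded2[of 1 "(\<delta> - 2) / 3"] unfolding e_def by (simp, simp, argo)
  define J where "J = 2 * (LINT \<eta> :: real \<times> real|lborel. (1 + norm \<eta>) powr (- (2 + e)))"
  define g where "g l \<eta> = ((1 + norm \<eta>) / ((1 + norm l) * (1 + norm (l - \<eta>))))\<^sup>2 * (1 + norm \<eta>) powr (- \<delta>)" for l \<eta> :: "real \<times> real"
  define h where "h l \<eta> = (1 + norm l) powr (- (2 + e)) * ((1 + norm (l - \<eta>)) powr (- (2 + e)) + (1 + norm \<eta>) powr (- (2 + e)))" for l \<eta> :: "real \<times> real"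
  have gh: "g l \<eta> \<le> h l \<eta>" for l \<eta>
  proof -
    define x y z where "x = 1 + norm \<eta>" and "y = 1 + norm l" and "z = 1 + norm (l - \<eta>)"
    have p: "x \<ge> 1" "y \<ge> 1" "z \<ge> 1" by (auto simp: x_def y_def z_def)
    have "y \<le> x * z"
    proof -
      have "norm l \<le> norm (l - \<eta>) + norm \<eta>" using norm_triangle_sub[of l \<eta>] by (simp add: add.commute)
      moreover have "0 \<le> norm \<eta> * norm (l - \<eta>)" by simp
      moreover have "x * z = 1 + norm \<eta> + norm (l - \<eta>) + norm \<eta> * norm (l - \<eta>)"
        by (simp add: x_def z_def algebra_simps)
      ultimately show ?thesis unfolding y_def by linarith
    qed
    have "g l \<eta> = x powr 2 * y powr (- 2) * z powr (- 2) * x powr (- \<delta>)"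
      using p by (simp add: g_def x_def[symmetric] y_def[symmetric] z_def[symmetric] power_divide power_mult_distrib powr_minus field_simps)
    also have "\<dots> = y powr (- 2) * z powr (- 2) * x powr (2 - \<delta>)"
      by (simp add: mult_ac flip: powr_add)
    also have "\<dots> \<le> y powr (- 2) * z powr (- 2) * x powr (- (3 * e))"
      using p e by (intro mult_left_mono powr_mono) auto
    also have "x powr (- (3 * e)) = x powr (- e) * x powr (- (2 * e))" by (simp flip: powr_add)
    also have "y powr (- 2) * z powr (- 2) * (x powr (- e) * x powr (- (2 * e))) \<le> y powr (- 2) * z powr (- 2) * ((y powr (- e) * z powr e) * x powr (- (2 * e)))"
    proof (intro mult_left_mono mult_right_mono)
      have "(x * z) powr (- e) \<le> y powr (- e)" using p e \<open>y \<le> x * z\<close> by (intro powr_mono2') auto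
      then have "(x * z) powr (- e) * z powr e \<le> y powr (- e) * z powr e" by (intro mult_right_mono) auto
      moreover have "(x * z) powr (- e) * z powr e = x powr (- e)"
        using p by (simp add: powr_mult mult.assoc flip: powr_add)
      ultimately show "x powr (- e) \<le> y powr (- e) * z powr e" by simp
    qed (use p in auto)
    also have "\<dots> = (y powr (- 2) * y powr (- e)) * ((z powr (- 2) * z powr e) * x powr (- (2 * e)))" by (simp only: mult_ac)
    also have "\<dots> = y powr (- (2 + e)) * (z powr (- (2 - e)) * x powr (- (2 * e)))" by (simp flip: powr_add)
    also have "\<dots> \<le> y powr (- (2 + e)) * (z powr (- (2 - e + 2 * e)) + x powr (- (2 - e + 2 * e)))"
      using p e by (intro mult_left_mono powr_mult_le_sum) auto
    also have "\<dots> = h l \<eta>"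
    proof -
      have "2 - e + 2 * e = 2 + e" by simp
      then show ?thesis by (simp only: h_def x_def y_def z_def)
    qed
    finally show ?thesis .
  qed
  have hi: "integrable lborel (h l)" for l
    unfolding h_def using e by (intro integrable_mult_right Bochner_Integration.integrable_add integral_shifted_decay integrable_phase_plane_decay) auto
  have hv: "integral\<^sup>L lborel (h l) = J * (1 + norm l) powr (- (2 + e))" for l
    unfolding h_def using e integral_shifted_decay[of "2 + e" l] integrable_phase_plane_decay[of "2 + e"]
    by (simp add: J_def)
  have [measurable]: "g l \<in> borel_measurable borel" for l unfolding g_def by measurable
  have g0: "\<bar>g l \<eta>\<bar> = g l \<eta>" for l \<eta> by (simp add: g_def)
  have gi: "integrable lborel (g l)" for l
    by (rule Bochner_Integration.integrable_bound[OF hi[of l]]) (use gh g0 in \<open>auto intro!: AE_I2 order_trans[OF gh abs_ge_self]\<close>)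
  show ?thesis
  proof (rule that[of e J])
    show "J \<ge> 0" by (auto simp: J_def intro!: Bochner_Integration.integral_nonneg)
    show "integrable lborel (\<lambda>\<eta>. ((1 + norm \<eta>) / ((1 + norm l) * (1 + norm (l - \<eta>))))\<^sup>2 * (1 + norm \<eta>) powr (- \<delta>))" for l :: "real \<times> real"
      using gi[of l] by (simp add: g_def[abs_def])
    show "(LINT \<eta>|lborel. ((1 + norm \<eta>) / ((1 + norm l) * (1 + norm (l - \<eta>))))\<^sup>2 * (1 + norm \<eta>) powr (- \<delta>)) \<le> J * (1 + norm l) powr (- (2 + e))" for l :: "real \<times> real"
      using integral_mono[OF gi hi gh, of l] unfolding hv by (simp add: g_def[abs_def])
  qed (use e in auto)
qed

lemma lat_decay_summable:
  assumes "e > 0"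
  shows "(\<lambda>z. (1 + norm (lat z)) powr (- (2 + e))) summable_on UNIV"
proof -
  have s: "(\<lambda>z :: int \<times> int. (1 + \<bar>real_of_int (fst z)\<bar>) powr (- (1 + e/2)) * (1 + \<bar>real_of_int (snd z)\<bar>) powr (- (1 + e/2))) summable_on UNIV"
    using assms by (intro summable_on_product summable_on_int_powr) auto
  show ?thesis
  proof (rule summable_on_comparison_test[OF s])
    fix z :: "int \<times> int"
    have n: "\<bar>real_of_int (fst z)\<bar> \<le> norm (lat z)" "\<bar>real_of_int (snd z)\<bar> \<le> norm (lat z)"
      using norm_fst_le[of "fst (lat z)" "snd (lat z)"] norm_snd_le[of "snd (lat z)" "fst (lat z)"] by (auto simp: lat_def)
    have "(1 + norm (lat z)) powr (- (2 + e)) = (1 + norm (lat z)) powr (- (1 + e/2)) * (1 + norm (lat z)) powr (- (1 + e/2))"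
      by (simp flip: powr_add)
    also have "\<dots> \<le> (1 + \<bar>real_of_int (fst z)\<bar>) powr (- (1 + e/2)) * (1 + \<bar>real_of_int (snd z)\<bar>) powr (- (1 + e/2))"
      using n assms by (intro mult_mono powr_mono2') auto
    finally show "(1 + norm (lat z)) powr (- (2 + e)) \<le> (1 + \<bar>real_of_int (fst z)\<bar>) powr (- (1 + e/2)) * (1 + \<bar>real_of_int (snd z)\<bar>) powr (- (1 + e/2))" .
  qed auto
qed

text \<open>Cauchy-Schwarz in each row of the corrected kernel; the squared row norms decay like (1
  + norm l) powr (- (2 + e)) and are thus summable over the lattice.\<close>

lemma beta_square_summable:
  assumes "\<delta> > 2"
  shows "\<exists>C\<ge>0. \<forall>f\<in>H_space \<delta>. half_int_sum (synth (trf f)) = 0 \<longrightarrow>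
    (\<lambda>z. (norm (beta (lat z) f))\<^sup>2) summable_on UNIV \<and>
    (\<Sum>\<^sub>\<infinity>z. (norm (beta (lat z) f))\<^sup>2) \<le> C * (H_norm \<delta> f)\<^sup>2"
proof -
  obtain e J where e: "e > 0" and J: "J \<ge> 0"
    and Ri: "\<And>l :: real \<times> real. integrable lborel (\<lambda>\<eta>. ((1 + norm \<eta>) / ((1 + norm l) * (1 + norm (l - \<eta>))))\<^sup>2 * (1 + norm \<eta>) powr (- \<delta>))"
    and Rv: "\<And>l :: real \<times> real. (LINT \<eta>|lborel. ((1 + norm \<eta>) / ((1 + norm l) * (1 + norm (l - \<eta>))))\<^sup>2 * (1 + norm \<eta>) powr (- \<delta>)) \<le> J * (1 + norm l) powr (- (2 + e))"
    by (rule kernel_row_bound[OF assms]) (rule that; assumption)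
  define D where "D = 4 * (dual_window_bound * 2 powr (1/4)) + 10 * (\<bar>kappa\<bar> * (2 powr (1/4) * gauss_sum_bound))"
  define S where "S = (\<Sum>\<^sub>\<infinity>z. (1 + norm (lat z)) powr (- (2 + e)))"
  define C where "C = D\<^sup>2 * J * 2 powr \<delta> * S"
  have S: "S \<ge> 0" unfolding S_def by (rule infsum_nonneg) simp
  have "C \<ge> 0" using J S by (auto simp: C_def)
  have main: "(norm (beta (lat z) f))\<^sup>2 \<le> D\<^sup>2 * J * 2 powr \<delta> * (H_norm \<delta> f)\<^sup>2 * (1 + norm (lat z)) powr (- (2 + e))"
    if f: "f \<in> H_space \<delta>" and G0: "half_int_sum (synth (trf f)) = 0" for f z
  proof -
    have F: "f \<in> feichtinger" by (rule H_space_feichtinger[OF f assms])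
    define b where "b = of_real (kappa * alt (fst z + snd z)) / (cpoint sharp_pt - cpoint (lat z))"
    \<comment> \<open>Because the half-integer sum of f vanishes, subtracting the multiple b of its
      kernel leaves the pairing with the transform of f unchanged.\<close>
    define k where "k \<eta> = beta (lat z) (gabor \<eta>) - b * half_int_sum (gabor \<eta>)" for \<eta>
    have km[measurable]: "k \<in> borel_measurable borel"
      unfolding k_def using beta_gabor_measurable[of "lat z"] half_int_sum_gabor_measurable by (auto intro!: borel_measurable_diff borel_measurable_times)
    have kb: "(norm (k \<eta>))\<^sup>2 * (1 + norm \<eta>) powr (- \<delta>) \<le> D\<^sup>2 * (((1 + norm \<eta>) / ((1 + norm (lat z)) * (1 + norm (lat z - \<eta>))))\<^sup>2 * (1 + norm \<eta>) powr (- \<delta>))" for \<eta>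
    proof -
      have "(norm (k \<eta>))\<^sup>2 \<le> (D * ((1 + norm \<eta>) / ((1 + norm (lat z)) * (1 + norm (lat z - \<eta>)))))\<^sup>2"
        unfolding k_def b_def D_def by (intro power_mono beta_gabor_difference_bound) auto
      then show ?thesis unfolding power_mult_distrib mult.assoc[symmetric] by (intro mult_right_mono) auto
    qed
    have ki: "integrable lborel (\<lambda>\<eta>. (norm (k \<eta>))\<^sup>2 * (1 + norm \<eta>) powr (- \<delta>))"
      by (rule Bochner_Integration.integrable_bound[OF integrable_mult_right[OF Ri, of "D\<^sup>2" "lat z"]])
        (use kb in \<open>auto intro!: AE_I2 order_trans[OF kb abs_ge_self] simp: abs_mult\<close>)
    have "beta (lat z) f = (LINT \<eta>|lborel. trf f \<eta> * k \<eta>)"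
    proof -
      have "(\<lambda>\<eta>. trf f \<eta> * k \<eta>) = (\<lambda>\<eta>. trf f \<eta> * beta (lat z) (gabor \<eta>) - b * (trf f \<eta> * half_int_sum (gabor \<eta>)))"
        by (simp add: k_def algebra_simps)
      then show ?thesis
        using feichtinger_beta[OF F, of "lat z"] feichtinger_half_int_sum(2,3)[OF F] G0 by simp
    qed
    then have "(norm (beta (lat z) f))\<^sup>2 \<le> (LINT \<eta>|lborel. (norm (k \<eta>))\<^sup>2 * (1 + norm \<eta>) powr (- \<delta>)) * (2 powr \<delta> * (H_norm \<delta> f)\<^sup>2)"
      using H_space_pairing(2)[OF f _ km ki] assms by simp
    also have "\<dots> \<le> (D\<^sup>2 * (J * (1 + norm (lat z)) powr (- (2 + e)))) * (2 powr \<delta> * (H_norm \<delta> f)\<^sup>2)"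
    proof (rule mult_right_mono)
      have "(LINT \<eta>|lborel. (norm (k \<eta>))\<^sup>2 * (1 + norm \<eta>) powr (- \<delta>)) \<le> (LINT \<eta>|lborel. D\<^sup>2 * (((1 + norm \<eta>) / ((1 + norm (lat z)) * (1 + norm (lat z - \<eta>))))\<^sup>2 * (1 + norm \<eta>) powr (- \<delta>)))"
        by (rule integral_mono[OF ki _ kb]) (intro integrable_mult_right Ri)
      also have "\<dots> \<le> D\<^sup>2 * (J * (1 + norm (lat z)) powr (- (2 + e)))"
        unfolding integral_mult_right_zero by (intro mult_left_mono Rv) auto
      finally show "(LINT \<eta>|lborel. (norm (k \<eta>))\<^sup>2 * (1 + norm \<eta>) powr (- \<delta>)) \<le> D\<^sup>2 * (J * (1 + norm (lat z)) powr (- (2 + e)))" .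
    qed auto
    finally show ?thesis by (simp add: mult_ac)
  qed
  show ?thesis
  proof (intro exI[of _ C] conjI ballI impI)
    fix f assume f: "f \<in> H_space \<delta>" and G0: "half_int_sum (synth (trf f)) = 0"
    let ?c = "D\<^sup>2 * J * 2 powr \<delta> * (H_norm \<delta> f)\<^sup>2"
    have s: "(\<lambda>z. ?c * (1 + norm (lat z)) powr (- (2 + e))) summable_on UNIV"
      by (intro summable_on_cmult_right lat_decay_summable e)
    show 1: "(\<lambda>z. (norm (beta (lat z) f))\<^sup>2) summable_on UNIV"
      by (rule summable_on_comparison_test[OF s]) (use main[OF f G0] in auto)
    have "(\<Sum>\<^sub>\<infinity>z. (norm (beta (lat z) f))\<^sup>2) \<le> (\<Sum>\<^sub>\<infinity>z. ?c * (1 + norm (lat z)) powr (- (2 + e)))"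
      by (rule infsum_mono[OF 1 s main[OF f G0]])
    also have "\<dots> = C * (H_norm \<delta> f)\<^sup>2"
      unfolding infsum_cmult_right' C_def S_def by (simp add: mult_ac)
    finally show "(\<Sum>\<^sub>\<infinity>z. (norm (beta (lat z) f))\<^sup>2) \<le> C * (H_norm \<delta> f)\<^sup>2" .
  qed fact
qed

section \<open>Poisson summation and the Gabor expansion\<close>

lemma abs_sin_ge_half:
  assumes "\<bar>y\<bar> \<le> pi / 2"
  shows "\<bar>sin y\<bar> \<ge> \<bar>y\<bar> / 2"
proof -
  have *: "sin y \<ge> y / 2" if y: "0 \<le> y" "y \<le> pi / 2" for y
  proof (cases "y \<le> pi / 3")
    case True
    show ?thesis
    proof (cases "y = 0")
      case False
      then have "y > 0" using y by simp
      then obtain z where z: "0 < z" "z < y" "sin y - sin 0 = (y - 0) * cos z"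
        using MVT2[of 0 y sin cos] by (auto intro: DERIV_sin)
      have "cos (pi / 3) \<le> cos z" using z y True by (intro cos_monotone_0_pi_le) auto
      then have "y * (1/2) \<le> y * cos z" using y by (intro mult_left_mono) (auto simp: cos_60)
      then show ?thesis using z by simp
    qed simp
  next
    case False
    have "sin (pi / 3) \<le> sin y" using False y by (intro sin_monotone_2pi_le) auto
    \<comment> \<open>Beyond pi / 3 the value y / 2 is at most pi / 4, while the sine is at least
      sqrt 3 / 2.\<close>
    moreover have "pi / 4 \<le> sqrt 3 / 2"
    proof -
      have "pi / 2 \<le> 17/10" using pi_approx(2) by simp
      also have "17/10 \<le> sqrt 3" by (rule real_le_rsqrt) (simp add: power2_eq_square)
      finally show ?thesis by simp
    qed
    ultimately show ?thesis using y by (simp add: sin_60)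
  qed
  show ?thesis using *[of y] *[of "- y"] assms by (cases "y \<ge> 0") auto
qed

lemma norm_cis_minus_one_ge:
  assumes "\<bar>x\<bar> \<le> 1/2"
  shows "norm (cis (2 * pi * x) - 1) \<ge> pi * \<bar>x\<bar>"
proof -
  have "cis (2 * pi * x) - 1 = 2 * \<i> * of_real (sin (pi * x)) * cis (pi * x)"
    using cos_double_sin[of "pi * x"] sin_double[of "pi * x"]
    by (simp add: complex_eq_iff power2_eq_square mult_ac)
  then have "norm (cis (2 * pi * x) - 1) = 2 * \<bar>sin (pi * x)\<bar>" by (simp add: norm_mult)
  moreover have "\<bar>pi * x\<bar> \<le> pi / 2" using assms by (simp add: abs_mult)
  ultimately show ?thesis using abs_sin_ge_half[of "pi * x"] by (simp add: abs_mult)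
qed

section \<open>Fourier coefficients on the unit interval\<close>

definition unit_ind :: "real \<Rightarrow> complex" where
  "unit_ind x = indicator {- 1/2 ..< 1/2} x"

lemma unit_ind_measurable[measurable]: "unit_ind \<in> borel_measurable borel"
  unfolding unit_ind_def[abs_def] by measurable

lemma unit_bounded_integrable:
  assumes [measurable]: "g \<in> borel_measurable borel" and "\<And>x. \<bar>x\<bar> \<le> 1/2 \<Longrightarrow> norm (g x :: complex) \<le> B"
  shows "integrable lborel (\<lambda>x. unit_ind x * g x)"
proof -
  have "integrable lborel (\<lambda>x. \<bar>B\<bar> * indicator {- 1/2 .. 1/2 :: real} x)"
    by (intro integrable_mult_right) (auto simp: integrable_indicator_iff)
  then show ?thesis
  proof (rule Bochner_Integration.integrable_bound)
    have "norm (unit_ind x * g x) \<le> norm (\<bar>B\<bar> * indicator {- 1/2 .. 1/2} x)" for x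
    proof (cases "x \<in> {- 1/2 ..< 1/2}")
      case True
      then have "\<bar>x\<bar> \<le> 1/2" by (auto simp: abs_le_iff)
      then show ?thesis using assms(2)[of x] True by (auto simp: unit_ind_def norm_mult)
    qed (auto simp: unit_ind_def)
    then show "AE x in lborel. norm (unit_ind x * g x) \<le> norm (\<bar>B\<bar> * indicator {- 1/2 .. 1/2} x)" by simp
  qed simp
qed

lemma integral_unit_cis:
  fixes q :: int
  shows "(LINT x|lborel. unit_ind x * cis (2 * pi * real_of_int q * x)) = (if q = 0 then 1 else 0)"
proof -
  have "(LINT x|lborel. unit_ind x * cis (2 * pi * real_of_int q * x)) = (LINT x|lborel. indicator {- 1/2..1/2} x *\<^sub>R cis (2 * pi * real_of_int q * x))"
  proof (rule integral_cong_AE)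
    have "AE x in lborel. x \<noteq> (1/2 :: real)" by (rule AE_lborel_singleton)
    then show "AE x in lborel. unit_ind x * cis (2 * pi * real_of_int q * x) = indicator {- 1/2..1/2} x *\<^sub>R cis (2 * pi * real_of_int q * x)"
      by eventually_elim (auto simp: unit_ind_def indicator_def)
  qed auto
  also have "\<dots> = (if q = 0 then 1 else 0)"
  proof (cases "q = 0")
    case True
    have "(LINT x|lborel. indicator {- 1/2..1/2 :: real} x *\<^sub>R (1 :: complex)) = of_real (1/2) - of_real (- 1/2)"
    proof (rule integral_FTC_atLeastAtMost)
      show "(complex_of_real has_vector_derivative 1) (at x within {- 1/2..1/2})" for x
        by (auto simp: has_vector_derivative_def scaleR_conv_of_real intro!: derivative_eq_intros)
    qed auto
    then show ?thesis using True by simp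
  next
    case False
    define w where "w = 2 * pi * real_of_int q"
    have w: "w \<noteq> 0" using False by (simp add: w_def)
    have "(LINT x|lborel. indicator {- 1/2..1/2} x *\<^sub>R cis (w * x)) = cis (w * (1/2)) / (\<i> * of_real w) - cis (w * (- 1/2)) / (\<i> * of_real w)"
    proof (rule integral_FTC_atLeastAtMost)
      fix x :: real
      have "((\<lambda>z. exp (\<i> * of_real w * z) / (\<i> * of_real w)) has_field_derivative exp (\<i> * of_real w * of_real x)) (at (of_real x))"
        using w by (auto intro!: derivative_eq_intros)
      from has_vector_derivative_real_field[OF this]
      have "((\<lambda>x. cis (w * x) / (\<i> * of_real w)) has_vector_derivative cis (w * x)) (at x)"
        unfolding cis_conv_exp by (simp add: mult.assoc)
      then show "((\<lambda>x. cis (w * x) / (\<i> * of_real w)) has_vector_derivative cis (w * x)) (at x within {- 1/2..1/2})"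
        by (rule has_vector_derivative_at_within)
    qed (auto simp: cis_conv_exp intro!: continuous_intros)
    also have "cis (w * (1/2)) = cis (w * (- 1/2))"
      using cis_pi_int[of q] cis_pi_int[of "- q"] by (simp add: w_def alt_simps)
    finally show ?thesis using False by (simp add: w_def)
  qed
  finally show ?thesis .
qed

text \<open>The squared distance between g and its partial Fourier sum s over F is non-negative; by
  orthonormality it equals the squared norm of g minus the sum in question.\<close>

lemma bessel_unit_interval:
  fixes g :: "real \<Rightarrow> complex" and c :: "int \<Rightarrow> complex"
  assumes g: "g \<in> borel_measurable borel" and B: "\<And>x. \<bar>x\<bar> \<le> 1/2 \<Longrightarrow> norm (g x) \<le> B"
    and c: "\<And>q. c q = (LINT x|lborel. unit_ind x * (g x * cis (- (2 * pi * real_of_int q * x))))"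
    and F: "finite F"
  shows "(\<Sum>q\<in>F. (norm (c q))\<^sup>2) \<le> B\<^sup>2"
proof -
  note [measurable] = g
  define e where "e q x = cis (2 * pi * real_of_int q * x)" for q :: int and x
  have [measurable]: "e q \<in> borel_measurable borel" for q unfolding e_def by measurable
  have ne: "norm (e q x) = 1" for q x by (simp add: e_def)
  have cn: "cnj (e q x) = cis (- (2 * pi * real_of_int q * x))" for q x by (simp add: e_def cis_cnj)
  define s where "s x = (\<Sum>q\<in>F. c q * e q x)" for x
  have [measurable]: "s \<in> borel_measurable borel" unfolding s_def by measurable
  define M where "M = (\<Sum>q\<in>F. norm (c q))"
  have sb: "norm (s x) \<le> M" for x
    unfolding s_def M_def by (rule order_trans[OF norm_sum]) (simp add: norm_mult ne)
  have B0: "B \<ge> 0" using B[of 0] norm_ge_zero[of "g 0"] by linarith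
  have i1: "integrable lborel (\<lambda>x. unit_ind x * (g x * cnj (e q x)))" for q
    by (rule unit_bounded_integrable[where B = B]) (use B in \<open>auto simp: norm_mult ne\<close>)
  have i2: "integrable lborel (\<lambda>x. unit_ind x * (s x * cnj (e q x)))" for q
    by (rule unit_bounded_integrable[where B = M]) (use sb in \<open>auto simp: norm_mult ne\<close>)
  have i3: "integrable lborel (\<lambda>x. unit_ind x * (g x * cnj (g x)))"
    by (rule unit_bounded_integrable[where B = "B * B"]) (use B B0 in \<open>auto simp: norm_mult intro!: mult_mono\<close>)
  have i4: "integrable lborel (\<lambda>x. unit_ind x * (e r x * cnj (e q x)))" for q r
    by (rule unit_bounded_integrable[where B = 1]) (auto simp: norm_mult ne)
  have orth: "(LINT x|lborel. unit_ind x * (e r x * cnj (e q x))) = (if r = q then 1 else 0)" for q r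
  proof -
    have "e r x * cnj (e q x) = cis (2 * pi * real_of_int (r - q) * x)" for x
      unfolding cn unfolding e_def cis_mult by (simp add: algebra_simps)
    then show ?thesis using integral_unit_cis[of "r - q"] by simp
  qed
  have ct: "(LINT x|lborel. unit_ind x * (g x * cnj (e q x))) = c q" for q unfolding cn c ..
  have st: "(LINT x|lborel. unit_ind x * (s x * cnj (e q x))) = (if q \<in> F then c q else 0)" for q
  proof -
    have "(\<lambda>x. unit_ind x * (s x * cnj (e q x))) = (\<lambda>x. \<Sum>r\<in>F. c r * (unit_ind x * (e r x * cnj (e q x))))"
      by (auto simp: s_def sum_distrib_left sum_distrib_right mult_ac)
    then have "(LINT x|lborel. unit_ind x * (s x * cnj (e q x))) = (\<Sum>r\<in>F. c r * (if r = q then 1 else 0))"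
      by (simp only:) (simp add: i4 orth)
    then show ?thesis using F by (simp add: if_distrib[of "(*) _"] cong: if_cong)
  qed
  have gs: "(LINT x|lborel. unit_ind x * (g x * cnj (s x))) = (\<Sum>q\<in>F. cnj (c q) * c q)" "integrable lborel (\<lambda>x. unit_ind x * (g x * cnj (s x)))"
  proof -
    have eq: "(\<lambda>x. unit_ind x * (g x * cnj (s x))) = (\<lambda>x. \<Sum>q\<in>F. cnj (c q) * (unit_ind x * (g x * cnj (e q x))))"
      by (auto simp: s_def sum_distrib_left mult_ac)
    show "(LINT x|lborel. unit_ind x * (g x * cnj (s x))) = (\<Sum>q\<in>F. cnj (c q) * c q)"
      unfolding eq using i1 by (simp add: ct)
    show "integrable lborel (\<lambda>x. unit_ind x * (g x * cnj (s x)))" unfolding eq using i1 by auto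
  qed
  have ss: "(LINT x|lborel. unit_ind x * (s x * cnj (s x))) = (\<Sum>q\<in>F. cnj (c q) * c q)" "integrable lborel (\<lambda>x. unit_ind x * (s x * cnj (s x)))"
  proof -
    have eq: "(\<lambda>x. unit_ind x * (s x * cnj (s x))) = (\<lambda>x. \<Sum>q\<in>F. cnj (c q) * (unit_ind x * (s x * cnj (e q x))))"
      by (subst (2) s_def) (auto simp: sum_distrib_left mult_ac)
    show "(LINT x|lborel. unit_ind x * (s x * cnj (s x))) = (\<Sum>q\<in>F. cnj (c q) * c q)"
      unfolding eq using i2 by (simp add: st)
    show "integrable lborel (\<lambda>x. unit_ind x * (s x * cnj (s x)))" unfolding eq using i2 by auto
  qed
  define T where "T = (\<Sum>q\<in>F. (norm (c q))\<^sup>2)"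
  have Tc: "(\<Sum>q\<in>F. cnj (c q) * c q) = of_real T"
    unfolding T_def of_real_sum complex_norm_square by (simp add: mult.commute)
  let ?u = "\<lambda>x. indicator {- 1/2 ..< 1/2 :: real} x :: real"
  have "0 \<le> (LINT x|lborel. ?u x * (norm (g x - s x))\<^sup>2)"
    by (intro Bochner_Integration.integral_nonneg) auto
  also have "complex_of_real (LINT x|lborel. ?u x * (norm (g x - s x))\<^sup>2) = (LINT x|lborel. unit_ind x * (g x * cnj (g x)) - unit_ind x * (g x * cnj (s x)) - cnj (unit_ind x * (g x * cnj (s x))) + unit_ind x * (s x * cnj (s x)))"
  proof -
    have "complex_of_real (?u x * (norm (g x - s x))\<^sup>2) = unit_ind x * (g x * cnj (g x)) - unit_ind x * (g x * cnj (s x)) - cnj (unit_ind x * (g x * cnj (s x))) + unit_ind x * (s x * cnj (s x))" for x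
      unfolding of_real_mult complex_norm_square by (auto simp: unit_ind_def indicator_def algebra_simps)
    then show ?thesis by (simp only: integral_complex_of_real[symmetric])
  qed
  then have "(LINT x|lborel. ?u x * (norm (g x - s x))\<^sup>2) = (LINT x|lborel. ?u x * (norm (g x))\<^sup>2) - T"
  proof -
    have gg: "(LINT x|lborel. unit_ind x * (g x * cnj (g x))) = of_real (LINT x|lborel. ?u x * (norm (g x))\<^sup>2)"
    proof -
      have "unit_ind x * (g x * cnj (g x)) = complex_of_real (?u x * (norm (g x))\<^sup>2)" for x
        unfolding of_real_mult complex_norm_square by (auto simp: unit_ind_def indicator_def)
      then show ?thesis by (simp only: integral_complex_of_real[symmetric])
    qed
    have "(LINT x|lborel. unit_ind x * (g x * cnj (g x)) - unit_ind x * (g x * cnj (s x)) - cnj (unit_ind x * (g x * cnj (s x))) + unit_ind x * (s x * cnj (s x)))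
      = of_real (LINT x|lborel. ?u x * (norm (g x))\<^sup>2) - of_real T - cnj (of_real T) + of_real T"
      using i3 gs(2) ss(2) by (simp del: complex_cnj_mult add: gg gs(1)[unfolded Tc] ss(1)[unfolded Tc])
    then have "complex_of_real (LINT x|lborel. ?u x * (norm (g x - s x))\<^sup>2) = of_real ((LINT x|lborel. ?u x * (norm (g x))\<^sup>2) - T)"
      using \<open>complex_of_real (LINT x|lborel. ?u x * (norm (g x - s x))\<^sup>2) = _\<close> by simp
    then show ?thesis unfolding of_real_eq_iff .
  qed
  finally have "T \<le> (LINT x|lborel. ?u x * (norm (g x))\<^sup>2)" by simp
  also have "\<dots> \<le> (LINT x|lborel. B\<^sup>2 * indicator {- 1/2 .. 1/2 :: real} x)"
  proof (rule integral_mono')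
    show "integrable lborel (\<lambda>x. B\<^sup>2 * indicator {- 1/2 .. 1/2 :: real} x)"
      by (intro integrable_mult_right) (auto simp: integrable_indicator_iff)
    fix x
    show "?u x * (norm (g x))\<^sup>2 \<le> B\<^sup>2 * indicator {- 1/2 .. 1/2} x"
      using B[of x] by (auto simp: indicator_def intro!: power_mono)
  qed auto
  also have "\<dots> = B\<^sup>2" by simp
  finally show ?thesis unfolding T_def .
qed

text \<open>Chernoff's argument: the periodization of \<open>v\<close> is Lipschitz at 0, so that after subtracting its value there it is a bounded function
  times \<open>cis (2 * pi * x) - 1\<close>; its Fourier coefficients are then differences of a square summable sequence and sum to 0.\<close>

lemma poisson_summation:
  fixes v v' :: "real \<Rightarrow> complex"
  assumes d: "\<And>x. (v has_vector_derivative v' x) (at x)"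
    and b: "\<And>x. norm (v x) \<le> B * (1 + \<bar>x\<bar>) powr (- 2)" "\<And>x. norm (v' x) \<le> B * (1 + \<bar>x\<bar>) powr (- 2)"
    and c: "\<And>q :: int. c q = (LINT x|lborel. v x * cis (- (2 * pi * real_of_int q * x)))"
    and cs: "(\<lambda>q. norm (c q)) summable_on UNIV"
  shows "(\<Sum>\<^sub>\<infinity>q. c q) = (\<Sum>\<^sub>\<infinity>k :: int. v (real_of_int k))"
proof -
  have B: "B \<ge> 0" using order_trans[OF norm_ge_zero b(1)[of 0]] by simp
  have vc: "continuous_on UNIV v"
    using d by (meson continuous_at_imp_continuous_on has_vector_derivative_continuous)
  note [measurable] = borel_measurable_continuous_onI[OF vc]
  have vi: "integrable lborel v"
    by (rule Bochner_Integration.integrable_bound[OF integrable_mult_right[OF integrable_one_plus_abs_powr[of 2], of B]])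
      (use b in \<open>auto intro!: AE_I2 order_trans[OF b(1) abs_ge_self]\<close>)
  \<comment> \<open>One constant serves both as a bound for the periodization and as its Lipschitz
    constant at 0; the 4 is 2 powr 2 from the shift by at most 1.\<close>
  define L where "L = B * (4 * (\<Sum>\<^sub>\<infinity>n :: int. (1 + \<bar>real_of_int n\<bar>) powr (- 2)))"
  have vs: "(\<lambda>k :: int. norm (v (x + real_of_int k))) summable_on UNIV" "(\<Sum>\<^sub>\<infinity>k :: int. norm (v (x + real_of_int k))) \<le> L" for x
  proof -
    have s: "(\<lambda>k :: int. B * (1 + \<bar>real_of_int k + x\<bar>) powr (- 2)) summable_on UNIV"
      by (intro summable_on_cmult_right int_shift_sum) simp
    have le: "norm (v (x + real_of_int k)) \<le> B * (1 + \<bar>real_of_int k + x\<bar>) powr (- 2)" for k :: int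
      using b(1)[of "x + real_of_int k"] by (simp add: add.commute)
    show 1: "(\<lambda>k :: int. norm (v (x + real_of_int k))) summable_on UNIV"
      by (rule summable_on_comparison_test[OF s]) (use le in auto)
    have "(\<Sum>\<^sub>\<infinity>k :: int. norm (v (x + real_of_int k))) \<le> (\<Sum>\<^sub>\<infinity>k :: int. B * (1 + \<bar>real_of_int k + x\<bar>) powr (- 2))"
      by (rule infsum_mono[OF 1 s le])
    also have "\<dots> \<le> L"
      unfolding infsum_cmult_right' L_def using int_shift_sum(2)[of 2 x] by (intro mult_left_mono B) simp
    finally show "(\<Sum>\<^sub>\<infinity>k :: int. norm (v (x + real_of_int k))) \<le> L" .
  qed
  define \<psi> where "\<psi> x = (\<Sum>\<^sub>\<infinity>k :: int. v (x + real_of_int k))" for x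
  have psib: "norm (\<psi> x) \<le> L" for x
    unfolding \<psi>_def by (rule order_trans[OF norm_infsum_bound]) (use vs in auto)
  have [measurable]: "\<psi> \<in> borel_measurable borel"
  proof -
    have "(\<lambda>x. LINT k|count_space UNIV. v (x + real_of_int k)) \<in> borel_measurable borel"
    proof (rule sigma_finite_measure.borel_measurable_lebesgue_integral[OF sigma_finite_measure_count_space])
      have "(\<lambda>(k :: int, x). v (x + real_of_int k)) \<in> borel_measurable (count_space UNIV \<Otimes>\<^sub>M borel)"
        by (rule measurable_pair_measure_countable1) auto
      from measurable_compose[OF measurable_pair_swap' this]
      show "(\<lambda>(x, k :: int). v (x + real_of_int k)) \<in> borel_measurable (borel \<Otimes>\<^sub>M count_space UNIV)"
        by (simp add: case_prod_unfold)
    qed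
    then show ?thesis unfolding \<psi>_def[abs_def] using integral_count_space_eq_infsum[OF vs(1)] by simp
  qed
  \<comment> \<open>The mean value inequality is applied to each translate of v; the decay of v'
    makes the resulting bounds summable.\<close>
  have lip: "norm (\<psi> x - \<psi> 0) \<le> L * \<bar>x\<bar>" if x: "\<bar>x\<bar> \<le> 1/2" for x
  proof -
    have vd: "norm (v (x + real_of_int k) - v (real_of_int k)) \<le> (4 * (B * (1 + \<bar>real_of_int k\<bar>) powr (- 2))) * \<bar>x\<bar>" for k :: int
    proof -
      let ?S = "{real_of_int k - 1/2 .. real_of_int k + 1/2}"
      have "norm (v (x + real_of_int k) - v (real_of_int k)) \<le> (4 * (B * (1 + \<bar>real_of_int k\<bar>) powr (- 2))) * norm (x + real_of_int k - real_of_int k)"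
      proof (rule differentiable_bound[of ?S v "\<lambda>y h. h *\<^sub>R v' y"])
        show "(v has_derivative (\<lambda>h. h *\<^sub>R v' y)) (at y within ?S)" for y
          using d[of y] unfolding has_vector_derivative_def by (rule has_derivative_at_withinI)
        fix y assume y: "y \<in> ?S"
        have "norm (v' y) \<le> B * (1 + \<bar>y\<bar>) powr (- 2)" by (rule b)
        also have "B * (1 + \<bar>y\<bar>) powr (- 2) \<le> B * (2 powr 2 * (1 + \<bar>real_of_int k\<bar>) powr (- 2))"
        proof (rule mult_left_mono[OF _ B])
          show "(1 + \<bar>y\<bar>) powr (- 2) \<le> 2 powr 2 * (1 + \<bar>real_of_int k\<bar>) powr (- 2)"
          using one_plus_abs_shift_bound[of "y - real_of_int k" 2 k] y by (auto simp: abs_le_iff)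
        qed
        finally have n: "norm (v' y) \<le> 4 * (B * (1 + \<bar>real_of_int k\<bar>) powr (- 2))" by (simp add: mult_ac)
        show "onorm (\<lambda>h. h *\<^sub>R v' y) \<le> 4 * (B * (1 + \<bar>real_of_int k\<bar>) powr (- 2))"
          by (rule onorm_le) (simp add: mult.commute[of _ "\<bar>_\<bar>"] mult_left_mono[OF n])
      qed (use x in \<open>auto simp: abs_le_iff\<close>)
      then show ?thesis by simp
    qed
    have s1: "(\<lambda>k :: int. (4 * (B * (1 + \<bar>real_of_int k\<bar>) powr (- 2))) * \<bar>x\<bar>) summable_on UNIV"
      by (intro summable_on_cmult_left summable_on_cmult_right summable_on_int_powr) simp
    have s0: "(\<lambda>k :: int. norm (v (x + real_of_int k) - v (real_of_int k))) summable_on UNIV"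
      by (rule summable_on_comparison_test[OF s1]) (use vd in auto)
    have "\<psi> x - \<psi> 0 = (\<Sum>\<^sub>\<infinity>k :: int. v (x + real_of_int k) - v (real_of_int k))"
      unfolding \<psi>_def using vs(1)[of x] vs(1)[of 0] by (subst infsum_diff) (auto intro: abs_summable_summable)
    also have "norm \<dots> \<le> (\<Sum>\<^sub>\<infinity>k :: int. norm (v (x + real_of_int k) - v (real_of_int k)))"
      by (rule norm_infsum_bound[OF s0])
    also have "\<dots> \<le> (\<Sum>\<^sub>\<infinity>k :: int. (4 * (B * (1 + \<bar>real_of_int k\<bar>) powr (- 2))) * \<bar>x\<bar>)"
      by (rule infsum_mono[OF s0 s1 vd])
    also have "\<dots> = L * \<bar>x\<bar>"
      unfolding infsum_cmult_left' infsum_cmult_right' L_def by simp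
    finally show ?thesis .
  qed
  have cpsi: "c q = (LINT x|lborel. unit_ind x * (\<psi> x * cis (- (2 * pi * real_of_int q * x))))" for q
  proof -
    let ?e = "\<lambda>x. cis (- (2 * pi * real_of_int q * x))"
    have ui: "integrable lborel (\<lambda>x. v x * ?e x)"
      by (rule Bochner_Integration.integrable_bound[OF vi]) (auto simp: norm_mult)
    have A: "integrable lborel (\<lambda>x. unit_ind x * ?e x)"
      by (rule unit_bounded_integrable[where B = 1]) auto
    have piece: "(LINT x|lborel. (v x * ?e x) * indicator {0 + real_of_int N - 1/2 ..< 0 + real_of_int N + 1/2} x) = (LINT x|lborel. (unit_ind x * ?e x) * v (x + real_of_int N))" for N
    proof -
      have "(LINT x|lborel. (v x * ?e x) * indicator {0 + real_of_int N - 1/2 ..< 0 + real_of_int N + 1/2} x) =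
        (LINT x|lborel. (v (real_of_int N + 1 * x) * ?e (real_of_int N + 1 * x)) * indicator {0 + real_of_int N - 1/2 ..< 0 + real_of_int N + 1/2} (real_of_int N + 1 * x))"
        by (subst lborel_integral_real_affine[of 1 _ "real_of_int N"]) auto
      also have "\<dots> = (LINT x|lborel. (unit_ind x * ?e x) * v (x + real_of_int N))"
      proof (intro Bochner_Integration.integral_cong refl)
        fix x
        have "?e (real_of_int N + 1 * x) = cis (2 * pi * real_of_int (- q * N)) * ?e x"
          unfolding cis_mult by (rule arg_cong[where f = cis]) (simp add: algebra_simps)
        then have "?e (real_of_int N + 1 * x) = ?e x" using cis_multiple_2pi[of "real_of_int (- q * N)"] by simp
        then show "(v (real_of_int N + 1 * x) * ?e (real_of_int N + 1 * x)) * indicator {0 + real_of_int N - 1/2 ..< 0 + real_of_int N + 1/2} (real_of_int N + 1 * x) =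
          (unit_ind x * ?e x) * v (x + real_of_int N)"
          by (auto simp: unit_ind_def indicator_def add.commute)
      qed
      finally show ?thesis .
    qed
    have "c q = (\<Sum>\<^sub>\<infinity>N. LINT x|lborel. (unit_ind x * ?e x) * v (x + real_of_int N))"
      unfolding c using integral_unit_partition(2)[OF ui, of 0] unfolding piece by simp
    also have "\<dots> = (LINT x|lborel. (unit_ind x * ?e x) * \<psi> x)"
      unfolding \<psi>_def by (rule superpose_sum(2)[OF lborel.sigma_finite_measure_axioms A _ vs]) simp
    finally show ?thesis by (simp add: mult_ac)
  qed
  define quot where "quot x = (if x = 0 then 0 else (\<psi> x - \<psi> 0) / (cis (2 * pi * x) - 1))" for x :: real
  have [measurable]: "quot \<in> borel_measurable borel" unfolding quot_def[abs_def] by measurable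
  have L0: "L \<ge> 0" using psib[of 0] norm_ge_zero[of "\<psi> 0"] by linarith
  have ne: "cis (2 * pi * x) - 1 \<noteq> 0" if "\<bar>x\<bar> \<le> 1/2" "x \<noteq> 0" for x
  proof -
    have "pi * \<bar>x\<bar> > 0" using that by simp
    then show ?thesis using norm_cis_minus_one_ge[OF that(1)] by auto
  qed
  have qb: "norm (quot x) \<le> L / pi" if x: "\<bar>x\<bar> \<le> 1/2" for x
  proof (cases "x = 0")
    case True
    then show ?thesis using L0 by (simp add: quot_def)
  next
    case False
    have "norm (quot x) = norm (\<psi> x - \<psi> 0) / norm (cis (2 * pi * x) - 1)"
      using False by (simp add: quot_def norm_divide)
    also have "\<dots> \<le> (L * \<bar>x\<bar>) / (pi * \<bar>x\<bar>)"
      by (rule frac_le) (use lip[OF x] norm_cis_minus_one_ge[OF x] False L0 in auto)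
    also have "\<dots> = L / pi" using False by simp
    finally show ?thesis .
  qed
  define d where "d q = (LINT x|lborel. unit_ind x * (quot x * cis (- (2 * pi * real_of_int q * x))))" for q
  have di: "integrable lborel (\<lambda>x. unit_ind x * (quot x * cis (- (2 * pi * real_of_int q * x))))" for q
    by (rule unit_bounded_integrable[where B = "L / pi"]) (use qb in \<open>auto simp: norm_mult\<close>)
  \<comment> \<open>On the cell \<psi> equals \<psi> 0 + quot (cis (2 pi x) - 1), and the factor cis
    (2 pi x) lowers the index of the Fourier coefficient of \<open>quot\<close> by one. The constant
    \<psi> 0 contributes at q = 0 only.\<close>
  have tele: "c q = (if q = 0 then \<psi> 0 else 0) + (d (q - 1) - d q)" for q
  proof -
    have eq: "unit_ind x * (\<psi> x * cis (- (2 * pi * real_of_int q * x))) =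
       \<psi> 0 * (unit_ind x * cis (2 * pi * real_of_int (- q) * x)) + (unit_ind x * (quot x * cis (- (2 * pi * real_of_int (q - 1) * x))) - unit_ind x * (quot x * cis (- (2 * pi * real_of_int q * x))))" for x
    proof (cases "\<bar>x\<bar> \<le> 1/2 \<and> x \<noteq> 0")
      case True
      then have q: "\<psi> x = \<psi> 0 + quot x * (cis (2 * pi * x) - 1)" using ne[of x] by (simp add: quot_def)
      have "cis (- (2 * pi * real_of_int (q - 1) * x)) = cis (2 * pi * x) * cis (- (2 * pi * real_of_int q * x))"
        unfolding cis_mult by (rule arg_cong[where f = cis]) (simp add: algebra_simps)
      then show ?thesis unfolding q by (simp add: algebra_simps)
    next
      case False
      then show ?thesis by (auto simp: unit_ind_def indicator_def quot_def)
    qed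
    have i: "integrable lborel (\<lambda>x. unit_ind x * cis (2 * pi * real_of_int (- q) * x))"
      by (rule unit_bounded_integrable[where B = 1]) auto
    have *: "(LINT x|lborel. a * f x + (g x - h x)) = a * integral\<^sup>L lborel f + (integral\<^sup>L lborel g - integral\<^sup>L lborel h)"
      if "integrable lborel f" "integrable lborel g" "integrable lborel h" for a and f g h :: "real \<Rightarrow> complex"
      using that by simp
    show ?thesis unfolding cpsi eq *[OF i di di] d_def integral_unit_cis by simp
  qed
  \<comment> \<open>Bessel's inequality for the bounded function \<open>quot\<close>. It is used to
    make both ends of the telescoping sum tend to 0.\<close>
  have dsq: "(\<lambda>q. (norm (d q))\<^sup>2) summable_on UNIV"
    by (rule nonneg_bounded_partial_sums_imp_summable_on[where C = "(L / pi)\<^sup>2"])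
      (use bessel_unit_interval[OF _ qb d_def] in \<open>auto intro!: eventually_finite_subsets_at_top_weakI\<close>)
  have dlim: "(\<lambda>n. d (f n)) \<longlonglongrightarrow> 0" if "inj f" for f :: "nat \<Rightarrow> int"
  proof -
    have "(\<lambda>q. (norm (d q))\<^sup>2) summable_on range f" by (rule summable_on_subset_banach[OF dsq]) simp
    then have "(\<lambda>n. (norm (d (f n)))\<^sup>2) summable_on UNIV"
      using that by (subst (asm) summable_on_reindex) (auto simp: o_def)
    then have "summable (\<lambda>n. (norm (d (f n)))\<^sup>2)" by (rule summable_on_imp_summable)
    then have "(\<lambda>n. (norm (d (f n)))\<^sup>2) \<longlonglongrightarrow> 0" by (rule summable_LIMSEQ_zero)
    then have "(\<lambda>n. sqrt ((norm (d (f n)))\<^sup>2)) \<longlonglongrightarrow> sqrt 0" by (rule tendsto_real_sqrt)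
    then show ?thesis by (simp add: tendsto_norm_zero_iff)
  qed
  have part: "(\<Sum>q\<in>{- int N..int N}. c q) = \<psi> 0 + (d (- int N - 1) - d (int N))" for N
  proof (induction N)
    case 0
    then show ?case using tele[of 0] by simp
  next
    case (Suc N)
    have "{- int (Suc N)..int (Suc N)} = insert (- int (Suc N)) (insert (int (Suc N)) {- int N..int N})" by auto
    then have "(\<Sum>q\<in>{- int (Suc N)..int (Suc N)}. c q) = c (- int (Suc N)) + (c (int (Suc N)) + (\<Sum>q\<in>{- int N..int N}. c q))"
      by (simp only:) (subst sum.insert; simp)
    then have "(\<Sum>q\<in>{- int (Suc N)..int (Suc N)}. c q) = c (- int (Suc N)) + (c (int (Suc N)) + (\<psi> 0 + (d (- int N - 1) - d (int N))))"
      unfolding Suc.IH .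
    moreover have "- int N - 1 = - int (Suc N)" "int (Suc N) - 1 = int N" by simp_all
    ultimately show ?case using tele[of "- int (Suc N)"] tele[of "int (Suc N)"] by (simp only: ) simp
  qed
  have "(\<lambda>N. \<Sum>q\<in>{- int N..int N}. c q) \<longlonglongrightarrow> \<psi> 0 + (0 - 0)"
    unfolding part by (intro tendsto_intros dlim) (auto simp: inj_on_def)
  moreover have "(\<lambda>N. \<Sum>q\<in>{- int N..int N}. c q) \<longlonglongrightarrow> infsum c UNIV"
  proof -
    have "(c has_sum infsum c UNIV) UNIV" by (rule has_sum_infsum[OF abs_summable_summable[OF cs]])
    then have l: "(sum c \<longlongrightarrow> infsum c UNIV) (finite_subsets_at_top UNIV)" by (simp add: has_sum_def)
    have "filterlim (\<lambda>N. {- int N..int N}) (finite_subsets_at_top UNIV) sequentially"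
      unfolding filterlim_finite_subsets_at_top
    proof (intro allI impI)
      fix X :: "int set" assume X: "finite X \<and> X \<subseteq> UNIV"
      then obtain M where M: "\<And>x. x \<in> X \<Longrightarrow> nat \<bar>x\<bar> \<le> M"
        using finite_nat_set_iff_bounded_le[of "(\<lambda>x. nat \<bar>x\<bar>) ` X"] by auto
      show "\<forall>\<^sub>F N in sequentially. finite {- int N..int N} \<and> X \<subseteq> {- int N..int N} \<and> {- int N..int N} \<subseteq> UNIV"
        by (rule eventually_sequentiallyI[of M]) (use M in force)
    qed
    from filterlim_compose[OF l this] show ?thesis .
  qed
  ultimately have "infsum c UNIV = \<psi> 0" using LIMSEQ_unique by fastforce
  then show ?thesis by (simp add: \<psi>_def)
qed

section \<open>The lattice expansion, pointwise and in weak form\<close>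

lemma lattice_inner_sum:
  "(\<lambda>z. norm (L2_inner (gabor (lat z)) (gabor \<eta>))) summable_on UNIV"
  "(\<Sum>\<^sub>\<infinity>z. norm (L2_inner (gabor (lat z)) (gabor \<eta>))) \<le> gauss_sum_bound * gauss_sum_bound"
proof -
  have c: "pi / 2 \<ge> 1/2" using pi_gt3 by simp
  define g where "g t n = exp (- (pi / 2) * (real_of_int n + (- t))\<^sup>2)" for t and n :: int
  have eq: "norm (L2_inner (gabor (lat z)) (gabor \<eta>)) = g (fst \<eta>) (fst z) * g (snd \<eta>) (snd z)" for z
    by (simp add: norm_L2_inner_gabor_gabor lat_def g_def)
  have s: "g t summable_on UNIV" "infsum (g t) UNIV \<le> gauss_sum_bound" for t
    unfolding g_def using gauss_int_sum[OF c, of "- t"] by auto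
  have g0: "g t n \<ge> 0" for t n by (simp add: g_def)
  note p = summable_on_product[OF s(1)[of "fst \<eta>"] s(1)[of "snd \<eta>"] g0 g0]
  show "(\<lambda>z. norm (L2_inner (gabor (lat z)) (gabor \<eta>))) summable_on UNIV" unfolding eq by (rule p)
  show "(\<Sum>\<^sub>\<infinity>z. norm (L2_inner (gabor (lat z)) (gabor \<eta>))) \<le> gauss_sum_bound * gauss_sum_bound"
    unfolding eq p(2) by (intro mult_mono s infsum_nonneg g0 gauss_sum_bound_nonneg)
qed

text \<open>These are the decay hypotheses of \<open>poisson_summation\<close> for a product of two
  Gabor functions and for its derivative in t. The linear factor from the derivative is at most (2 +
  c) exp (u^2), which uses up one unit of the rate pi and leaves pi - 1.\<close>

lemma gabor_product_decay:
  obtains B where "\<And>t. norm (gabor a (x + t) * cnj (gabor \<eta> (x + t))) \<le> B * (1 + \<bar>t\<bar>) powr (- 2)"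
    "\<And>t. norm (2 * of_real pi * ((cpoint a - of_real (x + t)) + cnj (cpoint \<eta> - of_real (x + t))) * (gabor a (x + t) * cnj (gabor \<eta> (x + t)))) \<le> B * (1 + \<bar>t\<bar>) powr (- 2)"
proof -
  define c where "c = \<bar>snd a\<bar> + \<bar>fst a - fst \<eta>\<bar> + \<bar>snd \<eta>\<bar>"
  define M where "M = 2 * pi * (2 + c) * (2 powr (1/4) * 2 powr (1/4))"
  define D where "D = (1 + \<bar>x - fst a\<bar>)\<^sup>2"
  have c0: "c \<ge> 0" by (simp add: c_def)
  have pi1: "1 \<le> 2 * pi * (2 + c)"
  proof -
    have "1 * 1 \<le> (2 * pi) * (2 + c)" using c0 pi_gt3 by (intro mult_mono) auto
    then show ?thesis by simp
  qed
  have decay: "exp (- (pi - 1) * (x + t - fst a)\<^sup>2) \<le> 4 * D * (1 + \<bar>t\<bar>) powr (- 2)" for t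
  proof -
    have "exp (- (pi - 1) * (x + t - fst a)\<^sup>2) \<le> 4 * (1 + \<bar>x + t - fst a\<bar>) powr (- 2)"
      using pi_gt3 by (intro exp_neg_sq_le_powr) simp
    also have "(1 + \<bar>x + t - fst a\<bar>) powr (- 2) \<le> D * (1 + \<bar>t\<bar>) powr (- 2)"
    proof -
      have "\<bar>t\<bar> \<le> \<bar>x + t - fst a\<bar> + \<bar>x - fst a\<bar>" by arith
      moreover have "0 \<le> \<bar>x - fst a\<bar> * \<bar>x + t - fst a\<bar>" by simp
      moreover have "(1 + \<bar>x - fst a\<bar>) * (1 + \<bar>x + t - fst a\<bar>) = 1 + \<bar>x - fst a\<bar> + \<bar>x + t - fst a\<bar> + \<bar>x - fst a\<bar> * \<bar>x + t - fst a\<bar>"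
        by (simp add: algebra_simps)
      ultimately have "1 + \<bar>t\<bar> \<le> (1 + \<bar>x - fst a\<bar>) * (1 + \<bar>x + t - fst a\<bar>)" by linarith
      then have "(1 + \<bar>t\<bar>)\<^sup>2 \<le> D * (1 + \<bar>x + t - fst a\<bar>)\<^sup>2"
        unfolding D_def power_mult_distrib[symmetric] by (intro power_mono) auto
      moreover have "u powr (- 2) = 1 / u\<^sup>2" if "u > 0" for u :: real
        using that by (simp add: powr_minus divide_inverse)
      moreover have "1 + \<bar>t\<bar> > 0" "1 + \<bar>x + t - fst a\<bar> > 0" by auto
      ultimately show ?thesis by (simp only:) (simp add: divide_simps mult_ac)
    qed
    finally show ?thesis by simp
  qed
  define u where "u t = x + t - fst a" for t
  have v: "norm (gabor a (x + t) * cnj (gabor \<eta> (x + t))) \<le> 2 powr (1/4) * 2 powr (1/4) * exp (- pi * (u t)\<^sup>2)" for t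
  proof -
    have "norm (gabor a (x + t)) * norm (gabor \<eta> (x + t)) \<le> (2 powr (1/4) * exp (- pi * (u t)\<^sup>2)) * (2 powr (1/4) * 1)"
      unfolding norm_gabor u_def by (intro mult_mono) auto
    then show ?thesis by (simp add: norm_mult mult_ac)
  qed
  have e1: "exp (- pi * (u t)\<^sup>2) = exp (- (pi - 1) * (u t)\<^sup>2) * exp (- (u t)\<^sup>2)" for t
    by (simp add: algebra_simps flip: exp_add)
  show ?thesis
  proof (rule that[of "M * (4 * D)"])
    fix t
    have d: "M * exp (- (pi - 1) * (u t)\<^sup>2) \<le> M * (4 * D) * (1 + \<bar>t\<bar>) powr (- 2)"
      using mult_left_mono[OF decay[of t], of M] c0 by (simp add: M_def u_def mult_ac)
    have "2 powr (1/4) * 2 powr (1/4) * exp (- pi * (u t)\<^sup>2) \<le> M * exp (- (pi - 1) * (u t)\<^sup>2)"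
    proof -
      have *: "K * (E1 * E2) \<le> (A * K) * E1" if "1 \<le> A" "0 \<le> K" "0 \<le> E1" "E2 \<le> 1" for A K E1 E2 :: real
      proof -
        have "(K * E1) * E2 \<le> (K * E1) * 1" using that by (intro mult_left_mono) auto
        also have "(K * E1) * 1 \<le> (K * E1) * A" using that by (intro mult_left_mono) auto
        finally show ?thesis by (simp add: mult_ac)
      qed
      show ?thesis unfolding M_def e1 by (rule *[OF pi1]) auto
    qed
    then show "norm (gabor a (x + t) * cnj (gabor \<eta> (x + t))) \<le> M * (4 * D) * (1 + \<bar>t\<bar>) powr (- 2)"
      using v[of t] d by linarith
    have n1: "norm (cpoint a - of_real (x + t)) \<le> \<bar>u t\<bar> + \<bar>snd a\<bar>"
      using cmod_le[of "cpoint a - of_real (x + t)"] by (simp add: u_def abs_minus_commute)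
    have n2: "norm (cnj (cpoint \<eta> - of_real (x + t))) \<le> \<bar>u t\<bar> + \<bar>fst a - fst \<eta>\<bar> + \<bar>snd \<eta>\<bar>"
      using cmod_le[of "cnj (cpoint \<eta> - of_real (x + t))"] unfolding u_def by simp
    have "norm ((cpoint a - of_real (x + t)) + cnj (cpoint \<eta> - of_real (x + t))) \<le> 2 * \<bar>u t\<bar> + c"
      using norm_triangle_ineq[of "cpoint a - of_real (x + t)" "cnj (cpoint \<eta> - of_real (x + t))"] n1 n2 unfolding c_def by linarith
    also have "\<dots> \<le> (2 + c) * exp ((u t)\<^sup>2)"
    proof -
      have "2 * \<bar>u t\<bar> \<le> 1 + (u t)\<^sup>2" using sum_squares_bound[of 1 "\<bar>u t\<bar>"] by simp
      moreover have "c * 1 \<le> c * (1 + (u t)\<^sup>2)" using c0 by (intro mult_left_mono) auto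
      moreover have "(2 + c) * (1 + (u t)\<^sup>2) \<le> (2 + c) * exp ((u t)\<^sup>2)" using c0 by (intro mult_left_mono exp_ge_add_one_self) auto
      moreover have "2 * \<bar>u t\<bar> + c \<le> (2 + c) * (1 + (u t)\<^sup>2)" if "2 * \<bar>u t\<bar> \<le> 1 + (u t)\<^sup>2" "c * 1 \<le> c * (1 + (u t)\<^sup>2)"
      proof -
        have "2 * \<bar>u t\<bar> \<le> 2 * (1 + (u t)\<^sup>2)" using that(1) by (rule order_trans) simp
        from add_mono[OF this that(2)] show ?thesis by (simp only: distrib_right mult_1_right)
      qed
      ultimately show ?thesis by (meson order_trans)
    qed
    finally have n: "norm ((cpoint a - of_real (x + t)) + cnj (cpoint \<eta> - of_real (x + t))) \<le> (2 + c) * exp ((u t)\<^sup>2)" .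
    have "norm (2 * of_real pi * ((cpoint a - of_real (x + t)) + cnj (cpoint \<eta> - of_real (x + t))) * (gabor a (x + t) * cnj (gabor \<eta> (x + t))))
      = 2 * pi * norm ((cpoint a - of_real (x + t)) + cnj (cpoint \<eta> - of_real (x + t))) * norm (gabor a (x + t) * cnj (gabor \<eta> (x + t)))"
      by (simp only: norm_mult norm_of_real) simp
    also have "\<dots> \<le> 2 * pi * ((2 + c) * exp ((u t)\<^sup>2)) * (2 powr (1/4) * 2 powr (1/4) * exp (- pi * (u t)\<^sup>2))"
      using c0 by (intro mult_mono mult_left_mono n v) auto
    also have "\<dots> = M * exp (- (pi - 1) * (u t)\<^sup>2)"
      unfolding M_def e1 by (simp add: exp_minus)
    finally show "norm (2 * of_real pi * ((cpoint a - of_real (x + t)) + cnj (cpoint \<eta> - of_real (x + t))) * (gabor a (x + t) * cnj (gabor \<eta> (x + t)))) \<le> M * (4 * D) * (1 + \<bar>t\<bar>) powr (- 2)"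
      using d by linarith
  qed
qed

text \<open>Poisson summation for the product of the two functions at x + t, regarded as a function
  of t. The substitution s = x + t puts the phase in front of the inner product and gives frequency
  -q for the coefficient with index q, whence the reflection of the index at the end.\<close>

lemma poisson_gabor:
  "(\<Sum>\<^sub>\<infinity>q :: int. cis (- (2 * pi * real_of_int q * x)) * L2_inner (gabor (p, real_of_int q)) (gabor \<eta>)) =
   (\<Sum>\<^sub>\<infinity>k :: int. gabor (p, 0) (x + real_of_int k) * cnj (gabor \<eta> (x + real_of_int k)))"
proof -
  define v where "v t = gabor (p, 0) (x + t) * cnj (gabor \<eta> (x + t))" for t
  define v' where "v' t = 2 * of_real pi * ((cpoint (p, 0) - of_real (x + t)) + cnj (cpoint \<eta> - of_real (x + t))) * (gabor (p, 0) (x + t) * cnj (gabor \<eta> (x + t)))" for t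
  obtain B where B: "\<And>t. norm (v t) \<le> B * (1 + \<bar>t\<bar>) powr (- 2)" "\<And>t. norm (v' t) \<le> B * (1 + \<bar>t\<bar>) powr (- 2)"
    using gabor_product_decay[of "(p, 0)" x \<eta>] unfolding v_def v'_def by blast
  define c where "c q = cis (2 * pi * real_of_int q * x) * L2_inner (gabor (p, - real_of_int q)) (gabor \<eta>)" for q :: int
  have gd: "((\<lambda>t. gabor a (x + t)) has_vector_derivative 2 * of_real pi * (cpoint a - of_real (x + t)) * gabor a (x + t)) (at t)" for a t
  proof -
    have 1: "((\<lambda>t. x + t) has_vector_derivative 1) (at t)" by (auto intro!: derivative_eq_intros)
    show ?thesis using vector_diff_chain_at[OF 1 gabor_has_vector_derivative[of a "x + t"]] by (simp add: o_def)
  qed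
  have "(\<Sum>\<^sub>\<infinity>q. c q) = (\<Sum>\<^sub>\<infinity>k :: int. v (real_of_int k))"
  proof (rule poisson_summation[of v v' B])
    fix t
    have "(v has_vector_derivative gabor (p, 0) (x + t) * cnj (2 * of_real pi * (cpoint \<eta> - of_real (x + t)) * gabor \<eta> (x + t)) + 2 * of_real pi * (cpoint (p, 0) - of_real (x + t)) * gabor (p, 0) (x + t) * cnj (gabor \<eta> (x + t))) (at t)"
      unfolding v_def by (intro has_vector_derivative_mult gd has_vector_derivative_cnj)
    then show "(v has_vector_derivative v' t) (at t)"
      by (rule back_subst[where P = "\<lambda>d. (v has_vector_derivative d) (at t)"]) (simp add: v'_def algebra_simps)
  next
    fix q :: int
    have "(LINT t|lborel. v t * cis (- (2 * pi * real_of_int q * t))) = (LINT s|lborel. v (- x + 1 * s) * cis (- (2 * pi * real_of_int q * (- x + 1 * s))))"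
      by (subst lborel_integral_real_affine[of 1 _ "- x"]) auto
    also have "\<dots> = (LINT s|lborel. cis (2 * pi * real_of_int q * x) * (gabor (p, - real_of_int q) s * cnj (gabor \<eta> s)))"
    proof (intro Bochner_Integration.integral_cong refl)
      fix s
      have "cis (- (2 * pi * real_of_int q * (- x + 1 * s))) = cis (2 * pi * real_of_int q * x) * cis (2 * pi * (- real_of_int q) * s)"
        unfolding cis_mult by (rule arg_cong[where f = cis]) (simp add: algebra_simps)
      then show "v (- x + 1 * s) * cis (- (2 * pi * real_of_int q * (- x + 1 * s))) = cis (2 * pi * real_of_int q * x) * (gabor (p, - real_of_int q) s * cnj (gabor \<eta> s))"
        unfolding v_def by (simp add: gabor_eq[of "(p, _)"])
    qed
    also have "\<dots> = c q" unfolding c_def L2_inner_def by (rule integral_mult_right_zero)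
    finally show "c q = (LINT t|lborel. v t * cis (- (2 * pi * real_of_int q * t)))" ..
  next
    have c2: "pi / 2 \<ge> 1/2" using pi_gt3 by simp
    have "norm (c q) = exp (- (pi / 2) * (p - fst \<eta>)\<^sup>2) * exp (- (pi / 2) * (real_of_int q + snd \<eta>)\<^sup>2)" for q
    proof -
      have "(- real_of_int q - snd \<eta>)\<^sup>2 = (real_of_int q + snd \<eta>)\<^sup>2" by (simp add: power2_eq_square algebra_simps)
      then show ?thesis by (simp add: c_def norm_mult norm_L2_inner_gabor_gabor)
    qed
    then show "(\<lambda>q. norm (c q)) summable_on UNIV"
      using summable_on_cmult_right[OF gauss_int_sum(1)[OF c2, of "snd \<eta>"]] by simp
  qed (use B in auto)
  moreover have "(\<Sum>\<^sub>\<infinity>q. c q) = (\<Sum>\<^sub>\<infinity>q. c (0 - q))" using infsum_reindex_bij_betw[OF bij_reflect[of 0], of c] by simp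
  ultimately show ?thesis by (simp add: c_def v_def)
qed


text \<open>The sum over the frequencies becomes by Poisson summation a sum over the translates x +
  k; for fixed k the sum over the positions is the biorthogonality relation, which keeps only k =
  0.\<close>

lemma dual_window_lattice_pointwise:
  "(\<Sum>\<^sub>\<infinity>z. of_real (dual_window (x - fst (lat z))) * cis (- (2 * pi * snd (lat z) * x)) * L2_inner (gabor (lat z)) (gabor \<eta>)) = cnj (gabor \<eta> x)"
proof -
  define t where "t z = of_real (dual_window (x - fst (lat z))) * cis (- (2 * pi * snd (lat z) * x)) * L2_inner (gabor (lat z)) (gabor \<eta>)" for z
  have ts: "(\<lambda>z. norm (t z)) summable_on UNIV"
  proof (rule summable_on_comparison_test[OF summable_on_cmult_right[OF lattice_inner_sum(1)[of \<eta>], of dual_window_bound]])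
    show "norm (t z) \<le> dual_window_bound * norm (L2_inner (gabor (lat z)) (gabor \<eta>))" for z
      unfolding t_def using dual_window_le[of "x - fst (lat z)"] by (auto simp: norm_mult intro!: mult_right_mono)
  qed auto
  define F where "F k p = of_real (dual_window (x - real_of_int p)) * (gabor (real_of_int p, 0) (x + real_of_int k) * cnj (gabor \<eta> (x + real_of_int k)))" for k p :: int
  have g0: "gabor (real_of_int p, 0) (x + real_of_int k) = of_real (2 powr (1/4) * exp (- pi * (x + real_of_int k - real_of_int p)\<^sup>2))" for p k :: int
    by (simp add: gabor_eq)
  define E where "E k p = exp (- pi * (real_of_int p + (- x - real_of_int k))\<^sup>2)" for k p :: int
  have E: "2 powr (1/4) * exp (- pi * (x + real_of_int k - real_of_int p)\<^sup>2) = 2 powr (1/4) * E k p" for k p :: int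
    unfolding E_def by (simp add: power2_eq_square algebra_simps)
  define n where "n k = dual_window_bound * (2 powr (1/4) * norm (gabor \<eta> (x + real_of_int k)))" for k :: int
  have n0: "n k \<ge> 0" for k by (simp add: n_def dual_window_bound_nonneg)
  have ns: "n summable_on UNIV" unfolding n_def
    using gabor_half_int_sum(1)[of \<eta> x] by (intro summable_on_cmult_right) (simp add: add.commute)
  have Es: "E k summable_on UNIV" "infsum (E k) UNIV \<le> gauss_sum_bound" for k
    unfolding E_def using gauss_int_sum[OF pi_ge_half, of "- x - real_of_int k"] by auto
  have E0: "E k p \<ge> 0" for k p by (simp add: E_def)
  \<comment> \<open>Absolute summability in both indices justifies the interchange: for fixed k the
    sum over p is a Gaussian sum bounded uniformly in k, and the values of gabor \<eta> along the
    translates are summable.\<close>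
  have Fs: "(\<lambda>(k, p). F k p) summable_on UNIV \<times> UNIV"
  proof -
    have 1: "((\<lambda>p. (\<lambda>(k, p). n k * E k p) (k, p)) has_sum (n k * infsum (E k) UNIV)) UNIV" for k
      using has_sum_cmult_right[OF has_sum_infsum[OF Es(1)[of k]], of "n k"] by simp
    have 2: "(\<lambda>k. n k * infsum (E k) UNIV) summable_on UNIV"
    proof (rule summable_on_comparison_test[OF summable_on_cmult_left[OF ns, of gauss_sum_bound]])
      show "n k * infsum (E k) UNIV \<le> n k * gauss_sum_bound" for k by (intro mult_left_mono Es n0)
      show "0 \<le> n k * infsum (E k) UNIV" for k by (intro mult_nonneg_nonneg n0 infsum_nonneg E0)
    qed
    have s: "(\<lambda>(k, p). n k * E k p) summable_on (UNIV \<times> UNIV)"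
      by (rule summable_on_SigmaI[OF 1 2]) (use n0 E0 in auto)
    have "(\<lambda>z. norm (case z of (k, p) \<Rightarrow> F k p)) summable_on UNIV \<times> UNIV"
    proof (rule summable_on_comparison_test[OF s])
      fix z :: "int \<times> int"
      obtain k p where z: "z = (k, p)" by (cases z)
      have "norm (F k p) = \<bar>dual_window (x - real_of_int p)\<bar> * (2 powr (1/4) * E k p * norm (gabor \<eta> (x + real_of_int k)))"
        unfolding F_def g0 E by (simp add: norm_mult E0)
      also have "\<dots> \<le> dual_window_bound * (2 powr (1/4) * E k p * norm (gabor \<eta> (x + real_of_int k)))"
        by (intro mult_right_mono dual_window_le) (simp add: E0)
      finally show "norm (case z of (k, p) \<Rightarrow> F k p) \<le> (case z of (k, p) \<Rightarrow> n k * E k p)"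
        by (simp add: z n_def mult_ac)
    qed auto
    then show ?thesis by (rule abs_summable_summable)
  qed
  have "infsum t UNIV = (\<Sum>\<^sub>\<infinity>p. \<Sum>\<^sub>\<infinity>q. t (p, q))"
    using infsum_Sigma_banach[of t UNIV "\<lambda>_. UNIV"] abs_summable_summable[OF ts] by simp
  also have "\<dots> = (\<Sum>\<^sub>\<infinity>p. \<Sum>\<^sub>\<infinity>k. F k p)"
  proof (rule infsum_cong)
    fix p :: int
    have "(\<Sum>\<^sub>\<infinity>q. t (p, q)) = of_real (dual_window (x - real_of_int p)) * (\<Sum>\<^sub>\<infinity>q :: int. cis (- (2 * pi * real_of_int q * x)) * L2_inner (gabor (real_of_int p, real_of_int q)) (gabor \<eta>))"
      unfolding t_def lat_def by (simp add: mult.assoc infsum_cmult_right')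
    also have "\<dots> = (\<Sum>\<^sub>\<infinity>k. F k p)"
      unfolding poisson_gabor F_def by (rule infsum_cmult_right'[symmetric])
    finally show "(\<Sum>\<^sub>\<infinity>q. t (p, q)) = (\<Sum>\<^sub>\<infinity>k. F k p)" .
  qed
  also have "\<dots> = (\<Sum>\<^sub>\<infinity>k. \<Sum>\<^sub>\<infinity>p. F k p)"
    using infsum_swap_banach[OF Fs] by simp
  also have "\<dots> = (\<Sum>\<^sub>\<infinity>k :: int. if k = 0 then cnj (gabor \<eta> x) else 0)"
  proof (rule infsum_cong)
    fix k :: int
    have "(\<Sum>\<^sub>\<infinity>p. F k p) = (\<Sum>\<^sub>\<infinity>p. of_real (dual_window (x - real_of_int p) * (2 powr (1/4) * exp (- pi * (x + real_of_int k - real_of_int p)\<^sup>2))) * cnj (gabor \<eta> (x + real_of_int k)))"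
      unfolding F_def g0 by (simp add: mult.assoc)
    also have "\<dots> = (\<Sum>\<^sub>\<infinity>p. complex_of_real (dual_window (x - real_of_int p) * (2 powr (1/4) * exp (- pi * (x + real_of_int k - real_of_int p)\<^sup>2)))) * cnj (gabor \<eta> (x + real_of_int k))"
      by (rule infsum_cmult_left')
    also have "(\<Sum>\<^sub>\<infinity>p. complex_of_real (dual_window (x - real_of_int p) * (2 powr (1/4) * exp (- pi * (x + real_of_int k - real_of_int p)\<^sup>2)))) = of_real (if k = 0 then 1 else 0)"
    proof -
      have "(\<lambda>p. \<bar>dual_window (x - real_of_int p) * (2 powr (1/4) * exp (- pi * (x + real_of_int k - real_of_int p)\<^sup>2))\<bar>) summable_on UNIV"
      proof (rule summable_on_comparison_test[OF summable_on_cmult_right[OF Es(1)[of k], of "dual_window_bound * 2 powr (1/4)"]])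
        show "\<bar>dual_window (x - real_of_int p) * (2 powr (1/4) * exp (- pi * (x + real_of_int k - real_of_int p)\<^sup>2))\<bar> \<le> dual_window_bound * 2 powr (1/4) * E k p" for p
          unfolding E using mult_right_mono[OF dual_window_le[of "x - real_of_int p"], of "2 powr (1/4) * E k p"] by (simp add: abs_mult E0 mult_ac)
      qed auto
      then have "(\<lambda>p. dual_window (x - real_of_int p) * (2 powr (1/4) * exp (- pi * (x + real_of_int k - real_of_int p)\<^sup>2))) summable_on UNIV"
        by (rule abs_summable_summable[OF back_subst[where P = "\<lambda>h. h summable_on UNIV"]]) (simp only: real_norm_def)
      from infsumI[OF has_sum_of_real_iff[THEN iffD2, OF has_sum_infsum[OF this]]] show ?thesis
        unfolding dual_window_biorthogonal .
    qed
    finally show "(\<Sum>\<^sub>\<infinity>p. F k p) = (if k = 0 then cnj (gabor \<eta> x) else 0)" by simp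
  qed
  also have "\<dots> = cnj (gabor \<eta> x)"
    using infsumI[OF has_sum_single[of "0 :: int" "\<lambda>k. if k = 0 then cnj (gabor \<eta> x) else 0"]] by simp
  finally show ?thesis by (simp add: t_def[abs_def])
qed

lemma beta_expansion_gabor:
  assumes f: "integrable lborel f"
  shows "L2_inner f (gabor \<eta>) = (\<Sum>\<^sub>\<infinity>z. beta (lat z) f * L2_inner (gabor (lat z)) (gabor \<eta>))"
proof -
  define K where "K z x = of_real (dual_window (x - fst (lat z))) * cis (- (2 * pi * snd (lat z) * x)) * L2_inner (gabor (lat z)) (gabor \<eta>)" for z x
  have Km: "K z \<in> borel_measurable lborel" for z unfolding K_def by measurable
  have le: "norm (K z x) \<le> dual_window_bound * norm (L2_inner (gabor (lat z)) (gabor \<eta>))" for z x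
    unfolding K_def using dual_window_le[of "x - fst (lat z)"] by (auto simp: norm_mult intro!: mult_right_mono)
  have s: "(\<lambda>z. dual_window_bound * norm (L2_inner (gabor (lat z)) (gabor \<eta>))) summable_on UNIV"
    by (intro summable_on_cmult_right lattice_inner_sum)
  have 1: "(\<lambda>z. norm (K z x)) summable_on UNIV" for x
    by (rule summable_on_comparison_test[OF s]) (use le in auto)
  have 2: "(\<Sum>\<^sub>\<infinity>z. norm (K z x)) \<le> (\<Sum>\<^sub>\<infinity>z. dual_window_bound * norm (L2_inner (gabor (lat z)) (gabor \<eta>)))" for x
    by (rule infsum_mono[OF 1 s le])
  have eq: "(LINT x|lborel. f x * K z x) = beta (lat z) f * L2_inner (gabor (lat z)) (gabor \<eta>)" for z
  proof -
    have "(\<lambda>x. f x * K z x) = (\<lambda>x. (f x * (of_real (dual_window (x - fst (lat z))) * cis (- (2 * pi * snd (lat z) * x)))) * L2_inner (gabor (lat z)) (gabor \<eta>))"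
      by (simp add: K_def mult_ac)
    then show ?thesis unfolding beta_def by (simp only: integral_mult_left_zero)
  qed
  have "(\<Sum>\<^sub>\<infinity>z. LINT x|lborel. f x * K z x) = (LINT x|lborel. f x * (\<Sum>\<^sub>\<infinity>z. K z x))"
    by (rule superpose_sum(2)[OF lborel.sigma_finite_measure_axioms f Km 1 2])
  then show ?thesis unfolding eq unfolding K_def dual_window_lattice_pointwise L2_inner_def[of f] by simp
qed

text \<open>Parseval's identity for the Gabor transform. The integrability of the transform of g
  allows its synthesis to be inserted under the integral.\<close>

lemma feichtinger_inner:
  assumes f: "f \<in> L2" and g: "g \<in> feichtinger"
  shows "L2_inner f g = (LINT \<eta>|lborel. cnj (trf g \<eta>) * trf f \<eta>)"
proof -
  have A: "integrable lborel (\<lambda>\<eta>. cnj (trf g \<eta>))" and gA: "integrable lborel (trf g)" using g by (auto simp: feichtinger_def)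
  have [measurable]: "f \<in> borel_measurable borel" "g \<in> borel_measurable borel" using f feichtinger_measurable[OF g] by (auto simp: L2_def)
  note [measurable] = synth_measurable[OF gA]
  have m: "(\<lambda>(x, \<eta>). f x * cnj (gabor \<eta> x)) \<in> borel_measurable (lborel \<Otimes>\<^sub>M lborel)" by measurable
  note sp = superpose(2)[OF lborel.sigma_finite_measure_axioms lborel.sigma_finite_measure_axioms A m L2_times_gabor_integrable(1,2)[OF f]]
  have eq: "(LINT \<eta>|lborel. cnj (trf g \<eta>) * (f x * cnj (gabor \<eta> x))) = f x * cnj (synth (trf g) x)" for x
  proof -
    have "(\<lambda>\<eta>. cnj (trf g \<eta>) * (f x * cnj (gabor \<eta> x))) = (\<lambda>\<eta>. f x * cnj (trf g \<eta> * gabor \<eta> x))" by (simp add: mult_ac)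
    then show ?thesis by (simp only: integral_mult_right_zero Bochner_Integration.integral_cnj synth_def)
  qed
  have "L2_inner f g = (LINT x|lborel. f x * cnj (synth (trf g) x))"
    unfolding L2_inner_def[of f]
    by (rule integral_cong_AE) (use feichtinger_synth(1)[OF g] in \<open>auto elim!: eventually_mono\<close>)
  also have "\<dots> = (LINT \<eta>|lborel. cnj (trf g \<eta>) * trf f \<eta>)"
    using sp unfolding eq unfolding L2_inner_def[of f] .
  finally show ?thesis .
qed

text \<open>The coefficients are only known to be bounded at this point, so the expansion is weak:
  after pairing with g, whose transform is integrable, the lattice sum converges absolutely.\<close>

lemma beta_expansion:
  assumes f: "f \<in> feichtinger" and g: "g \<in> feichtinger"
  shows "L2_inner f g = (\<Sum>\<^sub>\<infinity>z. beta (lat z) f * L2_inner (gabor (lat z)) g)"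
    and "(\<lambda>z. norm (beta (lat z) f * L2_inner (gabor (lat z)) g)) summable_on UNIV"
proof -
  have A: "integrable lborel (\<lambda>\<eta>. cnj (trf g \<eta>))" using g by (auto simp: feichtinger_def)
  have fi: "integrable lborel f" by (rule feichtinger_synth(3)[OF f])
  define C where "C = dual_window_bound * (LINT x|lborel. norm (f x))"
  have bC: "norm (beta l f) \<le> C" for l unfolding C_def by (rule norm_beta_le[OF fi])
  define K where "K z \<eta> = beta (lat z) f * L2_inner (gabor (lat z)) (gabor \<eta>)" for z \<eta>
  have Km: "K z \<in> borel_measurable lborel" for z
    unfolding K_def using L2_inner_gabor_measurable[OF gabor_in_L2] by simp
  have le: "norm (K z \<eta>) \<le> C * norm (L2_inner (gabor (lat z)) (gabor \<eta>))" for z \<eta>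
    unfolding K_def norm_mult by (intro mult_right_mono bC) auto
  have s: "(\<lambda>z. C * norm (L2_inner (gabor (lat z)) (gabor \<eta>))) summable_on UNIV" for \<eta>
    by (intro summable_on_cmult_right lattice_inner_sum)
  have 1: "(\<lambda>z. norm (K z \<eta>)) summable_on UNIV" for \<eta>
    by (rule summable_on_comparison_test[OF s[of \<eta>] le]) auto
  have C0: "C \<ge> 0" using order_trans[OF norm_ge_zero bC] .
  have 2: "(\<Sum>\<^sub>\<infinity>z. norm (K z \<eta>)) \<le> C * (gauss_sum_bound * gauss_sum_bound)" for \<eta>
  proof -
    have "(\<Sum>\<^sub>\<infinity>z. norm (K z \<eta>)) \<le> (\<Sum>\<^sub>\<infinity>z. C * norm (L2_inner (gabor (lat z)) (gabor \<eta>)))"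
      by (rule infsum_mono[OF 1 s le])
    also have "\<dots> \<le> C * (gauss_sum_bound * gauss_sum_bound)"
      unfolding infsum_cmult_right' by (intro mult_left_mono lattice_inner_sum C0)
    finally show ?thesis .
  qed
  note sp = superpose_sum[OF lborel.sigma_finite_measure_axioms A Km 1 2]
  have eq: "(LINT \<eta>|lborel. cnj (trf g \<eta>) * K z \<eta>) = beta (lat z) f * L2_inner (gabor (lat z)) g" for z
  proof -
    have "(\<lambda>\<eta>. cnj (trf g \<eta>) * K z \<eta>) = (\<lambda>\<eta>. beta (lat z) f * (cnj (trf g \<eta>) * trf (gabor (lat z)) \<eta>))"
      by (simp add: K_def mult_ac)
    then show ?thesis unfolding feichtinger_inner[OF gabor_in_L2 g] by (simp only: integral_mult_right_zero)
  qed
  show "(\<lambda>z. norm (beta (lat z) f * L2_inner (gabor (lat z)) g)) summable_on UNIV"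
    using sp(1) unfolding eq .
  have fL: "f \<in> L2" using f by (simp add: feichtinger_def)
  show "L2_inner f g = (\<Sum>\<^sub>\<infinity>z. beta (lat z) f * L2_inner (gabor (lat z)) g)"
    using sp(2) unfolding eq unfolding K_def beta_expansion_gabor[OF fi, symmetric] feichtinger_inner[OF fL g] by simp
qed

section \<open>Bessel inequalities for lattice sums\<close>

text \<open>When the square is expanded, the integral of the pair q, r is bounded by a Gaussian in q
  - r. The quadratic form is therefore bounded as in Schur's test, with the row sums controlled by
  \<open>gauss_sum_bound\<close>.\<close>

lemma gaussian_window_bessel:
  fixes Q :: "int set" and b :: "int \<Rightarrow> complex" and p :: real
  assumes Q: "finite Q"
  defines "E \<equiv> \<lambda>x. exp (- (pi * (1/2)) * (x - p)\<^sup>2) * (norm (\<Sum>q\<in>Q. b q * cis (2 * pi * real_of_int q * x)))\<^sup>2"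
  shows "integrable lborel E" and "integral\<^sup>L lborel E \<le> sqrt 2 * gauss_sum_bound * (\<Sum>q\<in>Q. (norm (b q))\<^sup>2)"
proof -
  define g where "g x = exp (- (pi * (1/2)) * (x - p)\<^sup>2)" for x
  define I where "I q r = (LINT x|lborel. of_real (g x) * cis (2 * pi * real_of_int (q - r) * x))" for q r
  have i: "integrable lborel (\<lambda>x. of_real (g x) * cis (2 * pi * real_of_int (q - r) * x))" for q r
    unfolding g_def by (rule gaussian_fourier(1)) simp
  define w where "w k = sqrt 2 * exp (- (2 * pi) * (real_of_int k + 0)\<^sup>2)" for k :: int
  have In: "norm (I q r) = w (q - r)" for q r
    unfolding I_def g_def by (subst gaussian_fourier(2)) (simp_all add: norm_mult w_def real_sqrt_divide)
  have eq: "of_real (E x) = (\<Sum>q\<in>Q. \<Sum>r\<in>Q. (b q * cnj (b r)) * (of_real (g x) * cis (2 * pi * real_of_int (q - r) * x)))" for x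
  proof -
    have c: "cis (2 * pi * real_of_int q * x) * cnj (cis (2 * pi * real_of_int r * x)) = cis (2 * pi * real_of_int (q - r) * x)" for q r
      unfolding cis_cnj cis_mult by (simp add: algebra_simps)
    have "complex_of_real (E x) = of_real (g x) * ((\<Sum>q\<in>Q. b q * cis (2 * pi * real_of_int q * x)) * cnj (\<Sum>q\<in>Q. b q * cis (2 * pi * real_of_int q * x)))"
      unfolding E_def g_def of_real_mult complex_norm_square ..
    also have "\<dots> = (\<Sum>q\<in>Q. \<Sum>r\<in>Q. (b q * cnj (b r)) * (of_real (g x) * (cis (2 * pi * real_of_int q * x) * cnj (cis (2 * pi * real_of_int r * x)))))"
      by (simp add: sum_product sum_distrib_left mult_ac del: cis_cnj) (rule sum.swap)
    finally show ?thesis unfolding c .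
  qed
  have "integrable lborel (\<lambda>x. complex_of_real (E x))"
    unfolding eq by (intro Bochner_Integration.integrable_sum integrable_mult_right i)
  then show "integrable lborel E" by (simp add: complex_of_real_integrable_eq)
  have "complex_of_real (integral\<^sup>L lborel E) = (\<Sum>q\<in>Q. \<Sum>r\<in>Q. (b q * cnj (b r)) * I q r)"
    unfolding integral_complex_of_real[symmetric] eq I_def
    by (subst Bochner_Integration.integral_sum, intro Bochner_Integration.integrable_sum integrable_mult_right i,
        subst Bochner_Integration.integral_sum, intro integrable_mult_right i) (simp only: integral_mult_right_zero)
  then have "norm (complex_of_real (integral\<^sup>L lborel E)) \<le> (\<Sum>q\<in>Q. \<Sum>r\<in>Q. norm ((b q * cnj (b r)) * I q r))"
    by (simp only:) (intro order_trans[OF norm_sum] sum_mono norm_sum)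
  also have "\<dots> \<le> (\<Sum>q\<in>Q. \<Sum>r\<in>Q. ((norm (b q))\<^sup>2 / 2) * w (q - r) + ((norm (b r))\<^sup>2 / 2) * w (q - r))"
  proof (intro sum_mono)
    fix q r
    have "norm (b q) * norm (b r) \<le> (norm (b q))\<^sup>2 / 2 + (norm (b r))\<^sup>2 / 2"
      using sum_squares_bound[of "norm (b q)" "norm (b r)"] by simp
    then have "norm (b q) * norm (b r) * w (q - r) \<le> ((norm (b q))\<^sup>2 / 2 + (norm (b r))\<^sup>2 / 2) * w (q - r)"
      by (intro mult_right_mono) (auto simp: w_def)
    then show "norm ((b q * cnj (b r)) * I q r) \<le> ((norm (b q))\<^sup>2 / 2) * w (q - r) + ((norm (b r))\<^sup>2 / 2) * w (q - r)"
      by (simp add: norm_mult In distrib_right)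
  qed
  also have "\<dots> = (\<Sum>q\<in>Q. ((norm (b q))\<^sup>2 / 2) * (\<Sum>r\<in>Q. w (q - r))) + (\<Sum>r\<in>Q. ((norm (b r))\<^sup>2 / 2) * (\<Sum>q\<in>Q. w (q - r)))"
    by (simp add: sum.distrib sum_distrib_left) (rule sum.swap)
  also have "\<dots> \<le> (\<Sum>q\<in>Q. ((norm (b q))\<^sup>2 / 2) * (sqrt 2 * gauss_sum_bound)) + (\<Sum>r\<in>Q. ((norm (b r))\<^sup>2 / 2) * (sqrt 2 * gauss_sum_bound))"
  proof -
    have p2: "2 * pi \<ge> 1/2" using pi_gt3 by simp
    have "(\<Sum>r\<in>Q. w (h r)) \<le> sqrt 2 * gauss_sum_bound" if h: "inj h" for h :: "int \<Rightarrow> int"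
    proof -
      have "(\<Sum>r\<in>Q. w (h r)) = (\<Sum>k\<in>h ` Q. w k)"
        using h by (subst sum.reindex) (auto simp: inj_on_def o_def inj_def)
      also have "\<dots> \<le> (\<Sum>\<^sub>\<infinity>k. w k)"
        unfolding w_def by (intro finite_sum_le_infsum summable_on_cmult_right gauss_int_sum p2 finite_imageI Q) auto
      also have "\<dots> \<le> sqrt 2 * gauss_sum_bound"
        unfolding w_def infsum_cmult_right' by (intro mult_left_mono gauss_int_sum p2) auto
      finally show ?thesis .
    qed
    note h = this[of "\<lambda>r. q - r" for q] this[of "\<lambda>q. q - r" for r]
    show ?thesis by (intro add_mono sum_mono mult_left_mono h) (auto simp: inj_def)
  qed
  also have "\<dots> = sqrt 2 * gauss_sum_bound * (\<Sum>q\<in>Q. (norm (b q))\<^sup>2)"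
    by (simp add: sum_distrib_left sum_distrib_right flip: sum.distrib) (simp add: mult_ac)
  finally show "integral\<^sup>L lborel E \<le> sqrt 2 * gauss_sum_bound * (\<Sum>q\<in>Q. (norm (b q))\<^sup>2)"
    using abs_ge_self[of "integral\<^sup>L lborel E"] by simp
qed

text \<open>Half of the Gaussian is spent on the power: the n-th power of the absolute value is at
  most exp (n times it), whose exponent is at most n^2 + (pi / 2) u^2.\<close>

lemma monomial_gaussian_bound:
  "\<bar>u\<bar> ^ n * exp (- pi * u\<^sup>2) \<le> exp (real n ^ 2) * exp (- (pi * (1/2)) * u\<^sup>2)"
proof -
  have "\<bar>u\<bar> ^ n \<le> exp \<bar>u\<bar> ^ n"
  proof (rule power_mono)
    show "\<bar>u\<bar> \<le> exp \<bar>u\<bar>" using exp_ge_add_one_self[of "\<bar>u\<bar>"] by linarith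
  qed simp
  also have "\<dots> = exp (real n * \<bar>u\<bar>)" by (simp add: exp_of_nat_mult)
  also have "\<dots> \<le> exp (real n ^ 2 + (pi * (1/2)) * u\<^sup>2)"
  proof -
    have "2 * (real n * \<bar>u\<bar>) \<le> real n ^ 2 + u\<^sup>2" using sum_squares_bound[of "real n" "\<bar>u\<bar>"] by (simp add: mult.assoc)
    moreover have "u\<^sup>2 \<le> pi * u\<^sup>2" using mult_right_mono[of 1 pi "u\<^sup>2"] pi_gt3 by simp
    moreover have "0 \<le> real n ^ 2" by simp
    ultimately have "real n * \<bar>u\<bar> \<le> real n ^ 2 + (pi * (1/2)) * u\<^sup>2" by argo
    then show ?thesis by simp
  qed
  finally have "\<bar>u\<bar> ^ n * exp (- pi * u\<^sup>2) \<le> exp (real n ^ 2 + (pi * (1/2)) * u\<^sup>2) * exp (- pi * u\<^sup>2)"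
    by (rule mult_right_mono) simp
  also have "\<dots> = exp (real n ^ 2) * exp (- (pi * (1/2)) * u\<^sup>2)"
    by (simp add: exp_add[symmetric])
  finally show ?thesis .
qed

text \<open>The square comes from replacing the monomial times the Gaussian by a wider Gaussian, the
  first \<open>gauss_sum_bound\<close> from Cauchy-Schwarz over the positions, the last factor from
  the frequencies at a fixed position.\<close>

definition bessel_const :: "nat \<Rightarrow> real" where
  "bessel_const n = (2 powr (1/4) * exp (real n ^ 2))\<^sup>2 * gauss_sum_bound * (sqrt 2 * gauss_sum_bound)"

text \<open>The terms are grouped by position p. Cauchy-Schwarz with Gaussian weights reduces the
  sum over p to single positions, where \<open>gaussian_window_bessel\<close> applies. The monomial
  is present for the sake of the derivatives.\<close>

lemma lattice_bessel:
  fixes F :: "(int \<times> int) set" and b :: "int \<times> int \<Rightarrow> complex" and n :: nat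
  assumes F: "finite F"
  defines "T \<equiv> \<lambda>x. \<Sum>z\<in>F. b z * (of_real ((x - fst (lat z)) ^ n) * gabor (lat z) x)"
  shows "integrable lborel (\<lambda>x. (norm (T x))\<^sup>2)"
    and "(LINT x|lborel. (norm (T x))\<^sup>2) \<le> bessel_const n * (\<Sum>z\<in>F. (norm (b z))\<^sup>2)"
proof -
  define P Q where "P = fst ` F" and "Q = snd ` F"
  have PQ: "finite P" "finite Q" using F by (auto simp: P_def Q_def)
  \<comment> \<open>Extension of the coefficients by zero to the rectangle P \<times> Q that
    contains F.\<close>
  define c where "c p q = (if (p, q) \<in> F then b (p, q) else 0)" for p q
  have FPQ: "F \<subseteq> P \<times> Q" by (force simp: P_def Q_def)
  have sumF: "(\<Sum>z\<in>F. h z (b z)) = (\<Sum>p\<in>P. \<Sum>q\<in>Q. h (p, q) (c p q))" if "\<And>z. h z 0 = 0" for h :: "int \<times> int \<Rightarrow> complex \<Rightarrow> 'c :: comm_monoid_add"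
  proof -
    have "(\<Sum>p\<in>P. \<Sum>q\<in>Q. h (p, q) (c p q)) = (\<Sum>z\<in>P \<times> Q. h z (c (fst z) (snd z)))"
      by (simp add: sum.cartesian_product case_prod_unfold)
    also have "\<dots> = (\<Sum>z\<in>F. h z (c (fst z) (snd z)))"
      by (rule sum.mono_neutral_right) (use PQ FPQ that in \<open>auto simp: c_def\<close>)
    also have "\<dots> = (\<Sum>z\<in>F. h z (b z))" by (rule sum.cong) (auto simp: c_def)
    finally show ?thesis ..
  qed
  define h where "h p x = (x - real_of_int p) ^ n * (2 powr (1/4) * exp (- pi * (x - real_of_int p)\<^sup>2))" for p :: int and x
  define B where "B p x = (\<Sum>q\<in>Q. c p q * cis (2 * pi * real_of_int q * x))" for p x
  define M where "M = 2 powr (1/4) * exp (real n ^ 2)"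
  define g where "g p x = exp (- (pi * (1/2)) * (x - real_of_int p)\<^sup>2)" for p :: int and x
  have hg: "\<bar>h p x\<bar> \<le> M * g p x" for p x
    using mult_left_mono[OF monomial_gaussian_bound[of "x - real_of_int p" n], of "2 powr (1/4)"]
    by (simp add: h_def M_def g_def abs_mult power_abs mult_ac)
  have T: "T x = (\<Sum>p\<in>P. of_real (h p x) * B p x)" for x
  proof -
    have "T x = (\<Sum>p\<in>P. \<Sum>q\<in>Q. c p q * (of_real ((x - fst (lat (p, q))) ^ n) * gabor (lat (p, q)) x))"
      unfolding T_def by (rule sumF) simp
    also have "\<dots> = (\<Sum>p\<in>P. of_real (h p x) * B p x)"
      by (rule sum.cong) (auto simp: B_def sum_distrib_left h_def gabor_eq lat_def mult_ac)
    finally show ?thesis .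
  qed
  have gsum: "(\<Sum>p\<in>P. g p x) \<le> gauss_sum_bound" for x
  proof -
    have c: "pi * (1/2) \<ge> 1/2" using pi_gt3 by simp
    have g: "g p x = exp (- (pi * (1/2)) * (real_of_int p + (- x))\<^sup>2)" for p by (simp add: g_def power2_commute)
    have "(\<Sum>p\<in>P. g p x) \<le> (\<Sum>\<^sub>\<infinity>p. g p x)"
      unfolding g by (intro finite_sum_le_infsum gauss_int_sum c PQ) auto
    also have "\<dots> \<le> gauss_sum_bound" unfolding g by (rule gauss_int_sum[OF c])
    finally show ?thesis .
  qed
  have g0: "g p x \<ge> 0" for p x by (simp add: g_def)
  have le: "(norm (T x))\<^sup>2 \<le> M\<^sup>2 * gauss_sum_bound * (\<Sum>p\<in>P. g p x * (norm (B p x))\<^sup>2)" for x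
  proof -
    have "norm (T x) \<le> (\<Sum>p\<in>P. M * g p x * norm (B p x))"
      unfolding T by (rule order_trans[OF norm_sum]) (auto simp: norm_mult intro!: sum_mono mult_right_mono hg)
    also have "\<dots> = M * (\<Sum>p\<in>P. sqrt (g p x) * (sqrt (g p x) * norm (B p x)))"
      unfolding sum_distrib_left by (rule sum.cong) (auto simp: g0 mult.assoc simp flip: mult.assoc[of "sqrt _" "sqrt _"])
    finally have "(norm (T x))\<^sup>2 \<le> (M * (\<Sum>p\<in>P. sqrt (g p x) * (sqrt (g p x) * norm (B p x))))\<^sup>2"
      by (rule power_mono) simp
    also have "\<dots> \<le> M\<^sup>2 * ((\<Sum>p\<in>P. (sqrt (g p x))\<^sup>2) * (\<Sum>p\<in>P. (sqrt (g p x) * norm (B p x))\<^sup>2))"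
      unfolding power_mult_distrib[of M] by (intro mult_left_mono Cauchy_Schwarz_ineq_sum) auto
    also have "\<dots> = M\<^sup>2 * ((\<Sum>p\<in>P. g p x) * (\<Sum>p\<in>P. g p x * (norm (B p x))\<^sup>2))"
      by (simp add: power_mult_distrib g0)
    also have "\<dots> \<le> M\<^sup>2 * (gauss_sum_bound * (\<Sum>p\<in>P. g p x * (norm (B p x))\<^sup>2))"
      by (intro mult_left_mono mult_right_mono gsum sum_nonneg mult_nonneg_nonneg g0) auto
    finally show ?thesis by (simp add: mult.assoc)
  qed
  have bi: "integrable lborel (\<lambda>x. g p x * (norm (B p x))\<^sup>2)"
    "(LINT x|lborel. g p x * (norm (B p x))\<^sup>2) \<le> sqrt 2 * gauss_sum_bound * (\<Sum>q\<in>Q. (norm (c p q))\<^sup>2)" for p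
    unfolding g_def B_def by (rule gaussian_window_bessel[OF PQ(2)])+
  have ri: "integrable lborel (\<lambda>x. M\<^sup>2 * gauss_sum_bound * (\<Sum>p\<in>P. g p x * (norm (B p x))\<^sup>2))"
    by (intro integrable_mult_right Bochner_Integration.integrable_sum bi)
  have [measurable]: "T \<in> borel_measurable borel" unfolding T_def by measurable
  show i: "integrable lborel (\<lambda>x. (norm (T x))\<^sup>2)"
    by (rule Bochner_Integration.integrable_bound[OF ri]) (auto intro!: AE_I2 order_trans[OF le abs_ge_self])
  have "(LINT x|lborel. (norm (T x))\<^sup>2) \<le> M\<^sup>2 * gauss_sum_bound * (\<Sum>p\<in>P. (LINT x|lborel. g p x * (norm (B p x))\<^sup>2))"
    using integral_mono[OF i ri le] bi(1) by simp
  also have "\<dots> \<le> M\<^sup>2 * gauss_sum_bound * (\<Sum>p\<in>P. sqrt 2 * gauss_sum_bound * (\<Sum>q\<in>Q. (norm (c p q))\<^sup>2))"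
    by (intro mult_left_mono sum_mono bi mult_nonneg_nonneg gauss_sum_bound_nonneg) auto
  also have "\<dots> = bessel_const n * (\<Sum>p\<in>P. \<Sum>q\<in>Q. (norm (c p q))\<^sup>2)"
    by (simp add: bessel_const_def M_def sum_distrib_left mult.assoc)
  also have "(\<Sum>p\<in>P. \<Sum>q\<in>Q. (norm (c p q))\<^sup>2) = (\<Sum>z\<in>F. (norm (b z))\<^sup>2)"
    using sumF[of "\<lambda>z w. (norm w)\<^sup>2"] by simp
  finally show "(LINT x|lborel. (norm (T x))\<^sup>2) \<le> bessel_const n * (\<Sum>z\<in>F. (norm (b z))\<^sup>2)" .
qed

section \<open>Convergence in Sobolev spaces\<close>

lemma L2_linear:
  assumes "f \<in> L2" "g \<in> L2"
  shows "(\<lambda>x. a * f x + b * g x) \<in> L2"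
    and "(LINT x|lborel. (norm (a * f x + b * g x))\<^sup>2) \<le> 2 * (norm a)\<^sup>2 * (LINT x|lborel. (norm (f x))\<^sup>2) + 2 * (norm b)\<^sup>2 * (LINT x|lborel. (norm (g x))\<^sup>2)"
proof -
  have [measurable]: "f \<in> borel_measurable borel" "g \<in> borel_measurable borel"
    and i: "integrable lborel (\<lambda>x. (norm (f x))\<^sup>2)" "integrable lborel (\<lambda>x. (norm (g x))\<^sup>2)"
    using assms by (auto simp: L2_def)
  have le: "(norm (a * f x + b * g x))\<^sup>2 \<le> 2 * (norm a)\<^sup>2 * (norm (f x))\<^sup>2 + 2 * (norm b)\<^sup>2 * (norm (g x))\<^sup>2" for x
  proof -
    have "(norm (a * f x + b * g x))\<^sup>2 \<le> (norm a * norm (f x) + norm b * norm (g x))\<^sup>2"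
      by (intro power_mono order_trans[OF norm_triangle_ineq]) (auto simp: norm_mult)
    also have "\<dots> \<le> 2 * (norm a * norm (f x))\<^sup>2 + 2 * (norm b * norm (g x))\<^sup>2"
      using sum_squares_bound[of "norm a * norm (f x)" "norm b * norm (g x)"] by (simp add: power2_sum)
    finally show ?thesis by (simp add: power_mult_distrib)
  qed
  have r: "integrable lborel (\<lambda>x. 2 * (norm a)\<^sup>2 * (norm (f x))\<^sup>2 + 2 * (norm b)\<^sup>2 * (norm (g x))\<^sup>2)"
    using i by (intro Bochner_Integration.integrable_add integrable_mult_right)
  then have l: "integrable lborel (\<lambda>x. (norm (a * f x + b * g x))\<^sup>2)"
    by (rule Bochner_Integration.integrable_bound) (use le in \<open>auto intro!: AE_I2 order_trans[OF _ abs_ge_self]\<close>)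
  then show "(\<lambda>x. a * f x + b * g x) \<in> L2" by (auto simp: L2_def)
  show "(LINT x|lborel. (norm (a * f x + b * g x))\<^sup>2) \<le> 2 * (norm a)\<^sup>2 * (LINT x|lborel. (norm (f x))\<^sup>2) + 2 * (norm b)\<^sup>2 * (LINT x|lborel. (norm (g x))\<^sup>2)"
    using integral_mono[OF l r le] i by simp
qed

lemma L2_sum:
  assumes "finite A" "\<And>a. a \<in> A \<Longrightarrow> f a \<in> L2"
  shows "(\<lambda>x. \<Sum>a\<in>A. f a x) \<in> L2"
    and "(LINT x|lborel. (norm (\<Sum>a\<in>A. f a x))\<^sup>2) \<le> real (card A) * (\<Sum>a\<in>A. LINT x|lborel. (norm (f a x))\<^sup>2)"
proof -
  have m[measurable]: "f a \<in> borel_measurable borel" and i: "integrable lborel (\<lambda>x. (norm (f a x))\<^sup>2)" if "a \<in> A" for a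
    using assms(2)[OF that] by (auto simp: L2_def)
  have le: "(norm (\<Sum>a\<in>A. f a x))\<^sup>2 \<le> real (card A) * (\<Sum>a\<in>A. (norm (f a x))\<^sup>2)" for x
  proof -
    have "(norm (\<Sum>a\<in>A. f a x))\<^sup>2 \<le> (\<Sum>a\<in>A. 1 * norm (f a x))\<^sup>2"
      by (intro power_mono) (auto intro: norm_sum)
    also have "\<dots> \<le> (\<Sum>a\<in>A. 1\<^sup>2) * (\<Sum>a\<in>A. (norm (f a x))\<^sup>2)" by (rule Cauchy_Schwarz_ineq_sum)
    finally show ?thesis by simp
  qed
  have ms: "(\<lambda>x. \<Sum>a\<in>A. f a x) \<in> borel_measurable borel" by (intro borel_measurable_sum m)
  have r: "integrable lborel (\<lambda>x. real (card A) * (\<Sum>a\<in>A. (norm (f a x))\<^sup>2))"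
    by (intro integrable_mult_right Bochner_Integration.integrable_sum i)
  have l: "integrable lborel (\<lambda>x. (norm (\<Sum>a\<in>A. f a x))\<^sup>2)"
    by (rule Bochner_Integration.integrable_bound[OF r]) (use ms in \<open>auto intro!: AE_I2 order_trans[OF le abs_ge_self]\<close>)
  show "(\<lambda>x. \<Sum>a\<in>A. f a x) \<in> L2" using l ms by (auto simp: L2_def)
  show "(LINT x|lborel. (norm (\<Sum>a\<in>A. f a x))\<^sup>2) \<le> real (card A) * (\<Sum>a\<in>A. LINT x|lborel. (norm (f a x))\<^sup>2)"
    using integral_mono[OF l r le] i by simp
qed

lemma L2_inner_bound:
  assumes "f \<in> L2" "g \<in> L2"
  shows "integrable lborel (\<lambda>x. f x * cnj (g x))"
    and "(norm (L2_inner f g))\<^sup>2 \<le> (LINT x|lborel. (norm (f x))\<^sup>2) * (LINT x|lborel. (norm (g x))\<^sup>2)"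
proof -
  have [measurable]: "f \<in> borel_measurable borel" "g \<in> borel_measurable borel"
    and i: "integrable lborel (\<lambda>x. (norm (f x))\<^sup>2)" "integrable lborel (\<lambda>x. (norm (g x))\<^sup>2)"
    using assms by (auto simp: L2_def)
  note cs = integral_Cauchy_Schwarz[OF _ _ i]
  have "integrable lborel (\<lambda>x. norm (f x) * norm (g x))" by (rule cs(1)) auto
  then show "integrable lborel (\<lambda>x. f x * cnj (g x))"
    by (rule Bochner_Integration.integrable_bound) (auto simp: norm_mult)
  have "norm (L2_inner f g) \<le> (LINT x|lborel. \<bar>norm (f x) * norm (g x)\<bar>)"
    unfolding L2_inner_def by (rule order_trans[OF integral_norm_bound]) (simp add: norm_mult)
  then have "(norm (L2_inner f g))\<^sup>2 \<le> (LINT x|lborel. \<bar>norm (f x) * norm (g x)\<bar>)\<^sup>2" by (intro power_mono) auto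
  also have "\<dots> \<le> (LINT x|lborel. (norm (f x))\<^sup>2) * (LINT x|lborel. (norm (g x))\<^sup>2)" by (rule cs(2)) auto
  finally show "(norm (L2_inner f g))\<^sup>2 \<le> (LINT x|lborel. (norm (f x))\<^sup>2) * (LINT x|lborel. (norm (g x))\<^sup>2)" .
qed

lemma feichtinger_gabor_sum:
  assumes "finite F"
  shows "(\<lambda>x. \<Sum>i\<in>F. c i * gabor (\<mu> i) x) \<in> feichtinger"
    and "trf (\<lambda>x. \<Sum>i\<in>F. c i * gabor (\<mu> i) x) \<eta> = (\<Sum>i\<in>F. c i * trf (gabor (\<mu> i)) \<eta>)"
proof -
  have "(\<lambda>x. \<Sum>i\<in>F. c i * gabor (\<mu> i) x) \<in> feichtinger \<and> (\<forall>\<eta>. trf (\<lambda>x. \<Sum>i\<in>F. c i * gabor (\<mu> i) x) \<eta> = (\<Sum>i\<in>F. c i * trf (gabor (\<mu> i)) \<eta>))"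
    using assms
  proof (induction F)
    case empty
    then show ?case
      using feichtinger_linear[OF gabor_feichtinger gabor_feichtinger, of 0 undefined 0 undefined] by (auto simp: L2_inner_def)
  next
    case (insert i F)
    let ?s = "\<lambda>x. \<Sum>i\<in>F. c i * gabor (\<mu> i) x"
    have eq: "(\<lambda>x. \<Sum>i\<in>insert i F. c i * gabor (\<mu> i) x) = (\<lambda>x. c i * gabor (\<mu> i) x + 1 * ?s x)"
      using insert by simp
    have s: "?s \<in> feichtinger" "\<And>\<eta>. trf ?s \<eta> = (\<Sum>i\<in>F. c i * trf (gabor (\<mu> i)) \<eta>)" using insert by auto
    show ?case unfolding eq
      using feichtinger_linear(1)[where a = "c i" and b = 1, OF gabor_feichtinger[of "\<mu> i"] s(1)]
        fun_cong[OF feichtinger_linear(2)[where a = "c i" and b = 1, OF gabor_feichtinger[of "\<mu> i"] s(1)]] s(2) insert by simp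
  qed
  then show "(\<lambda>x. \<Sum>i\<in>F. c i * gabor (\<mu> i) x) \<in> feichtinger"
    and "trf (\<lambda>x. \<Sum>i\<in>F. c i * gabor (\<mu> i) x) \<eta> = (\<Sum>i\<in>F. c i * trf (gabor (\<mu> i)) \<eta>)" by blast+
qed

lemma L2_inner_gabor_sum:
  assumes "finite F" "g \<in> L2"
  shows "L2_inner (\<lambda>x. \<Sum>i\<in>F. c i * gabor (\<mu> i) x) g = (\<Sum>i\<in>F. c i * L2_inner (gabor (\<mu> i)) g)"
proof -
  have "(\<lambda>x. (\<Sum>i\<in>F. c i * gabor (\<mu> i) x) * cnj (g x)) = (\<lambda>x. \<Sum>i\<in>F. c i * (gabor (\<mu> i) x * cnj (g x)))"
    by (simp add: sum_distrib_right mult.assoc)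
  then show ?thesis unfolding L2_inner_def
    by (simp only:) (simp add: L2_inner_bound(1)[OF gabor_in_L2 assms(2)])
qed

lemma norm_infsum_le_of_finite:
  fixes f :: "'a \<Rightarrow> complex"
  assumes "f summable_on A" "\<And>F. finite F \<Longrightarrow> F \<subseteq> A \<Longrightarrow> norm (sum f F) \<le> M"
  shows "norm (infsum f A) \<le> M"
proof -
  have "(sum f \<longlongrightarrow> infsum f A) (finite_subsets_at_top A)"
    using has_sum_infsum[OF assms(1)] by (simp add: has_sum_def)
  then show ?thesis
    by (rule Lim_norm_ubound[rotated]) (auto intro!: eventually_finite_subsets_at_top_weakI assms(2))
qed

text \<open>Duality turns the weak expansion into a norm estimate. The squared norm X of the
  remainder \<phi> is the tail of the expansion paired with \<phi> itself; Cauchy-Schwarz and the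
  Bessel inequality bound the finite parts of that tail by sqrt (K X), hence X \<le> K.\<close>

lemma gabor_expansion_error:
  fixes f :: "real \<Rightarrow> complex"
  assumes f: "f \<in> feichtinger" and s: "(\<lambda>z. (norm (beta (lat z) f))\<^sup>2) summable_on UNIV" and F: "finite F"
  shows "(LINT x|lborel. (norm (f x - (\<Sum>z\<in>F. beta (lat z) f * gabor (lat z) x)))\<^sup>2) \<le> bessel_const 0 * (\<Sum>\<^sub>\<infinity>z\<in>-F. (norm (beta (lat z) f))\<^sup>2)"
proof -
  let ?S = "\<lambda>F x. \<Sum>z\<in>F. beta (lat z) f * gabor (lat z) x"
  define \<phi> where "\<phi> x = f x - ?S F x" for x
  have S: "?S F \<in> feichtinger" if "finite F" for F by (rule feichtinger_gabor_sum[OF that])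
  have \<phi>: "\<phi> \<in> feichtinger"
    using feichtinger_linear(1)[OF f S[OF F], of 1 "- 1"] by (simp add: \<phi>_def[abs_def])
  then have \<phi>2: "\<phi> \<in> L2" by (simp add: feichtinger_def)
  have f2: "f \<in> L2" using f by (simp add: feichtinger_def)
  define X where "X = (LINT x|lborel. (norm (\<phi> x))\<^sup>2)"
  define t where "t z = beta (lat z) f * L2_inner (gabor (lat z)) \<phi>" for z
  have ts: "t summable_on A" for A
    using abs_summable_summable[OF summable_on_subset_banach[OF beta_expansion(2)[OF f \<phi>]]] unfolding t_def by blast
  have SF: "L2_inner (?S G) \<phi> = sum t G" if "finite G" for G
    unfolding t_def by (rule L2_inner_gabor_sum[OF that \<phi>2])
  have "complex_of_real X = L2_inner \<phi> \<phi>"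
    unfolding X_def L2_inner_def integral_complex_of_real[symmetric] complex_norm_square ..
  also have "\<dots> = L2_inner f \<phi> - L2_inner (?S F) \<phi>"
  proof -
    have "(\<lambda>x. \<phi> x * cnj (\<phi> x)) = (\<lambda>x. f x * cnj (\<phi> x) - ?S F x * cnj (\<phi> x))"
      by (simp add: \<phi>_def algebra_simps)
    moreover have "?S F \<in> L2" using S[OF F] by (simp add: feichtinger_def)
    ultimately show ?thesis unfolding L2_inner_def
      by (simp only:) (rule Bochner_Integration.integral_diff; intro L2_inner_bound f2 \<phi>2)
  qed
  also have "\<dots> = infsum t UNIV - sum t F" unfolding SF[OF F] using beta_expansion(1)[OF f \<phi>] by (simp add: t_def[abs_def])
  also have "infsum t UNIV = sum t F + infsum t (- F)"
    using infsum_Un_disjoint[OF ts ts, of F "- F"] F by (simp add: Compl_partition)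
  finally have X: "complex_of_real X = infsum t (- F)" by simp
  define K where "K = bessel_const 0 * (\<Sum>\<^sub>\<infinity>z\<in>-F. (norm (beta (lat z) f))\<^sup>2)"
  have b0: "bessel_const 0 \<ge> 0" unfolding bessel_const_def by (intro mult_nonneg_nonneg gauss_sum_bound_nonneg) auto
  have X0: "X \<ge> 0" by (simp add: X_def)
  have "norm (sum t G) \<le> sqrt (K * X)" if G: "finite G" "G \<subseteq> - F" for G
  proof (rule real_le_rsqrt)
    have "(norm (sum t G))\<^sup>2 \<le> (LINT x|lborel. (norm (?S G x))\<^sup>2) * X"
      unfolding SF[OF G(1), symmetric] X_def by (rule L2_inner_bound(2)) (use S[OF G(1)] \<phi>2 in \<open>auto simp: feichtinger_def\<close>)
    also have "\<dots> \<le> (bessel_const 0 * (\<Sum>z\<in>G. (norm (beta (lat z) f))\<^sup>2)) * X"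
      using lattice_bessel(2)[OF G(1), of "\<lambda>z. beta (lat z) f" 0] X0 by (intro mult_right_mono) auto
    also have "\<dots> \<le> K * X"
      unfolding K_def using G by (intro mult_right_mono mult_left_mono X0 b0 finite_sum_le_infsum summable_on_subset_banach[OF s]) auto
    finally show "(norm (sum t G))\<^sup>2 \<le> K * X" .
  qed
  from norm_infsum_le_of_finite[OF ts[of "- F"] this] have "X \<le> sqrt (K * X)"
    unfolding X[symmetric] using X0 by simp
  then have "X * X \<le> K * X" using X0 by (metis abs_of_nonneg power2_eq_square power_mono real_sqrt_pow2_iff real_sqrt_ge_0_iff order_trans)
  moreover have "K \<ge> 0" unfolding K_def by (intro mult_nonneg_nonneg b0 infsum_nonneg) auto
  ultimately have "X \<le> K" using X0 by (cases "X = 0") auto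
  then show ?thesis by (simp add: X_def K_def \<phi>_def)
qed

text \<open>Since d/dx = 2 pi (annih - x), the k-th derivative is a combination of the iterates of
  \<open>annih\<close> with polynomial coefficients, and these are the coefficients. The recursion
  is the product rule.\<close>

fun hermite_coeff :: "nat \<Rightarrow> nat \<Rightarrow> real poly" where
  "hermite_coeff 0 j = (if j = 0 then 1 else 0)"
| "hermite_coeff (Suc k) j = pderiv (hermite_coeff k j) - [:0, 2 * pi:] * hermite_coeff k j +
     (if j = 0 then 0 else smult (2 * pi) (hermite_coeff k (j - 1)))"

lemma hermite_coeff_zero: "j > k \<Longrightarrow> hermite_coeff k j = 0"
  by (induction k arbitrary: j) auto

lemma hermite_coeff_step:
  fixes u :: "nat \<Rightarrow> complex"
  shows "(\<Sum>j\<le>Suc k. of_real (poly (hermite_coeff (Suc k) j) x) * u j) =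
    (\<Sum>j\<le>k. of_real (poly (hermite_coeff k j) x) * (2 * of_real pi * (u (Suc j) - of_real x * u j)) + of_real (poly (pderiv (hermite_coeff k j)) x) * u j)"
proof -
  let ?P = "\<lambda>j. of_real (poly (hermite_coeff k j) x)" and ?D = "\<lambda>j. of_real (poly (pderiv (hermite_coeff k j)) x)"
  have "(\<Sum>j\<le>Suc k. of_real (poly (hermite_coeff (Suc k) j) x) * u j) =
    (\<Sum>j\<le>Suc k. (?D j - 2 * of_real pi * of_real x * ?P j) * u j) + (\<Sum>j\<le>Suc k. (if j = 0 then 0 else 2 * of_real pi * ?P (j - 1)) * u j)"
    unfolding sum.distrib[symmetric] by (rule sum.cong) (auto simp: algebra_simps)
  also have "(\<Sum>j\<le>Suc k. (?D j - 2 * of_real pi * of_real x * ?P j) * u j) = (\<Sum>j\<le>k. (?D j - 2 * of_real pi * of_real x * ?P j) * u j)"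
    by (simp add: hermite_coeff_zero)
  also have "(\<Sum>j\<le>Suc k. (if j = 0 then 0 else 2 * of_real pi * ?P (j - 1)) * u j) = (\<Sum>j\<le>k. 2 * of_real pi * ?P j * u (Suc j))"
    by (subst sum.atMost_Suc_shift) simp
  finally show ?thesis by (simp add: sum.distrib[symmetric] algebra_simps)
qed

lemma times_diff_poly: "times_diff n (\<lambda>x. complex_of_real (poly P x))"
proof (induction P)
  case (pCons a P)
  have "times_diff n (\<lambda>x. of_real a + of_real x * complex_of_real (poly P x))"
    by (intro times_diff_add times_diff_mult times_diff_const times_diff_ident pCons)
  then show ?case by simp
qed (simp add: times_diff_const)

lemma poly_has_vector_derivative: "((\<lambda>x. complex_of_real (poly P x)) has_vector_derivative of_real (poly (pderiv P) x)) (at x)"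
  using poly_DERIV[of P x] by (intro has_vector_derivative_of_real) (simp add: has_real_derivative_iff_has_vector_derivative)

lemma is_weak_deriv_sum:
  assumes "finite A" "\<And>a. a \<in> A \<Longrightarrow> is_weak_deriv (f a) (g a)"
  shows "is_weak_deriv (\<lambda>x. \<Sum>a\<in>A. f a x) (\<lambda>x. \<Sum>a\<in>A. g a x)"
  using assms
proof (induction A)
  case empty
  then show ?case by (simp add: is_weak_deriv_classical)
next
  case (insert a A)
  then show ?case using is_weak_deriv_linear[of "f a" "g a" "\<lambda>x. \<Sum>a\<in>A. f a x" "\<lambda>x. \<Sum>a\<in>A. g a x" 1 1] by simp
qed

text \<open>This carries the regularity of the \<open>annih\<close> iterates over to plain weak
  derivatives. At each step the iterate is replaced almost everywhere by the combination of
  \<open>annih\<close> iterates, which can be differentiated by the product rule.\<close>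

lemma weak_deriv_iterate:
  assumes u: "annih_regular m u" and k: "k \<le> m"
  shows "AE x in lborel. (weak_deriv ^^ k) u x = (\<Sum>j\<le>k. of_real (poly (hermite_coeff k j) x) * (annih ^^ j) u x)"
    and "locally_integrable ((weak_deriv ^^ k) u)"
    and "i < k \<Longrightarrow> weakly_differentiable ((weak_deriv ^^ i) u)"
proof -
  have "(AE x in lborel. (weak_deriv ^^ k) u x = (\<Sum>j\<le>k. of_real (poly (hermite_coeff k j) x) * (annih ^^ j) u x)) \<and>
    locally_integrable ((weak_deriv ^^ k) u) \<and> (\<forall>i<k. weakly_differentiable ((weak_deriv ^^ i) u))"
    using k
  proof (induction k)
    case 0
    then show ?case using u by (auto simp: annih_regular_def)
  next
    case (Suc k)
    then have IH: "AE x in lborel. (weak_deriv ^^ k) u x = (\<Sum>j\<le>k. of_real (poly (hermite_coeff k j) x) * (annih ^^ j) u x)"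
      "locally_integrable ((weak_deriv ^^ k) u)" "\<forall>i<k. weakly_differentiable ((weak_deriv ^^ i) u)" by auto
    let ?a = "\<lambda>j. (annih ^^ j) u" and ?P = "\<lambda>j x. complex_of_real (poly (hermite_coeff k j) x)" and ?D = "\<lambda>j x. complex_of_real (poly (pderiv (hermite_coeff k j)) x)"
    have w: "is_weak_deriv (?a j) (weak_deriv (?a j))" if "j \<le> k" for j
      using u Suc.prems that by (intro weakly_differentiableD) (auto simp: annih_regular_def)
    have wm: "is_weak_deriv (\<lambda>x. \<Sum>j\<le>k. ?a j x * ?P j x) (\<lambda>x. \<Sum>j\<le>k. weak_deriv (?a j) x * ?P j x + ?a j x * ?D j x)"
      by (intro is_weak_deriv_sum is_weak_deriv_mult_smooth w times_diff_poly poly_has_vector_derivative)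
        (auto intro!: continuous_intros)
    have wu: "is_weak_deriv ((weak_deriv ^^ k) u) (\<lambda>x. \<Sum>j\<le>k. weak_deriv (?a j) x * ?P j x + ?a j x * ?D j x)"
    proof (rule is_weak_deriv_cong_AE[OF wm])
      show "(weak_deriv ^^ k) u \<in> borel_measurable borel" using IH(2) by (rule locally_integrable_measurable)
      show "(\<lambda>x. \<Sum>j\<le>k. weak_deriv (?a j) x * ?P j x + ?a j x * ?D j x) \<in> borel_measurable borel"
        using wm by (intro locally_integrable_measurable) (auto simp: is_weak_deriv_def)
      show "AE x in lborel. (\<Sum>j\<le>k. ?a j x * ?P j x) = (weak_deriv ^^ k) u x"
        using IH(1) by eventually_elim (simp add: mult.commute)
    qed auto
    have wd: "weak_deriv (?a j) x = 2 * of_real pi * (?a (Suc j) x - of_real x * ?a j x)" for j x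
      by (simp add: annih_def)
    have "AE x in lborel. (weak_deriv ^^ Suc k) u x = (\<Sum>j\<le>Suc k. of_real (poly (hermite_coeff (Suc k) j) x) * ?a j x)"
      using weak_deriv_AE_eq(2)[OF wu]
    proof eventually_elim
      case (elim x)
      show ?case unfolding hermite_coeff_step[where u = "\<lambda>j. ?a j x"] funpow.simps o_def elim wd by (simp add: mult_ac)
    qed
    moreover have "locally_integrable ((weak_deriv ^^ Suc k) u)"
      using weakly_differentiableD[OF weak_deriv_AE_eq(1)[OF wu]] by (simp add: is_weak_deriv_def)
    ultimately show ?case using IH(3) weak_deriv_AE_eq(1)[OF wu] by (auto simp: less_Suc_eq)
  qed
  then show "AE x in lborel. (weak_deriv ^^ k) u x = (\<Sum>j\<le>k. of_real (poly (hermite_coeff k j) x) * (annih ^^ j) u x)"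
    and "locally_integrable ((weak_deriv ^^ k) u)"
    and "i < k \<Longrightarrow> weakly_differentiable ((weak_deriv ^^ i) u)" by auto
qed

text \<open>The symbol depends on \<open>z - x\<close> only; this is what makes the Bessel inequality applicable to it, uniformly in the lattice point \<open>z\<close>.\<close>

lemma hermite_symbol:
  "\<exists>H :: complex poly. degree H \<le> k \<and> (\<forall>x z. (\<Sum>j\<le>k. of_real (poly (hermite_coeff k j) x) * z ^ j) = poly H (z - of_real x))"
proof (induction k)
  case 0
  then show ?case by (intro exI[of _ 1]) auto
next
  case (Suc k)
  then obtain H :: "complex poly" where H: "degree H \<le> k" "\<And>x z. (\<Sum>j\<le>k. of_real (poly (hermite_coeff k j) x) * z ^ j) = poly H (z - of_real x)" by auto
  define H' where "H' = [:0, 2 * of_real pi:] * H - pderiv H"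
  have d: "(\<Sum>j\<le>k. of_real (poly (pderiv (hermite_coeff k j)) x) * z ^ j) = - poly (pderiv H) (z - of_real x)" for x z
  proof -
    have "((\<lambda>x. \<Sum>j\<le>k. of_real (poly (hermite_coeff k j) x) * z ^ j) has_vector_derivative (\<Sum>j\<le>k. of_real (poly (pderiv (hermite_coeff k j)) x) * z ^ j)) (at x)"
      by (intro has_vector_derivative_sum has_vector_derivative_mult_left poly_has_vector_derivative)
    moreover have "((\<lambda>w. poly H (z - w)) has_field_derivative - poly (pderiv H) (z - of_real x)) (at (of_real x))"
      by (auto intro!: derivative_eq_intros poly_DERIV[THEN DERIV_chain2])
    from has_vector_derivative_real_field[OF this]
    have "((\<lambda>x. \<Sum>j\<le>k. of_real (poly (hermite_coeff k j) x) * z ^ j) has_vector_derivative - poly (pderiv H) (z - of_real x)) (at x)"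
      unfolding H(2) .
    ultimately show ?thesis by (rule vector_derivative_unique_at)
  qed
  have "(\<Sum>j\<le>Suc k. of_real (poly (hermite_coeff (Suc k) j) x) * z ^ j) = poly H' (z - of_real x)" for x z
  proof -
    have "(\<Sum>j\<le>Suc k. of_real (poly (hermite_coeff (Suc k) j) x) * z ^ j) = 2 * of_real pi * (z - of_real x) * (\<Sum>j\<le>k. of_real (poly (hermite_coeff k j) x) * z ^ j) + (\<Sum>j\<le>k. of_real (poly (pderiv (hermite_coeff k j)) x) * z ^ j)"
      unfolding hermite_coeff_step sum_distrib_left sum.distrib[symmetric] by (rule sum.cong) (auto simp: algebra_simps)
    then show ?thesis unfolding d H(2) H'_def by (simp add: algebra_simps)
  qed
  moreover have "degree H' \<le> Suc k"
  proof -
    have "degree ([:0, 2 * of_real pi:] * H) \<le> Suc k"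
      using degree_mult_le[of "[:0, 2 * of_real pi:]" H] H(1) by (auto split: if_splits)
    moreover have "degree (pderiv H) \<le> Suc k" using H(1) by (simp add: degree_pderiv)
    ultimately show ?thesis unfolding H'_def by (rule degree_diff_le)
  qed
  ultimately show ?case by blast
qed

lemma lattice_poly_bessel:
  fixes H :: "complex poly"
  assumes "degree H \<le> k"
  shows "\<exists>C\<ge>0. \<forall>F (b :: int \<times> int \<Rightarrow> complex). finite F \<longrightarrow>
    (\<lambda>x. \<Sum>z\<in>F. b z * (poly H (cpoint (lat z) - of_real x) * gabor (lat z) x)) \<in> L2 \<and>
    (LINT x|lborel. (norm (\<Sum>z\<in>F. b z * (poly H (cpoint (lat z) - of_real x) * gabor (lat z) x)))\<^sup>2) \<le>
      C * (\<Sum>z\<in>F. ((norm (lat z))\<^sup>2 + 1) ^ k * (norm (b z))\<^sup>2)"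
proof -
  define A where "A = (SIGMA n:{..k}. {..n :: nat})"
  define h where "h a = coeff H (fst a) * of_nat (fst a choose snd a) * \<i> ^ snd a * (- 1) ^ (fst a - snd a)" for a :: "nat \<times> nat"
  define C where "C = real (card A) * (\<Sum>a\<in>A. (norm (h a))\<^sup>2 * bessel_const (fst a - snd a))"
  have bc: "bessel_const n \<ge> 0" for n unfolding bessel_const_def by (intro mult_nonneg_nonneg gauss_sum_bound_nonneg) auto
  have fA: "finite A" by (simp add: A_def)
  have Hx: "poly H (cpoint (lat z) - of_real x) = (\<Sum>a\<in>A. h a * of_real (snd (lat z) ^ snd a) * of_real ((x - fst (lat z)) ^ (fst a - snd a)))" for z x
  proof -
    have w: "cpoint (lat z) - of_real x = \<i> * of_real (snd (lat z)) + (- 1) * of_real (x - fst (lat z))"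
      by (simp add: complex_eq_iff)
    have "poly H (cpoint (lat z) - of_real x) = (\<Sum>n\<le>k. coeff H n * (cpoint (lat z) - of_real x) ^ n)"
      unfolding poly_altdef by (rule sum.mono_neutral_left) (use assms in \<open>auto simp: coeff_eq_0\<close>)
    also have "\<dots> = (\<Sum>n\<le>k. \<Sum>i\<le>n. h (n, i) * of_real (snd (lat z) ^ i) * of_real ((x - fst (lat z)) ^ (n - i)))"
      unfolding w binomial_ring sum_distrib_left power_mult_distrib by (intro sum.cong refl) (simp add: h_def mult_ac)
    also have "\<dots> = (\<Sum>a\<in>A. h a * of_real (snd (lat z) ^ snd a) * of_real ((x - fst (lat z)) ^ (fst a - snd a)))"
      unfolding A_def by (subst sum.Sigma) (auto simp: case_prod_unfold)
    finally show ?thesis .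
  qed
  show ?thesis
  proof (intro exI[of _ C] conjI allI impI)
    show "C \<ge> 0" unfolding C_def by (intro mult_nonneg_nonneg sum_nonneg bc) auto
    fix F :: "(int \<times> int) set" and b :: "int \<times> int \<Rightarrow> complex" assume F: "finite F"
    define B where "B = (\<Sum>z\<in>F. ((norm (lat z))\<^sup>2 + 1) ^ k * (norm (b z))\<^sup>2)"
    define T where "T a x = (\<Sum>z\<in>F. (h a * of_real (snd (lat z) ^ snd a) * b z) * (of_real ((x - fst (lat z)) ^ (fst a - snd a)) * gabor (lat z) x))" for a x
    have eq: "(\<Sum>z\<in>F. b z * (poly H (cpoint (lat z) - of_real x) * gabor (lat z) x)) = (\<Sum>a\<in>A. T a x)" for x
      unfolding T_def Hx by (subst sum.swap) (auto simp: sum_distrib_left sum_distrib_right mult_ac intro!: sum.cong)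
    note lb = lattice_bessel[OF F, of "\<lambda>z. h a * of_real (snd (lat z) ^ snd a) * b z" "fst a - snd a" for a, folded T_def]
    have T2: "T a \<in> L2" for a using lb(1)[of a] unfolding L2_def T_def by auto
    have Tb: "(LINT x|lborel. (norm (T a x))\<^sup>2) \<le> ((norm (h a))\<^sup>2 * bessel_const (fst a - snd a)) * B" if a: "a \<in> A" for a
    proof -
      have "(\<Sum>z\<in>F. (norm (h a * of_real (snd (lat z) ^ snd a) * b z))\<^sup>2) \<le> (\<Sum>z\<in>F. (norm (h a))\<^sup>2 * (((norm (lat z))\<^sup>2 + 1) ^ k * (norm (b z))\<^sup>2))"
      proof (rule sum_mono)
        fix z
        have "(snd (lat z))\<^sup>2 \<le> (norm (lat z))\<^sup>2 + 1" by (cases "lat z") (simp add: norm_prod_def)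
        then have "((snd (lat z))\<^sup>2) ^ snd a \<le> ((norm (lat z))\<^sup>2 + 1) ^ snd a" by (intro power_mono) auto
        also have "\<dots> \<le> ((norm (lat z))\<^sup>2 + 1) ^ k" using a by (intro power_increasing) (auto simp: A_def)
        finally have "(norm (of_real (snd (lat z) ^ snd a) :: complex))\<^sup>2 \<le> ((norm (lat z))\<^sup>2 + 1) ^ k"
          by (simp only: norm_of_real power2_abs power_mult[symmetric] mult.commute)
        then have "(norm (h a))\<^sup>2 * ((norm (of_real (snd (lat z) ^ snd a) :: complex))\<^sup>2 * (norm (b z))\<^sup>2) \<le> (norm (h a))\<^sup>2 * (((norm (lat z))\<^sup>2 + 1) ^ k * (norm (b z))\<^sup>2)"
          by (intro mult_left_mono mult_right_mono) auto
        then show "(norm (h a * of_real (snd (lat z) ^ snd a) * b z))\<^sup>2 \<le> (norm (h a))\<^sup>2 * (((norm (lat z))\<^sup>2 + 1) ^ k * (norm (b z))\<^sup>2)"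
          unfolding norm_mult power_mult_distrib mult.assoc .
      qed
      also have "\<dots> = (norm (h a))\<^sup>2 * B" by (simp add: B_def sum_distrib_left)
      finally have "bessel_const (fst a - snd a) * (\<Sum>z\<in>F. (norm (h a * of_real (snd (lat z) ^ snd a) * b z))\<^sup>2) \<le> bessel_const (fst a - snd a) * ((norm (h a))\<^sup>2 * B)"
        by (intro mult_left_mono bc)
      with lb(2)[of a] show ?thesis by (simp add: mult_ac)
    qed
    show "(\<lambda>x. \<Sum>z\<in>F. b z * (poly H (cpoint (lat z) - of_real x) * gabor (lat z) x)) \<in> L2"
      unfolding eq by (rule L2_sum[OF fA T2])
    have "(LINT x|lborel. (norm (\<Sum>a\<in>A. T a x))\<^sup>2) \<le> real (card A) * (\<Sum>a\<in>A. LINT x|lborel. (norm (T a x))\<^sup>2)"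
      by (rule L2_sum(2)[OF fA T2])
    also have "\<dots> \<le> real (card A) * (\<Sum>a\<in>A. ((norm (h a))\<^sup>2 * bessel_const (fst a - snd a)) * B)"
      by (intro mult_left_mono sum_mono Tb) auto
    also have "\<dots> = C * B" by (simp add: C_def sum_distrib_right mult.assoc)
    finally show "(LINT x|lborel. (norm (\<Sum>z\<in>F. b z * (poly H (cpoint (lat z) - of_real x) * gabor (lat z) x)))\<^sup>2) \<le>
      C * (\<Sum>z\<in>F. ((norm (lat z))\<^sup>2 + 1) ^ k * (norm (b z))\<^sup>2)" unfolding eq B_def .
  qed
qed

lemma integral_le_of_truncations:
  fixes h :: "real \<Rightarrow> real"
  assumes [measurable]: "h \<in> borel_measurable borel" and h: "\<And>x. h x \<ge> 0"
    and i: "\<And>n :: nat. integrable lborel (\<lambda>x. indicator {- real n..real n} x * h x)"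
    and K: "\<And>n :: nat. (LINT x|lborel. indicator {- real n..real n} x * h x) \<le> K"
  shows "integrable lborel h" "integral\<^sup>L lborel h \<le> K"
proof -
  define f where "f n x = indicator {- real n..real n} x * h x" for n and x
  have mono: "mono (\<lambda>n. f n x)" for x
    by (rule monoI) (use h in \<open>auto simp: f_def indicator_def\<close>)
  have lim: "(\<lambda>n. f n x) \<longlonglongrightarrow> h x" for x
  proof -
    obtain N where "\<bar>x\<bar> \<le> real N" using real_arch_simple by blast
    then have "\<forall>\<^sub>F n in sequentially. f n x = h x"
      by (intro eventually_sequentiallyI[of N]) (auto simp: f_def indicator_def)
    then show ?thesis by (rule tendsto_eventually)
  qed
  have fi: "integrable lborel (f n)" for n using i[of n] by (simp add: f_def[abs_def])
  have inc: "incseq (\<lambda>n. integral\<^sup>L lborel (f n))"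
    by (intro incseq_SucI integral_mono fi monoD[OF mono]) auto
  have "\<forall>n. integral\<^sup>L lborel (f n) \<le> K" using K by (simp add: f_def[abs_def])
  from incseq_convergent[OF inc this] obtain L where L: "(\<lambda>n. integral\<^sup>L lborel (f n)) \<longlonglongrightarrow> L" by blast
  have LK: "L \<le> K" by (rule LIMSEQ_le_const2[OF L]) (use K in \<open>auto simp: f_def[abs_def]\<close>)
  show "integrable lborel h"
    by (rule integrable_monotone_convergence[OF fi _ _ L]) (use mono lim in auto)
  have "integral\<^sup>L lborel h = L"
    by (rule integral_monotone_convergence[OF fi _ _ L]) (use mono lim in auto)
  then show "integral\<^sup>L lborel h \<le> K" using LK by simp
qed

lemma tail_tendsto_zero:
  fixes W :: "'a \<Rightarrow> real"
  assumes "W summable_on UNIV"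
  shows "((\<lambda>F. infsum W (- F)) \<longlongrightarrow> 0) (finite_subsets_at_top UNIV)"
proof -
  have "(sum W \<longlongrightarrow> infsum W UNIV) (finite_subsets_at_top UNIV)"
    using has_sum_infsum[OF assms] by (simp add: has_sum_def)
  then have 1: "((\<lambda>F. infsum W UNIV - sum W F) \<longlongrightarrow> infsum W UNIV - infsum W UNIV) (finite_subsets_at_top UNIV)"
    by (intro tendsto_intros)
  have ev: "\<forall>\<^sub>F F in finite_subsets_at_top UNIV. infsum W UNIV - sum W F = infsum W (- F)"
  proof (rule eventually_finite_subsets_at_top_weakI)
    fix F :: "'a set" assume F: "finite F"
    have "infsum W (F \<union> - F) = infsum W F + infsum W (- F)"
      by (intro infsum_Un_disjoint summable_on_subset_banach[OF assms]) auto
    then show "infsum W UNIV - sum W F = infsum W (- F)" using F by (simp add: Compl_partition)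
  qed
  show ?thesis using iffD1[OF tendsto_cong[OF ev] 1] by simp
qed

text \<open>The derivative of the remainder is a combination of the remainders of the \<open>annih\<close>-iterates with polynomial coefficients, which are
  bounded on bounded intervals only. There, enlarging \<open>F\<close> to \<open>F'\<close> makes the remainder negligible and leaves a finite lattice sum, for which the
  Bessel inequality is uniform in \<open>F'\<close> and in the interval.\<close>

lemma sobolev_remainder_bound:
  fixes g :: "real \<Rightarrow> complex"
  assumes reg: "annih_regular m g" and fe: "\<And>j. j \<le> m \<Longrightarrow> (annih ^^ j) g \<in> feichtinger"
    and rel: "\<And>j z. j \<le> m \<Longrightarrow> beta (lat z) ((annih ^^ j) g) = cpoint (lat z) ^ j * beta (lat z) g"
    and s: "(\<lambda>z. ((norm (lat z))\<^sup>2 + 1) ^ m * (norm (beta (lat z) g))\<^sup>2) summable_on UNIV"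
    and k: "k \<le> m"
  shows "\<exists>C\<ge>0. \<forall>F. finite F \<longrightarrow> (weak_deriv ^^ k) (\<lambda>x. g x - (\<Sum>z\<in>F. beta (lat z) g * gabor (lat z) x)) \<in> L2 \<and>
    (L2_norm ((weak_deriv ^^ k) (\<lambda>x. g x - (\<Sum>z\<in>F. beta (lat z) g * gabor (lat z) x))))\<^sup>2 \<le>
      C * (\<Sum>\<^sub>\<infinity>z\<in>-F. ((norm (lat z))\<^sup>2 + 1) ^ m * (norm (beta (lat z) g))\<^sup>2)"
proof -
  define c where "c z = beta (lat z) g" for z
  define W where "W z = ((norm (lat z))\<^sup>2 + 1) ^ m * (norm (c z))\<^sup>2" for z
  have W0: "W z \<ge> 0" for z by (simp add: W_def)
  have Ws: "W summable_on A" for A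
    by (rule summable_on_subset_banach[of _ UNIV]) (use s in \<open>auto simp: W_def[abs_def] c_def\<close>)
  define tail where "tail F = infsum W (- F)" for F
  obtain H :: "complex poly" where H: "degree H \<le> k" "\<And>x z. (\<Sum>j\<le>k. of_real (poly (hermite_coeff k j) x) * z ^ j) = poly H (z - of_real x)"
    using hermite_symbol by blast
  obtain C where C: "C \<ge> 0" "\<And>F (b :: int \<times> int \<Rightarrow> complex). finite F \<Longrightarrow>
    (\<lambda>x. \<Sum>z\<in>F. b z * (poly H (cpoint (lat z) - of_real x) * gabor (lat z) x)) \<in> L2 \<and>
    (LINT x|lborel. (norm (\<Sum>z\<in>F. b z * (poly H (cpoint (lat z) - of_real x) * gabor (lat z) x)))\<^sup>2) \<le>
      C * (\<Sum>z\<in>F. ((norm (lat z))\<^sup>2 + 1) ^ k * (norm (b z))\<^sup>2)"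
    using lattice_poly_bessel[OF H(1)] by blast
  have wk: "((norm (lat z))\<^sup>2 + 1) ^ i * (norm (c z))\<^sup>2 \<le> W z" if "i \<le> m" for i z
    unfolding W_def using that by (intro mult_right_mono power_increasing) auto
  \<comment> \<open>The remainder of the j-th iterate: by \<open>rel\<close> the coefficients here
    are those of (annih ^^ j) g, so \<open>gabor_expansion_error\<close> applies to it.\<close>
  define E where "E j F x = (annih ^^ j) g x - (\<Sum>z\<in>F. c z * cpoint (lat z) ^ j * gabor (lat z) x)" for j F x
  have b0: "bessel_const 0 \<ge> 0" unfolding bessel_const_def by (intro mult_nonneg_nonneg gauss_sum_bound_nonneg) auto
  have E2: "E j F \<in> L2" "(LINT x|lborel. (norm (E j F x))\<^sup>2) \<le> bessel_const 0 * tail F" if j: "j \<le> m" and F: "finite F" for j F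
  proof -
    have le: "(norm (beta (lat z) ((annih ^^ j) g)))\<^sup>2 \<le> W z" for z
    proof -
      have "((norm (lat z))\<^sup>2) ^ j \<le> ((norm (lat z))\<^sup>2 + 1) ^ j" by (intro power_mono) auto
      then have "(norm (cpoint (lat z) ^ j))\<^sup>2 \<le> ((norm (lat z))\<^sup>2 + 1) ^ j"
        by (simp add: norm_power norm_cpoint mult.commute flip: power_mult)
      then have "(norm (cpoint (lat z) ^ j))\<^sup>2 * (norm (c z))\<^sup>2 \<le> ((norm (lat z))\<^sup>2 + 1) ^ j * (norm (c z))\<^sup>2" by (rule mult_right_mono) simp
      with wk[OF j, of z] show ?thesis unfolding rel[OF j] norm_mult power_mult_distrib c_def[symmetric] by linarith
    qed
    have bs: "(\<lambda>z. (norm (beta (lat z) ((annih ^^ j) g)))\<^sup>2) summable_on A" for A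
      by (rule summable_on_comparison_test[OF Ws le]) auto
    have Eq: "E j F x = (annih ^^ j) g x - (\<Sum>z\<in>F. beta (lat z) ((annih ^^ j) g) * gabor (lat z) x)" for x
      unfolding E_def rel[OF j] c_def by (simp add: mult_ac)
    show "E j F \<in> L2"
      using feichtinger_linear(1)[OF fe[OF j] feichtinger_gabor_sum(1)[OF F], where a = 1 and b = "- 1"]
      unfolding Eq[abs_def] by (simp add: feichtinger_def)
    have "(LINT x|lborel. (norm (E j F x))\<^sup>2) \<le> bessel_const 0 * (\<Sum>\<^sub>\<infinity>z\<in>-F. (norm (beta (lat z) ((annih ^^ j) g)))\<^sup>2)"
      unfolding Eq by (rule gabor_expansion_error[OF fe[OF j] bs F])
    also have "\<dots> \<le> bessel_const 0 * tail F"
      unfolding tail_def by (intro mult_left_mono b0 infsum_mono bs Ws le)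
    finally show "(LINT x|lborel. (norm (E j F x))\<^sup>2) \<le> bessel_const 0 * tail F" .
  qed
  \<comment> \<open>A representative of the k-th weak derivative of the remainder of g.\<close>
  define D where "D F x = (\<Sum>j\<le>k. of_real (poly (hermite_coeff k j) x) * E j F x)" for F x
  have DAE: "AE x in lborel. (weak_deriv ^^ k) (\<lambda>x. g x - (\<Sum>z\<in>F. c z * gabor (lat z) x)) x = D F x"
    and dm: "(weak_deriv ^^ k) (\<lambda>x. g x - (\<Sum>z\<in>F. c z * gabor (lat z) x)) \<in> borel_measurable borel" if F: "finite F" for F
  proof -
    let ?S = "\<lambda>x. \<Sum>z\<in>F. c z * gabor (lat z) x"
    note lin = annih_iterate_linear[OF reg annih_iterate_gabor_sum(1)[OF F, where c = c and \<mu> = lat and m = m], where a = 1 and b = "- 1"]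
    have r: "annih_regular m (\<lambda>x. g x - ?S x)" using lin(1) by simp
    have "AE x in lborel. \<forall>j\<in>{..k}. (annih ^^ j) (\<lambda>x. g x - ?S x) x = E j F x"
    proof (intro AE_finite_allI)
      fix j assume "j \<in> {..k}"
      then have j: "j \<le> m" using k by simp
      show "AE x in lborel. (annih ^^ j) (\<lambda>x. g x - ?S x) x = E j F x"
        using lin(2)[OF j] annih_iterate_gabor_sum(2)[OF F, where c = c and \<mu> = lat and m = j]
        by eventually_elim (simp add: E_def)
    qed simp
    then show "AE x in lborel. (weak_deriv ^^ k) (\<lambda>x. g x - ?S x) x = D F x"
      using weak_deriv_iterate(1)[OF r k] by eventually_elim (simp add: D_def)
    show "(weak_deriv ^^ k) (\<lambda>x. g x - ?S x) \<in> borel_measurable borel"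
      using weak_deriv_iterate(2)[OF r k] by (rule locally_integrable_measurable)
  qed
  have Em[measurable]: "E j F \<in> borel_measurable borel" if "j \<le> k" "finite F" for j F
    using E2(1)[of j F] that k by (auto simp: L2_def)
  have Dm[measurable]: "D F \<in> borel_measurable borel" if F: "finite F" for F
  proof -
    have "(\<lambda>x. complex_of_real (poly P x)) \<in> borel_measurable borel" for P :: "real poly"
      by (intro borel_measurable_continuous_onI continuous_intros)
    then show ?thesis unfolding D_def[abs_def] using F by (intro borel_measurable_sum borel_measurable_times Em) auto
  qed
  \<comment> \<open>The difference of the two remainders is a finite lattice sum, and on each Gabor
    function the polynomial coefficients combine to H evaluated at cpoint (lat z) - x.\<close>
  have split: "D F x = D F' x + (\<Sum>z\<in>F' - F. c z * (poly H (cpoint (lat z) - of_real x) * gabor (lat z) x))"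
    if "F \<subseteq> F'" "finite F'" for F F' x
  proof -
    have "E j F x = E j F' x + (\<Sum>z\<in>F' - F. c z * cpoint (lat z) ^ j * gabor (lat z) x)" for j
      unfolding E_def using sum.subset_diff[OF that, of "\<lambda>z. c z * cpoint (lat z) ^ j * gabor (lat z) x"] by simp
    then have "D F x = D F' x + (\<Sum>j\<le>k. of_real (poly (hermite_coeff k j) x) * (\<Sum>z\<in>F' - F. c z * cpoint (lat z) ^ j * gabor (lat z) x))"
      by (simp add: D_def distrib_left sum.distrib)
    also have "(\<Sum>j\<le>k. of_real (poly (hermite_coeff k j) x) * (\<Sum>z\<in>F' - F. c z * cpoint (lat z) ^ j * gabor (lat z) x)) = (\<Sum>z\<in>F' - F. c z * ((\<Sum>j\<le>k. of_real (poly (hermite_coeff k j) x) * cpoint (lat z) ^ j) * gabor (lat z) x))"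
      unfolding sum_distrib_left sum_distrib_right by (subst sum.swap) (simp add: mult_ac)
    finally show ?thesis unfolding H(2) .
  qed
  have trunc: "integrable lborel (\<lambda>x. indicator {- real n..real n} x * (norm (D F x))\<^sup>2)"
    "(LINT x|lborel. indicator {- real n..real n} x * (norm (D F x))\<^sup>2) \<le> 2 * C * tail F" if F: "finite F" for n F
  proof -
    obtain B where B: "B \<ge> 0" "\<And>j x. j \<le> k \<Longrightarrow> \<bar>x\<bar> \<le> real n \<Longrightarrow> \<bar>poly (hermite_coeff k j) x\<bar> \<le> B"
    proof -
      have "\<exists>b\<ge>0. \<forall>x. \<bar>x\<bar> \<le> real n \<longrightarrow> \<bar>poly (hermite_coeff k j) x\<bar> \<le> b" for j
      proof -
        have "compact (poly (hermite_coeff k j) ` {- real n..real n})"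
          by (intro compact_continuous_image continuous_intros) auto
        then obtain b where b: "\<forall>y\<in>poly (hermite_coeff k j) ` {- real n..real n}. norm y \<le> b"
          using compact_imp_bounded bounded_iff by metis
        have "0 \<le> b" using b[rule_format, of "poly (hermite_coeff k j) 0"] norm_ge_zero order_trans by fastforce
        then show ?thesis using b by (intro exI[of _ b]) (auto simp: abs_le_iff)
      qed
      then obtain b where b: "\<And>j. b j \<ge> 0" "\<And>j x. \<bar>x\<bar> \<le> real n \<Longrightarrow> \<bar>poly (hermite_coeff k j) x\<bar> \<le> b j" by metis
      show ?thesis
      proof (rule that[of "\<Sum>j\<le>k. b j"])
        fix j x assume "j \<le> k" "\<bar>x\<bar> \<le> real n"
        then show "\<bar>poly (hermite_coeff k j) x\<bar> \<le> (\<Sum>j\<le>k. b j)"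
          using b(2)[of x j] member_le_sum[of j "{..k}" b] b(1) by fastforce
      qed (auto intro!: sum_nonneg b)
    qed
    define M where "M = real (Suc k) * B\<^sup>2"
    have M0: "M \<ge> 0" by (simp add: M_def)
    have Dle: "indicator {- real n..real n} x * (norm (D F' x))\<^sup>2 \<le> M * (\<Sum>j\<le>k. (norm (E j F' x))\<^sup>2)" for F' x
    proof (cases "\<bar>x\<bar> \<le> real n")
      case True
      have "norm (D F' x) \<le> (\<Sum>j\<le>k. B * norm (E j F' x))"
        unfolding D_def by (rule order_trans[OF norm_sum]) (auto simp: norm_mult intro!: sum_mono mult_right_mono B True)
      then have "(norm (D F' x))\<^sup>2 \<le> (\<Sum>j\<le>k. B * norm (E j F' x))\<^sup>2" by (intro power_mono) auto
      also have "\<dots> \<le> (\<Sum>j\<le>k. B\<^sup>2) * (\<Sum>j\<le>k. (norm (E j F' x))\<^sup>2)" by (rule Cauchy_Schwarz_ineq_sum)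
      moreover have "x \<in> {- real n..real n}" using True by (auto simp: abs_le_iff)
      ultimately show ?thesis by (simp add: M_def)
    next
      case False
      then show ?thesis using M0 by (auto simp: indicator_def intro!: mult_nonneg_nonneg sum_nonneg)
    qed
    have Ei: "integrable lborel (\<lambda>x. (norm (E j F' x))\<^sup>2)" if "j \<le> k" "finite F'" for j F'
      using E2(1)[of j F'] that k by (auto simp: L2_def)
    have ri: "integrable lborel (\<lambda>x. M * (\<Sum>j\<le>k. (norm (E j F' x))\<^sup>2))" if "finite F'" for F'
      by (intro integrable_mult_right Bochner_Integration.integrable_sum Ei that) auto
    have ti: "integrable lborel (\<lambda>x. indicator {- real n..real n} x * (norm (D F' x))\<^sup>2)" if "finite F'" for F'
      by (rule Bochner_Integration.integrable_bound[OF ri[OF that]])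
        (use Dm[OF that] Dle in \<open>auto intro!: AE_I2 order_trans[OF Dle abs_ge_self]\<close>)
    show "integrable lborel (\<lambda>x. indicator {- real n..real n} x * (norm (D F x))\<^sup>2)" by (rule ti[OF F])
    show "(LINT x|lborel. indicator {- real n..real n} x * (norm (D F x))\<^sup>2) \<le> 2 * C * tail F"
    proof (rule field_le_epsilon)
      fix e :: real assume e: "e > 0"
      \<comment> \<open>N depends on the interval through M, so F' is chosen after it, large enough
        for N * tail F' \<le> e. What remains is the Bessel bound of the finite sum over F' - F,
        which involves neither n nor F'. Dividing by N + 1 covers N = 0.\<close>
      define N where "N = 2 * (M * (real (Suc k) * bessel_const 0))"
      have N0: "N \<ge> 0" unfolding N_def by (intro mult_nonneg_nonneg M0 b0) auto
      have ev: "\<forall>\<^sub>F G in finite_subsets_at_top UNIV. tail G < e / (N + 1)"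
        using order_tendstoD(2)[OF tail_tendsto_zero[OF Ws], of "e / (N + 1)"] e N0 unfolding tail_def by auto
      obtain F' where F': "finite F'" "F \<subseteq> F'" "tail F' < e / (N + 1)"
      proof -
        obtain G where "finite G" "\<And>Y. finite Y \<Longrightarrow> G \<subseteq> Y \<Longrightarrow> tail Y < e / (N + 1)"
          using ev unfolding eventually_finite_subsets_at_top by auto
        then show ?thesis using that[of "F \<union> G"] F by auto
      qed
      define S where "S x = (\<Sum>z\<in>F' - F. c z * (poly H (cpoint (lat z) - of_real x) * gabor (lat z) x))" for x
      have fd: "finite (F' - F)" using F' by simp
      have S2: "S \<in> L2" "(LINT x|lborel. (norm (S x))\<^sup>2) \<le> C * (\<Sum>z\<in>F' - F. ((norm (lat z))\<^sup>2 + 1) ^ k * (norm (c z))\<^sup>2)"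
        using C(2)[OF fd, of c] by (auto simp: S_def[abs_def])
      have Si: "integrable lborel (\<lambda>x. (norm (S x))\<^sup>2)" using S2(1) by (auto simp: L2_def)
      have "(\<Sum>z\<in>F' - F. ((norm (lat z))\<^sup>2 + 1) ^ k * (norm (c z))\<^sup>2) \<le> (\<Sum>z\<in>F' - F. W z)"
        by (intro sum_mono wk k)
      also have "\<dots> \<le> tail F"
        unfolding tail_def by (intro finite_sum_le_infsum Ws fd W0) auto
      finally have St: "(LINT x|lborel. (norm (S x))\<^sup>2) \<le> C * tail F"
        using S2(2) C(1) by (meson mult_left_mono order_trans)
      have pw: "indicator {- real n..real n} x * (norm (D F x))\<^sup>2 \<le> 2 * (indicator {- real n..real n} x * (norm (D F' x))\<^sup>2) + 2 * (norm (S x))\<^sup>2" for x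
      proof -
        have "(norm (D F x))\<^sup>2 \<le> (norm (D F' x) + norm (S x))\<^sup>2"
          unfolding split[OF F'(2,1)] S_def by (intro power_mono norm_triangle_ineq) auto
        also have "\<dots> \<le> 2 * (norm (D F' x))\<^sup>2 + 2 * (norm (S x))\<^sup>2"
          using sum_squares_bound[of "norm (D F' x)" "norm (S x)"] by (simp add: power2_sum)
        finally show ?thesis by (auto simp: indicator_def)
      qed
      have "(LINT x|lborel. indicator {- real n..real n} x * (norm (D F x))\<^sup>2) \<le> (LINT x|lborel. 2 * (indicator {- real n..real n} x * (norm (D F' x))\<^sup>2) + 2 * (norm (S x))\<^sup>2)"
        by (rule integral_mono[OF ti[OF F] _ pw]) (intro Bochner_Integration.integrable_add integrable_mult_right ti F' Si)
      also have "\<dots> = 2 * (LINT x|lborel. indicator {- real n..real n} x * (norm (D F' x))\<^sup>2) + 2 * (LINT x|lborel. (norm (S x))\<^sup>2)"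
        using ti[OF F'(1)] Si by simp
      also have "\<dots> \<le> 2 * (M * (\<Sum>j\<le>k. bessel_const 0 * tail F')) + 2 * (C * tail F)"
      proof (intro add_mono mult_left_mono St)
        have "(LINT x|lborel. indicator {- real n..real n} x * (norm (D F' x))\<^sup>2) \<le> (LINT x|lborel. M * (\<Sum>j\<le>k. (norm (E j F' x))\<^sup>2))"
          by (rule integral_mono[OF ti[OF F'(1)] ri[OF F'(1)] Dle])
        also have "\<dots> = M * (\<Sum>j\<le>k. LINT x|lborel. (norm (E j F' x))\<^sup>2)"
          using Ei[OF _ F'(1)] by simp
        also have "\<dots> \<le> M * (\<Sum>j\<le>k. bessel_const 0 * tail F')"
          by (intro mult_left_mono sum_mono E2 F' M0) (use k in auto)
        finally show "(LINT x|lborel. indicator {- real n..real n} x * (norm (D F' x))\<^sup>2) \<le> M * (\<Sum>j\<le>k. bessel_const 0 * tail F')" .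
      qed auto
      also have "2 * (M * (\<Sum>j\<le>k. bessel_const 0 * tail F')) = N * tail F'" by (simp add: N_def)
      also have "N * tail F' \<le> e"
      proof -
        have "N * tail F' \<le> N * (e / (N + 1))" using F'(3) N0 by (intro mult_left_mono) auto
        also have "\<dots> \<le> e" using N0 e by (simp add: divide_le_eq)
        finally show ?thesis .
      qed
      finally show "(LINT x|lborel. indicator {- real n..real n} x * (norm (D F x))\<^sup>2) \<le> 2 * C * tail F + e" by simp
    qed
  qed
  show ?thesis
  proof (intro exI[of _ "2 * C"] conjI allI impI)
    show "0 \<le> 2 * C" using C by simp
    fix F :: "(int \<times> int) set" assume F: "finite F"
    note [measurable] = Dm[OF F]
    have "integrable lborel (\<lambda>x. (norm (D F x))\<^sup>2)" "(LINT x|lborel. (norm (D F x))\<^sup>2) \<le> 2 * C * tail F"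
      using integral_le_of_truncations[of "\<lambda>x. (norm (D F x))\<^sup>2", OF _ _ trunc[OF F]] by auto
    then have D2: "D F \<in> L2" "(L2_norm (D F))\<^sup>2 \<le> 2 * C * tail F" by (auto simp: L2_def L2_norm_def)
    have ae: "AE x in lborel. D F x = (weak_deriv ^^ k) (\<lambda>x. g x - (\<Sum>z\<in>F. c z * gabor (lat z) x)) x"
      using DAE[OF F] by eventually_elim simp
    from L2_cong_AE[OF D2(1) ae dm[OF F]] D2(2)
    show "(weak_deriv ^^ k) (\<lambda>x. g x - (\<Sum>z\<in>F. beta (lat z) g * gabor (lat z) x)) \<in> L2"
      "(L2_norm ((weak_deriv ^^ k) (\<lambda>x. g x - (\<Sum>z\<in>F. beta (lat z) g * gabor (lat z) x))))\<^sup>2 \<le>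
      2 * C * (\<Sum>\<^sub>\<infinity>z\<in>-F. ((norm (lat z))\<^sup>2 + 1) ^ m * (norm (beta (lat z) g))\<^sup>2)"
      by (auto simp: c_def tail_def W_def[abs_def])
  qed
qed

lemma monomial_gabor_L2: "(\<lambda>x. of_real ((x - fst l) ^ n) * gabor l x) \<in> L2"
proof -
  define M where "M = (2 powr (1/4) * exp (real n ^ 2))\<^sup>2"
  have le: "(norm (of_real ((x - fst l) ^ n) * gabor l x))\<^sup>2 \<le> M * exp (- (pi * 1) * (x - fst l)\<^sup>2)" for x
  proof -
    have "norm (of_real ((x - fst l) ^ n) * gabor l x) = 2 powr (1/4) * (\<bar>x - fst l\<bar> ^ n * exp (- pi * (x - fst l)\<^sup>2))"
      by (simp only: norm_mult norm_gabor norm_of_real power_abs mult_ac)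
    also have "\<dots> \<le> 2 powr (1/4) * (exp (real n ^ 2) * exp (- (pi * (1/2)) * (x - fst l)\<^sup>2))"
      by (intro mult_left_mono monomial_gaussian_bound) auto
    finally have "(norm (of_real ((x - fst l) ^ n) * gabor l x))\<^sup>2 \<le> (2 powr (1/4) * (exp (real n ^ 2) * exp (- (pi * (1/2)) * (x - fst l)\<^sup>2)))\<^sup>2"
      by (intro power_mono) auto
    also have "\<dots> = M * (exp (- (pi * (1/2)) * (x - fst l)\<^sup>2))\<^sup>2"
      unfolding M_def power_mult_distrib by (simp only: mult.assoc)
    also have "(exp (- (pi * (1/2)) * (x - fst l)\<^sup>2))\<^sup>2 = exp (- (pi * 1) * (x - fst l)\<^sup>2)"
      by (simp flip: exp_double)
    finally show ?thesis .
  qed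
  have "integrable lborel (\<lambda>x. M * exp (- (pi * 1) * (x - fst l)\<^sup>2))"
    by (intro integrable_mult_right gaussian_integral) simp
  then have "integrable lborel (\<lambda>x. (norm (of_real ((x - fst l) ^ n) * gabor l x))\<^sup>2)"
  proof (rule Bochner_Integration.integrable_bound)
    show "AE x in lborel. norm ((norm (of_real ((x - fst l) ^ n) * gabor l x))\<^sup>2) \<le> norm (M * exp (- (pi * 1) * (x - fst l)\<^sup>2))"
      unfolding real_norm_def abs_of_nonneg[OF zero_le_power2] by (intro AE_I2 order_trans[OF le abs_ge_self])
  qed auto
  then show ?thesis by (auto simp: L2_def)
qed

lemma poly_gabor_L2:
  fixes H :: "complex poly"
  shows "(\<lambda>x. c * (poly H (cpoint l - of_real x) * gabor l x)) \<in> L2"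
proof -
  define R where "R = pcompose H [:\<i> * of_real (snd l), - 1:]"
  \<comment> \<open>The polynomial is expanded anew in powers of x - fst l; the zero summand gives
    the terms the shape of \<open>L2_linear\<close>.\<close>
  have "c * (poly H (cpoint l - of_real x) * gabor l x) = (\<Sum>n\<le>degree R. c * coeff R n * (of_real ((x - fst l) ^ n) * gabor l x) + 0 * gabor l x)" for x
  proof -
    have "poly [:\<i> * of_real (snd l), - 1:] (of_real (x - fst l)) = cpoint l - of_real x" by (simp add: complex_eq_iff)
    then have "poly H (cpoint l - of_real x) = poly R (of_real (x - fst l))"
      by (simp only: R_def poly_pcompose)
    then show ?thesis by (simp add: poly_altdef sum_distrib_left sum_distrib_right mult_ac)
  qed
  moreover have "(\<lambda>x. \<Sum>n\<le>degree R. c * coeff R n * (of_real ((x - fst l) ^ n) * gabor l x) + 0 * gabor l x) \<in> L2"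
    by (intro L2_sum(1) L2_linear(1) monomial_gabor_L2 gabor_in_L2) auto
  ultimately show ?thesis by simp
qed

lemma gabor_sum_weak_deriv_L2:
  assumes F: "finite F"
  shows "(weak_deriv ^^ k) (\<lambda>x. \<Sum>i\<in>F. c i * gabor (\<mu> i) x) \<in> L2"
proof -
  let ?S = "\<lambda>x. \<Sum>i\<in>F. c i * gabor (\<mu> i) x"
  obtain H :: "complex poly" where H: "\<And>x z. (\<Sum>j\<le>k. of_real (poly (hermite_coeff k j) x) * z ^ j) = poly H (z - of_real x)"
    using hermite_symbol by blast
  have r: "annih_regular k ?S" by (rule annih_iterate_gabor_sum(1)[OF F])
  have "AE x in lborel. \<forall>j\<in>{..k}. (annih ^^ j) ?S x = (\<Sum>i\<in>F. c i * cpoint (\<mu> i) ^ j * gabor (\<mu> i) x)"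
    by (intro AE_finite_allI annih_iterate_gabor_sum(2) F) simp
  then have ae: "AE x in lborel. (\<Sum>i\<in>F. c i * (poly H (cpoint (\<mu> i) - of_real x) * gabor (\<mu> i) x)) = (weak_deriv ^^ k) ?S x"
    using weak_deriv_iterate(1)[OF r order_refl]
  proof eventually_elim
    case (elim x)
    have "(weak_deriv ^^ k) ?S x = (\<Sum>j\<le>k. of_real (poly (hermite_coeff k j) x) * (\<Sum>i\<in>F. c i * cpoint (\<mu> i) ^ j * gabor (\<mu> i) x))"
      using elim by simp
    also have "\<dots> = (\<Sum>i\<in>F. c i * ((\<Sum>j\<le>k. of_real (poly (hermite_coeff k j) x) * cpoint (\<mu> i) ^ j) * gabor (\<mu> i) x))"
      unfolding sum_distrib_left sum_distrib_right by (subst sum.swap) (simp add: mult_ac)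
    finally show ?case unfolding H ..
  qed
  show ?thesis
    by (rule L2_cong_AE(1)[OF L2_sum(1)[OF F poly_gabor_L2] ae locally_integrable_measurable[OF weak_deriv_iterate(2)[OF r order_refl]]])
qed

text \<open>The iterates of \<open>weak_deriv\<close> are compared through those of
  \<open>annih\<close>, for which linearity almost everywhere is available. With it f is recovered
  from its remainder.\<close>

lemma sobolev_linear_gabor_sum:
  assumes F: "finite F" and r: "annih_regular m g" and g: "\<And>k. k \<le> m \<Longrightarrow> (weak_deriv ^^ k) g \<in> L2"
  shows "(\<lambda>x. a * g x + b * (\<Sum>i\<in>F. c i * gabor (\<mu> i) x)) \<in> sobolev m"
proof -
  let ?S = "\<lambda>x. \<Sum>i\<in>F. c i * gabor (\<mu> i) x" and ?h = "\<lambda>x. a * g x + b * (\<Sum>i\<in>F. c i * gabor (\<mu> i) x)"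
  have rS: "annih_regular m ?S" by (rule annih_iterate_gabor_sum(1)[OF F])
  note lin = annih_iterate_linear[OF r rS, where a = a and b = b]
  have "(weak_deriv ^^ k) ?h \<in> L2" if k: "k \<le> m" for k
  proof -
    have "AE x in lborel. \<forall>j\<in>{..k}. (annih ^^ j) ?h x = a * (annih ^^ j) g x + b * (annih ^^ j) ?S x"
      by (intro AE_finite_allI lin(2)) (use k in auto)
    then have "AE x in lborel. a * (weak_deriv ^^ k) g x + b * (weak_deriv ^^ k) ?S x = (weak_deriv ^^ k) ?h x"
      using weak_deriv_iterate(1)[OF lin(1) k] weak_deriv_iterate(1)[OF r k] weak_deriv_iterate(1)[OF rS k]
    proof eventually_elim
      case (elim x)
      have "(weak_deriv ^^ k) ?h x = (\<Sum>j\<le>k. of_real (poly (hermite_coeff k j) x) * (a * (annih ^^ j) g x + b * (annih ^^ j) ?S x))"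
        unfolding elim(2) using elim(1) by (intro sum.cong) auto
      then show ?case unfolding elim(3,4) by (simp add: sum_distrib_left distrib_left sum.distrib mult_ac)
    qed
    from L2_cong_AE(1)[OF L2_linear(1)[OF g[OF k] gabor_sum_weak_deriv_L2[OF F]] this]
    show ?thesis using locally_integrable_measurable[OF weak_deriv_iterate(2)[OF lin(1) k]] by simp
  qed
  then show ?thesis using weak_deriv_iterate(3)[OF lin(1) order_refl] by (auto simp: sobolev_def)
qed

lemma gabor_sum_sobolev:
  assumes F: "finite F"
  shows "(\<lambda>x. \<Sum>i\<in>F. c i * gabor (\<mu> i) x) \<in> sobolev m"
  using weak_deriv_iterate(3)[OF annih_iterate_gabor_sum(1)[OF F] order_refl] gabor_sum_weak_deriv_L2[OF F]
  by (auto simp: sobolev_def)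

lemma sobolev_expansion:
  fixes g :: "real \<Rightarrow> complex"
  assumes reg: "annih_regular m g" and fe: "\<And>j. j \<le> m \<Longrightarrow> (annih ^^ j) g \<in> feichtinger"
    and rel: "\<And>j z. j \<le> m \<Longrightarrow> beta (lat z) ((annih ^^ j) g) = cpoint (lat z) ^ j * beta (lat z) g"
    and s: "(\<lambda>z. ((norm (lat z))\<^sup>2 + 1) ^ m * (norm (beta (lat z) g))\<^sup>2) summable_on UNIV"
  shows "has_sobolev_sum m (\<lambda>l x. beta l g * gabor l x) g Lambda" and "\<And>k. k \<le> m \<Longrightarrow> (weak_deriv ^^ k) g \<in> L2"
proof -
  define W where "W z = ((norm (lat z))\<^sup>2 + 1) ^ m * (norm (beta (lat z) g))\<^sup>2" for z
  let ?R = "\<lambda>F x. g x - (\<Sum>z\<in>F. beta (lat z) g * gabor (lat z) x)"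
  have "\<forall>k. \<exists>C. k \<le> m \<longrightarrow> C \<ge> 0 \<and> (\<forall>F. finite F \<longrightarrow> (weak_deriv ^^ k) (?R F) \<in> L2 \<and> (L2_norm ((weak_deriv ^^ k) (?R F)))\<^sup>2 \<le> C * infsum W (- F))"
    using sobolev_remainder_bound[OF assms] unfolding W_def[symmetric] by blast
  from choice[OF this] obtain C where C': "\<forall>k. k \<le> m \<longrightarrow> C k \<ge> 0 \<and> (\<forall>F. finite F \<longrightarrow> (weak_deriv ^^ k) (?R F) \<in> L2 \<and> (L2_norm ((weak_deriv ^^ k) (?R F)))\<^sup>2 \<le> C k * infsum W (- F))" ..
  then have C: "\<And>k. k \<le> m \<Longrightarrow> C k \<ge> 0" "\<And>k F. k \<le> m \<Longrightarrow> finite F \<Longrightarrow> (weak_deriv ^^ k) (?R F) \<in> L2"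
    "\<And>k F. k \<le> m \<Longrightarrow> finite F \<Longrightarrow> (L2_norm ((weak_deriv ^^ k) (?R F)))\<^sup>2 \<le> C k * infsum W (- F)"
    by blast+
  \<comment> \<open>The empty set of lattice points leaves g itself as the remainder.\<close>
  show gk: "(weak_deriv ^^ k) g \<in> L2" if "k \<le> m" for k using C(2)[OF that, of "{}"] by simp
  have gs: "g \<in> sobolev m" using gk weak_deriv_iterate(3)[OF reg order_refl] by (auto simp: sobolev_def)
  have us: "(\<lambda>x. beta l g * gabor l x) \<in> sobolev m" for l
    using gabor_sum_sobolev[of "{l}" "\<lambda>l. beta l g" "\<lambda>l. l"] by simp
  define K where "K = (\<Sum>k\<le>m. C k)"
  define t where "t F = sqrt (K * infsum W (- F))" for F
  have tl: "(t \<longlongrightarrow> 0) (finite_subsets_at_top UNIV)"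
  proof -
    have "W summable_on UNIV" using s by (simp add: W_def[abs_def])
    from tendsto_real_sqrt[OF tendsto_mult[OF tendsto_const tail_tendsto_zero[OF this], of K]] show ?thesis
      unfolding t_def by simp
  qed
  have nb: "norm (sobolev_norm m (?R F)) \<le> t F" if "finite F" for F
  proof -
    have "(\<Sum>j\<le>m. (L2_norm ((weak_deriv ^^ j) (?R F)))\<^sup>2) \<le> (\<Sum>j\<le>m. C j * infsum W (- F))"
      by (intro sum_mono C(3) that) auto
    then show ?thesis unfolding sobolev_norm_def t_def K_def sum_distrib_right
      by (simp add: sum_nonneg real_sqrt_le_mono)
  qed
  \<comment> \<open>The bounds are indexed by finite sets of integer pairs, the required limit by
    finite subsets of \<open>Lambda\<close>; preimages under the injective map \<open>lat\<close>
    connect the two filters.\<close>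
  have fl: "filterlim (\<lambda>F. lat -` F) (finite_subsets_at_top UNIV) (finite_subsets_at_top Lambda)"
    unfolding filterlim_finite_subsets_at_top
  proof (intro allI impI)
    fix X :: "(int \<times> int) set" assume X: "finite X \<and> X \<subseteq> UNIV"
    show "\<forall>\<^sub>F F in finite_subsets_at_top Lambda. finite (lat -` F) \<and> X \<subseteq> lat -` F \<and> lat -` F \<subseteq> UNIV"
      unfolding eventually_finite_subsets_at_top
      by (intro exI[of _ "lat ` X"]) (use X in \<open>auto simp: Lambda_eq intro: finite_vimageI[OF _ inj_lat]\<close>)
  qed
  have "((\<lambda>F. sobolev_norm m (\<lambda>x. g x - (\<Sum>l\<in>F. beta l g * gabor l x))) \<longlongrightarrow> 0) (finite_subsets_at_top Lambda)"
  proof (rule Lim_null_comparison[OF _ filterlim_compose[OF tl fl]])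
    show "\<forall>\<^sub>F F in finite_subsets_at_top Lambda. norm (sobolev_norm m (\<lambda>x. g x - (\<Sum>l\<in>F. beta l g * gabor l x))) \<le> t (lat -` F)"
    proof (rule eventually_finite_subsets_at_top_weakI)
      fix F assume F: "finite F" "F \<subseteq> Lambda"
      have img: "F = lat ` (lat -` F)" using F by (auto simp: Lambda_eq)
      have "(\<Sum>l\<in>F. beta l g * gabor l x) = (\<Sum>z\<in>lat -` F. beta (lat z) g * gabor (lat z) x)" for x
        by (subst img, subst sum.reindex) (auto intro: inj_on_subset[OF inj_lat])
      then show "norm (sobolev_norm m (\<lambda>x. g x - (\<Sum>l\<in>F. beta l g * gabor l x))) \<le> t (lat -` F)"
        using nb[OF finite_vimageI[OF F(1) inj_lat]] by simp
    qed
  qed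
  then show "has_sobolev_sum m (\<lambda>l x. beta l g * gabor l x) g Lambda"
    unfolding has_sobolev_sum_def using gs us by auto
qed

section \<open>Interpolation at half-integer points\<close>

text \<open>The inverse of the Vandermonde matrix is read off from the Lagrange basis L of the
  nodes: X^k is the sum of w s ^ k times L s, since both sides agree at m + 1 nodes, and the
  coefficients of X^j are compared.\<close>

lemma lagrange_coefficients:
  fixes w :: "nat \<Rightarrow> complex"
  assumes "inj_on w {..m}"
  shows "\<exists>a :: nat \<Rightarrow> nat \<Rightarrow> complex. \<forall>j\<le>m. \<forall>k\<le>m. (\<Sum>s\<le>m. a j s * w s ^ k) = (if k = j then 1 else 0)"
proof -
  define L where "L s = (\<Prod>t\<in>{..m} - {s}. smult (1 / (w s - w t)) [:- w t, 1:])" for s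
  have ev: "poly (L s) (w t) = (if s = t then 1 else 0)" if "s \<le> m" "t \<le> m" for s t
  proof (cases "s = t")
    case True
    have "poly (smult (1 / (w s - w u)) [:- w u, 1:]) (w s) = 1" if "u \<in> {..m} - {s}" for u
    proof -
      have ne: "w s - w u \<noteq> 0" using that \<open>s \<le> m\<close> assms by (auto simp: inj_on_def)
      have e: "poly (smult (1 / (w s - w u)) [:- w u, 1:]) (w s) = (w s - w u) / (w s - w u)"
        by (simp only: diff_divide_distrib) simp
      show ?thesis unfolding e by (rule divide_self[OF ne])
    qed
    then have "poly (L s) (w s) = (\<Prod>u\<in>{..m} - {s}. 1)"
      unfolding L_def poly_prod by (intro prod.cong refl)
    then show ?thesis using True by simp
  next
    case False
    then show ?thesis using that unfolding L_def poly_prod by (auto intro!: prod_zero bexI[of _ t])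
  qed
  have dL: "degree (L s) \<le> m" if "s \<le> m" for s
  proof -
    have "degree (L s) \<le> (\<Sum>t\<in>{..m} - {s}. degree (smult (1 / (w s - w t)) [:- w t, 1:]))"
      unfolding L_def by (rule order_trans[OF degree_prod_sum_le]) (simp_all add: o_def)
    also have "\<dots> \<le> (\<Sum>t\<in>{..m} - {s}. 1)"
      by (intro sum_mono order_trans[OF degree_smult_le]) simp
    also have "\<dots> = m" using that by simp
    finally show ?thesis .
  qed
  have mon: "monom 1 k = (\<Sum>s\<le>m. smult (w s ^ k) (L s))" if k: "k \<le> m" for k
  proof (rule poly_eqI_degree[of "w ` {..m}"])
    show "poly (monom 1 k) x = poly (\<Sum>s\<le>m. smult (w s ^ k) (L s)) x" if "x \<in> w ` {..m}" for x
    proof -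
      obtain t where t: "t \<le> m" "x = w t" using \<open>x \<in> w ` {..m}\<close> by auto
      have "poly (\<Sum>s\<le>m. smult (w s ^ k) (L s)) x = (\<Sum>s\<le>m. w s ^ k * (if s = t then 1 else 0))"
        unfolding poly_sum poly_smult t(2) by (intro sum.cong refl) (use ev t in auto)
      also have "\<dots> = w t ^ k" using t by (simp add: if_distrib[of "(*) _"] cong: if_cong)
      finally show ?thesis by (simp add: poly_monom t)
    qed
    have c: "card (w ` {..m}) = Suc m" using card_image[OF assms] by simp
    show "degree (monom (1::complex) k) < card (w ` {..m})" using k c by (simp add: degree_monom_eq)
    have "degree (\<Sum>s\<le>m. smult (w s ^ k) (L s)) \<le> m"
      by (intro degree_sum_le order_trans[OF degree_smult_le] dL) auto
    then show "degree (\<Sum>s\<le>m. smult (w s ^ k) (L s)) < card (w ` {..m})" using c by simp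
  qed
  show ?thesis
  proof (intro exI[of _ "\<lambda>j s. coeff (L s) j"] allI impI)
    fix j k assume "j \<le> m" "k \<le> m"
    have "coeff (monom 1 k) j = (\<Sum>s\<le>m. w s ^ k * coeff (L s) j)"
      unfolding mon[OF \<open>k \<le> m\<close>] by (simp add: coeff_sum)
    then show "(\<Sum>s\<le>m. coeff (L s) j * w s ^ k) = (if k = j then 1 else 0)"
      by (simp add: mult.commute coeff_monom)
  qed
qed

text \<open>Agrees with \<^const>\<open>gamma_sharp\<close> on \<^const>\<open>feichtinger\<close>, but is visibly linear and insensitive to null sets.\<close>

definition sharp_transform :: "(real \<Rightarrow> complex) \<Rightarrow> complex" where
  "sharp_transform f = 1 / (\<i> * Theta 0) * (LINT \<eta>|lborel. trf f \<eta> * half_int_sum (gabor \<eta>))"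

lemma gamma_sharp_eq_transform: "f \<in> feichtinger \<Longrightarrow> gamma_sharp f = sharp_transform f"
  unfolding gamma_sharp_eq sharp_transform_def feichtinger_half_int_sum(2) ..

lemma sharp_transform_linear:
  assumes "f \<in> feichtinger" "g \<in> feichtinger"
  shows "sharp_transform (\<lambda>x. a * f x + b * g x) = a * sharp_transform f + b * sharp_transform g"
proof -
  have "(\<lambda>\<eta>. trf (\<lambda>x. a * f x + b * g x) \<eta> * half_int_sum (gabor \<eta>)) = (\<lambda>\<eta>. a * (trf f \<eta> * half_int_sum (gabor \<eta>)) + b * (trf g \<eta> * half_int_sum (gabor \<eta>)))"
    using fun_cong[OF feichtinger_linear(2)[OF assms, of a b]] by (simp add: algebra_simps)
  then show ?thesis unfolding sharp_transform_def
    by (simp only:) (simp add: feichtinger_half_int_sum(3) assms distrib_left mult.left_commute)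
qed

lemma sharp_transform_gabor_sum:
  assumes "finite F"
  shows "sharp_transform (\<lambda>x. \<Sum>i\<in>F. c i * gabor (\<mu> i) x) = (\<Sum>i\<in>F. c i * sharp_transform (gabor (\<mu> i)))"
proof -
  have "(\<lambda>\<eta>. trf (\<lambda>x. \<Sum>i\<in>F. c i * gabor (\<mu> i) x) \<eta> * half_int_sum (gabor \<eta>)) = (\<lambda>\<eta>. \<Sum>i\<in>F. c i * (trf (gabor (\<mu> i)) \<eta> * half_int_sum (gabor \<eta>)))"
    unfolding feichtinger_gabor_sum(2)[OF assms] by (simp add: sum_distrib_right mult.assoc)
  then show ?thesis unfolding sharp_transform_def
    by (simp only:) (subst Bochner_Integration.integral_sum; simp add: feichtinger_half_int_sum(3)[OF gabor_feichtinger] sum_distrib_left mult.left_commute sum_divide_distrib)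
qed

lemma feichtinger_cong_AE:
  assumes "f \<in> feichtinger" "AE x in lborel. f x = g x" "g \<in> borel_measurable borel"
  shows "g \<in> feichtinger" "trf g = trf f" "sharp_transform g = sharp_transform f"
proof -
  have fm: "f \<in> borel_measurable borel" by (rule feichtinger_measurable[OF assms(1)])
  show t: "trf g = trf f" by (rule trf_cong_AE[OF assms(2) fm assms(3), symmetric])
  show "g \<in> feichtinger"
    using assms(1) L2_cong_AE(1)[OF _ assms(2,3)] unfolding feichtinger_def mem_Collect_eq fun_cong[OF t] by blast
  show "sharp_transform g = sharp_transform f" unfolding sharp_transform_def fun_cong[OF t] ..
qed

text \<open>At the half-integers the phase of such a Gabor function is i (-1)^q times the
  alternating sign, so the half-integer sum loses its alternation and becomes i (-1)^q
  \<open>Theta 0\<close>. This accounts for the normalisation of \<open>gamma_sharp\<close>, and the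
  value is never 0.\<close>

lemma sharp_transform_gabor_half_lattice:
  "sharp_transform (gabor (lat z + sharp_pt)) = of_real (alt (snd z))"
proof -
  define p q where "p = fst z" and "q = snd z"
  define e where "e n = exp (- pi * (real_of_int n)\<^sup>2)" for n :: int
  have es: "e summable_on UNIV" using gauss_int_sum(1)[OF pi_ge_half, of 0] by (simp add: e_def[abs_def])
  have Th: "Theta 0 = of_real (2 powr (1/4) * infsum e UNIV)"
  proof -
    have "exp (2 * of_real pi * \<i> * of_int q * 0 - of_real pi * (of_int q)\<^sup>2) = complex_of_real (e q)" for q :: int
      by (simp add: e_def exp_of_real[symmetric])
    then show ?thesis unfolding Theta_def using infsumI[OF has_sum_of_real_iff[THEN iffD2, OF has_sum_infsum[OF es]]] by simp
  qed
  have t: "of_real (alt n) * gabor (lat z + sharp_pt) (real_of_int n + 1/2) = (\<i> * of_real (alt q) * of_real (2 powr (1/4))) * of_real (e (n - p))" for n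
  proof -
    have "cis (2 * pi * (real_of_int q + 1/2) * (real_of_int n + 1/2)) = cis (pi * real_of_int (2 * q * n + n + q)) * cis (pi/2)"
      unfolding cis_mult by (rule arg_cong[where f = cis]) (simp add: algebra_simps)
    also have "\<dots> = of_real (alt n * alt q) * \<i>" unfolding cis_pi_int by (simp add: alt_def)
    finally have c: "cis (2 * pi * (real_of_int q + 1/2) * (real_of_int n + 1/2)) = of_real (alt n * alt q) * \<i>" .
    have g: "gabor (lat z + sharp_pt) (real_of_int n + 1/2) = of_real (2 powr (1/4) * e (n - p)) * cis (2 * pi * (real_of_int q + 1/2) * (real_of_int n + 1/2))"
      by (simp add: gabor_eq lat_def sharp_pt_def e_def p_def q_def)
    have "complex_of_real (alt n) * of_real (alt n) = 1" using alt_simps(5)[of n] by (simp flip: of_real_mult)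
    then show ?thesis unfolding g c by (simp add: mult_ac)
  qed
  have "half_int_sum (gabor (lat z + sharp_pt)) = (\<Sum>\<^sub>\<infinity>n. (\<i> * of_real (alt q) * of_real (2 powr (1/4))) * of_real (e (n - p)))"
    unfolding half_int_sum_def t ..
  also have "\<dots> = (\<i> * of_real (alt q) * of_real (2 powr (1/4))) * (\<Sum>\<^sub>\<infinity>n. complex_of_real (e (n + (- p))))"
    by (simp add: infsum_cmult_right')
  also have "(\<Sum>\<^sub>\<infinity>n. complex_of_real (e (n + (- p)))) = (\<Sum>\<^sub>\<infinity>n. complex_of_real (e n))"
    by (rule infsum_reindex_bij_betw[OF bij_shift])
  also have "\<dots> = of_real (infsum e UNIV)" by (rule infsumI[OF has_sum_of_real_iff[THEN iffD2, OF has_sum_infsum[OF es]]])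
  finally have G: "half_int_sum (gabor (lat z + sharp_pt)) = \<i> * Theta 0 * of_real (alt q)" unfolding Th by simp
  have "synth (trf (gabor l)) = gabor l" for l
    by (rule ext) (simp add: synth_def gabor_reproducing[symmetric])
  then have "sharp_transform (gabor (lat z + sharp_pt)) = 1 / (\<i> * Theta 0) * half_int_sum (gabor (lat z + sharp_pt))"
    using gamma_sharp_eq[OF gabor_feichtinger] gamma_sharp_eq_transform[OF gabor_feichtinger] by simp
  then show ?thesis unfolding G using Theta_0_nonzero by (simp add: q_def)
qed

lemma annih_gabor_sum_feichtinger:
  assumes F: "finite F"
  shows "(annih ^^ k) (\<lambda>x. \<Sum>i\<in>F. c i * gabor (\<mu> i) x) \<in> feichtinger"
    and "gamma_sharp ((annih ^^ k) (\<lambda>x. \<Sum>i\<in>F. c i * gabor (\<mu> i) x)) = (\<Sum>i\<in>F. c i * cpoint (\<mu> i) ^ k * sharp_transform (gabor (\<mu> i)))"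
proof -
  let ?S = "\<lambda>x. \<Sum>i\<in>F. c i * gabor (\<mu> i) x" and ?T = "\<lambda>x. \<Sum>i\<in>F. c i * cpoint (\<mu> i) ^ k * gabor (\<mu> i) x"
  have ae: "AE x in lborel. ?T x = (annih ^^ k) ?S x"
    using annih_iterate_gabor_sum(2)[OF F, where m = k and c = c and \<mu> = \<mu>] by eventually_elim simp
  have m: "(annih ^^ k) ?S \<in> borel_measurable borel"
    by (rule locally_integrable_measurable[OF annih_regular_locally_integrable[OF annih_iterate_gabor_sum(1)[OF F] order_refl]])
  note c = feichtinger_cong_AE[OF feichtinger_gabor_sum(1)[OF F] ae m]
  show "(annih ^^ k) ?S \<in> feichtinger" by (rule c(1))
  show "gamma_sharp ((annih ^^ k) ?S) = (\<Sum>i\<in>F. c i * cpoint (\<mu> i) ^ k * sharp_transform (gabor (\<mu> i)))"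
    unfolding gamma_sharp_eq_transform[OF c(1)] c(3) sharp_transform_gabor_sum[OF F] ..
qed

text \<open>The choice in \<open>d_coeff\<close> is meaningful because a solution exists: the
  inverse Vandermonde matrix for the distinct numbers cpoint (\<mu> s), with its entries divided by
  the nonzero values of the functional at gabor (\<mu> s).\<close>

lemma d_coeff_spec:
  assumes \<mu>: "\<forall>s\<le>m. \<mu> s \<in> (\<lambda>l. l + sharp_pt) ` Lambda" and inj: "inj_on \<mu> {..m}" and j: "j \<le> m" "k \<le> m"
  shows "(\<Sum>s\<le>m. d_coeff m \<mu> j s * cpoint (\<mu> s) ^ k * sharp_transform (gabor (\<mu> s))) = (if k = j then 1 else 0)"
proof -
  have ne: "sharp_transform (gabor (\<mu> s)) \<noteq> 0" if s: "s \<le> m" for s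
  proof -
    obtain z where "\<mu> s = lat z + sharp_pt" using \<mu> s unfolding Lambda_eq by auto
    then show ?thesis by (simp add: sharp_transform_gabor_half_lattice alt_def)
  qed
  have "inj_on (\<lambda>s. cpoint (\<mu> s)) {..m}"
    using inj by (auto simp: inj_on_def prod_eq_iff)
  from lagrange_coefficients[OF this] obtain a :: "nat \<Rightarrow> nat \<Rightarrow> complex" where
    a: "\<forall>j\<le>m. \<forall>k\<le>m. (\<Sum>s\<le>m. a j s * cpoint (\<mu> s) ^ k) = (if k = j then 1 else 0)" by blast
  have gs: "gamma_sharp ((annih ^^ k) (gabor_comb m \<mu> h)) = (\<Sum>s\<le>m. h s * cpoint (\<mu> s) ^ k * sharp_transform (gabor (\<mu> s)))" for k h
    unfolding gabor_comb_def by (rule annih_gabor_sum_feichtinger(2)) simp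
  have "\<exists>h. \<forall>j\<le>m. \<forall>k\<le>m. gamma_sharp ((annih ^^ k) (gabor_comb m \<mu> (h j))) = (if k = j then 1 else 0)"
  proof (intro exI[of _ "\<lambda>j s. a j s / sharp_transform (gabor (\<mu> s))"] allI impI)
    fix j k assume jk: "j \<le> m" "k \<le> m"
    have "(\<Sum>s\<le>m. a j s / sharp_transform (gabor (\<mu> s)) * cpoint (\<mu> s) ^ k * sharp_transform (gabor (\<mu> s))) = (\<Sum>s\<le>m. a j s * cpoint (\<mu> s) ^ k)"
      by (intro sum.cong refl) (use ne in auto)
    then show "gamma_sharp ((annih ^^ k) (gabor_comb m \<mu> (\<lambda>s. a j s / sharp_transform (gabor (\<mu> s))))) = (if k = j then 1 else 0)"
      unfolding gs using a jk by simp
  qed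
  from someI_ex[OF this, folded d_coeff_def] j show ?thesis unfolding gs by blast
qed

section \<open>Linear operations and null sets in the weighted spaces\<close>

lemma H_space_linear:
  assumes f: "f \<in> H_space \<delta>" and g: "g \<in> H_space \<delta>"
  shows "(\<lambda>x. a * f x + b * g x) \<in> H_space \<delta>"
    and "(H_norm \<delta> (\<lambda>x. a * f x + b * g x))\<^sup>2 \<le> 2 * (norm a)\<^sup>2 * (H_norm \<delta> f)\<^sup>2 + 2 * (norm b)\<^sup>2 * (H_norm \<delta> g)\<^sup>2"
proof -
  let ?w = "\<lambda>l :: real \<times> real. norm l powr \<delta> + 1"
  have L: "f \<in> L2" "g \<in> L2" and i: "integrable lborel (\<lambda>l. ?w l * (norm (trf f l))\<^sup>2)" "integrable lborel (\<lambda>l. ?w l * (norm (trf g l))\<^sup>2)"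
    using f g by (auto simp: H_space_def)
  have eq: "trf (\<lambda>x. a * f x + b * g x) l = a * trf f l + b * trf g l" for l
  proof -
    have "(\<lambda>x. (a * f x + b * g x) * cnj (gabor l x)) = (\<lambda>x. a * (f x * cnj (gabor l x)) + b * (g x * cnj (gabor l x)))"
      by (auto simp: algebra_simps)
    then show ?thesis unfolding L2_inner_def by (simp only:) (use L2_times_gabor_integrable(1) L in simp)
  qed
  note [measurable] = L2_inner_gabor_measurable[OF L(1)] L2_inner_gabor_measurable[OF L(2)]
  have le: "?w l * (norm (a * trf f l + b * trf g l))\<^sup>2 \<le> 2 * (norm a)\<^sup>2 * (?w l * (norm (trf f l))\<^sup>2) + 2 * (norm b)\<^sup>2 * (?w l * (norm (trf g l))\<^sup>2)" for l
  proof -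
    have "(norm (a * trf f l + b * trf g l))\<^sup>2 \<le> (norm a * norm (trf f l) + norm b * norm (trf g l))\<^sup>2"
      by (intro power_mono order_trans[OF norm_triangle_ineq]) (auto simp: norm_mult)
    also have "\<dots> \<le> 2 * (norm a * norm (trf f l))\<^sup>2 + 2 * (norm b * norm (trf g l))\<^sup>2"
      using sum_squares_bound[of "norm a * norm (trf f l)" "norm b * norm (trf g l)"] by (simp add: power2_sum)
    finally have "?w l * (norm (a * trf f l + b * trf g l))\<^sup>2 \<le> ?w l * (2 * (norm a * norm (trf f l))\<^sup>2 + 2 * (norm b * norm (trf g l))\<^sup>2)"
      by (intro mult_left_mono) auto
    then show ?thesis by (simp add: power_mult_distrib algebra_simps)
  qed
  have r: "integrable lborel (\<lambda>l. 2 * (norm a)\<^sup>2 * (?w l * (norm (trf f l))\<^sup>2) + 2 * (norm b)\<^sup>2 * (?w l * (norm (trf g l))\<^sup>2))"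
    using i by (intro Bochner_Integration.integrable_add integrable_mult_right)
  have l: "integrable lborel (\<lambda>l. ?w l * (norm (a * trf f l + b * trf g l))\<^sup>2)"
    by (rule Bochner_Integration.integrable_bound[OF r]) (use le in \<open>auto simp: abs_mult intro!: AE_I2 order_trans[OF _ abs_ge_self]\<close>)
  show "(\<lambda>x. a * f x + b * g x) \<in> H_space \<delta>"
    using l L2_linear(1)[OF L] unfolding H_space_def mem_Collect_eq eq by blast
  show "(H_norm \<delta> (\<lambda>x. a * f x + b * g x))\<^sup>2 \<le> 2 * (norm a)\<^sup>2 * (H_norm \<delta> f)\<^sup>2 + 2 * (norm b)\<^sup>2 * (H_norm \<delta> g)\<^sup>2"
    unfolding H_norm_sq eq using integral_mono[OF l r le] i by simp
qed

lemma H_space_cong_AE: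
  assumes "f \<in> H_space \<delta>" "AE x in lborel. f x = g x" "g \<in> borel_measurable borel"
  shows "g \<in> H_space \<delta>" "H_norm \<delta> g = H_norm \<delta> f"
proof -
  have f: "f \<in> L2" using assms by (simp add: H_space_def)
  then have fm: "f \<in> borel_measurable borel" by (simp add: L2_def)
  have t: "trf g = trf f" by (rule trf_cong_AE[OF assms(2) fm assms(3), symmetric])
  have t': "L2_inner g (gabor l) = L2_inner f (gabor l)" for l using fun_cong[OF t] .
  show "g \<in> H_space \<delta>" using assms(1) L2_cong_AE(1)[OF f assms(2,3)] unfolding H_space_def mem_Collect_eq t' by blast
  show "H_norm \<delta> g = H_norm \<delta> f" unfolding H_norm_def t' ..
qed

section \<open>Necessity of the exponent 2\<close>

lemma integral_product:
  fixes f g :: "real \<Rightarrow> real"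
  assumes "integrable lborel f" "integrable lborel g"
  shows "(LINT l|lborel. f (fst l) * g (snd l)) = integral\<^sup>L lborel f * integral\<^sup>L lborel g"
proof -
  have i: "integrable lborel (\<lambda>l. complex_of_real (f (fst l) * g (snd l)))"
    unfolding complex_of_real_integrable_eq by (rule integrable_product[OF assms])
  have "complex_of_real (LINT l|lborel. f (fst l) * g (snd l)) = of_real (integral\<^sup>L lborel f * integral\<^sup>L lborel g)"
    unfolding integral_complex_of_real[symmetric] integral_iterated[OF i] by simp
  then show ?thesis unfolding of_real_eq_iff .
qed

lemma norm_sq_le_shift:
  fixes l \<mu> :: "real \<times> real"
  shows "(norm l)\<^sup>2 \<le> 2 * (norm \<mu>)\<^sup>2 + 2 * (norm (l - \<mu>))\<^sup>2"
proof -
  have "norm l \<le> norm \<mu> + norm (l - \<mu>)" by (rule norm_triangle_sub)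
  then have "(norm l)\<^sup>2 \<le> (norm \<mu> + norm (l - \<mu>))\<^sup>2" by (intro power_mono) auto
  also have "\<dots> \<le> 2 * (norm \<mu>)\<^sup>2 + 2 * (norm (l - \<mu>))\<^sup>2"
    using sum_squares_bound[of "norm \<mu>" "norm (l - \<mu>)"] by (simp add: power2_sum)
  finally show ?thesis .
qed

lemma norm_trf_gabor: "norm (trf (gabor \<mu>) l) = exp (- (pi / 2) * (norm (l - \<mu>))\<^sup>2)"
  unfolding L2_inner_gabor_gabor by (simp add: norm_mult norm_minus_commute)

lemma gaussian_plane:
  fixes \<mu> :: "real \<times> real"
  assumes "s > 0"
  shows "integrable lborel (\<lambda>l. exp (- (pi * s) * (norm (l - \<mu>))\<^sup>2))"
    and "(LINT l|lborel. exp (- (pi * s) * (norm (l - \<mu>))\<^sup>2)) = 1 / s"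
proof -
  have eq: "exp (- (pi * s) * (norm (l - \<mu>))\<^sup>2) = exp (- (pi * s) * (fst l - fst \<mu>)\<^sup>2) * exp (- (pi * s) * (snd l - snd \<mu>)\<^sup>2)" for l
    by (simp add: norm_prod_def algebra_simps flip: exp_add)
  note g = gaussian_integral[OF assms]
  show "integrable lborel (\<lambda>l. exp (- (pi * s) * (norm (l - \<mu>))\<^sup>2))"
    unfolding eq by (rule integrable_product[OF g(1) g(1)])
  have "(LINT l|lborel. exp (- (pi * s) * (norm (l - \<mu>))\<^sup>2)) = (1 / sqrt s) * (1 / sqrt s)"
    unfolding eq integral_product[OF g(1) g(1), of "fst \<mu>" "snd \<mu>"] g(2) ..
  then show "(LINT l|lborel. exp (- (pi * s) * (norm (l - \<mu>))\<^sup>2)) = 1 / s" using assms by simp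
qed

lemma gabor_H_space:
  assumes "\<delta> > 0"
  shows "gabor \<mu> \<in> H_space \<delta>"
proof -
  define C where "C = 2 * exp (\<delta>\<^sup>2 + (norm \<mu>)\<^sup>2 / 2)"
  have w: "norm l powr \<delta> + 1 \<le> C * exp ((norm (l - \<mu>))\<^sup>2 / 2)" for l
  proof -
    have "norm l powr \<delta> \<le> exp (norm l) powr \<delta>"
    proof (rule powr_mono2)
      show "norm l \<le> exp (norm l)" using exp_ge_add_one_self[of "norm l"] by linarith
    qed (use assms in auto)
    also have "\<dots> = exp (\<delta> * norm l)" by (simp add: powr_def mult.commute)
    also have "\<dots> \<le> exp (\<delta>\<^sup>2 + (norm \<mu>)\<^sup>2 / 2 + (norm (l - \<mu>))\<^sup>2 / 2)"
    proof -
      have "\<delta> * norm l \<le> \<delta>\<^sup>2 + (norm l)\<^sup>2 / 4"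
        using sum_squares_bound[of \<delta> "norm l / 2"] by (simp add: power_divide)
      then show ?thesis using norm_sq_le_shift[of l \<mu>] by simp
    qed
    finally have "norm l powr \<delta> \<le> exp (\<delta>\<^sup>2 + (norm \<mu>)\<^sup>2 / 2) * exp ((norm (l - \<mu>))\<^sup>2 / 2)" by (simp add: exp_add)
    moreover have "1 \<le> exp (\<delta>\<^sup>2 + (norm \<mu>)\<^sup>2 / 2) * exp ((norm (l - \<mu>))\<^sup>2 / 2)"
      unfolding exp_add[symmetric] by simp
    ultimately show ?thesis by (simp add: C_def)
  qed
  \<comment> \<open>The weight costs a factor exp (norm (l - \<mu>)^2 / 2) of the available exp (-
    pi norm (l - \<mu>)^2); the rate left over is pi s.\<close>
  define s where "s = 1 - 1 / (2 * pi)"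
  have s: "s > 0" "pi * s = pi - 1/2" using pi_gt3 by (auto simp: s_def field_simps)
  have le: "(norm l powr \<delta> + 1) * (norm (trf (gabor \<mu>) l))\<^sup>2 \<le> C * exp (- (pi * s) * (norm (l - \<mu>))\<^sup>2)" for l
  proof -
    have "(norm l powr \<delta> + 1) * (norm (trf (gabor \<mu>) l))\<^sup>2 \<le> C * exp ((norm (l - \<mu>))\<^sup>2 / 2) * (norm (trf (gabor \<mu>) l))\<^sup>2"
      by (intro mult_right_mono w) auto
    also have "\<dots> = C * exp ((norm (l - \<mu>))\<^sup>2 / 2) * exp (- pi * (norm (l - \<mu>))\<^sup>2)"
      unfolding norm_trf_gabor by (simp flip: exp_double)
    also have "\<dots> = C * exp (- (pi * s) * (norm (l - \<mu>))\<^sup>2)"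
      unfolding s mult.assoc exp_add[symmetric] by (simp add: algebra_simps)
    finally show ?thesis .
  qed
  have "integrable lborel (\<lambda>l. (norm l powr \<delta> + 1) * (norm (trf (gabor \<mu>) l))\<^sup>2)"
  proof (rule Bochner_Integration.integrable_bound[OF integrable_mult_right[OF gaussian_plane(1)[OF s(1), of \<mu>], of C]])
    show "(\<lambda>l. (norm l powr \<delta> + 1) * (norm (trf (gabor \<mu>) l))\<^sup>2) \<in> borel_measurable lborel"
      using L2_inner_gabor_measurable[OF gabor_in_L2[of \<mu>]] by simp
    show "AE l in lborel. norm ((norm l powr \<delta> + 1) * (norm (trf (gabor \<mu>) l))\<^sup>2) \<le> norm (C * exp (- (pi * s) * (norm (l - \<mu>))\<^sup>2))"
    proof (intro AE_I2)
      fix l :: "real \<times> real"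
      have "\<bar>(norm l powr \<delta> + 1) * (norm (trf (gabor \<mu>) l))\<^sup>2\<bar> = (norm l powr \<delta> + 1) * (norm (trf (gabor \<mu>) l))\<^sup>2" by simp
      then show "norm ((norm l powr \<delta> + 1) * (norm (trf (gabor \<mu>) l))\<^sup>2) \<le> norm (C * exp (- (pi * s) * (norm (l - \<mu>))\<^sup>2))"
        unfolding real_norm_def using order_trans[OF le abs_ge_self, of l] by simp
    qed
  qed
  then show ?thesis by (simp add: H_space_def gabor_in_L2)
qed

lemma gabor_sum_H_space:
  assumes "finite F" "\<delta> > 0"
  shows "(\<lambda>x. \<Sum>i\<in>F. c i * gabor (\<mu> i) x) \<in> H_space \<delta>"
  using assms(1)
proof (induction F)
  case empty
  then show ?case using H_space_linear(1)[OF gabor_H_space[OF assms(2)] gabor_H_space[OF assms(2)], where a = 0 and b = 0] by simp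
next
  case (insert i F)
  then show ?case
    using H_space_linear(1)[OF gabor_H_space[OF assms(2), of "\<mu> i"] insert.IH, where a = "c i" and b = 1] by simp
qed

text \<open>For \<open>\<delta> \<le> 2\<close> and coefficients of size \<open>1 / (1 + norm l\<^sup>2)\<close> the right-hand side diverges only as fast as the value of
  \<^const>\<open>gamma_sharp\<close>, hence slower than its square: the functional is unbounded.\<close>

lemma half_lattice_sum_H_norm:
  assumes \<delta>: "0 < \<delta>" "\<delta> \<le> 2"
  shows "\<exists>K>0. \<forall>S (c :: int \<times> int \<Rightarrow> real). finite S \<longrightarrow>
    (H_norm \<delta> (\<lambda>x. \<Sum>z\<in>S. of_real (c z) * gabor (lat z + sharp_pt) x))\<^sup>2 \<le> K * (\<Sum>z\<in>S. (1 + (norm (lat z + sharp_pt))\<^sup>2) * (c z)\<^sup>2)"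
proof -
  \<comment> \<open>The rate pi / 2 of the transform is reduced by 1, the cost of absorbing the
    weight 1 + norm (l - \<mu> z)^2.\<close>
  define s where "s = 1/2 - 1 / pi"
  have s: "s > 0" "pi * s = pi / 2 - 1" using pi_gt3 by (auto simp: s_def field_simps)
  define G where "G = gauss_sum_bound * gauss_sum_bound"
  have G: "G \<ge> 0" by (simp add: G_def)
  define K where "K = 4 * (G + 1) / s"
  define \<mu> where "\<mu> z = lat z + sharp_pt" for z
  define E where "E z l = norm (trf (gabor (\<mu> z)) l)" for z l
  \<comment> \<open>Shifting l by \<open>sharp_pt\<close> turns the half-lattice into the lattice,
    for which the sum is bounded uniformly.\<close>
  have Esum: "(\<Sum>z\<in>S. E z l) \<le> G" if "finite S" for S l
  proof -
    have eq: "E z l = norm (L2_inner (gabor (lat z)) (gabor (l - sharp_pt)))" for z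
      unfolding E_def norm_trf_gabor by (simp add: \<mu>_def algebra_simps)
    have "(\<Sum>z\<in>S. E z l) \<le> (\<Sum>\<^sub>\<infinity>z. E z l)"
      unfolding eq by (intro finite_sum_le_infsum lattice_inner_sum that) auto
    also have "\<dots> \<le> G" unfolding eq G_def by (rule lattice_inner_sum)
    finally show ?thesis .
  qed
  have w: "norm l powr \<delta> + 1 \<le> 2 * (1 + (norm l)\<^sup>2)" for l :: "real \<times> real"
  proof -
    have "norm l powr \<delta> \<le> 1 + (norm l)\<^sup>2"
    proof (cases "norm l \<le> 1")
      case True
      then have "norm l powr \<delta> \<le> 1 powr \<delta>" using \<delta> by (intro powr_mono2) auto
      then show ?thesis by (simp add: add_increasing2)
    next
      case False
      then have "norm l powr \<delta> \<le> norm l powr 2" using \<delta> by (intro powr_mono) auto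
      also have "\<dots> = (norm l)\<^sup>2" using False by (subst powr_numeral) auto
      finally show ?thesis by simp
    qed
    then show ?thesis by (smt (verit) zero_le_power2)
  qed
  have wE: "(norm l powr \<delta> + 1) * E z l \<le> 4 * (1 + (norm (\<mu> z))\<^sup>2) * exp (- (pi * s) * (norm (l - \<mu> z))\<^sup>2)" for z l
  proof -
    define a b where "a = (norm (\<mu> z))\<^sup>2" and "b = (norm (l - \<mu> z))\<^sup>2"
    have ab: "a \<ge> 0" "b \<ge> 0" by (auto simp: a_def b_def)
    have "(norm l)\<^sup>2 \<le> 2 * a + 2 * b" unfolding a_def b_def by (rule norm_sq_le_shift)
    moreover have "0 \<le> a * b" using ab by simp
    moreover have "4 * (1 + a) * (1 + b) = 4 + 4 * a + 4 * b + 4 * (a * b)" by (simp add: algebra_simps)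
    ultimately have "2 * (1 + (norm l)\<^sup>2) \<le> 4 * (1 + a) * (1 + b)" by argo
    also have "\<dots> \<le> 4 * (1 + a) * exp b" using ab by (intro mult_left_mono exp_ge_add_one_self) auto
    finally have "norm l powr \<delta> + 1 \<le> 4 * (1 + a) * exp b" using w[of l] by linarith
    then have "(norm l powr \<delta> + 1) * E z l \<le> 4 * (1 + a) * exp b * E z l"
      by (intro mult_right_mono) (auto simp: E_def)
    also have "\<dots> = 4 * (1 + a) * exp (- (pi * s) * b)"
      unfolding E_def norm_trf_gabor b_def[symmetric] s(2) mult.assoc exp_add[symmetric] by (simp add: algebra_simps)
    finally show ?thesis by (simp add: a_def b_def)
  qed
  show ?thesis
  proof (intro exI[of _ K] conjI allI impI)
    show "K > 0" using s G by (simp add: K_def)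
    fix S :: "(int \<times> int) set" and c :: "int \<times> int \<Rightarrow> real" assume S: "finite S"
    let ?f = "\<lambda>x. \<Sum>z\<in>S. of_real (c z) * gabor (lat z + sharp_pt) x"
    define B where "B = (\<Sum>z\<in>S. (1 + (norm (lat z + sharp_pt))\<^sup>2) * (c z)\<^sup>2)"
    have B0: "B \<ge> 0" unfolding B_def by (intro sum_nonneg mult_nonneg_nonneg) auto
    have fH: "?f \<in> H_space \<delta>" by (rule gabor_sum_H_space[OF S \<delta>(1)])
    have le: "(norm l powr \<delta> + 1) * (norm (trf ?f l))\<^sup>2 \<le> G * (\<Sum>z\<in>S. (c z)\<^sup>2 * (4 * (1 + (norm (\<mu> z))\<^sup>2) * exp (- (pi * s) * (norm (l - \<mu> z))\<^sup>2)))" for l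
    proof -
      have E0: "E z l \<ge> 0" for z by (simp add: E_def)
      \<comment> \<open>Cauchy-Schwarz with half of each E z l in either factor: the plain sum of
        the E z l is bounded by G, and the other sum still carries the decay that absorbs the
        weight.\<close>
      have "norm (trf ?f l) \<le> (\<Sum>z\<in>S. \<bar>c z\<bar> * E z l)"
        unfolding feichtinger_gabor_sum(2)[OF S] E_def \<mu>_def by (rule order_trans[OF norm_sum]) (simp add: norm_mult)
      also have "\<dots> = (\<Sum>z\<in>S. sqrt (E z l) * (sqrt (E z l) * \<bar>c z\<bar>))"
      proof (intro sum.cong refl)
        fix z
        have "sqrt (E z l) * (sqrt (E z l) * \<bar>c z\<bar>) = (sqrt (E z l) * sqrt (E z l)) * \<bar>c z\<bar>" by (simp only: mult.assoc)
        also have "\<dots> = E z l * \<bar>c z\<bar>" using E0[of z] by simp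
        finally show "\<bar>c z\<bar> * E z l = sqrt (E z l) * (sqrt (E z l) * \<bar>c z\<bar>)" by (simp only: mult.commute)
      qed
      finally have "(norm (trf ?f l))\<^sup>2 \<le> (\<Sum>z\<in>S. sqrt (E z l) * (sqrt (E z l) * \<bar>c z\<bar>))\<^sup>2"
        by (rule power_mono) simp
      also have "\<dots> \<le> (\<Sum>z\<in>S. (sqrt (E z l))\<^sup>2) * (\<Sum>z\<in>S. (sqrt (E z l) * \<bar>c z\<bar>)\<^sup>2)"
        by (rule Cauchy_Schwarz_ineq_sum)
      also have "\<dots> = (\<Sum>z\<in>S. E z l) * (\<Sum>z\<in>S. E z l * (c z)\<^sup>2)"
        by (simp add: power_mult_distrib E0)
      also have "\<dots> \<le> G * (\<Sum>z\<in>S. E z l * (c z)\<^sup>2)"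
        by (intro mult_right_mono Esum S sum_nonneg mult_nonneg_nonneg E0) auto
      finally have "(norm l powr \<delta> + 1) * (norm (trf ?f l))\<^sup>2 \<le> (norm l powr \<delta> + 1) * (G * (\<Sum>z\<in>S. E z l * (c z)\<^sup>2))"
        by (rule mult_left_mono) simp
      also have "\<dots> = G * (\<Sum>z\<in>S. (c z)\<^sup>2 * ((norm l powr \<delta> + 1) * E z l))"
        by (simp add: sum_distrib_left mult_ac)
      also have "\<dots> \<le> G * (\<Sum>z\<in>S. (c z)\<^sup>2 * (4 * (1 + (norm (\<mu> z))\<^sup>2) * exp (- (pi * s) * (norm (l - \<mu> z))\<^sup>2)))"
        by (intro mult_left_mono sum_mono wE G) auto
      finally show ?thesis .
    qed
    have gi: "integrable lborel (\<lambda>l. (c z)\<^sup>2 * (4 * (1 + (norm (\<mu> z))\<^sup>2) * exp (- (pi * s) * (norm (l - \<mu> z))\<^sup>2)))" for z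
      by (intro integrable_mult_right gaussian_plane(1) s)
    have "(H_norm \<delta> ?f)\<^sup>2 \<le> (LINT l|lborel. G * (\<Sum>z\<in>S. (c z)\<^sup>2 * (4 * (1 + (norm (\<mu> z))\<^sup>2) * exp (- (pi * s) * (norm (l - \<mu> z))\<^sup>2))))"
      unfolding H_norm_sq
      by (rule integral_mono[OF _ _ le]) (use fH in \<open>simp add: H_space_def\<close>, intro integrable_mult_right Bochner_Integration.integrable_sum gi)
    also have "\<dots> = G * (\<Sum>z\<in>S. (c z)\<^sup>2 * (4 * (1 + (norm (\<mu> z))\<^sup>2) * (1 / s)))"
      unfolding integral_mult_right_zero by (subst Bochner_Integration.integral_sum[OF gi]) (simp only: integral_mult_right_zero gaussian_plane(2)[OF s(1)])
    also have "\<dots> = 4 * G / s * B"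
      by (simp add: B_def \<mu>_def sum_distrib_left sum_distrib_right mult_ac)
    also have "\<dots> \<le> K * B" unfolding K_def using s B0 by (intro mult_right_mono divide_right_mono) auto
    finally show "(H_norm \<delta> ?f)\<^sup>2 \<le> K * (\<Sum>z\<in>S. (1 + (norm (lat z + sharp_pt))\<^sup>2) * (c z)\<^sup>2)" unfolding B_def .
  qed
qed

text \<open>In the sector 0 \<le> q \<le> p of the lattice the row p has p + 1 points, each
  contributing at least 1 / (6 (p + 1)^2), so a multiple of the harmonic series is a lower
  bound.\<close>

lemma half_lattice_sum_unbounded:
  "\<exists>S. finite S \<and> C < (\<Sum>z\<in>S. 1 / (1 + (norm (lat z + sharp_pt))\<^sup>2))"
proof (rule ccontr)
  assume *: "\<not> ?thesis"
  define w where "w z = 1 / (1 + (norm (lat z + sharp_pt))\<^sup>2)" for z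
  have le: "sum w S \<le> C" if "finite S" for S using * that by (auto simp: w_def[abs_def] not_less)
  define T where "T N = (SIGMA p:{..<N}. {..p :: nat})" for N
  have "(\<Sum>p<N. 1 / real (Suc p)) \<le> 6 * C" for N
  proof -
    let ?h = "\<lambda>a :: nat \<times> nat. (int (fst a), int (snd a))"
    have "(\<Sum>p<N. 1 / real (Suc p)) = (\<Sum>p<N. \<Sum>q\<le>p. 1 / (real (Suc p))\<^sup>2)"
      by (rule sum.cong) (auto simp: power2_eq_square)
    also have "\<dots> \<le> (\<Sum>p<N. \<Sum>q\<le>p. 6 * w (int p, int q))"
    proof (intro sum_mono)
      fix p q :: nat assume "q \<in> {..p}"
      then have q: "real q \<le> real p" by simp
      have n: "(norm (lat (int p, int q) + sharp_pt))\<^sup>2 = (real p + 1/2)\<^sup>2 + (real q + 1/2)\<^sup>2"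
        by (simp add: lat_def sharp_pt_def norm_prod_def)
      have "(real q + 1/2)\<^sup>2 \<le> (real p + 1)\<^sup>2" "(real p + 1/2)\<^sup>2 \<le> (real p + 1)\<^sup>2" "1 \<le> (real p + 1)\<^sup>2"
        using q by (intro power_mono; simp)+ simp
      have "1 + (norm (lat (int p, int q) + sharp_pt))\<^sup>2 \<le> 6 * (real (Suc p))\<^sup>2"
      proof -
        have "1 + (a + b) \<le> 6 * d" if "b \<le> d" "a \<le> d" "1 \<le> d" for a b d :: real using that by linarith
        moreover have "real (Suc p) = real p + 1" by simp
        ultimately show ?thesis using \<open>(real q + 1/2)\<^sup>2 \<le> (real p + 1)\<^sup>2\<close> \<open>(real p + 1/2)\<^sup>2 \<le> (real p + 1)\<^sup>2\<close> \<open>1 \<le> (real p + 1)\<^sup>2\<close>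
          unfolding n by presburger
      qed
      then have "1 / (6 * (real (Suc p))\<^sup>2) \<le> w (int p, int q)"
        unfolding w_def by (intro divide_left_mono mult_pos_pos) (auto simp: add_pos_nonneg)
      then show "1 / (real (Suc p))\<^sup>2 \<le> 6 * w (int p, int q)" by simp
    qed
    also have "\<dots> = 6 * (\<Sum>a\<in>T N. w (?h a))"
      unfolding T_def by (subst sum.Sigma) (auto simp: sum_distrib_left case_prod_unfold)
    also have "(\<Sum>a\<in>T N. w (?h a)) = sum w (?h ` T N)"
      by (subst sum.reindex) (auto simp: inj_on_def o_def)
    also have "6 * sum w (?h ` T N) \<le> 6 * C"
      by (intro mult_left_mono le finite_imageI) (auto simp: T_def)
    finally show ?thesis .
  qed
  then have "summable (\<lambda>p. 1 / real (Suc p))"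
    by (intro summableI_nonneg_bounded) auto
  then show False using not_summable_harmonic[where 'a = real] summable_Suc_iff[of "\<lambda>n. inverse (real n)"] by (simp add: inverse_eq_divide)
qed

lemma Hm_zero: "Hm_space \<delta> 0 = H_space \<delta>" "Hm_norm \<delta> 0 f = H_norm \<delta> f"
  by (auto simp: Hm_space_def Hm_norm_def H_norm_nonneg)

text \<open>Continuity at 0 is contradicted by finite sums of Gabor functions at half-lattice points
  on which \<open>gamma_sharp\<close> equals 1 while their norms are arbitrarily small.\<close>

lemma gamma_sharp_well_defined_imp:
  assumes "\<delta>0 \<ge> 1" "gamma_sharp_well_defined \<delta>0"
  shows "\<delta>0 \<ge> 2"
proof (rule ccontr)
  assume "\<not> \<delta>0 \<ge> 2"
  \<comment> \<open>The midpoint exceeds \<delta>0, so the assumed continuity applies to it, and is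
    still at most 2, so the norm estimate applies.\<close>
  define \<delta> where "\<delta> = (\<delta>0 + 2) / 2"
  have \<delta>: "0 < \<delta>" "\<delta> \<le> 2" "\<delta>0 < \<delta>" using assms(1) \<open>\<not> \<delta>0 \<ge> 2\<close> by (auto simp: \<delta>_def)
  obtain K where K: "K > 0" "\<And>S (c :: int \<times> int \<Rightarrow> real). finite S \<Longrightarrow>
    (H_norm \<delta> (\<lambda>x. \<Sum>z\<in>S. of_real (c z) * gabor (lat z + sharp_pt) x))\<^sup>2 \<le> K * (\<Sum>z\<in>S. (1 + (norm (lat z + sharp_pt))\<^sup>2) * (c z)\<^sup>2)"
    using half_lattice_sum_H_norm[OF \<delta>(1,2)] by blast
  have cont: "continuous_functional_on (Hm_norm \<delta> 0) (Hm_space \<delta> 0) gamma_sharp"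
    using assms(2) \<delta> by (auto simp: gamma_sharp_well_defined_def continuous_linear_functional_def)
  have z: "(\<lambda>x. 0) \<in> Hm_space \<delta> 0"
    using gabor_sum_H_space[of "{} :: nat set", OF _ \<delta>(1)] by (simp add: Hm_zero)
  have gsum: "gamma_sharp (\<lambda>x. \<Sum>z\<in>S. of_real (c z) * gabor (lat z + sharp_pt) x) = (\<Sum>z\<in>S. of_real (c z) * of_real (alt (snd z)))" if "finite S" for S and c :: "int \<times> int \<Rightarrow> real"
    unfolding gamma_sharp_eq_transform[OF feichtinger_gabor_sum(1)[OF that]] sharp_transform_gabor_sum[OF that] sharp_transform_gabor_half_lattice ..
  have g0: "gamma_sharp (\<lambda>x. 0) = 0" using gsum[of "{}"] by simp
  obtain \<epsilon> where \<epsilon>: "\<epsilon> > 0" "\<And>g. g \<in> Hm_space \<delta> 0 \<Longrightarrow> Hm_norm \<delta> 0 (\<lambda>x. g x - 0) < \<epsilon> \<Longrightarrow> norm (gamma_sharp g - gamma_sharp (\<lambda>x. 0)) < 1"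
    using bspec[OF cont[unfolded continuous_functional_on_def] z] zero_less_one by blast
  obtain S where S: "finite S" "4 * K / \<epsilon>\<^sup>2 < (\<Sum>z\<in>S. 1 / (1 + (norm (lat z + sharp_pt))\<^sup>2))"
    using half_lattice_sum_unbounded by blast
  define A where "A = (\<Sum>z\<in>S. 1 / (1 + (norm (lat z + sharp_pt))\<^sup>2))"
  have A: "A > 4 * K / \<epsilon>\<^sup>2" "A > 0" using S(2) K(1) \<epsilon>(1) unfolding A_def[symmetric] by (auto intro: le_less_trans[rotated])
  \<comment> \<open>The signs match the values of \<open>gamma_sharp\<close> on the Gabor functions,
    so that nothing cancels; dividing by A normalises the total to 1. The squared norm is then at
    most K / A, with A as large as desired.\<close>
  define c where "c z = (1 / A) * (alt (snd z) / (1 + (norm (lat z + sharp_pt))\<^sup>2))" for z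
  let ?f = "\<lambda>x. \<Sum>z\<in>S. of_real (c z) * gabor (lat z + sharp_pt) x"
  have "gamma_sharp ?f = of_real (\<Sum>z\<in>S. c z * alt (snd z))" unfolding gsum[OF S(1)] by simp
  also have "(\<Sum>z\<in>S. c z * alt (snd z)) = 1"
  proof -
    have "c z * alt (snd z) = (1 / A) * (1 / (1 + (norm (lat z + sharp_pt))\<^sup>2))" for z
      using alt_simps(5)[of "snd z"] by (simp add: c_def mult_ac)
    then have "(\<Sum>z\<in>S. c z * alt (snd z)) = (1 / A) * A" unfolding A_def by (simp add: sum_distrib_left)
    then show ?thesis using A by simp
  qed
  finally have g1: "gamma_sharp ?f = 1" by simp
  have "(H_norm \<delta> ?f)\<^sup>2 \<le> K * (\<Sum>z\<in>S. (1 + (norm (lat z + sharp_pt))\<^sup>2) * (c z)\<^sup>2)" by (rule K(2)[OF S(1)])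
  also have "(\<Sum>z\<in>S. (1 + (norm (lat z + sharp_pt))\<^sup>2) * (c z)\<^sup>2) = (\<Sum>z\<in>S. (1 / A)\<^sup>2 * (1 / (1 + (norm (lat z + sharp_pt))\<^sup>2)))"
  proof (rule sum.cong)
    fix z
    have "v * ((1 / A) * (a / v))\<^sup>2 = (1 / A)\<^sup>2 * (1 / v)" if "v \<noteq> 0" "a * a = 1" for v a :: real
      using that by (simp add: power2_eq_square power_mult_distrib field_simps)
    moreover have "1 + (norm (lat z + sharp_pt))\<^sup>2 \<noteq> 0" using zero_le_power2[of "norm (lat z + sharp_pt)"] by linarith
    ultimately show "(1 + (norm (lat z + sharp_pt))\<^sup>2) * (c z)\<^sup>2 = (1 / A)\<^sup>2 * (1 / (1 + (norm (lat z + sharp_pt))\<^sup>2))"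
      unfolding c_def using alt_simps(5)[of "snd z"] by blast
  qed simp
  also have "\<dots> = (1 / A)\<^sup>2 * A" by (simp add: A_def sum_distrib_left)
  also have "K * ((1 / A)\<^sup>2 * A) = K / A" using A by (simp add: power2_eq_square)
  also have "K / A < \<epsilon>\<^sup>2"
  proof -
    have "4 * K < A * \<epsilon>\<^sup>2" using A(1) \<epsilon>(1) by (simp add: divide_less_eq)
    then have "K < A * \<epsilon>\<^sup>2" using K(1) by linarith
    then show ?thesis using A(2) by (simp add: divide_less_eq mult.commute)
  qed
  finally have "H_norm \<delta> ?f < \<epsilon>"
    by (rule power_less_imp_less_base) (use \<epsilon>(1) in simp)
  then have "norm (gamma_sharp ?f - gamma_sharp (\<lambda>x. 0)) < 1"
    unfolding diff_zero by (intro \<epsilon>(2)[unfolded diff_zero Hm_zero] gabor_sum_H_space[OF S(1) \<delta>(1)])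
  then show False unfolding g1 g0 by simp
qed

section \<open>The coefficient functionals\<close>

text \<open>A version of membership in \<open>Hm_space\<close> for exponents above 2 that does not
  mention the exponent. It allows elements of spaces with different \<delta> to be added, which
  linearity on \<open>Hm_union\<close> demands.\<close>

definition annih_feichtinger :: "nat \<Rightarrow> (real \<Rightarrow> complex) \<Rightarrow> bool" where
  "annih_feichtinger m f \<longleftrightarrow> annih_regular m f \<and> (\<forall>j\<le>m. (annih ^^ j) f \<in> feichtinger)"

lemma annih_feichtinger_linear:
  assumes f: "annih_feichtinger m f" and g: "annih_feichtinger m g"
  shows "annih_feichtinger m (\<lambda>x. a * f x + b * g x)"
    and "j \<le> m \<Longrightarrow> sharp_transform ((annih ^^ j) (\<lambda>x. a * f x + b * g x)) = a * sharp_transform ((annih ^^ j) f) + b * sharp_transform ((annih ^^ j) g)"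
proof -
  let ?h = "\<lambda>x. a * f x + b * g x"
  have rf: "annih_regular m f" and rg: "annih_regular m g" using f g by (auto simp: annih_feichtinger_def)
  note lin = annih_iterate_linear[OF rf rg, where a = a and b = b]
  have *: "(annih ^^ j) ?h \<in> feichtinger \<and> sharp_transform ((annih ^^ j) ?h) = a * sharp_transform ((annih ^^ j) f) + b * sharp_transform ((annih ^^ j) g)" if j: "j \<le> m" for j
  proof -
    have ff: "(annih ^^ j) f \<in> feichtinger" and fg: "(annih ^^ j) g \<in> feichtinger" using f g j by (auto simp: annih_feichtinger_def)
    have ae: "AE x in lborel. a * (annih ^^ j) f x + b * (annih ^^ j) g x = (annih ^^ j) ?h x"
      using lin(2)[OF j] by eventually_elim simp
    have ms: "(annih ^^ j) ?h \<in> borel_measurable borel"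
      by (rule locally_integrable_measurable[OF annih_regular_locally_integrable[OF lin(1) j]])
    note c = feichtinger_cong_AE[OF feichtinger_linear(1)[OF ff fg] ae ms]
    show ?thesis using c(1) unfolding c(3) sharp_transform_linear[OF ff fg] by blast
  qed
  show "annih_feichtinger m ?h" using * lin(1) unfolding annih_feichtinger_def by blast
  show "j \<le> m \<Longrightarrow> sharp_transform ((annih ^^ j) ?h) = a * sharp_transform ((annih ^^ j) f) + b * sharp_transform ((annih ^^ j) g)" using * by blast
qed

lemma annih_feichtinger_gabor_sum:
  "finite F \<Longrightarrow> annih_feichtinger m (\<lambda>x. \<Sum>i\<in>F. c i * gabor (\<mu> i) x)"
  unfolding annih_feichtinger_def by (intro conjI allI impI annih_iterate_gabor_sum(1) annih_gabor_sum_feichtinger(1))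

lemma Hm_space_regular:
  assumes "f \<in> Hm_space \<delta> m"
  shows "annih_regular m f"
proof -
  have "(annih ^^ 0) f \<in> H_space \<delta>" using assms unfolding Hm_space_def by blast
  then show ?thesis
    using assms L2_locally_integrable[of f] by (auto simp: Hm_space_def H_space_def annih_regular_def)
qed

lemma Hm_space_annih_feichtinger: "f \<in> Hm_space \<delta> m \<Longrightarrow> \<delta> > 2 \<Longrightarrow> annih_feichtinger m f"
  unfolding annih_feichtinger_def using Hm_space_regular H_space_feichtinger by (auto simp: Hm_space_def)

lemma H_space_annih_linear:
  assumes f: "annih_regular m f" "(annih ^^ j) f \<in> H_space \<delta>" and g: "annih_regular m g" "(annih ^^ j) g \<in> H_space \<delta>" and j: "j \<le> m"
  shows "(annih ^^ j) (\<lambda>x. a * f x + b * g x) \<in> H_space \<delta>"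
    and "(H_norm \<delta> ((annih ^^ j) (\<lambda>x. a * f x + b * g x)))\<^sup>2 \<le> 2 * (norm a)\<^sup>2 * (H_norm \<delta> ((annih ^^ j) f))\<^sup>2 + 2 * (norm b)\<^sup>2 * (H_norm \<delta> ((annih ^^ j) g))\<^sup>2"
proof -
  let ?h = "\<lambda>x. a * f x + b * g x"
  note lin = annih_iterate_linear[OF f(1) g(1), where a = a and b = b]
  have ae: "AE x in lborel. a * (annih ^^ j) f x + b * (annih ^^ j) g x = (annih ^^ j) ?h x"
    using lin(2)[OF j] by eventually_elim simp
  have ms: "(annih ^^ j) ?h \<in> borel_measurable borel"
    by (rule locally_integrable_measurable[OF annih_regular_locally_integrable[OF lin(1) j]])
  note c = H_space_cong_AE[OF H_space_linear(1)[OF f(2) g(2)] ae ms]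
  show "(annih ^^ j) ?h \<in> H_space \<delta>" by (rule c(1))
  show "(H_norm \<delta> ((annih ^^ j) ?h))\<^sup>2 \<le> 2 * (norm a)\<^sup>2 * (H_norm \<delta> ((annih ^^ j) f))\<^sup>2 + 2 * (norm b)\<^sup>2 * (H_norm \<delta> ((annih ^^ j) g))\<^sup>2"
    unfolding c(2) by (rule H_space_linear(2)[OF f(2) g(2)])
qed

lemma Hm_space_linear:
  assumes f: "f \<in> Hm_space \<delta> m" and g: "g \<in> Hm_space \<delta> m"
  shows "(\<lambda>x. a * f x + b * g x) \<in> Hm_space \<delta> m"
proof -
  note r = Hm_space_regular[OF f] Hm_space_regular[OF g]
  have "(annih ^^ j) (\<lambda>x. a * f x + b * g x) \<in> H_space \<delta>" if "j \<le> m" for j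
    by (rule H_space_annih_linear(1)[OF r(1) _ r(2) _ that]) (use f g that in \<open>auto simp: Hm_space_def\<close>)
  then show ?thesis
    using annih_iterate_linear(1)[OF r, where a = a and b = b] unfolding Hm_space_def annih_regular_def by blast
qed

lemma annih_gabor_sum_H:
  assumes F: "finite F" and \<delta>: "\<delta> > 0"
  shows "(annih ^^ k) (\<lambda>x. \<Sum>i\<in>F. c i * gabor (\<mu> i) x) \<in> H_space \<delta>"
    and "H_norm \<delta> ((annih ^^ k) (\<lambda>x. \<Sum>i\<in>F. c i * gabor (\<mu> i) x)) = H_norm \<delta> (\<lambda>x. \<Sum>i\<in>F. c i * cpoint (\<mu> i) ^ k * gabor (\<mu> i) x)"
proof -
  let ?S = "\<lambda>x. \<Sum>i\<in>F. c i * gabor (\<mu> i) x" and ?T = "\<lambda>x. \<Sum>i\<in>F. c i * cpoint (\<mu> i) ^ k * gabor (\<mu> i) x"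
  have ae: "AE x in lborel. ?T x = (annih ^^ k) ?S x"
    using annih_iterate_gabor_sum(2)[OF F, where m = k and c = c and \<mu> = \<mu>] by eventually_elim simp
  have m: "(annih ^^ k) ?S \<in> borel_measurable borel"
    by (rule locally_integrable_measurable[OF annih_regular_locally_integrable[OF annih_iterate_gabor_sum(1)[OF F] order_refl]])
  note c = H_space_cong_AE[OF gabor_sum_H_space[OF F \<delta>] ae m]
  show "(annih ^^ k) ?S \<in> H_space \<delta>" "H_norm \<delta> ((annih ^^ k) ?S) = H_norm \<delta> ?T" by (rule c)+
qed

lemma gabor_sum_H_norm:
  fixes F :: "'a set"
  assumes "finite F" and \<delta>: "\<delta> > 0"
  shows "\<exists>D\<ge>0. \<forall>c. (H_norm \<delta> (\<lambda>x. \<Sum>i\<in>F. c i * gabor (\<mu> i) x))\<^sup>2 \<le> D * (\<Sum>i\<in>F. (norm (c i))\<^sup>2)"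
  using assms(1)
proof (induction F)
  case empty
  then show ?case by (intro exI[of _ 0]) (simp add: H_norm_def L2_inner_def)
next
  case (insert i F)
  then obtain D where D: "D \<ge> 0" "\<And>c. (H_norm \<delta> (\<lambda>x. \<Sum>i\<in>F. c i * gabor (\<mu> i) x))\<^sup>2 \<le> D * (\<Sum>i\<in>F. (norm (c i))\<^sup>2)" by blast
  define N where "N = (H_norm \<delta> (gabor (\<mu> i)))\<^sup>2"
  have N: "N \<ge> 0" by (simp add: N_def)
  show ?case
  proof (intro exI[of _ "2 * N + 2 * D"] conjI allI)
    show "0 \<le> 2 * N + 2 * D" using D N by simp
    fix c :: "'a \<Rightarrow> complex"
    define a s where "a = (norm (c i))\<^sup>2" and "s = (\<Sum>i\<in>F. (norm (c i))\<^sup>2)"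
    have as: "a \<ge> 0" "s \<ge> 0" by (auto simp: a_def s_def sum_nonneg)
    have "(H_norm \<delta> (\<lambda>x. c i * gabor (\<mu> i) x + 1 * (\<Sum>i\<in>F. c i * gabor (\<mu> i) x)))\<^sup>2 \<le> 2 * a * N + 2 * (norm (1 :: complex))\<^sup>2 * (H_norm \<delta> (\<lambda>x. \<Sum>i\<in>F. c i * gabor (\<mu> i) x))\<^sup>2"
      unfolding a_def N_def by (rule H_space_linear(2)[OF gabor_H_space[OF \<delta>] gabor_sum_H_space[OF insert.hyps(1) \<delta>]])
    also have "\<dots> \<le> 2 * a * N + 2 * (D * s)" using D(2)[of c] by (simp add: s_def)
    also have "\<dots> \<le> (2 * N + 2 * D) * (a + s)"
      using mult_nonneg_nonneg[OF as(1) D(1)] mult_nonneg_nonneg[OF as(2) N] by (simp add: algebra_simps)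
    finally show "(H_norm \<delta> (\<lambda>x. \<Sum>i\<in>insert i F. c i * gabor (\<mu> i) x))\<^sup>2 \<le> (2 * N + 2 * D) * (\<Sum>i\<in>insert i F. (norm (c i))\<^sup>2)"
      using insert.hyps by (simp add: a_def s_def)
  qed
qed

text \<open>The coefficient of the Gabor function at \<mu> s once the interpolating sum of the
  \<open>d_fun\<close> is regrouped by Gabor functions.\<close>

definition interp_coeff :: "nat \<Rightarrow> (nat \<Rightarrow> real \<times> real) \<Rightarrow> (real \<Rightarrow> complex) \<Rightarrow> nat \<Rightarrow> complex" where
  "interp_coeff m \<mu> f s = (\<Sum>j\<le>m. gamma_sharp ((annih ^^ j) f) * d_coeff m \<mu> j s)"

definition interp_rest :: "nat \<Rightarrow> (nat \<Rightarrow> real \<times> real) \<Rightarrow> (real \<Rightarrow> complex) \<Rightarrow> real \<Rightarrow> complex" where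
  "interp_rest m \<mu> f = (\<lambda>x. f x - (\<Sum>j\<le>m. gamma_sharp ((annih ^^ j) f) * d_fun m \<mu> j x))"

text \<open>The coefficients \<open>1\<close> and \<open>-1\<close> are written out so that the linearity lemmas match syntactically.\<close>

lemma interp_rest_eq:
  "interp_rest m \<mu> f = (\<lambda>x. 1 * f x + (-1) * (\<Sum>s\<in>{..m}. interp_coeff m \<mu> f s * gabor (\<mu> s) x))"
proof -
  have "(\<Sum>j\<le>m. gamma_sharp ((annih ^^ j) f) * d_fun m \<mu> j x) = (\<Sum>s\<le>m. interp_coeff m \<mu> f s * gabor (\<mu> s) x)" for x
    unfolding d_fun_def gabor_comb_def interp_coeff_def sum_distrib_left sum_distrib_right
    by (subst sum.swap) (simp add: mult_ac)
  then show ?thesis by (simp add: interp_rest_def)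
qed

lemma interp_rest_linear:
  assumes f: "annih_feichtinger m f" and g: "annih_feichtinger m g"
  shows "interp_rest m \<mu> (\<lambda>x. a * f x + b * g x) = (\<lambda>x. a * interp_rest m \<mu> f x + b * interp_rest m \<mu> g x)"
proof -
  let ?h = "\<lambda>x. a * f x + b * g x"
  have G: "gamma_sharp ((annih ^^ j) ?h) = a * gamma_sharp ((annih ^^ j) f) + b * gamma_sharp ((annih ^^ j) g)" if "j \<le> m" for j
    using annih_feichtinger_linear[OF f g, where a = a and b = b] f g that by (simp add: annih_feichtinger_def gamma_sharp_eq_transform)
  have "(\<Sum>j\<le>m. gamma_sharp ((annih ^^ j) ?h) * d_fun m \<mu> j x) =
    a * (\<Sum>j\<le>m. gamma_sharp ((annih ^^ j) f) * d_fun m \<mu> j x) + b * (\<Sum>j\<le>m. gamma_sharp ((annih ^^ j) g) * d_fun m \<mu> j x)" for x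
    unfolding sum_distrib_left sum.distrib[symmetric]
    by (intro sum.cong refl) (simp only: G atMost_iff distrib_right mult.assoc)
  then show ?thesis unfolding interp_rest_def by (simp add: algebra_simps)
qed

locale half_lattice_points =
  fixes m :: nat and \<mu> :: "nat \<Rightarrow> real \<times> real"
  assumes half_lattice: "\<forall>s\<le>m. \<mu> s \<in> (\<lambda>l. l + sharp_pt) ` Lambda" and distinct: "inj_on \<mu> {..m}"
begin

text \<open>Interchanging the sums over j and s brings out the duality of
  \<open>d_coeff_spec\<close>: the subtracted sum takes the same values as f under the m + 1
  functionals.\<close>

lemma interp_rest_annih_feichtinger:
  assumes "annih_feichtinger m f"
  shows "annih_feichtinger m (interp_rest m \<mu> f)"
    and "k \<le> m \<Longrightarrow> sharp_transform ((annih ^^ k) (interp_rest m \<mu> f)) = 0"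
proof -
  note lin = annih_feichtinger_linear[OF assms annih_feichtinger_gabor_sum[of "{..m}", OF finite_atMost], where a = 1 and b = "-1" and c1 = "interp_coeff m \<mu> f" and \<mu>1 = \<mu>, folded interp_rest_eq]
  show "annih_feichtinger m (interp_rest m \<mu> f)" by (rule lin(1))
  assume k: "k \<le> m"
  let ?S = "\<lambda>x. \<Sum>s\<in>{..m}. interp_coeff m \<mu> f s * gabor (\<mu> s) x"
  have "sharp_transform ((annih ^^ k) ?S) = (\<Sum>s\<le>m. interp_coeff m \<mu> f s * cpoint (\<mu> s) ^ k * sharp_transform (gabor (\<mu> s)))"
    using annih_gabor_sum_feichtinger[of "{..m}" k "interp_coeff m \<mu> f" \<mu>] gamma_sharp_eq_transform by simp
  also have "\<dots> = (\<Sum>j\<le>m. gamma_sharp ((annih ^^ j) f) * (\<Sum>s\<le>m. d_coeff m \<mu> j s * cpoint (\<mu> s) ^ k * sharp_transform (gabor (\<mu> s))))"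
    unfolding interp_coeff_def sum_distrib_left sum_distrib_right
    by (subst sum.swap) (simp add: mult_ac)
  also have "\<dots> = (\<Sum>j\<le>m. gamma_sharp ((annih ^^ j) f) * (if k = j then 1 else 0))"
    by (intro sum.cong refl) (use d_coeff_spec[OF half_lattice distinct _ k] in simp)
  also have "\<dots> = gamma_sharp ((annih ^^ k) f)" using k by (simp add: if_distrib cong: if_cong)
  also have "\<dots> = sharp_transform ((annih ^^ k) f)"
    using assms k by (simp add: annih_feichtinger_def gamma_sharp_eq_transform)
  finally show "sharp_transform ((annih ^^ k) (interp_rest m \<mu> f)) = 0" unfolding lin(2)[OF k] by simp
qed

lemma half_int_sum_interp_rest:
  assumes "annih_feichtinger m f" "k \<le> m"
  shows "half_int_sum (synth (trf ((annih ^^ k) (interp_rest m \<mu> f)))) = 0"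
proof -
  have fe: "(annih ^^ k) (interp_rest m \<mu> f) \<in> feichtinger"
    using interp_rest_annih_feichtinger(1)[OF assms(1)] assms(2) by (auto simp: annih_feichtinger_def)
  show ?thesis
    using interp_rest_annih_feichtinger(2)[OF assms] gamma_sharp_eq[OF fe] Theta_0_nonzero
    unfolding gamma_sharp_eq_transform[OF fe] by simp
qed

lemma beta_annih_interp_rest:
  assumes f: "annih_feichtinger m f" and "k \<le> m"
  shows "beta (lat z) ((annih ^^ k) (interp_rest m \<mu> f)) = cpoint (lat z) ^ k * beta (lat z) (interp_rest m \<mu> f)"
  using assms(2)
proof (induction k)
  case (Suc k)
  let ?u = "(annih ^^ k) (interp_rest m \<mu> f)"
  have af: "annih_feichtinger m (interp_rest m \<mu> f)" by (rule interp_rest_annih_feichtinger(1)[OF f])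
  have u: "?u \<in> feichtinger" "annih ?u \<in> feichtinger" "weakly_differentiable ?u"
    using af Suc.prems unfolding annih_feichtinger_def annih_regular_def by (auto dest: spec[of _ "Suc k"])
  have G: "half_int_sum (synth (trf ?u)) = 0" using Suc.prems by (intro half_int_sum_interp_rest f) simp
  have "beta (lat z) (annih ?u) = cpoint (lat z) * beta (lat z) ?u"
    using beta_annih[OF u(3) feichtinger_synth(2,1)[OF u(1)] feichtinger_synth(3)[OF u(1)] feichtinger_synth(3)[OF u(2)] feichtinger_half_int_sum(1)[OF u(1)], of "fst z" "snd z"]
    unfolding G lat_def[symmetric] by simp
  then show ?case using Suc by simp
qed simp

text \<open>The subtracted function lies in the span of m + 1 fixed Gabor functions, and its
  coefficients are linear in the numbers gamma_sharp ((annih ^^ j) f), which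
  \<open>half_int_sum_H_bound\<close> controls by the norms of the iterates.\<close>

lemma interp_rest_H_norm:
  assumes \<delta>: "\<delta> > 2" and k: "k \<le> m"
  shows "\<exists>C\<ge>0. \<forall>f\<in>Hm_space \<delta> m. (annih ^^ k) (interp_rest m \<mu> f) \<in> H_space \<delta> \<and>
    (H_norm \<delta> ((annih ^^ k) (interp_rest m \<mu> f)))\<^sup>2 \<le> C * (Hm_norm \<delta> m f)\<^sup>2"
proof -
  have \<delta>0: "\<delta> > 0" using \<delta> by simp
  obtain D where D: "D \<ge> 0" "\<And>c. (H_norm \<delta> (\<lambda>x. \<Sum>i\<in>{..m}. c i * gabor (\<mu> i) x))\<^sup>2 \<le> D * (\<Sum>i\<in>{..m}. (norm (c i))\<^sup>2)"
    using gabor_sum_H_norm[OF finite_atMost \<delta>0] by blast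
  obtain C1 where C1: "C1 \<ge> 0" "\<And>f. f \<in> H_space \<delta> \<Longrightarrow> (norm (half_int_sum (synth (trf f))))\<^sup>2 \<le> C1 * (H_norm \<delta> f)\<^sup>2"
    using half_int_sum_H_bound[OF \<delta>] by blast
  define t where "t = (norm (1 / (\<i> * Theta 0)))\<^sup>2 * C1"
  have t: "t \<ge> 0" using C1 by (simp add: t_def)
  define e where "e s = (\<Sum>j\<le>m. (norm (d_coeff m \<mu> j s))\<^sup>2) * (norm (cpoint (\<mu> s) ^ k))\<^sup>2" for s
  have e: "e s \<ge> 0" for s by (simp add: e_def sum_nonneg)
  define C where "C = 2 + 2 * (D * (t * (\<Sum>s\<le>m. e s)))"
  show ?thesis
  proof (intro exI[of _ C] conjI ballI)
    show "C \<ge> 0" unfolding C_def by (intro add_nonneg_nonneg mult_nonneg_nonneg sum_nonneg D t e) auto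
    fix f assume f: "f \<in> Hm_space \<delta> m"
    define N where "N = (Hm_norm \<delta> m f)\<^sup>2"
    have N: "N = (\<Sum>j\<le>m. (H_norm \<delta> ((annih ^^ j) f))\<^sup>2)" unfolding N_def Hm_norm_def by (simp add: sum_nonneg)
    have fk: "(annih ^^ j) f \<in> H_space \<delta>" if "j \<le> m" for j using f that by (auto simp: Hm_space_def)
    let ?b = "interp_coeff m \<mu> f"
    have G: "(norm (gamma_sharp ((annih ^^ j) f)))\<^sup>2 \<le> t * (H_norm \<delta> ((annih ^^ j) f))\<^sup>2" if "j \<le> m" for j
      unfolding gamma_sharp_eq[OF H_space_feichtinger[OF fk[OF that] \<delta>]] norm_mult power_mult_distrib t_def mult.assoc
      by (intro mult_left_mono C1 fk that) simp
    have b: "(norm (?b s * cpoint (\<mu> s) ^ k))\<^sup>2 \<le> t * N * e s" for s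
    proof -
      have "norm (?b s) \<le> (\<Sum>j\<le>m. norm (gamma_sharp ((annih ^^ j) f)) * norm (d_coeff m \<mu> j s))"
        unfolding interp_coeff_def by (rule order_trans[OF norm_sum]) (simp add: norm_mult)
      then have "(norm (?b s))\<^sup>2 \<le> (\<Sum>j\<le>m. norm (gamma_sharp ((annih ^^ j) f)) * norm (d_coeff m \<mu> j s))\<^sup>2"
        by (rule power_mono) simp
      also have "\<dots> \<le> (\<Sum>j\<le>m. (norm (gamma_sharp ((annih ^^ j) f)))\<^sup>2) * (\<Sum>j\<le>m. (norm (d_coeff m \<mu> j s))\<^sup>2)"
        by (rule Cauchy_Schwarz_ineq_sum)
      also have "\<dots> \<le> (t * N) * (\<Sum>j\<le>m. (norm (d_coeff m \<mu> j s))\<^sup>2)"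
        unfolding N sum_distrib_left[of t] by (intro mult_right_mono sum_mono G sum_nonneg) auto
      finally have "(norm (?b s))\<^sup>2 * (norm (cpoint (\<mu> s) ^ k))\<^sup>2 \<le> (t * N) * (\<Sum>j\<le>m. (norm (d_coeff m \<mu> j s))\<^sup>2) * (norm (cpoint (\<mu> s) ^ k))\<^sup>2"
        by (rule mult_right_mono) simp
      then show ?thesis unfolding e_def norm_mult power_mult_distrib mult.assoc .
    qed
    let ?S = "\<lambda>x. \<Sum>s\<in>{..m}. ?b s * gabor (\<mu> s) x"
    have S: "(annih ^^ k) ?S \<in> H_space \<delta>" by (rule annih_gabor_sum_H(1)[OF finite_atMost \<delta>0])
    have "(H_norm \<delta> ((annih ^^ k) ?S))\<^sup>2 \<le> D * (\<Sum>s\<in>{..m}. (norm (?b s * cpoint (\<mu> s) ^ k))\<^sup>2)"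
      unfolding annih_gabor_sum_H(2)[OF finite_atMost \<delta>0] by (rule D(2))
    also have "\<dots> \<le> D * (\<Sum>s\<in>{..m}. t * N * e s)" by (intro mult_left_mono sum_mono b D)
    also have "\<dots> = D * (t * (\<Sum>s\<le>m. e s)) * N" by (simp add: sum_distrib_left mult_ac)
    finally have Sn: "(H_norm \<delta> ((annih ^^ k) ?S))\<^sup>2 \<le> D * (t * (\<Sum>s\<le>m. e s)) * N" .
    have "(H_norm \<delta> ((annih ^^ k) f))\<^sup>2 \<le> N"
      unfolding N using k by (intro member_le_sum) auto
    note lin = H_space_annih_linear[OF Hm_space_regular[OF f] fk[OF k] annih_iterate_gabor_sum(1)[OF finite_atMost] S k, where a = 1 and b = "-1", folded interp_rest_eq]
    show "(annih ^^ k) (interp_rest m \<mu> f) \<in> H_space \<delta>" by (rule lin(1))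
    have "(H_norm \<delta> ((annih ^^ k) (interp_rest m \<mu> f)))\<^sup>2 \<le> 2 * (H_norm \<delta> ((annih ^^ k) f))\<^sup>2 + 2 * (H_norm \<delta> ((annih ^^ k) ?S))\<^sup>2"
      using lin(2) by simp
    also have "\<dots> \<le> 2 * N + 2 * (D * (t * (\<Sum>s\<le>m. e s)) * N)"
      using Sn \<open>(H_norm \<delta> ((annih ^^ k) f))\<^sup>2 \<le> N\<close> by (intro add_mono mult_left_mono) auto
    also have "\<dots> = C * N" by (simp add: C_def algebra_simps)
    finally show "(H_norm \<delta> ((annih ^^ k) (interp_rest m \<mu> f)))\<^sup>2 \<le> C * (Hm_norm \<delta> m f)\<^sup>2" unfolding N_def .
  qed
qed

text \<open>The weight is expanded by the binomial theorem. Its k-th term turns the squared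
  coefficient of the remainder into that of its k-th iterate, to which
  \<open>beta_square_summable\<close> applies.\<close>

lemma weighted_beta_bound:
  assumes \<delta>: "\<delta> > 2"
  shows "\<exists>C\<ge>0. \<forall>f\<in>Hm_space \<delta> m.
    (\<lambda>z. ((norm (lat z))\<^sup>2 + 1) ^ m * (norm (beta (lat z) (interp_rest m \<mu> f)))\<^sup>2) summable_on UNIV \<and>
    (\<Sum>\<^sub>\<infinity>z. ((norm (lat z))\<^sup>2 + 1) ^ m * (norm (beta (lat z) (interp_rest m \<mu> f)))\<^sup>2) \<le> C * (Hm_norm \<delta> m f)\<^sup>2"
proof -
  obtain C1 where C1: "C1 \<ge> 0" "\<And>f. f \<in> H_space \<delta> \<Longrightarrow> half_int_sum (synth (trf f)) = 0 \<Longrightarrow>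
    (\<lambda>z. (norm (beta (lat z) f))\<^sup>2) summable_on UNIV \<and> (\<Sum>\<^sub>\<infinity>z. (norm (beta (lat z) f))\<^sup>2) \<le> C1 * (H_norm \<delta> f)\<^sup>2"
    using beta_square_summable[OF \<delta>] by blast
  have "\<forall>k. \<exists>C. k \<le> m \<longrightarrow> C \<ge> 0 \<and> (\<forall>f\<in>Hm_space \<delta> m. (annih ^^ k) (interp_rest m \<mu> f) \<in> H_space \<delta> \<and>
    (H_norm \<delta> ((annih ^^ k) (interp_rest m \<mu> f)))\<^sup>2 \<le> C * (Hm_norm \<delta> m f)\<^sup>2)"
    using interp_rest_H_norm[OF \<delta>] by blast
  from choice[OF this] obtain B where B: "\<forall>k. k \<le> m \<longrightarrow> B k \<ge> 0 \<and> (\<forall>f\<in>Hm_space \<delta> m. (annih ^^ k) (interp_rest m \<mu> f) \<in> H_space \<delta> \<and>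
    (H_norm \<delta> ((annih ^^ k) (interp_rest m \<mu> f)))\<^sup>2 \<le> B k * (Hm_norm \<delta> m f)\<^sup>2)" ..
  define C where "C = (\<Sum>k\<le>m. of_nat (m choose k) * (C1 * B k))"
  show ?thesis
  proof (intro exI[of _ C] conjI[rotated] ballI)
    show "C \<ge> 0" unfolding C_def using B C1(1) by (intro sum_nonneg mult_nonneg_nonneg) auto
    fix f assume f: "f \<in> Hm_space \<delta> m"
    note af = Hm_space_annih_feichtinger[OF f \<delta>]
    define N where "N = (Hm_norm \<delta> m f)\<^sup>2"
    define g where "g = interp_rest m \<mu> f"
    define b where "b k z = of_nat (m choose k) * (norm (beta (lat z) ((annih ^^ k) g)))\<^sup>2" for k z
    have theta_tail_sum: "b k summable_on UNIV \<and> infsum (b k) UNIV \<le> of_nat (m choose k) * (C1 * B k) * N" if k: "k \<le> m" for k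
    proof -
      have H: "(annih ^^ k) g \<in> H_space \<delta>" "(H_norm \<delta> ((annih ^^ k) g))\<^sup>2 \<le> B k * N"
        using B k f unfolding g_def N_def by blast+
      have G: "half_int_sum (synth (trf ((annih ^^ k) g))) = 0" unfolding g_def by (rule half_int_sum_interp_rest[OF af k])
      have s: "(\<lambda>z. (norm (beta (lat z) ((annih ^^ k) g)))\<^sup>2) summable_on UNIV"
        and le: "(\<Sum>\<^sub>\<infinity>z. (norm (beta (lat z) ((annih ^^ k) g)))\<^sup>2) \<le> C1 * (H_norm \<delta> ((annih ^^ k) g))\<^sup>2"
        using C1(2)[OF H(1) G] by blast+
      have "infsum (b k) UNIV = of_nat (m choose k) * (\<Sum>\<^sub>\<infinity>z. (norm (beta (lat z) ((annih ^^ k) g)))\<^sup>2)"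
        unfolding b_def[abs_def] by (rule infsum_cmult_right')
      also have "\<dots> \<le> of_nat (m choose k) * (C1 * (B k * N))"
        by (intro mult_left_mono order_trans[OF le] H C1(1)) auto
      finally show ?thesis
        using summable_on_cmult_right[OF s] by (simp add: b_def[abs_def] mult_ac)
    qed
    have eq: "((norm (lat z))\<^sup>2 + 1) ^ m * (norm (beta (lat z) g))\<^sup>2 = (\<Sum>k\<le>m. b k z)" for z
    proof -
      have "b k z = of_nat (m choose k) * ((norm (lat z))\<^sup>2) ^ k * 1 ^ (m - k) * (norm (beta (lat z) g))\<^sup>2" if "k \<le> m" for k
        unfolding b_def g_def beta_annih_interp_rest[OF af that] norm_mult norm_power norm_cpoint
        by (simp add: power_mult_distrib power_mult[symmetric] mult.commute)
      then show ?thesis unfolding binomial_ring sum_distrib_right by simp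
    qed
    have hs: "((\<lambda>z. \<Sum>k\<le>m. b k z) has_sum (\<Sum>k\<le>m. infsum (b k) UNIV)) UNIV"
    proof -
      have "((\<lambda>z. \<Sum>k\<in>K. b k z) has_sum (\<Sum>k\<in>K. infsum (b k) UNIV)) UNIV" if "finite K" "K \<subseteq> {..m}" for K
        using that by (induction K) (auto intro!: has_sum_add has_sum_infsum dest: theta_tail_sum)
      then show ?thesis by blast
    qed
    show "(\<lambda>z. ((norm (lat z))\<^sup>2 + 1) ^ m * (norm (beta (lat z) (interp_rest m \<mu> f)))\<^sup>2) summable_on UNIV"
      unfolding g_def[symmetric] eq using hs by (rule has_sum_imp_summable)
    have "(\<Sum>k\<le>m. infsum (b k) UNIV) \<le> (\<Sum>k\<le>m. of_nat (m choose k) * (C1 * B k) * N)"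
      using theta_tail_sum by (intro sum_mono) auto
    then show "(\<Sum>\<^sub>\<infinity>z. ((norm (lat z))\<^sup>2 + 1) ^ m * (norm (beta (lat z) (interp_rest m \<mu> f)))\<^sup>2) \<le> C * (Hm_norm \<delta> m f)\<^sup>2"
      unfolding g_def[symmetric] N_def[symmetric] eq infsumI[OF hs] C_def sum_distrib_right .
  qed
qed

lemma weighted_beta_bound_Lambda:
  assumes "\<delta> > 2"
  shows "\<exists>C\<ge>0. \<forall>f\<in>Hm_space \<delta> m.
    (\<lambda>l. ((norm l)\<^sup>2 + 1) ^ m * (norm (beta l (interp_rest m \<mu> f)))\<^sup>2) summable_on Lambda \<and>
    (\<Sum>\<^sub>\<infinity>l\<in>Lambda. ((norm l)\<^sup>2 + 1) ^ m * (norm (beta l (interp_rest m \<mu> f)))\<^sup>2) \<le> C * (Hm_norm \<delta> m f)\<^sup>2"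
  using weighted_beta_bound[OF assms]
  unfolding Lambda_eq summable_on_reindex[OF inj_lat] infsum_reindex[OF inj_lat] o_def .

lemma interp_rest_sobolev_sum:
  assumes f: "f \<in> Hm_space \<delta> m" and \<delta>: "\<delta> > 2"
  shows "f \<in> sobolev m"
    and "has_sobolev_sum m (\<lambda>l x. beta l (interp_rest m \<mu> f) * gabor l x) (interp_rest m \<mu> f) Lambda"
proof -
  note af = Hm_space_annih_feichtinger[OF f \<delta>]
  let ?g = "interp_rest m \<mu> f"
  have g: "annih_regular m ?g" "\<And>j. j \<le> m \<Longrightarrow> (annih ^^ j) ?g \<in> feichtinger"
    using interp_rest_annih_feichtinger(1)[OF af] by (auto simp: annih_feichtinger_def)
  have s: "(\<lambda>z. ((norm (lat z))\<^sup>2 + 1) ^ m * (norm (beta (lat z) ?g))\<^sup>2) summable_on UNIV"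
    using weighted_beta_bound[OF \<delta>] f by blast
  note ex = sobolev_expansion[OF g beta_annih_interp_rest[OF af] s]
  show "has_sobolev_sum m (\<lambda>l x. beta l ?g * gabor l x) ?g Lambda" by (rule ex(1))
  \<comment> \<open>f is written as its remainder plus the finite Gabor sum that had been
    subtracted.\<close>
  have "(\<lambda>x. 1 * ?g x + 1 * (\<Sum>s\<in>{..m}. interp_coeff m \<mu> f s * gabor (\<mu> s) x)) \<in> sobolev m"
    by (rule sobolev_linear_gabor_sum[OF finite_atMost g(1) ex(2)])
  also have "(\<lambda>x. 1 * ?g x + 1 * (\<Sum>s\<in>{..m}. interp_coeff m \<mu> f s * gabor (\<mu> s) x)) = f"
    unfolding interp_rest_eq by simp
  finally show "f \<in> sobolev m" .
qed

lemma beta_interp_rest_linear: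
  assumes f: "annih_feichtinger m f" and g: "annih_feichtinger m g"
  shows "beta l (interp_rest m \<mu> (\<lambda>x. a * f x + b * g x)) = a * beta l (interp_rest m \<mu> f) + b * beta l (interp_rest m \<mu> g)"
proof -
  have i: "integrable lborel (interp_rest m \<mu> h)" if "annih_feichtinger m h" for h
  proof -
    have "(annih ^^ 0) (interp_rest m \<mu> h) \<in> feichtinger"
      using interp_rest_annih_feichtinger(1)[OF that] unfolding annih_feichtinger_def by blast
    then show ?thesis using feichtinger_synth(3) by simp
  qed
  show ?thesis unfolding interp_rest_linear[OF f g] by (rule beta_linear[OF i[OF f] i[OF g]])
qed

text \<open>The weight is at least 1, so a single coefficient is bounded by the whole weighted sum
  and hence by the norm; for a linear functional this gives continuity.\<close>

lemma beta_interp_rest_continuous: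
  assumes \<delta>0: "\<delta>0 \<ge> 2" and l: "l \<in> Lambda"
  shows "continuous_linear_functional \<delta>0 m (\<lambda>f. beta l (interp_rest m \<mu> f))"
  unfolding continuous_linear_functional_def linear_functional_on_def continuous_functional_on_def
proof (intro conjI ballI allI impI)
  have af: "annih_feichtinger m f" if "f \<in> Hm_union \<delta>0 m" for f
    using that \<delta>0 unfolding Hm_union_def by (auto intro: Hm_space_annih_feichtinger)
  show "beta l (interp_rest m \<mu> (\<lambda>x. f x + g x)) = beta l (interp_rest m \<mu> f) + beta l (interp_rest m \<mu> g)"
    if "f \<in> Hm_union \<delta>0 m" "g \<in> Hm_union \<delta>0 m" for f g
    using beta_interp_rest_linear[OF af[OF that(1)] af[OF that(2)], where l = l and a = 1 and b = 1] by simp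
  show "beta l (interp_rest m \<mu> (\<lambda>x. c * f x)) = c * beta l (interp_rest m \<mu> f)" if "f \<in> Hm_union \<delta>0 m" for f c
    using beta_interp_rest_linear[OF af[OF that] af[OF that], where l = l and a = c and b = 0] by simp
  fix \<delta> f and \<epsilon> :: real
  assume "\<delta>0 < \<delta>" and f: "f \<in> Hm_space \<delta> m" and \<epsilon>: "\<epsilon> > 0"
  then have \<delta>: "\<delta> > 2" using \<delta>0 by simp
  let ?w = "\<lambda>h l. ((norm l)\<^sup>2 + 1) ^ m * (norm (beta l (interp_rest m \<mu> h)))\<^sup>2"
  obtain C where C: "C \<ge> 0" "\<And>h. h \<in> Hm_space \<delta> m \<Longrightarrow> ?w h summable_on Lambda \<and> infsum (?w h) Lambda \<le> C * (Hm_norm \<delta> m h)\<^sup>2"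
    using weighted_beta_bound_Lambda[OF \<delta>] by blast
  have b: "norm (beta l (interp_rest m \<mu> h)) \<le> sqrt C * Hm_norm \<delta> m h" if h: "h \<in> Hm_space \<delta> m" for h
  proof (rule power2_le_imp_le)
    have "(norm (beta l (interp_rest m \<mu> h)))\<^sup>2 \<le> ?w h l"
      using mult_right_mono[OF one_le_power[of "(norm l)\<^sup>2 + 1" m], of "(norm (beta l (interp_rest m \<mu> h)))\<^sup>2"] by simp
    also have "\<dots> \<le> infsum (?w h) Lambda"
      using finite_sum_le_infsum[of "?w h" Lambda "{l}"] C(2)[OF h] l by simp
    also have "\<dots> \<le> C * (Hm_norm \<delta> m h)\<^sup>2" using C(2)[OF h] by blast
    finally show "(norm (beta l (interp_rest m \<mu> h)))\<^sup>2 \<le> (sqrt C * Hm_norm \<delta> m h)\<^sup>2"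
      using C(1) by (simp add: power_mult_distrib)
    show "0 \<le> sqrt C * Hm_norm \<delta> m h" using C(1) by (simp add: Hm_norm_def sum_nonneg)
  qed
  show "\<exists>\<eta>>0. \<forall>g\<in>Hm_space \<delta> m. Hm_norm \<delta> m (\<lambda>x. g x - f x) < \<eta> \<longrightarrow>
    cmod (beta l (interp_rest m \<mu> g) - beta l (interp_rest m \<mu> f)) < \<epsilon>"
  \<comment> \<open>Adding 1 keeps the denominator positive in case C = 0.\<close>
  proof (intro exI[of _ "\<epsilon> / (sqrt C + 1)"] conjI ballI impI)
    have p: "sqrt C + 1 > 0" using C(1) by (simp add: add_nonneg_pos)
    then show "\<epsilon> / (sqrt C + 1) > 0" using \<epsilon> by simp
    fix g assume g: "g \<in> Hm_space \<delta> m" and lt: "Hm_norm \<delta> m (\<lambda>x. g x - f x) < \<epsilon> / (sqrt C + 1)"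
    have e: "(\<lambda>x. g x - f x) = (\<lambda>x. 1 * g x + (-1) * f x)" by simp
    have h: "(\<lambda>x. g x - f x) \<in> Hm_space \<delta> m" unfolding e by (rule Hm_space_linear[OF g f])
    have "beta l (interp_rest m \<mu> g) - beta l (interp_rest m \<mu> f) = beta l (interp_rest m \<mu> (\<lambda>x. g x - f x))"
      unfolding e beta_interp_rest_linear[OF Hm_space_annih_feichtinger[OF g \<delta>] Hm_space_annih_feichtinger[OF f \<delta>]] by simp
    then have "cmod (beta l (interp_rest m \<mu> g) - beta l (interp_rest m \<mu> f)) \<le> sqrt C * Hm_norm \<delta> m (\<lambda>x. g x - f x)"
      using b[OF h] by simp
    also have "\<dots> \<le> (sqrt C + 1) * Hm_norm \<delta> m (\<lambda>x. g x - f x)"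
      by (intro mult_right_mono) (auto simp: Hm_norm_def sum_nonneg)
    also have "\<dots> < \<epsilon>" using lt p by (simp add: pos_less_divide_eq mult.commute)
    finally show "cmod (beta l (interp_rest m \<mu> g) - beta l (interp_rest m \<mu> f)) < \<epsilon>" .
  qed
qed

end

theorem theorem8p4:
  fixes m :: nat and \<mu> :: "nat \<Rightarrow> real \<times> real" and \<delta>0 :: real
  assumes "\<delta>0 \<ge> 1"
    and "gamma_sharp_well_defined \<delta>0"
    and "\<forall>s\<le>m. \<mu> s \<in> (\<lambda>l. l + sharp_pt) ` Lambda"
    and "inj_on \<mu> {..m}"
  shows "\<exists>\<gamma> :: real \<times> real \<Rightarrow> (real \<Rightarrow> complex) \<Rightarrow> complex.
      (\<forall>l\<in>Lambda. continuous_linear_functional \<delta>0 m (\<gamma> l)) \<and>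
      (\<forall>f\<in>Hm_union \<delta>0 m.
         f \<in> sobolev m \<and>
         has_sobolev_sum m (\<lambda>l x. \<gamma> l f * gabor l x)
           (\<lambda>x. f x - (\<Sum>j\<le>m. gamma_sharp ((annih ^^ j) f) * d_fun m \<mu> j x)) Lambda) \<and>
      (\<forall>\<delta>>\<delta>0. \<exists>C. \<forall>f\<in>Hm_space \<delta> m.
         (\<lambda>l. ((norm l)\<^sup>2 + 1) ^ m * (cmod (\<gamma> l f))\<^sup>2) summable_on Lambda \<and>
         (\<Sum>\<^sub>\<infinity>l\<in>Lambda. ((norm l)\<^sup>2 + 1) ^ m * (cmod (\<gamma> l f))\<^sup>2) \<le> C * (Hm_norm \<delta> m f)\<^sup>2)"
proof -
  \<comment> \<open>The hypothesis on \<open>gamma_sharp\<close> is converted into a bound on the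
    exponent, from which the estimates for the functional are obtained directly.\<close>
  have \<delta>0: "\<delta>0 \<ge> 2" by (rule gamma_sharp_well_defined_imp[OF assms(1,2)])
  interpret half_lattice_points m \<mu> by unfold_locales (use assms in auto)
  show ?thesis
  proof (intro exI[of _ "\<lambda>l f. beta l (interp_rest m \<mu> f)"] conjI ballI allI impI)
    show "continuous_linear_functional \<delta>0 m (\<lambda>f. beta l (interp_rest m \<mu> f))" if "l \<in> Lambda" for l
      by (rule beta_interp_rest_continuous[OF \<delta>0 that])
    fix f assume "f \<in> Hm_union \<delta>0 m"
    then obtain \<delta> where f: "f \<in> Hm_space \<delta> m" and \<delta>: "\<delta> > 2" using \<delta>0 by (auto simp: Hm_union_def)
    show "f \<in> sobolev m" by (rule interp_rest_sobolev_sum(1)[OF f \<delta>])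
    show "has_sobolev_sum m (\<lambda>l x. beta l (interp_rest m \<mu> f) * gabor l x)
      (\<lambda>x. f x - (\<Sum>j\<le>m. gamma_sharp ((annih ^^ j) f) * d_fun m \<mu> j x)) Lambda"
      using interp_rest_sobolev_sum(2)[OF f \<delta>] unfolding interp_rest_def .
  next
    fix \<delta> assume "\<delta>0 < \<delta>"
    then have "\<delta> > 2" using \<delta>0 by simp
    from weighted_beta_bound_Lambda[OF this]
    show "\<exists>C. \<forall>f\<in>Hm_space \<delta> m.
      (\<lambda>l. ((norm l)\<^sup>2 + 1) ^ m * (cmod (beta l (interp_rest m \<mu> f)))\<^sup>2) summable_on Lambda \<and>
      (\<Sum>\<^sub>\<infinity>l\<in>Lambda. ((norm l)\<^sup>2 + 1) ^ m * (cmod (beta l (interp_rest m \<mu> f)))\<^sup>2) \<le> C * (Hm_norm \<delta> m f)\<^sup>2"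
      by blast
  qed
qed

end
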